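(* Let the compact torus $T=\{(t_1,\dots,t_5)\in (S^1)^5 \mid t_1\cdots t_5=1\}$ act on the Grassmannian $\operatorname{Gr}(2,\mathbb{C}^5)$ of complex $2$-planes in $\mathbb{C}^5$ via the coordinatewise (diagonal) action on $\mathbb{C}^5$. Let $P=\Delta_{2,5}$ be the hypersimplex with octahedral facets $O_1,\dots,O_5$, let $Y$ be the degree $5$ del Pezzo surface with its five conic bundles $f_1,\dots,f_5:Y\to\mathbb{CP}^1$, and let $X=(P\times Y)/\!\sim$ be the quotient space in which, for $x\in\partial P$, the fibre $\{x\}\times Y$ is collapsed to $\mathbb{CP}^1$ via $f_i$ if $x\in\operatorname{int}(O_i)$, and is collapsed to a point if $x\notin\bigcup_i\operatorname{int}(O_i)$ (no identification being made over $\operatorname{int}(P)$). Then $X$ is homotopy equivalent to the orbit space $\operatorname{Gr}(2,\mathbb{C}^5)/T$.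
   Context: Hypersimplex: $P=\Delta_{2,5}=\{x\in[0,1]^5 \mid x_1+\dots+x_5=2\}$, a $4$-dimensional convex polytope with $10$ facets: five octahedra $O_1,\dots,O_5$ (the facets $x_i=0$) and five tetrahedra (the facets $x_i=1$). $\operatorname{int}(P)$ and $\partial P$ denote the relative interior and boundary of $P$, and $\operatorname{int}(O_i)$ is the relative interior of the facet $O_i$. Del Pezzo surface and conic bundles: $Y=dP_5$ is the blow-up of $\mathbb{CP}^2$ at four points $p_1,p_2,p_3,p_4$ in general position (no three on a line), regarded as a topological $4$-manifold. Let $E_1,\dots,E_4$ be the exceptional curves and $E_5$ the preimage of a line in $\mathbb{CP}^2$ not containing any $p_i$. For $i=1,\dots,4$, $f_i:Y\to\mathbb{CP}^1$ is the morphism (conic bundle) defined by the pencil $|E_5-E_i|$, i.e. by the proper transforms of the lines through $p_i$; $f_5:Y\to\mathbb{CP}^1$ is the conic bundle defined by the pencil $|2E_5-E_1-E_2-E_3-E_4|$, i.e. by the proper transforms of the conics through $p_1,\dots,p_4$. The space $X$: $X=(P\times Y)/\!\sim$ with the quotient topology, where $\sim$ is the equivalence relation such that $(x,y)\sim(x',y')$ implies $x=x'$, and: (i) if $x\in\operatorname{int}(P)$, then $(x,y)\sim(x,y')$ iff $y=y'$; (ii) if $x\in\operatorname{int}(O_i)$, then $(x,y)\sim(x,y')$ iff $f_i(y)=f_i(y')$; (iii) if $x\in\partial P\setminus\bigcup_i\operatorname{int}(O_i)$, then $(x,y)\sim(x,y')$ for all $y,y'\in Y$. *)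

theory Defs
  imports "HOL-Analysis.Analysis"
begin

section \<open>Quotient topologies\<close>

definition quotient_topology :: "'a topology \<Rightarrow> ('a \<Rightarrow> 'b) \<Rightarrow> 'b topology" where
  "quotient_topology X f =
     topology (\<lambda>U. U \<subseteq> f ` topspace X \<and> openin X {x \<in> topspace X. f x \<in> U})"

lemma openin_quotient_topology:
  "openin (quotient_topology X f) U \<longleftrightarrow>
     U \<subseteq> f ` topspace X \<and> openin X {x \<in> topspace X. f x \<in> U}"
proof -
  have "istopology (\<lambda>U. U \<subseteq> f ` topspace X \<and> openin X {x \<in> topspace X. f x \<in> U})"
    unfolding istopology_def
  proof (intro conjI allI impI)
    fix S T
    assume S: "S \<subseteq> f ` topspace X \<and> openin X {x \<in> topspace X. f x \<in> S}"
      and T: "T \<subseteq> f ` topspace X \<and> openin X {x \<in> topspace X. f x \<in> T}"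
    have "{x \<in> topspace X. f x \<in> S \<inter> T} =
        {x \<in> topspace X. f x \<in> S} \<inter> {x \<in> topspace X. f x \<in> T}"
      by auto
    with S T show "openin X {x \<in> topspace X. f x \<in> S \<inter> T}"
      by (simp add: openin_Int)
    from S show "S \<inter> T \<subseteq> f ` topspace X" by blast
  next
    fix \<K>
    assume K: "\<forall>K\<in>\<K>. K \<subseteq> f ` topspace X \<and> openin X {x \<in> topspace X. f x \<in> K}"
    have "{x \<in> topspace X. f x \<in> \<Union>\<K>} = (\<Union>K\<in>\<K>. {x \<in> topspace X. f x \<in> K})"
      by auto
    with K show "openin X {x \<in> topspace X. f x \<in> \<Union>\<K>}"
      by (auto intro: openin_Union)
    from K show "\<Union>\<K> \<subseteq> f ` topspace X" by blast
  qed
  then show ?thesis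
    by (simp add: quotient_topology_def topology_inverse')
qed

lemma topspace_quotient_topology [simp]:
  "topspace (quotient_topology X f) = f ` topspace X"
proof -
  have "{x \<in> topspace X. f x \<in> f ` topspace X} = topspace X" by auto
  then have "openin (quotient_topology X f) (f ` topspace X)"
    by (simp add: openin_quotient_topology)
  then show ?thesis
    by (metis openin_quotient_topology openin_subset openin_topspace subset_antisym)
qed

lemma quotient_map_quotient_topology: "quotient_map X (quotient_topology X f) f"
  by (auto simp: quotient_map_def openin_quotient_topology)


section \<open>Grassmannians and projective spaces\<close>

definition frames :: "nat \<Rightarrow> (nat \<Rightarrow> complex ^ 'n) set" where
  "frames k =
     {b \<in> {..<k} \<rightarrow>\<^sub>E UNIV. inj_on b {..<k} \<and> vec.independent (b ` {..<k})}"

definition grassmannian :: "nat \<Rightarrow> (complex ^ 'n) set topology" where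
  "grassmannian k =
     quotient_topology
       (subtopology (product_topology (\<lambda>_. euclidean) {..<k}) (frames k))
       (\<lambda>b. vec.span (b ` {..<k}))"

lemma topspace_grassmannian:
  "topspace (grassmannian k :: (complex ^ 'n) set topology) =
     {W. vec.subspace W \<and> vec.dim W = k}"
proof -
  have "(\<lambda>b. vec.span (b ` {..<k})) ` frames k =
      {W :: (complex ^ 'n) set. vec.subspace W \<and> vec.dim W = k}" (is "?L = ?R")
  proof (rule set_eqI, rule iffI)
    fix W :: "(complex ^ 'n) set"
    assume "W \<in> ?L"
    then obtain b where b: "inj_on b {..<k}" "vec.independent (b ` {..<k})"
      and W: "W = vec.span (b ` {..<k})"
      by (auto simp: frames_def)
    have "vec.dim W = card (b ` {..<k})"
      unfolding W by (rule vec.dim_span_eq_card_independent[OF b(2)])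
    with b(1) W show "W \<in> ?R"
      by (simp add: card_image vec.subspace_span)
  next
    fix W :: "(complex ^ 'n) set"
    assume W: "W \<in> ?R"
    obtain B where B: "B \<subseteq> W" "vec.independent B" "W \<subseteq> vec.span B" "card B = vec.dim W"
      using vec.basis_exists by metis
    have "finite B" using B(2) by (rule vec.finiteI_independent)
    with W B(4) obtain h where h: "bij_betw h {..<k} B"
      using ex_bij_betw_nat_finite[of B] by (auto simp: atLeast0LessThan)
    let ?b = "restrict h {..<k}"
    have im: "?b ` {..<k} = B" using h by (auto simp: bij_betw_def)
    have "?b \<in> frames k"
      using h B(2) im by (auto simp: frames_def bij_betw_def inj_on_def)
    moreover have "W = vec.span (?b ` {..<k})"
      unfolding im using W B(1,3) vec.span_minimal[of B W] by auto
    ultimately show "W \<in> ?L" by blast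
  qed
  moreover have "topspace (subtopology (product_topology (\<lambda>_. euclidean) {..<k}) (frames k))
      = (frames k :: (nat \<Rightarrow> complex ^ 'n) set)"
    by (auto simp: frames_def)
  ultimately show ?thesis by (simp add: grassmannian_def)
qed

text \<open>
  The projective plane is \<open>grassmannian 1\<close> on \<open>complex ^ 3\<close>; its lines are the points of
  \<open>grassmannian 2\<close> on \<open>complex ^ 3\<close>, a point \<open>x\<close> lying on the line \<open>L\<close> iff \<open>x \<subseteq> L\<close>.
\<close>

abbreviation CP2 :: "(complex ^ 3) set topology" where
  "CP2 \<equiv> grassmannian 1"

abbreviation CP2_dual :: "(complex ^ 3) set topology" where
  "CP2_dual \<equiv> grassmannian 2"


section \<open>The orbit space of the Grassmannian\<close>

definition torus :: "(complex ^ 5) set" where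
  "torus = {t. (\<forall>i. norm (t $ i) = 1) \<and> (\<Prod>i\<in>UNIV. t $ i) = 1}"

definition torus_act :: "complex ^ 5 \<Rightarrow> (complex ^ 5) set \<Rightarrow> (complex ^ 5) set" where
  "torus_act t W = (\<lambda>v. \<chi> i. t $ i * v $ i) ` W"

definition Gr25_mod_T :: "(complex ^ 5) set set topology" where
  "Gr25_mod_T = quotient_topology (grassmannian 2) (\<lambda>W. (\<lambda>t. torus_act t W) ` torus)"


section \<open>The hypersimplex\<close>

definition hypersimplex :: "(real ^ 5) set" where
  "hypersimplex = {x. (\<forall>i. 0 \<le> x $ i \<and> x $ i \<le> 1) \<and> (\<Sum>i\<in>UNIV. x $ i) = 2}"

definition octahedron :: "5 \<Rightarrow> (real ^ 5) set" where
  "octahedron i = {x \<in> hypersimplex. x $ i = 0}"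


section \<open>The del Pezzo surface and its conic bundles\<close>

text \<open>
  Everything carrying an index in 1, ..., 5 is indexed by the type \<open>5\<close>, where the numeral 5
  denotes the same element as 0. Only the values of \<open>p\<close> at 1, ..., 4 are used.
\<close>

definition pts :: "5 set" where
  "pts = {1, 2, 3, 4}"

definition general_position :: "(5 \<Rightarrow> (complex ^ 3) set) \<Rightarrow> bool" where
  "general_position p \<longleftrightarrow>
     p ` pts \<subseteq> topspace CP2 \<and> inj_on p pts \<and>
     (\<forall>i\<in>pts. \<forall>j\<in>pts. \<forall>k\<in>pts. i \<noteq> j \<and> i \<noteq> k \<and> j \<noteq> k \<longrightarrow>
        \<not> (\<exists>L \<in> topspace CP2_dual. p i \<subseteq> L \<and> p j \<subseteq> L \<and> p k \<subseteq> L))"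

text \<open>
  The blow-up of the plane at a single point \<open>q\<close> is the incidence variety of pairs \<open>(x, L)\<close>
  with \<open>L\<close> a line through \<open>q\<close> and \<open>x\<close> a point of \<open>L\<close>. The blow-up at four points is the
  fibre product of the four single blow-ups over the plane, and \<open>fst\<close> is the blow-down map.
\<close>

definition dP5 :: "(5 \<Rightarrow> (complex ^ 3) set) \<Rightarrow>
    ((complex ^ 3) set \<times> (5 \<Rightarrow> (complex ^ 3) set)) topology" where
  "dP5 p =
     subtopology (prod_topology CP2 (product_topology (\<lambda>_. CP2_dual) pts))
       {(x, L). \<forall>i\<in>pts. p i \<subseteq> L i \<and> x \<subseteq> L i}"

definition lines_through :: "(complex ^ 3) set \<Rightarrow> (complex ^ 3) set set set" where
  "lines_through q = {{x \<in> topspace CP2. x \<subseteq> L} | L. L \<in> topspace CP2_dual \<and> q \<subseteq> L}"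

definition conics_through :: "(complex ^ 3) set set \<Rightarrow> (complex ^ 3) set set set" where
  "conics_through Q =
     {C. Q \<subseteq> C \<and>
       (\<exists>A :: complex ^ 3 ^ 3. A \<noteq> 0 \<and> transpose A = A \<and>
         C = {x \<in> topspace CP2. \<forall>v\<in>x. (\<Sum>i\<in>UNIV. \<Sum>j\<in>UNIV. A $ i $ j * v $ i * v $ j) = 0})}"

text \<open>
  \<open>proper_transform p B C\<close> is the proper transform of the curve \<open>C\<close> with respect to the
  points of \<open>B\<close> only: exceptional curves over points of \<open>C\<close> outside \<open>B\<close> are kept. With \<open>B\<close>
  the base locus of a pencil, this gives exactly the members of the pencil on the blow-up.
  For instance, the member of |E5 - E1| given by the line through \<open>p 1\<close> and \<open>p 2\<close> is the
  reducible curve (E5 - E1 - E2) + E2.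
\<close>

definition proper_transform ::
  "(5 \<Rightarrow> (complex ^ 3) set) \<Rightarrow> (complex ^ 3) set set \<Rightarrow> (complex ^ 3) set set \<Rightarrow>
    ((complex ^ 3) set \<times> (5 \<Rightarrow> (complex ^ 3) set)) set" where
  "proper_transform p B C = dP5 p closure_of {y \<in> topspace (dP5 p). fst y \<in> C - B}"

text \<open>
  The morphism defined by a base point free pencil sends a point to the unique member through
  it. The target, a complex projective line, is the pencil itself.
\<close>

definition pencil_map ::
  "(5 \<Rightarrow> (complex ^ 3) set) \<Rightarrow> (complex ^ 3) set set \<Rightarrow> (complex ^ 3) set set set \<Rightarrow>
    (complex ^ 3) set \<times> (5 \<Rightarrow> (complex ^ 3) set) \<Rightarrow> (complex ^ 3) set set" where
  "pencil_map p B \<C> y = (THE C. C \<in> \<C> \<and> y \<in> proper_transform p B C)"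

definition conic_bundle ::
  "(5 \<Rightarrow> (complex ^ 3) set) \<Rightarrow> 5 \<Rightarrow>
    (complex ^ 3) set \<times> (5 \<Rightarrow> (complex ^ 3) set) \<Rightarrow> (complex ^ 3) set set" where
  "conic_bundle p i =
     (if i = 5 then pencil_map p (p ` pts) (conics_through (p ` pts))
      else pencil_map p {p i} (lines_through (p i)))"


section \<open>The space X\<close>

definition glue :: "(5 \<Rightarrow> (complex ^ 3) set) \<Rightarrow>
    ((real ^ 5) \<times> (complex ^ 3) set \<times> (5 \<Rightarrow> (complex ^ 3) set)) rel" where
  "glue p =
     {((x, y), (x', y')).
        x = x' \<and> x \<in> hypersimplex \<and> y \<in> topspace (dP5 p) \<and> y' \<in> topspace (dP5 p) \<and>
        (x \<in> rel_interior hypersimplex \<and> y = y' \<or>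
         (\<exists>i. x \<in> rel_interior (octahedron i) \<and> conic_bundle p i y = conic_bundle p i y') \<or>
         x \<in> rel_frontier hypersimplex - (\<Union>i. rel_interior (octahedron i)))}"

definition X_space :: "(5 \<Rightarrow> (complex ^ 3) set) \<Rightarrow>
    ((real ^ 5) \<times> (complex ^ 3) set \<times> (5 \<Rightarrow> (complex ^ 3) set)) set topology" where
  "X_space p =
     quotient_topology (prod_topology (top_of_set hypersimplex) (dP5 p)) (\<lambda>z. glue p `` {z})"

end

theory Submission
  imports Defs
begin

text \<open>
  Identify \<open>Y\<close> with the moduli space of stable configurations of five points on the projective line,
  the conic bundle \<open>f\<^sub>k\<close> being the cross ratio of the points other than the \<open>k\<close>-th. A point of the
  orbit space has a moment \<open>x \<in> P\<close> and a collection of cross ratios of its Pluecker coordinates.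
  Conversely, every \<open>(x, y) \<in> P \<times> Y\<close> determines a unique orbit with moment \<open>x\<close> whose cross ratios
  agree with those of \<open>y\<close> wherever they are defined. Hence the orbit space is a quotient of \<open>P \<times> Y\<close>
  as well. It is a further quotient of \<open>X\<close>: the additional identifications take place among points
  \<open>y\<close> of the divisor along which the points \<open>m\<close> and \<open>n\<close> collide, over the \<open>x\<close> with
  \<open>x m + x n \<ge> 1\<close>. These \<open>x\<close> stay away from the barycentre of \<open>P\<close>. The radial expansion of \<open>P\<close>
  from its barycentre respects both equivalence relations, and at time 1 it has pushed these \<open>x\<close>
  to the boundary, where the additional identifications are already made in \<open>X\<close>. So it induces a
  homotopy inverse of the projection of \<open>X\<close> onto the orbit space.
\<close>

section \<open>Homotopy equivalences between quotients\<close>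

text \<open>No formula for a map between \<open>X_space p\<close> and the orbit space is at hand:
  the orbit with a prescribed moment is found by minimization, and cross ratios degenerate on the
  boundary divisors. The proof therefore uses a correspondence, \<open>moment_rel\<close>, between
  points (x, y) and orthonormal frames with moment x and cross ratios compatible with y. It is cut
  out by polynomial equations in a compact set, so both of its projections are closed maps. Their
  surjectivity only has to be checked on dense subsets, where all five points are distinct. Its
  uniqueness up to the torus is a combinatorial matter: which Pluecker coordinates vanish is
  controlled by inequalities between moments. Continuity of the induced map is then a consequence of
  compactness. To obtain compact Euclidean models, Y is replaced by tuples of unit vectors
  (\<open>dP5_lift\<close>) and the Grassmannian by orthonormal frames (\<open>stiefel\<close>).
  Cross ratios are compared in cross-multiplied form, so that the equations survive collisions of
  points; the price is that such equalities compose only through stable configurations.\<close>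

lemma Hausdorff_space_separating:
  assumes "\<And>x y. \<lbrakk>x \<in> topspace X; y \<in> topspace X; x \<noteq> y\<rbrakk>
    \<Longrightarrow> \<exists>f. continuous_map X (euclidean :: 'b::t2_space topology) f \<and> f x \<noteq> f y"
  shows "Hausdorff_space X"
  unfolding Hausdorff_space_def
proof (intro allI impI, elim conjE)
  fix x y assume xy: "x \<in> topspace X" "y \<in> topspace X" "x \<noteq> y"
  then obtain f :: "'a \<Rightarrow> 'b" where f: "continuous_map X euclidean f" "f x \<noteq> f y"
    using assms by blast
  then obtain U V where UV: "open U" "open V" "f x \<in> U" "f y \<in> V" "U \<inter> V = {}"
    using hausdorff[of "f x" "f y"] by blast
  have "openin X {z \<in> topspace X. f z \<in> U}" "openin X {z \<in> topspace X. f z \<in> V}"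
    using f(1) UV by (auto intro: openin_continuous_map_preimage simp flip: open_openin)
  moreover have "disjnt {z \<in> topspace X. f z \<in> U} {z \<in> topspace X. f z \<in> V}"
    using UV by (auto simp: disjnt_def)
  ultimately show "\<exists>U V. openin X U \<and> openin X V \<and> x \<in> U \<and> y \<in> V \<and> disjnt U V"
    using xy UV by blast
qed

text \<open>Products of quotient maps need not be quotient maps; local compactness of the interval
  makes this one work. It is what allows a homotopy on A to be pushed down to X.\<close>

lemma quotient_map_prod_interval:
  assumes "quotient_map A X q"
  shows "quotient_map (prod_topology (top_of_set {0..1::real}) A)
           (prod_topology (top_of_set {0..1}) X) (\<lambda>(t, a). (t, q a))"
proof (rule quotient_map_prod_right[OF _ _ assms])
  show "locally_compact_space (top_of_set {0..1::real})"
    by (rule compact_imp_locally_compact_space) (simp add: compact_space_subtopology)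
  show "Hausdorff_space (top_of_set {0..1::real}) \<or> regular_space (top_of_set {0..1::real})"
    by (simp add: Hausdorff_space_subtopology)
qed

text \<open>The homotopy \<open>q \<circ> \<Phi>\<close> is constant on the fibres of the product of
  q with the identity of the interval, so it descends to a homotopy on X whose end is induced by
  \<Phi> at time 1.\<close>

lemma homotopic_id_by_quotient:
  assumes q: "quotient_map A X q"
    and \<Phi>: "continuous_map (prod_topology (top_of_set {0..1::real}) A) A \<Phi>"
    and \<Phi>0: "\<And>a. a \<in> topspace A \<Longrightarrow> \<Phi> (0, a) = a"
    and resp: "\<And>t a b. \<lbrakk>t \<in> {0..1}; a \<in> topspace A; b \<in> topspace A; q a = q b\<rbrakk>
        \<Longrightarrow> q (\<Phi> (t, a)) = q (\<Phi> (t, b))"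
    and h: "\<And>a. a \<in> topspace A \<Longrightarrow> h (q a) = q (\<Phi> (1, a))"
  shows "homotopic_with (\<lambda>_. True) X X h id"
proof -
  have "continuous_map (prod_topology (top_of_set {0..1::real}) A) X (q \<circ> \<Phi>)"
    using \<Phi> q continuous_map_compose quotient_imp_continuous_map by blast
  then obtain K where K: "continuous_map (prod_topology (top_of_set {0..1::real}) X) X K"
    and Kq: "\<And>z. z \<in> topspace (prod_topology (top_of_set {0..1::real}) A) \<Longrightarrow>
       K (case z of (t, a) \<Rightarrow> (t, q a)) = (q \<circ> \<Phi>) z"
  proof (rule quotient_map_lift_exists[OF quotient_map_prod_interval[OF q]])
    fix y z
    assume "y \<in> topspace (prod_topology (top_of_set {0..1::real}) A)"
      "z \<in> topspace (prod_topology (top_of_set {0..1::real}) A)"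
      "(case y of (t, a) \<Rightarrow> (t, q a)) = (case z of (t, a) \<Rightarrow> (t, q a))"
    then show "(q \<circ> \<Phi>) y = (q \<circ> \<Phi>) z"
      by (cases y; cases z) (auto intro!: resp)
  qed blast
  have Kt: "K (t, q a) = q (\<Phi> (t, a))" if "t \<in> {0..1}" "a \<in> topspace A" for t a
    using Kq[of "(t, a)"] that by simp
  have surj: "\<exists>a\<in>topspace A. x = q a" if "x \<in> topspace X" for x
    using that quotient_imp_surjective_map[OF q] by blast
  have K0: "K (0, x) = id x" and K1: "K (1, x) = h x" if x: "x \<in> topspace X" for x
  proof -
    obtain a where a: "a \<in> topspace A" "x = q a" using surj[OF x] by blast
    show "K (0, x) = id x" using Kt[of 0 a] \<Phi>0 a by simp
    show "K (1, x) = h x" using Kt[of 1 a] h a by simp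
  qed
  have "homotopic_with (\<lambda>_. True) X X id h"
  proof (subst homotopic_with)
    show "\<exists>k. continuous_map (prod_topology (top_of_set {0..1::real}) X) X k \<and>
       (\<forall>x\<in>topspace X. k (0, x) = id x) \<and> (\<forall>x\<in>topspace X. k (1, x) = h x) \<and> (\<forall>t\<in>{0..1::real}. True)"
      by (rule exI[of _ K]) (use K K0 K1 in blast)
  qed simp
  then show ?thesis by (rule homotopic_with_symD)
qed

text \<open>By \<open>qF\<close>, X is the finer quotient, which gives the map X to Z. The map back
  is induced by \<Phi> at time 1: \<open>Fq\<close> says that by then q has made every
  identification that F makes. Both composites are induced by \<Phi> at time 1, hence are homotopic
  to the identity through the descended \<Phi>.\<close>

lemma homotopy_equivalent_space_by_quotients:
  assumes q: "quotient_map A X q" and F: "quotient_map A Z F"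
    and qF: "\<And>a b. \<lbrakk>a \<in> topspace A; b \<in> topspace A; q a = q b\<rbrakk> \<Longrightarrow> F a = F b"
    and \<Phi>: "continuous_map (prod_topology (top_of_set {0..1::real}) A) A \<Phi>"
    and \<Phi>0: "\<And>a. a \<in> topspace A \<Longrightarrow> \<Phi> (0, a) = a"
    and q\<Phi>: "\<And>t a b. \<lbrakk>t \<in> {0..1}; a \<in> topspace A; b \<in> topspace A; q a = q b\<rbrakk>
        \<Longrightarrow> q (\<Phi> (t, a)) = q (\<Phi> (t, b))"
    and F\<Phi>: "\<And>t a b. \<lbrakk>t \<in> {0..1}; a \<in> topspace A; b \<in> topspace A; F a = F b\<rbrakk>
        \<Longrightarrow> F (\<Phi> (t, a)) = F (\<Phi> (t, b))"
    and Fq: "\<And>a b. \<lbrakk>a \<in> topspace A; b \<in> topspace A; F a = F b\<rbrakk>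
        \<Longrightarrow> q (\<Phi> (1, a)) = q (\<Phi> (1, b))"
  shows "X homotopy_equivalent_space Z"
proof -
  obtain f where f: "continuous_map X Z f" "\<And>a. a \<in> topspace A \<Longrightarrow> f (q a) = F a"
    using quotient_map_lift_exists[OF q quotient_imp_continuous_map[OF F]] qF by metis
  have "continuous_map A (prod_topology (top_of_set {0..1::real}) A) (\<lambda>a. (1, a))"
    by (auto simp: continuous_map_pairwise o_def)
  then have "continuous_map A X (q \<circ> (\<Phi> \<circ> (\<lambda>a. (1, a))))"
    using \<Phi> quotient_imp_continuous_map[OF q] by (intro continuous_map_compose)
  then obtain g where g: "continuous_map Z X g"
    "\<And>a. a \<in> topspace A \<Longrightarrow> g (F a) = q (\<Phi> (1, a))"
    using quotient_map_lift_exists[OF F, of X "q \<circ> (\<Phi> \<circ> (\<lambda>a. (1, a)))"] Fq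
    by (metis comp_apply)
  have \<Phi>1: "\<Phi> (1, a) \<in> topspace A" if "a \<in> topspace A" for a
    using that \<Phi> unfolding continuous_map_def by fastforce
  have "homotopic_with (\<lambda>_. True) X X (g \<circ> f) id"
    by (rule homotopic_id_by_quotient[OF q \<Phi> \<Phi>0 q\<Phi>]) (auto simp: f g)
  moreover have "homotopic_with (\<lambda>_. True) Z Z (f \<circ> g) id"
    by (rule homotopic_id_by_quotient[OF F \<Phi> \<Phi>0 F\<Phi>]) (auto simp: f g \<Phi>1)
  ultimately show ?thesis
    using f g unfolding homotopy_equivalent_space_def by blast
qed

section \<open>The five-element index type\<close>

lemma exhaust_5:
  fixes x :: 5
  shows "x = 1 \<or> x = 2 \<or> x = 3 \<or> x = 4 \<or> x = 5"
proof (induct x)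
  case (of_int z)
  then have "z = 0 \<or> z = 1 \<or> z = 2 \<or> z = 3 \<or> z = 4" by fastforce
  then show ?case by auto
qed

lemma UNIV_5: "UNIV = {1, 2, 3, 4, 5::5}"
  using exhaust_5 by auto

lemma sum_5: "sum f (UNIV::5 set) = f 1 + f 2 + f 3 + f 4 + f 5"
  unfolding UNIV_5 by (simp add: ac_simps)

lemma UNIV_5_distinct:
  assumes "distinct [i, j, k, l, m :: 5]"
  shows "UNIV = {i, j, k, l, m}"
proof -
  have "card {i, j, k, l, m} = CARD(5)" using assms by simp
  then show ?thesis by (metis card_subset_eq finite subset_UNIV)
qed

lemma sum_5_distinct:
  assumes "distinct [i, j, k, l, m :: 5]"
  shows "sum f UNIV = f i + f j + f k + f l + f m"
  unfolding UNIV_5_distinct[OF assms] using assms by (simp add: ac_simps)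

lemma ex_distinct_5:
  assumes "finite S" "card S < 5"
  shows "\<exists>x::5. x \<notin> S"
proof -
  have "S \<noteq> UNIV" using assms by auto
  then show ?thesis by blast
qed

section \<open>Torus orbits of Pluecker vectors\<close>

text \<open>The three-term relations describe the decomposable bivectors, that is, the cone over the
  Grassmannian of 2-planes, vertex 0 included. A column index i stands for a point of the projective
  line, and \<open>p i j = 0\<close> says that the columns i and j are parallel.\<close>

definition plucker_vector :: "('n \<Rightarrow> 'n \<Rightarrow> complex) \<Rightarrow> bool" where
  "plucker_vector p \<longleftrightarrow> (\<forall>i j. p i j = - p j i) \<and>
     (\<forall>i j k l. p i j * p k l - p i k * p j l + p i l * p j k = 0)"

text \<open>The factors are arbitrary nonzero complex numbers. An overall scalar is covered too,
  since it has a complex square root that can be put into every c i.\<close>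

definition torus_equiv :: "('n \<Rightarrow> 'n \<Rightarrow> complex) \<Rightarrow> ('n \<Rightarrow> 'n \<Rightarrow> complex) \<Rightarrow> bool" where
  "torus_equiv p p' \<longleftrightarrow> (\<exists>c. (\<forall>i. c i \<noteq> 0) \<and> (\<forall>i j. p' i j = c i * c j * p i j))"

lemma plucker_vector_antisym: "plucker_vector p \<Longrightarrow> p i j = - p j i"
  unfolding plucker_vector_def by blast

lemma plucker_vector_rel:
  "plucker_vector p \<Longrightarrow> p i j * p k l - p i k * p j l + p i l * p j k = 0"
  unfolding plucker_vector_def by blast

lemma plucker_vector_diag:
  assumes "plucker_vector p"
  shows "p i i = 0"
proof -
  have "p i i + p i i = 0" using plucker_vector_antisym[OF assms, of i i] by (simp only: eq_neg_iff_add_eq_0)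
  then show ?thesis by simp
qed

lemma plucker_vector_zero_sym: "plucker_vector p \<Longrightarrow> p i j = 0 \<longleftrightarrow> p j i = 0"
  by (metis plucker_vector_antisym neg_equal_0_iff_equal)

text \<open>Being parallel is transitive through a nonzero column; \<open>p j m \<noteq> 0\<close>
  witnesses that column j is nonzero.\<close>

lemma plucker_vector_zero_trans:
  assumes "plucker_vector p" "p i j = 0" "p j k = 0" "p j m \<noteq> 0"
  shows "p i k = 0"
  using plucker_vector_rel[OF assms(1), of i k j m] assms
    plucker_vector_antisym[OF assms(1), of j k] by simp

text \<open>Three pairwise independent columns i, j, k fix a coordinate on the projective line.
  Their own scalings are found with one square root, the scaling of every further column l is forced
  by its cross ratios with i, j, k, and the remaining coordinates follow from the Pluecker
  relations.\<close>

lemma torus_equiv_triple: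
  assumes p: "plucker_vector p" and p': "plucker_vector p'"
    and zero: "\<And>i j. p i j = 0 \<longleftrightarrow> p' i j = 0"
    and cross: "\<And>a b c d. distinct [a, b, c, d] \<Longrightarrow>
      p a b * p c d * (p' a c * p' b d) = p a c * p b d * (p' a b * p' c d)"
    and nz: "p i j \<noteq> 0" "p i k \<noteq> 0" "p j k \<noteq> 0"
  shows "torus_equiv p p'"
proof -
  \<comment> \<open>These are the required values of the products cj * ck, ci * ck and ci * cj,
    whence ci squared must be rk * rj / ri.\<close>
  define ri rj rk where r: "ri = p' j k / p j k" "rj = p' i k / p i k" "rk = p' i j / p i j"
  define ci where "ci = csqrt (rk * rj / ri)"
  define cj where "cj = rk / ci"
  define ck where "ck = rj / ci"
  have rnz: "ri \<noteq> 0" "rj \<noteq> 0" "rk \<noteq> 0" using nz zero unfolding r by auto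
  have ci2: "ci * ci = rk * rj / ri"
    unfolding ci_def by (metis power2_csqrt power2_eq_square)
  have cnz: "ci \<noteq> 0" "cj \<noteq> 0" "ck \<noteq> 0"
    using ci2 rnz unfolding cj_def ck_def by auto
  have cij: "p' i j = ci * cj * p i j" and cik: "p' i k = ci * ck * p i k"
    using nz cnz unfolding cj_def ck_def r by auto
  have "cj * ck = rk * rj / (ci * ci)" unfolding cj_def ck_def by simp
  also have "\<dots> = ri" unfolding ci2 using rnz by simp
  finally have cjk: "p' j k = cj * ck * p j k" using nz unfolding r by simp
  have dist: "i \<noteq> j" "i \<noteq> k" "j \<noteq> k" using nz plucker_vector_diag[OF p] by auto
  have anti: "p' a b = - p' b a" "p a b = - p b a" for a b
    by (rule plucker_vector_antisym[OF p'], rule plucker_vector_antisym[OF p])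
  \<comment> \<open>The identities \<open>ij\<close>, \<open>ik\<close>, \<open>jk\<close> below say
    that the triples (p l i, p l j, p l k) and (p' l i / ci, p' l j / cj, p' l k / ck) are
    proportional. The factor is read off at the leading nonzero entry; by equality of the zero
    patterns it is nonzero.\<close>
  have ex: "\<exists>c. c \<noteq> 0 \<and> p' l i = c * ci * p l i \<and> p' l j = c * cj * p l j \<and> p' l k = c * ck * p l k" for l
  proof (cases "l \<in> {i, j, k}")
    case True
    then consider "l = i" | "l = j" | "l = k" by auto
    then show ?thesis
    proof cases
      case 1
      then show ?thesis using cij cik cnz plucker_vector_diag[OF p] plucker_vector_diag[OF p']
        by (intro exI[of _ ci]) auto
    next
      case 2
      then show ?thesis using cij cjk cnz plucker_vector_diag[OF p] plucker_vector_diag[OF p'] anti[of i j]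
        by (intro exI[of _ cj]) auto
    next
      case 3
      then show ?thesis using cik cjk cnz plucker_vector_diag[OF p] plucker_vector_diag[OF p'] anti[of i k] anti[of j k]
        by (intro exI[of _ ck]) auto
    qed
  next
    case False
    have ij: "p l i * (p' l j * ci) = p l j * (p' l i * cj)"
    proof -
      have "p l i * p j k * (p' l j * p' i k) = p l j * p i k * (p' l i * p' j k)"
        using cross[of l i j k] False dist by auto
      then have "(p l i * (p' l j * ci)) * (p j k * p i k * ck) = (p l j * (p' l i * cj)) * (p j k * p i k * ck)"
        unfolding cik cjk by (simp add: algebra_simps)
      then show ?thesis using nz cnz by simp
    qed
    have ik: "p l i * (p' l k * ci) = p l k * (p' l i * ck)"
    proof -
      have "p l i * p k j * (p' l k * p' i j) = p l k * p i j * (p' l i * p' k j)"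
        using cross[of l i k j] False dist by auto
      moreover have "p' k j = cj * ck * p k j"
        using anti[of k j] cjk by simp
      ultimately have "(p l i * (p' l k * ci)) * (p k j * p i j * cj) = (p l k * (p' l i * ck)) * (p k j * p i j * cj)"
        by (simp add: cij mult_ac)
      moreover have "p k j \<noteq> 0" using nz anti[of j k] by simp
      ultimately show ?thesis using nz cnz by simp
    qed
    have jk: "p l j * (p' l k * cj) = p l k * (p' l j * ck)"
    proof -
      have "p l j * p k i * (p' l k * p' j i) = p l k * p j i * (p' l j * p' k i)"
        using cross[of l j k i] False dist by auto
      moreover have "p' k i = ci * ck * p k i" "p' j i = ci * cj * p j i"
        using anti[of k i] anti[of j i] cik cij by simp_all
      ultimately have "(p l j * (p' l k * cj)) * (p k i * p j i * ci) = (p l k * (p' l j * ck)) * (p k i * p j i * ci)"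
        by (simp add: mult_ac)
      moreover have "p k i \<noteq> 0" "p j i \<noteq> 0" using nz anti[of i k] anti[of i j] by simp_all
      ultimately show ?thesis using cnz by simp
    qed
    consider "p l i \<noteq> 0" | "p l i = 0" "p l j \<noteq> 0" | "p l i = 0" "p l j = 0" "p l k \<noteq> 0"
      | "p l i = 0" "p l j = 0" "p l k = 0" by blast
    then show ?thesis
    proof cases
      case 1
      then show ?thesis using ij ik cnz zero[of l i]
        by (intro exI[of _ "p' l i / (ci * p l i)"]) (auto simp: field_simps)
    next
      case 2
      then show ?thesis using jk cnz zero[of l i] zero[of l j]
        by (intro exI[of _ "p' l j / (cj * p l j)"]) (auto simp: field_simps)
    next
      case 3
      then show ?thesis using cnz zero[of l i] zero[of l j] zero[of l k]
        by (intro exI[of _ "p' l k / (ck * p l k)"]) (auto simp: field_simps)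
    next
      case 4
      then show ?thesis using zero[of l i] zero[of l j] zero[of l k] by (intro exI[of _ 1]) auto
    qed
  qed
  obtain c where c: "\<And>l. c l \<noteq> 0" "\<And>l. p' l i = c l * ci * p l i" "\<And>l. p' l j = c l * cj * p l j"
    using ex by metis
  \<comment> \<open>Up to the factor p i j, every coordinate p l m is a 2x2 minor of the rows i and
    j, whose scaling is already known.\<close>
  have "p' l m = c l * c m * p l m" for l m
  proof -
    have "p' i j * p' l m = p' i l * p' j m - p' i m * p' j l"
      using plucker_vector_rel[OF p', of i j l m] by (simp add: algebra_simps)
    also have "\<dots> = p' l i * p' m j - p' m i * p' l j"
      by (simp add: anti[of i l] anti[of i m] anti[of j l] anti[of j m])
    also have "\<dots> = c l * c m * (ci * cj) * (p i l * p j m - p i m * p j l)"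
      unfolding c(2,3) using anti[of i l] anti[of i m] anti[of j m] anti[of j l] by (simp add: algebra_simps)
    also have "p i l * p j m - p i m * p j l = p i j * p l m"
      using plucker_vector_rel[OF p, of i j l m] by (simp add: algebra_simps)
    finally show ?thesis using nz cnz unfolding cij by (simp add: algebra_simps)
  qed
  then show ?thesis using c(1) unfolding torus_equiv_def by blast
qed

text \<open>Without three pairwise independent columns, the nonzero columns split into the parallel
  class of a and that of b. For d in the former and e in the latter, p d e = p a e * p d b / p a b,
  so matching the entries against a and b matches everything. The scaling is normalized by c b = 1
  and c a = ca; zero columns receive 1.\<close>

lemma torus_equiv_bipartite:
  assumes p: "plucker_vector p" and p': "plucker_vector p'"
    and zero: "\<And>i j. p i j = 0 \<longleftrightarrow> p' i j = 0"
    and nz: "p a b \<noteq> 0"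
    and bip: "\<And>i j k. p i j = 0 \<or> p i k = 0 \<or> p j k = 0"
  shows "torus_equiv p p'"
proof -
  define ca where "ca = p' a b / p a b"
  define c where "c d = (if p d b \<noteq> 0 then p' d b / p d b
      else if p a d \<noteq> 0 then p' a d / (ca * p a d) else 1)" for d
  have canz: "ca \<noteq> 0" using nz zero unfolding ca_def by auto
  have cnz: "c d \<noteq> 0" for d using zero canz unfolding c_def by auto
  have anti: "p' i j = - p' j i" "p i j = - p j i" for i j
    by (rule plucker_vector_antisym[OF p'], rule plucker_vector_antisym[OF p])
  have det: "p d e = (p a d * p b e - p a e * p b d) / p a b" for d e
    using plucker_vector_rel[OF p, of a b d e] nz by (simp add: field_simps)
  have det': "p' d e = (p' a d * p' b e - p' a e * p' b d) / p' a b" for d e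
    using plucker_vector_rel[OF p', of a b d e] nz zero[of a b] by (simp add: field_simps)
  have one: "p' d e = c d * c e * p d e" if d: "p d b \<noteq> 0" for d e
  proof (cases "p e b = 0")
    case True
    have ad: "p a d = 0" using bip[of a b d] nz d anti[of b d] by fastforce
    then have d': "p' a d = 0" "p' e b = 0" using zero True by auto
    have be: "p b e = 0" "p' b e = 0" using True d' anti[of b e] by auto
    show ?thesis
    proof (cases "p a e = 0")
      case T: True
      then have "p d e = 0" using det[of d e] ad be by simp
      then show ?thesis using zero by simp
    next
      case False
      have "p' d e = p' a e * p' d b / p' a b" using det'[of d e] d' be anti[of b d] by simp
      moreover have "p d e = p a e * p d b / p a b" using det[of d e] ad be anti[of b d] by simp
      moreover have "c d = p' d b / p d b" "c e = p' a e / (ca * p a e)"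
        using d True False unfolding c_def by auto
      ultimately show ?thesis using nz d False canz unfolding ca_def by simp
    qed
  next
    case False
    then have "p d e = 0" using bip[of d e b] d by auto
    then show ?thesis using zero by simp
  qed
  have "p' d e = c d * c e * p d e" for d e
  proof -
    consider "p d b \<noteq> 0" | "p e b \<noteq> 0" | "p d b = 0" "p e b = 0" by blast
    then show ?thesis
    proof cases
      case 1 then show ?thesis by (rule one)
    next
      case 2 then show ?thesis using one[of e d] anti[of d e] by simp
    next
      case 3
      then have "p d e = 0" using det[of d e] anti[of b d] anti[of b e] by simp
      then show ?thesis using zero by simp
    qed
  qed
  then show ?thesis using cnz unfolding torus_equiv_def by blast
qed

text \<open>The two preceding cases are exhaustive: either some three columns are pairwise
  independent or none are. All orbit comparisons over a given moment are reduced to this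
  criterion.\<close>

lemma torus_equivI:
  assumes "plucker_vector p" "plucker_vector p'"
    and "\<And>i j. p i j = 0 \<longleftrightarrow> p' i j = 0"
    and "\<And>a b c d. distinct [a, b, c, d] \<Longrightarrow>
      p a b * p c d * (p' a c * p' b d) = p a c * p b d * (p' a b * p' c d)"
    and "p a b \<noteq> 0"
  shows "torus_equiv p p'"
  using torus_equiv_triple[OF assms(1-4)] torus_equiv_bipartite[OF assms(1-3,5)] by blast

section \<open>Moments of normalized Pluecker vectors\<close>

definition weight :: "('n::finite \<Rightarrow> 'n \<Rightarrow> complex) \<Rightarrow> 'n \<Rightarrow> real" where
  "weight p i = (\<Sum>j\<in>UNIV. (cmod (p i j))\<^sup>2)"

text \<open>The sum runs over ordered pairs, so total 2 means norm 1 over unordered pairs. With this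
  choice \<open>weight p\<close> is the moment of the plane and lies in the hypersimplex.\<close>

definition normalized :: "('n::finite \<Rightarrow> 'n \<Rightarrow> complex) \<Rightarrow> bool" where
  "normalized p \<longleftrightarrow> plucker_vector p \<and> (\<Sum>i\<in>UNIV. weight p i) = 2"

lemma normalized_plucker_vector [simp]: "normalized p \<Longrightarrow> plucker_vector p"
  by (simp add: normalized_def)

lemma normalized_sum: "normalized p \<Longrightarrow> (\<Sum>i\<in>UNIV. weight p i) = 2"
  by (simp add: normalized_def)

lemma weight_nonneg: "weight p i \<ge> 0"
  by (simp add: weight_def sum_nonneg)

lemma weight_eq_0_iff: "weight p i = 0 \<longleftrightarrow> (\<forall>j. p i j = 0)"
  by (auto simp: weight_def sum_nonneg_eq_0_iff)

text \<open>Split the sum of all squared absolute values, which is 2, according to S and its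
  complement. The block inside S vanishes and the two mixed blocks each equal the weight of S, so
  twice this weight plus the block outside S is 2. The second claim is the case of equality, where
  the outer block has to vanish.\<close>

lemma weight_parallel:
  assumes p: "normalized p" and S: "\<And>i j. \<lbrakk>i \<in> S; j \<in> S\<rbrakk> \<Longrightarrow> p i j = 0"
  shows "sum (weight p) S \<le> 1"
    and "\<lbrakk>sum (weight p) S = 1; i \<notin> S; j \<notin> S\<rbrakk> \<Longrightarrow> p i j = 0"
proof -
  let ?f = "\<lambda>i j. (cmod (p i j))\<^sup>2"
  have sym: "?f i j = ?f j i" for i j
    using plucker_vector_antisym[of p i j] p by (metis norm_minus_cancel normalized_plucker_vector)
  have split: "(\<Sum>j\<in>UNIV. g j) = sum g S + sum g (- S)" for g :: "'a \<Rightarrow> real"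
    by (metis finite sum.subset_diff subset_UNIV add.commute Compl_eq_Diff_UNIV)
  have "sum (weight p) S = (\<Sum>i\<in>S. \<Sum>j\<in>S. ?f i j) + (\<Sum>i\<in>S. \<Sum>j\<in>-S. ?f i j)"
    unfolding weight_def split sum.distrib ..
  then have wS: "sum (weight p) S = (\<Sum>i\<in>S. \<Sum>j\<in>-S. ?f i j)" using S by simp
  have "sum (weight p) (- S) = (\<Sum>i\<in>-S. \<Sum>j\<in>S. ?f i j) + (\<Sum>i\<in>-S. \<Sum>j\<in>-S. ?f i j)"
    unfolding weight_def split sum.distrib ..
  also have "(\<Sum>i\<in>-S. \<Sum>j\<in>S. ?f i j) = (\<Sum>i\<in>S. \<Sum>j\<in>-S. ?f i j)"
    by (subst sum.swap) (simp add: sym)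
  finally have "2 = 2 * sum (weight p) S + (\<Sum>i\<in>-S. \<Sum>j\<in>-S. ?f i j)"
    using normalized_sum[OF p] split[of "weight p"] wS by simp
  moreover have nn: "(\<Sum>i\<in>-S. \<Sum>j\<in>-S. ?f i j) \<ge> 0" by (intro sum_nonneg) auto
  ultimately show "sum (weight p) S \<le> 1" by linarith
  assume "sum (weight p) S = 1" and ij: "i \<notin> S" "j \<notin> S"
  then have "(\<Sum>i\<in>-S. \<Sum>j\<in>-S. ?f i j) = 0"
    using \<open>2 = _\<close> by linarith
  then show "p i j = 0" using ij by (simp add: sum_nonneg_eq_0_iff sum_nonneg)
qed

lemma weight_le_1: "normalized p \<Longrightarrow> weight p i \<le> 1"
  using weight_parallel(1)[of p "{i}"] by (simp add: plucker_vector_diag)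

text \<open>Two points of a complex torus orbit with equal moments have the same absolute values:
  with \<open>\<lambda> i j = ln \<bar>c i c j\<bar>\<^sup>2\<close>, the nonnegative sum of
  \<open>\<bar>p i j\<bar>\<^sup>2 (exp (\<lambda> i j) - 1) \<lambda> i j\<close> vanishes.\<close>

lemma torus_equiv_unitary:
  assumes p: "normalized p" and p': "normalized p'" and eq: "weight p = weight p'"
    and "torus_equiv p p'"
  shows "\<exists>t. (\<forall>i. cmod (t i) = 1) \<and> (\<forall>i j. p' i j = t i * t j * p i j)"
proof -
  obtain c where c: "\<And>i. c i \<noteq> 0" "\<And>i j. p' i j = c i * c j * p i j"
    using assms(4) unfolding torus_equiv_def by blast
  define s where "s i = ln ((cmod (c i))\<^sup>2)" for i
  define f where "f i j = (cmod (p i j))\<^sup>2" for i j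
  have cs: "(cmod (c i))\<^sup>2 = exp (s i)" for i using c(1)[of i] unfolding s_def by simp
  have f': "(cmod (p' i j))\<^sup>2 = exp (s i + s j) * f i j" for i j
    unfolding c(2) f_def by (simp add: norm_mult power_mult_distrib cs exp_add)
  have sym: "f i j = f j i" for i j
    using plucker_vector_antisym[of p i j] p unfolding f_def
    by (metis norm_minus_cancel normalized_plucker_vector)
  have w: "(\<Sum>j\<in>UNIV. (exp (s i + s j) - 1) * f i j) = 0" for i
    using fun_cong[OF eq, of i] unfolding weight_def f' f_def[symmetric]
    by (simp add: algebra_simps sum_subtractf)
  have z1: "(\<Sum>i\<in>UNIV. \<Sum>j\<in>UNIV. (exp (s i + s j) - 1) * f i j * s i) = 0"
    by (simp add: w flip: sum_distrib_right)
  moreover have "(\<Sum>i\<in>UNIV. \<Sum>j\<in>UNIV. (exp (s i + s j) - 1) * f i j * s j) = 0"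
    using z1 by (subst sum.swap) (simp add: sym add.commute)
  ultimately have z: "(\<Sum>i\<in>UNIV. \<Sum>j\<in>UNIV. (exp (s i + s j) - 1) * (s i + s j) * f i j) = 0"
    by (simp add: algebra_simps sum.distrib sum_subtractf)
  have nn: "(exp x - 1) * x \<ge> 0" for x :: real
    by (cases "x \<ge> 0") (auto simp: mult_nonneg_nonneg mult_nonpos_nonpos)
  have nn': "(exp (s i + s j) - 1) * (s i + s j) * f i j \<ge> 0" for i j
    using nn[of "s i + s j"] unfolding f_def by simp
  have zero: "(exp (s i + s j) - 1) * (s i + s j) * f i j = 0" for i j
    using z nn' by (simp add: sum_nonneg_eq_0_iff sum_nonneg)
  \<comment> \<open>Wherever p i j is nonzero the absolute values of c i and c j multiply to 1, so
    the phases alone carry p to p'.\<close>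
  define t where "t i = c i / cmod (c i)" for i
  have "p' i j = t i * t j * p i j" for i j
  proof (cases "p i j = 0")
    case True then show ?thesis by (simp add: c(2))
  next
    case False
    then have "s i + s j = 0" using zero[of i j] by (auto simp: f_def)
    then have "(cmod (c i) * cmod (c j))\<^sup>2 = 1"
      by (metis cs exp_add exp_zero power_mult_distrib)
    then have "cmod (c i) * cmod (c j) = 1"
      by (metis norm_ge_zero mult_nonneg_nonneg power2_eq_1_iff abs_of_nonneg abs_square_eq_1)
    then show ?thesis unfolding t_def c(2) 
      by (metis (no_types, opaque_lifting) times_divide_times_eq of_real_mult of_real_1 div_by_1)
  qed
  moreover have "cmod (t i) = 1" for i using c(1)[of i] by (simp add: t_def norm_divide)
  ultimately show ?thesis by blast
qed

section \<open>Cross ratios and stable configurations\<close>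

definition cross_ratio_eq ::
    "5 \<Rightarrow> (5 \<Rightarrow> 5 \<Rightarrow> complex) \<Rightarrow> (5 \<Rightarrow> 5 \<Rightarrow> complex) \<Rightarrow> bool" where
  "cross_ratio_eq k p q \<longleftrightarrow> (\<forall>a b c d. distinct [k, a, b, c, d] \<longrightarrow>
     p a b * p c d * (q a c * q b d) = p a c * p b d * (q a b * q c d))"

text \<open>Among the four points labelled by \<open>- {k}\<close>, no three coincide, so their cross ratio is defined.\<close>

definition stable_off :: "5 \<Rightarrow> (5 \<Rightarrow> 5 \<Rightarrow> complex) \<Rightarrow> bool" where
  "stable_off k p \<longleftrightarrow> plucker_vector p \<and>
     (\<forall>a b c. distinct [k, a, b, c] \<longrightarrow> p a b \<noteq> 0 \<or> p a c \<noteq> 0)"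

text \<open>The boundary divisor of \<open>dP\<^sub>5\<close> along which the points \<open>m\<close> and \<open>n\<close> collide, in terms of
  the values of the five conic bundles.\<close>

definition on_divisor :: "5 \<Rightarrow> 5 \<Rightarrow> (5 \<Rightarrow> 5 \<Rightarrow> 5 \<Rightarrow> complex) \<Rightarrow> bool" where
  "on_divisor m n B \<longleftrightarrow> (\<forall>k j l. distinct [m, n, k, j, l] \<longrightarrow> B k m n * B k j l = 0)"

lemma cross_ratio_eqD:
  "\<lbrakk>cross_ratio_eq k p q; distinct [k, a, b, c, d]\<rbrakk> \<Longrightarrow>
     p a b * p c d * (q a c * q b d) = p a c * p b d * (q a b * q c d)"
  unfolding cross_ratio_eq_def by blast

lemma cross_ratio_eq_sym: "cross_ratio_eq k p q \<longleftrightarrow> cross_ratio_eq k q p"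
  unfolding cross_ratio_eq_def by (metis mult.commute)

text \<open>The pairs ab, bd, dc, ca form a four-cycle. A vanishing factor in each of the two
  products would give two vanishing coordinates sharing an index, which stability excludes.\<close>

lemma stable_offD:
  assumes "stable_off k p" "distinct [k, a, b, c, d]"
  shows "p a b * p c d \<noteq> 0 \<or> p a c * p b d \<noteq> 0"
proof -
  have "p a b \<noteq> 0 \<or> p a c \<noteq> 0" "p b a \<noteq> 0 \<or> p b d \<noteq> 0" "p c d \<noteq> 0 \<or> p c a \<noteq> 0"
    "p d c \<noteq> 0 \<or> p d b \<noteq> 0"
    using assms unfolding stable_off_def by auto
  moreover have "p b a = 0 \<longleftrightarrow> p a b = 0" "p c a = 0 \<longleftrightarrow> p a c = 0" "p d c = 0 \<longleftrightarrow> p c d = 0"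
    "p d b = 0 \<longleftrightarrow> p b d = 0"
    using plucker_vector_zero_sym[of p] assms(1) unfolding stable_off_def by metis+
  ultimately show ?thesis by auto
qed

text \<open>A cross-multiplied equation is empty when both products of one side vanish. Stability of
  the middle term q rules this out, so the common ratio can be cancelled.\<close>

lemma cross_ratio_eq_trans:
  assumes "stable_off k q" "cross_ratio_eq k p q" "cross_ratio_eq k q r"
  shows "cross_ratio_eq k p r"
  unfolding cross_ratio_eq_def
proof (intro allI impI)
  fix a b c d assume d: "distinct [k, a, b, c, d]"
  define x y x' y' x'' y'' where xy: "x = p a b * p c d" "y = p a c * p b d"
    "x' = q a b * q c d" "y' = q a c * q b d" "x'' = r a b * r c d" "y'' = r a c * r b d"
  have "x * y' = y * x'" "x' * y'' = y' * x''" "x' \<noteq> 0 \<or> y' \<noteq> 0"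
    using cross_ratio_eqD[OF assms(2) d] cross_ratio_eqD[OF assms(3) d] stable_offD[OF assms(1) d]
    unfolding xy by auto
  then have "x' * (x * y'') = x' * (y * x'')" "y' * (x * y'') = y' * (y * x'')"
    by algebra+
  with \<open>x' \<noteq> 0 \<or> y' \<noteq> 0\<close> have "x * y'' = y * x''" by auto
  then show "p a b * p c d * (r a c * r b d) = p a c * p b d * (r a b * r c d)"
    unfolding xy .
qed

lemma cross_ratio_eq_torus_equiv:
  assumes "torus_equiv p p'" "cross_ratio_eq k p q"
  shows "cross_ratio_eq k p' q"
proof -
  obtain c where c: "\<And>i j. p' i j = c i * c j * p i j"
    using assms(1) unfolding torus_equiv_def by blast
  show ?thesis unfolding cross_ratio_eq_def
  proof (intro allI impI)
    fix a b e d assume "distinct [k, a, b, e, d]"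
    then have "p a b * p e d * (q a e * q b d) = p a e * p b d * (q a b * q e d)"
      using cross_ratio_eqD[OF assms(2)] by blast
    then have "(c a * c b * c e * c d) * (p a b * p e d * (q a e * q b d)) =
      (c a * c b * c e * c d) * (p a e * p b d * (q a b * q e d))" by simp
    then show "p' a b * p' e d * (q a e * q b d) = p' a e * p' b d * (q a b * q e d)"
      unfolding c by (simp add: mult_ac)
  qed
qed

lemma torus_equiv_sym:
  assumes "torus_equiv p p'"
  shows "torus_equiv p' p"
proof -
  obtain c where c: "\<And>i. c i \<noteq> 0" "\<And>i j. p' i j = c i * c j * p i j"
    using assms unfolding torus_equiv_def by blast
  then show ?thesis unfolding torus_equiv_def
    by (intro exI[of _ "\<lambda>i. 1 / c i"]) simp
qed

lemma divisor_products_nonzero: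
  assumes "stable_off k q" "distinct [k, a, b, c, d]" "q a b * q c d = 0"
  shows "q a c * q b d \<noteq> 0"
  using stable_offD[OF assms(1,2)] assms(3) by simp

lemma weight_pair:
  assumes "normalized p" "i \<noteq> j" "p i j = 0"
  shows "weight p i + weight p j \<le> 1"
    and "\<lbrakk>weight p i + weight p j = 1; k \<notin> {i, j}; l \<notin> {i, j}\<rbrakk> \<Longrightarrow> p k l = 0"
proof -
  have *: "p a b = 0" if "a \<in> {i, j}" "b \<in> {i, j}" for a b
    using that assms plucker_vector_diag[of p] plucker_vector_zero_sym[of p i j] by auto
  show "weight p i + weight p j \<le> 1"
    using weight_parallel(1)[of p "{i, j}", OF assms(1) *] assms(2) by simp
  show "\<lbrakk>weight p i + weight p j = 1; k \<notin> {i, j}; l \<notin> {i, j}\<rbrakk> \<Longrightarrow> p k l = 0"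
    using weight_parallel(2)[of p "{i, j}", OF assms(1) *] assms(2) by simp
qed

lemma weight_triple:
  assumes "normalized p" "distinct [i, j, k]" "p i j = 0" "p i k = 0" "p j k = 0"
  shows "weight p i + weight p j + weight p k \<le> 1"
    and "\<lbrakk>weight p i + weight p j + weight p k = 1; m \<notin> {i, j, k}; n \<notin> {i, j, k}\<rbrakk> \<Longrightarrow> p m n = 0"
proof -
  have *: "p a b = 0" if "a \<in> {i, j, k}" "b \<in> {i, j, k}" for a b
    using that assms plucker_vector_diag[of p] plucker_vector_zero_sym[of p i j]
      plucker_vector_zero_sym[of p i k] plucker_vector_zero_sym[of p j k] by auto
  show "weight p i + weight p j + weight p k \<le> 1"
    using weight_parallel(1)[of p "{i, j, k}", OF assms(1) *] assms(2) by (simp add: add.assoc)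
  show "\<lbrakk>weight p i + weight p j + weight p k = 1; m \<notin> {i, j, k}; n \<notin> {i, j, k}\<rbrakk> \<Longrightarrow> p m n = 0"
    using weight_parallel(2)[of p "{i, j, k}", OF assms(1) *] assms(2) by (simp add: add.assoc)
qed

section \<open>Uniqueness of the orbit with given moment and cross ratios\<close>

lemma normalized_nonzero:
  assumes "normalized p"
  shows "\<exists>a b. p a b \<noteq> 0"
proof (rule ccontr)
  assume "\<not> (\<exists>a b. p a b \<noteq> 0)"
  then have "weight p = (\<lambda>_. 0)" by (auto simp: weight_def)
  then show False using normalized_sum[OF assms] by simp
qed

text \<open>Equality in \<open>weight_parallel\<close> for the singleton of i kills all coordinates
  avoiding i, and then weight j is the squared absolute value of p j i. So the moment determines the
  zero pattern. Of two disjoint pairs one avoids i, hence all cross ratio equations read 0 =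
  0.\<close>

lemma torus_equiv_weight_1:
  fixes p p' :: "'n::finite \<Rightarrow> 'n \<Rightarrow> complex"
  assumes p: "normalized p" and p': "normalized p'" and w: "weight p = weight p'"
    and i: "weight p i = 1"
  shows "torus_equiv p p'"
proof -
  have z: "q j l = 0" if "normalized q" "weight q i = 1" "j \<noteq> i" "l \<noteq> i" for q :: "'n \<Rightarrow> 'n \<Rightarrow> complex" and j l
    using weight_parallel(2)[of q "{i}" j l] that plucker_vector_diag[of q] by simp
  have wj: "weight q j = (cmod (q j i))\<^sup>2" if "normalized q" "weight q i = 1" "j \<noteq> i" for q :: "'n \<Rightarrow> 'n \<Rightarrow> complex" and j
  proof -
    have "weight q j = (\<Sum>l\<in>UNIV. if l = i then (cmod (q j i))\<^sup>2 else 0)"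
      unfolding weight_def using z[OF that] by (intro sum.cong) auto
    then show ?thesis by simp
  qed
  have i': "weight p' i = 1" using i w by simp
  have ji: "p j i = 0 \<longleftrightarrow> p' j i = 0" if "j \<noteq> i" for j
    using wj[OF p i that] wj[OF p' i' that] w by auto
  show ?thesis
  proof (rule torus_equivI)
    show "plucker_vector p" "plucker_vector p'" using p p' by auto
    show "p a b = 0 \<longleftrightarrow> p' a b = 0" for a b
    proof -
      consider "a \<noteq> i" "b \<noteq> i" | "a \<noteq> i" "b = i" | "a = i" "b \<noteq> i" | "a = i" "b = i" by blast
      then show ?thesis
        using z[OF p i] z[OF p' i'] ji plucker_vector_zero_sym[of p a b] plucker_vector_zero_sym[of p' a b]
          plucker_vector_diag[of p] plucker_vector_diag[of p'] p p'
        by cases auto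
    qed
    show "p a b * p c d * (p' a c * p' b d) = p a c * p b d * (p' a b * p' c d)"
      if "distinct [a, b, c, d]" for a b c d
    proof -
      have "p a b * p c d = 0" "p a c * p b d = 0"
        using that z[OF p i, of a b] z[OF p i, of c d] z[OF p i, of a c] z[OF p i, of b d] by auto
      then show ?thesis by auto
    qed
    \<comment> \<open>The free indices of the nonvanishing condition in \<open>torus_equivI\<close>
      are instantiated with a chosen nonzero coordinate.\<close>
    show "p (fst (SOME z. p (fst z) (snd z) \<noteq> 0)) (snd (SOME z. p (fst z) (snd z) \<noteq> 0)) \<noteq> 0"
      by (rule someI_ex) (use normalized_nonzero[OF p] in auto)
  qed
qed

text \<open>The three remaining weights sum to 2 and are less than 1, so any two of them exceed 1
  and no two of the three columns are parallel. Every four distinct indices include m or n, so no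
  cross ratio is left to compare.\<close>

lemma torus_equiv_three_weights:
  assumes p: "normalized p" and p': "normalized p'" and w: "weight p = weight p'"
    and d: "distinct [i, j, k, m, n :: 5]" and z: "weight p m = 0" "weight p n = 0"
    and lt: "\<And>i. weight p i < 1"
  shows "torus_equiv p p'"
proof -
  have tot: "weight p i + weight p j + weight p k = 2"
    using normalized_sum[OF p] sum_5_distinct[OF d, of "weight p"] z by simp
  have z': "weight p' m = 0" "weight p' n = 0" using z w by auto
  have q0: "q a b = 0" if "normalized q" "weight q m = 0" "weight q n = 0" "a \<in> {m, n} \<or> b \<in> {m, n}"
    for q :: "5 \<Rightarrow> 5 \<Rightarrow> complex" and a b
    using that plucker_vector_zero_sym[of q a b] by (auto simp: weight_eq_0_iff)
  have nz: "q a b \<noteq> 0" if q: "normalized q" "weight q = weight p" and ab: "a \<noteq> b" "a \<notin> {m, n}" "b \<notin> {m, n}"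
    for q :: "5 \<Rightarrow> 5 \<Rightarrow> complex" and a b
  proof
    assume "q a b = 0"
    then have "weight p a + weight p b \<le> 1" using weight_pair(1)[OF q(1) ab(1)] q(2) by simp
    moreover have "a \<in> {i, j, k}" "b \<in> {i, j, k}"
      using UNIV_5_distinct[OF d] ab by auto
    ultimately show False using tot lt[of i] lt[of j] lt[of k] ab(1) by auto
  qed
  show ?thesis
  proof (rule torus_equivI)
    show "plucker_vector p" "plucker_vector p'" using p p' by auto
    show "p a b = 0 \<longleftrightarrow> p' a b = 0" for a b
    proof (cases "a = b \<or> a \<in> {m, n} \<or> b \<in> {m, n}")
      case True
      then show ?thesis
        using q0[OF p z, of a b] q0[OF p' z', of a b] plucker_vector_diag[of p] plucker_vector_diag[of p'] p p' by auto
    next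
      case False
      then show ?thesis using nz[OF p refl, of a b] nz[OF p' w[symmetric], of a b] by auto
    qed
    show "p a b * p c e * (p' a c * p' b e) = p a c * p b e * (p' a b * p' c e)"
      if de: "distinct [a, b, c, e]" for a b c e
    proof -
      have "a \<in> {m, n} \<or> b \<in> {m, n} \<or> c \<in> {m, n} \<or> e \<in> {m, n}"
      proof (rule ccontr)
        assume "\<not> ?thesis"
        then have "{a, b, c, e} \<subseteq> {i, j, k}" using UNIV_5_distinct[OF d] by auto
        then have "card {a, b, c, e} \<le> card {i, j, k}" by (intro card_mono) auto
        then show False using de d by simp
      qed
      then have "p a b * p c e = 0" "p a c * p b e = 0"
        using q0[OF p z, of a b] q0[OF p z, of c e] q0[OF p z, of a c] q0[OF p z, of b e] by auto
      then show ?thesis by auto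
    qed
    show "p i j \<noteq> 0" using nz[OF p refl, of i j] d by auto
  qed
qed

text \<open>Three parallel columns among the four have total weight at most 1, which would leave at
  least 1 for the fourth.\<close>

lemma stable_off_weight:
  assumes p: "normalized p" and pos: "\<And>i. i \<noteq> k \<Longrightarrow> weight p i > 0"
    and k: "weight p k = 0" and lt: "\<And>i. weight p i < 1"
  shows "stable_off k p"
  unfolding stable_off_def
proof (intro conjI allI impI)
  show "plucker_vector p" using p by simp
  fix a b c assume d: "distinct [k, a, b, c]"
  obtain e where e: "e \<notin> {k, a, b, c}"
    using ex_distinct_5[of "{k, a, b, c}"] d by auto
  show "p a b \<noteq> 0 \<or> p a c \<noteq> 0"
  proof (rule ccontr)
    assume "\<not> ?thesis"
    then have z: "p a b = 0" "p a c = 0" by auto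
    obtain m where "p a m \<noteq> 0" using pos[of a] d weight_eq_0_iff[of p a] by auto
    then have "p b c = 0"
      using plucker_vector_zero_trans[of p b a c m] z p plucker_vector_zero_sym[of p a b] by auto
    then have "weight p a + weight p b + weight p c \<le> 1"
      using weight_triple(1)[OF p _ z] d by auto
    moreover have "weight p k + weight p a + weight p b + weight p c + weight p e = 2"
      using normalized_sum[OF p] sum_5_distinct[of k a b c e "weight p"] d e by auto
    ultimately show False using k lt[of e] by simp
  qed
qed

text \<open>The point of the proof is that the zero patterns agree. If q a b = 0, the cross ratio
  forces q' a b = 0 or q' c d = 0 for the complementary pair. In the latter case the weights of {a,
  b} and of {c, d} are both at most 1 and sum to 2, so equality holds in \<open>weight_pair\<close>
  and q' a b vanishes as well.\<close>

lemma torus_equiv_four_weights: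
  assumes p: "normalized p" and p': "normalized p'" and w: "weight p = weight p'"
    and pos: "\<And>i. i \<noteq> k \<Longrightarrow> weight p i > 0"
    and k: "weight p k = 0" and lt: "\<And>i. weight p i < 1"
    and cr: "cross_ratio_eq k p p'"
  shows "torus_equiv p p'"
proof -
  have st: "stable_off k p" using stable_off_weight[OF p pos k lt] .
  have st': "stable_off k p'"
    using stable_off_weight[of p' k] p' pos k lt w by simp
  have zero: "q' a b = 0" if q: "normalized q" "normalized q'" "weight q = weight p" "weight q' = weight p"
    "stable_off k q" "cross_ratio_eq k q q'" and ab: "distinct [k, a, b]" "q a b = 0" for q q' a b
  proof -
    obtain c where c: "c \<notin> {k, a, b}" using ex_distinct_5[of "{k, a, b}"] ab by auto
    obtain d where d: "d \<notin> {k, a, b, c}" using ex_distinct_5[of "{k, a, b, c}"] ab c by auto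
    have D: "distinct [k, a, b, c, d]" using ab c d by auto
    have "q a c * q b d \<noteq> 0" using stable_offD[OF q(5) D] ab by simp
    then have *: "q' a b * q' c d = 0" using cross_ratio_eqD[OF q(6) D] ab(2) by auto
    show ?thesis
    proof (cases "q' c d = 0")
      case True
      have "weight p c + weight p d \<le> 1" using weight_pair(1)[OF q(2) _ True] D q(4) by auto
      moreover have "weight p a + weight p b \<le> 1" using weight_pair(1)[OF q(1) _ ab(2)] D q(3) by auto
      moreover have "weight p k + weight p a + weight p b + weight p c + weight p d = 2"
        using normalized_sum[OF p] sum_5_distinct[OF D, of "weight p"] by simp
      ultimately have "weight q' c + weight q' d = 1" using k q(4) by simp
      then show ?thesis using weight_pair(2)[OF q(2) _ True] D by auto
    qed (use * in auto)
  qed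
  have q0: "q a b = 0" if "normalized q" "weight q = weight p" "a = k \<or> b = k"
    for q :: "5 \<Rightarrow> 5 \<Rightarrow> complex" and a b
    using that k plucker_vector_zero_sym[of q a b] weight_eq_0_iff[of q k] by auto
  show ?thesis
  proof (rule torus_equivI)
    show "plucker_vector p" "plucker_vector p'" using p p' by auto
    show "p a b = 0 \<longleftrightarrow> p' a b = 0" for a b
    proof (cases "a = b \<or> a = k \<or> b = k")
      case True
      then show ?thesis
        using q0[OF p refl, of a b] q0[OF p' w[symmetric], of a b] plucker_vector_diag[of p] plucker_vector_diag[of p'] p p' by auto
    next
      case False
      then show ?thesis
        using zero[OF p p' refl w[symmetric] st cr, of a b]
          zero[OF p' p w[symmetric] refl st', of a b] cr cross_ratio_eq_sym[of k p p'] by auto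
    qed
    show "p a b * p c e * (p' a c * p' b e) = p a c * p b e * (p' a b * p' c e)"
      if de: "distinct [a, b, c, e]" for a b c e
    proof (cases "k \<in> {a, b, c, e}")
      case True
      then have "p a b * p c e = 0" "p a c * p b e = 0"
        using q0[OF p refl, of a b] q0[OF p refl, of c e] q0[OF p refl, of a c] q0[OF p refl, of b e] by auto
      then show ?thesis by auto
    next
      case False
      then show ?thesis using cross_ratio_eqD[OF cr, of a b c e] de by auto
    qed
    show "p (fst (SOME z. p (fst z) (snd z) \<noteq> 0)) (snd (SOME z. p (fst z) (snd z) \<noteq> 0)) \<noteq> 0"
      by (rule someI_ex) (use normalized_nonzero[OF p] in auto)
  qed
qed

text \<open>On the divisor the cross ratio forces p m n * p j l = 0. If it is p m n that vanishes,
  the weights of m and n sum to exactly 1, and equality in \<open>weight_pair\<close> gives p j l =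
  0 anyway. So for these moments the three points other than m and n collide.\<close>

lemma parallel_off_divisor:
  assumes p: "normalized p" and B: "\<And>k. stable_off k (B k)" and cr: "\<And>k. cross_ratio_eq k p (B k)"
    and D: "on_divisor m n B" and ge: "weight p m + weight p n \<ge> 1"
    and d: "distinct [m, n, k, j, l]"
  shows "p j l = 0"
proof -
  have d': "distinct [k, m, n, j, l]" "distinct [k, m, j, n, l]" using d by auto
  have "B k m n * B k j l = 0" using D d unfolding on_divisor_def by blast
  moreover have "B k m j * B k n l \<noteq> 0"
    using divisor_products_nonzero[OF B d'(1)] calculation by blast
  ultimately have mn: "p m n * p j l = 0" using cross_ratio_eqD[OF cr d'(1)] by auto
  show ?thesis
  proof (cases "p m n = 0")
    case True
    then have "weight p m + weight p n = 1" using weight_pair(1)[OF p _ True] d ge by auto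
    then show ?thesis using weight_pair(2)[OF p _ True] d by auto
  qed (use mn in auto)
qed

text \<open>The three columns outside {m, n} are parallel. Neither m nor n can join them, since four
  parallel columns would leave weight at least 1 for the fifth; and p m n = 0 is equivalent to
  equality of the triple weight with 1, so the moment decides it. Any four indices contain two of
  the triple, so one of the three pairings vanishes and each cross ratio is degenerate in the same
  way for p and p'.\<close>

lemma torus_equiv_parallel:
  assumes p: "normalized p" and p': "normalized p'" and w: "weight p = weight p'"
    and pos: "\<And>i. weight p i > 0" and lt: "\<And>i. weight p i < 1"
    and mn: "m \<noteq> (n :: 5)"
    and z: "\<And>j l. {j, l} \<inter> {m, n} = {} \<Longrightarrow> p j l = 0"
    and z': "\<And>j l. {j, l} \<inter> {m, n} = {} \<Longrightarrow> p' j l = 0"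
  shows "torus_equiv p p'"
proof -
  obtain i where i: "i \<notin> {m, n}" using ex_distinct_5[of "{m, n}"] mn by auto
  obtain j where j: "j \<notin> {m, n, i}" using ex_distinct_5[of "{m, n, i}"] mn i by auto
  obtain l where l: "l \<notin> {m, n, i, j}" using ex_distinct_5[of "{m, n, i, j}"] mn i j by auto
  have d: "distinct [m, n, i, j, l]" using i j l mn by auto
  have tot: "weight p m + weight p n + weight p i + weight p j + weight p l = 2"
    using normalized_sum[OF p] sum_5_distinct[OF d, of "weight p"] by simp
  have nz1: "q a b \<noteq> 0"
    if q: "normalized q" "weight q = weight p" and zq: "\<And>j l. {j, l} \<inter> {m, n} = {} \<Longrightarrow> q j l = 0"
      and ab: "a \<in> {m, n}" "b \<notin> {m, n}" for q a b
  proof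
    assume ab0: "q a b = 0"
    obtain e where "q b e \<noteq> 0" using pos[of b] weight_eq_0_iff[of q b] q by auto
    then have ac: "q a c = 0" if "c \<notin> {m, n}" for c
      using plucker_vector_zero_trans[of q a b c e] q ab0 zq[of b c] that ab by auto
    have "q x y = 0" if "x \<in> {a, i, j, l}" "y \<in> {a, i, j, l}" for x y
    proof -
      have *: "x = a \<or> x \<notin> {m, n}" "y = a \<or> y \<notin> {m, n}" using that d by auto
      show ?thesis
      proof (cases "x = a")
        case True
        then show ?thesis using * ac plucker_vector_diag[of q] q by auto
      next
        case False
        then show ?thesis using * ac[of x] zq[of x y] plucker_vector_zero_sym[of q x y] q by auto
      qed
    qed
    then have "sum (weight q) {a, i, j, l} \<le> 1" by (intro weight_parallel(1) q)
    then have "weight p a + weight p i + weight p j + weight p l \<le> 1"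
      using d ab q(2) by auto
    moreover have "a = m \<or> a = n" using ab by auto
    ultimately show False using tot lt[of m] lt[of n] by auto
  qed
  have zero: "q' m n = 0" if q: "normalized q" "normalized q'" "weight q = weight p" "weight q' = weight p"
      and zq: "\<And>j l. {j, l} \<inter> {m, n} = {} \<Longrightarrow> q' j l = 0" and "q m n = 0" for q q'
  proof -
    have z3: "q' i j = 0" "q' i l = 0" "q' j l = 0" using zq d by auto
    have "weight p i + weight p j + weight p l \<le> 1"
      using weight_triple(1)[OF q(2) _ z3] d q(4) by auto
    moreover have "weight p m + weight p n \<le> 1" using weight_pair(1)[OF q(1) mn \<open>q m n = 0\<close>] q(3) by simp
    ultimately have "weight q' i + weight q' j + weight q' l = 1" using tot q(4) by simp
    then show ?thesis using weight_triple(2)[OF q(2) _ z3] d by auto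
  qed
  show ?thesis
  proof (rule torus_equivI)
    show pv: "plucker_vector p" "plucker_vector p'" using p p' by auto
    show "p a b = 0 \<longleftrightarrow> p' a b = 0" for a b
    proof -
      have mn0: "p m n = 0 \<longleftrightarrow> p' m n = 0"
        using zero[OF p p' refl w[symmetric] z'] zero[OF p' p w[symmetric] refl z] by blast
      consider "a = b" | "a \<in> {m, n}" "b \<in> {m, n}" "a \<noteq> b" | "a \<in> {m, n}" "b \<notin> {m, n}"
        | "a \<notin> {m, n}" "b \<in> {m, n}" | "a \<notin> {m, n}" "b \<notin> {m, n}" by blast
      then show ?thesis
      proof cases
        case 1 then show ?thesis using pv by (simp add: plucker_vector_diag)
      next
        case 2
        then show ?thesis using mn0 plucker_vector_zero_sym[OF pv(1), of m n]
            plucker_vector_zero_sym[OF pv(2), of m n] by auto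
      next
        case 3
        then show ?thesis using nz1[OF p refl z 3] nz1[OF p' w[symmetric] z' 3] by blast
      next
        case 4
        then show ?thesis using nz1[OF p refl z 4(2,1)] nz1[OF p' w[symmetric] z' 4(2,1)]
            plucker_vector_zero_sym[OF pv(1), of a b] plucker_vector_zero_sym[OF pv(2), of a b] by blast
      next
        case 5 then show ?thesis using z[of a b] z'[of a b] by auto
      qed
    qed
    show "p a b * p c e * (p' a c * p' b e) = p a c * p b e * (p' a b * p' c e)"
      if de: "distinct [a, b, c, e]" for a b c e
    proof (cases "{a, b} \<inter> {m, n} = {} \<or> {c, e} \<inter> {m, n} = {} \<or> {a, c} \<inter> {m, n} = {} \<or> {b, e} \<inter> {m, n} = {}")
      case True
      then have "(p a b * p c e = 0 \<and> p' a b * p' c e = 0) \<or> (p a c * p b e = 0 \<and> p' a c * p' b e = 0)"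
        using z z' by (metis mult_eq_0_iff)
      then show ?thesis by auto
    next
      case False
      \<comment> \<open>The third pairing vanishes here, so the Pluecker relation makes the two
        remaining products equal: the cross ratio is 1 on both sides.\<close>
      then have "{a, e} \<inter> {m, n} = {} \<or> {b, c} \<inter> {m, n} = {}" using de by auto
      then have "p a e * p b c = 0" "p' a e * p' b c = 0" using z z' by (metis mult_eq_0_iff)+
      then have "p a b * p c e = p a c * p b e" "p' a b * p' c e = p' a c * p' b e"
        using plucker_vector_rel[OF pv(1), of a b c e] plucker_vector_rel[OF pv(2), of a b c e] by auto
      then show ?thesis by simp
    qed
    show "p m i \<noteq> 0" using nz1[OF p refl z] d by auto
  qed
qed

text \<open>Converse to \<open>parallel_off_divisor\<close>. The witnesses m and n are the two
  indices outside the collided triple, whose weight is at most 1. By the bounds on single weights, m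
  and n are not parallel to the triple, so in the cross ratio equation the products p m j * p n l
  are nonzero and can be cancelled.\<close>

lemma unstable_imp_divisor:
  assumes p: "normalized p" and pos: "\<And>i. weight p i > 0" and lt: "\<And>i. weight p i < 1"
    and abc: "distinct [a, b, c :: 5]" "p a b = 0" "p a c = 0"
  shows "\<exists>m n. m \<noteq> n \<and> weight p m + weight p n \<ge> 1 \<and>
    (\<forall>B. (\<forall>k. cross_ratio_eq k p (B k)) \<longrightarrow> on_divisor m n B)"
proof -
  have pv: "plucker_vector p" using p by simp
  obtain m where m: "m \<notin> {a, b, c}" using ex_distinct_5[of "{a, b, c}"] abc by auto
  obtain n where n: "n \<notin> {a, b, c, m}" using ex_distinct_5[of "{a, b, c, m}"] abc m by auto
  have d: "distinct [a, b, c, m, n]" using abc m n by auto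
  obtain e where "p a e \<noteq> 0" using pos[of a] weight_eq_0_iff[of p a] by auto
  then have bc: "p b c = 0"
    using plucker_vector_zero_trans[of p b a c e] abc pv plucker_vector_zero_sym[of p a b] by auto
  have tot: "weight p a + weight p b + weight p c + weight p m + weight p n = 2"
    using normalized_sum[OF p] sum_5_distinct[OF d, of "weight p"] by simp
  have "weight p a + weight p b + weight p c \<le> 1"
    using weight_triple(1)[OF p _ abc(2,3) bc] abc by auto
  then have ge: "weight p m + weight p n \<ge> 1" using tot by simp
  have z: "p x y = 0" if "x \<in> {a, b, c}" "y \<in> {a, b, c}" for x y
    using that abc bc pv plucker_vector_zero_sym[OF pv] plucker_vector_diag[OF pv] by blast
  have nz: "p j q \<noteq> 0" if "j \<in> {a, b, c}" "q \<in> {m, n}" for j q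
  proof
    assume "p j q = 0"
    then have qj: "p q j = 0" using plucker_vector_zero_sym[OF pv] by blast
    obtain e where "p j e \<noteq> 0" using pos[of j] weight_eq_0_iff[of p j] by auto
    then have qx: "p q x = 0" if "x \<in> {a, b, c}" for x
      using plucker_vector_zero_trans[OF pv qj] z \<open>j \<in> _\<close> that by blast
    have "p x y = 0" if "x \<in> {q, a, b, c}" "y \<in> {q, a, b, c}" for x y
      using that qx z plucker_vector_diag[OF pv] plucker_vector_zero_sym[OF pv] by blast
    then have "sum (weight p) {q, a, b, c} \<le> 1" by (intro weight_parallel(1) p)
    then have "weight p q + weight p a + weight p b + weight p c \<le> 1"
      using d \<open>q \<in> _\<close> by (auto simp: add.assoc)
    moreover have "q = m \<or> q = n" using \<open>q \<in> _\<close> by auto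
    ultimately show False using tot lt[of m] lt[of n] by auto
  qed
  have "on_divisor m n B" if cr: "\<forall>k. cross_ratio_eq k p (B k)" for B
    unfolding on_divisor_def
  proof (intro allI impI)
    fix k j l assume dk: "distinct [m, n, k, j, l]"
    then have jl: "j \<in> {a, b, c}" "l \<in> {a, b, c}" using UNIV_5_distinct[OF d] by auto
    have "distinct [k, m, n, j, l]" using dk by auto
    from cross_ratio_eqD[OF cr[rule_format] this]
    have "p m j * p n l * (B k m n * B k j l) = 0" using z[OF jl] by simp
    moreover have "p m j \<noteq> 0" "p n l \<noteq> 0"
      using nz jl plucker_vector_zero_sym[OF pv] by blast+
    ultimately show "B k m n * B k j l = 0" by simp
  qed
  then show ?thesis using d ge by (intro exI[of _ m] exI[of _ n]) auto
qed

lemma torus_equiv_divisor: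
  assumes p: "normalized p" and p': "normalized p'" and w: "weight p = weight p'"
    and pos: "\<And>i. weight p i > 0" and lt: "\<And>i. weight p i < 1"
    and B: "\<And>k. stable_off k (B k)" "\<And>k. stable_off k (B' k)"
    and cr: "\<And>k. cross_ratio_eq k p (B k)" "\<And>k. cross_ratio_eq k p' (B' k)"
    and mn: "m \<noteq> n" "weight p m + weight p n \<ge> 1" "on_divisor m n B" "on_divisor m n B'"
  shows "torus_equiv p p'"
proof (rule torus_equiv_parallel[OF p p' w pos lt mn(1)])
  have ex: "\<exists>k. distinct [m, n, k, j, l]" if "{j, l} \<inter> {m, n} = {}" "j \<noteq> l" for j l
    using ex_distinct_5[of "{m, n, j, l}"] that mn(1) by auto
  fix j l :: 5 assume jl: "{j, l} \<inter> {m, n} = {}"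
  show "p j l = 0"
    using ex[OF jl] parallel_off_divisor[OF p B(1) cr(1) mn(3,2)] p
    by (cases "j = l") (auto simp: plucker_vector_diag)
  show "p' j l = 0"
    using ex[OF jl] parallel_off_divisor[OF p' B(2) cr(2) mn(4)] p' mn(2) w
    by (cases "j = l") (auto simp: plucker_vector_diag)
qed

text \<open>If p or p' has three collided points, B lies on a divisor and the previous case applies.
  Otherwise both are stable and all cross ratios agree. Were q a b = 0 but q' a b nonzero, the
  equations would make q' vanish on every pair in the complement of {a, b}, a collision of three
  points.\<close>

lemma torus_equiv_interior:
  assumes p: "normalized p" and p': "normalized p'" and w: "weight p = weight p'"
    and pos: "\<And>i. weight p i > 0" and lt: "\<And>i. weight p i < 1"
    and B: "\<And>k. stable_off k (B k)"
    and cr: "\<And>k. cross_ratio_eq k p (B k)" "\<And>k. cross_ratio_eq k p' (B k)"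
  shows "torus_equiv p p'"
proof (cases "(\<exists>a b c. distinct [a, b, c] \<and> p a b = 0 \<and> p a c = 0) \<or>
    (\<exists>a b c. distinct [a, b, c] \<and> p' a b = 0 \<and> p' a c = 0)")
  case True
  then have "\<exists>m n. m \<noteq> n \<and> weight p m + weight p n \<ge> 1 \<and> on_divisor m n B"
    using unstable_imp_divisor[OF p pos lt] unstable_imp_divisor[OF p'] pos lt w cr by metis
  then show ?thesis using torus_equiv_divisor[OF p p' w pos lt B B cr] by blast
next
  case False
  then have st: "p a b \<noteq> 0 \<or> p a c \<noteq> 0" "p' a b \<noteq> 0 \<or> p' a c \<noteq> 0" if "distinct [a, b, c]" for a b c
    using that by blast+
  have pv: "plucker_vector p" "plucker_vector p'" using p p' by auto
  have S: "stable_off k p" "stable_off k p'" for k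
    using st pv unfolding stable_off_def by auto
  have crp: "cross_ratio_eq k p p'" for k
    using cross_ratio_eq_trans[OF B cr(1)] cr(2) cross_ratio_eq_sym by blast
  have zero: "q' a b = 0"
    if st: "\<And>a b c. distinct [a, b, c] \<Longrightarrow> q a b \<noteq> 0 \<or> q a c \<noteq> 0"
           "\<And>a b c. distinct [a, b, c] \<Longrightarrow> q' a b \<noteq> 0 \<or> q' a c \<noteq> 0"
      and q: "plucker_vector q" "plucker_vector q'" "\<And>k. cross_ratio_eq k q q'" and ab: "a \<noteq> b" "q a b = 0" for q q' a b
  proof (rule ccontr)
    assume nz: "q' a b \<noteq> 0"
    obtain c where c: "c \<notin> {a, b}" using ex_distinct_5[of "{a, b}"] ab by auto
    obtain d where d: "d \<notin> {a, b, c}" using ex_distinct_5[of "{a, b, c}"] ab c by auto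
    obtain e where e: "e \<notin> {a, b, c, d}" using ex_distinct_5[of "{a, b, c, d}"] ab c d by auto
    have "q' x y = 0" if D: "distinct [k, a, b, x, y]" for k x y
    proof -
      have "stable_off k q" using st(1) q(1) unfolding stable_off_def by auto
      from divisor_products_nonzero[OF this D] have "q a x * q b y \<noteq> 0" using ab by simp
      then show ?thesis using cross_ratio_eqD[OF q(3) D] ab(2) nz by simp
    qed
    from this[of e c d] this[of d c e] have "q' c d = 0" "q' c e = 0"
      using ab c d e by auto
    then show False using st(2)[of c d e] c d e by auto
  qed
  have crp': "cross_ratio_eq k p' p" for k using crp cross_ratio_eq_sym by blast
  show ?thesis
  proof (rule torus_equivI[OF pv])
    show "p a b = 0 \<longleftrightarrow> p' a b = 0" for a b
    proof (cases "a = b")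
      case True then show ?thesis using pv by (simp add: plucker_vector_diag)
    next
      case False
      then show ?thesis using zero[OF st pv crp, of a b] zero[OF st(2,1) pv(2,1) crp', of a b] by blast
    qed
    show "p a b * p c e * (p' a c * p' b e) = p a c * p b e * (p' a b * p' c e)"
      if de: "distinct [a, b, c, e]" for a b c e
    proof -
      obtain k where "k \<notin> {a, b, c, e}" using ex_distinct_5[of "{a, b, c, e}"] de by auto
      then show ?thesis using cross_ratio_eqD[OF crp, of k a b c e] de by auto
    qed
    show "p (fst (SOME z. p (fst z) (snd z) \<noteq> 0)) (snd (SOME z. p (fst z) (snd z) \<noteq> 0)) \<noteq> 0"
      by (rule someI_ex) (use normalized_nonzero[OF p] in auto)
  qed
qed

section \<open>Planes and their Pluecker coordinates\<close>

definition plucker :: "complex ^ 'n \<Rightarrow> complex ^ 'n \<Rightarrow> 'n \<Rightarrow> 'n \<Rightarrow> complex" where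
  "plucker u w i j = u $ i * w $ j - u $ j * w $ i"

lemma plucker_vector_plucker [simp]: "plucker_vector (plucker u w)"
  unfolding plucker_vector_def plucker_def by (auto simp: algebra_simps)

definition pairs2 :: "((complex ^ 'n) \<times> (complex ^ 'n)) set" where
  "pairs2 = {(u, w). \<exists>i j. plucker u w i j \<noteq> 0}"

lemma span_pair: "vec.span {u, w} = {a *s u + b *s w | a b. True}" for u w :: "complex ^ 'n"
proof -
  have "vec.span {u, w} = {x. \<exists>k. x - k *s u \<in> vec.span {w}}" by (rule vec.span_insert)
  also have "\<dots> = {a *s u + b *s w | a b. True}"
  proof (intro set_eqI iffI)
    fix x assume "x \<in> {x. \<exists>k. x - k *s u \<in> vec.span {w}}"
    then obtain k b where "x - k *s u = b *s w" by (auto simp: vec.span_singleton)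
    then have "x = k *s u + b *s w" by (metis add.commute diff_add_cancel)
    then show "x \<in> {a *s u + b *s w | a b. True}" by blast
  next
    fix x assume "x \<in> {a *s u + b *s w | a b. True}"
    then obtain a b where "x = a *s u + b *s w" by blast
    then have "x - a *s u = b *s w" by simp
    then show "x \<in> {x. \<exists>k. x - k *s u \<in> vec.span {w}}" by (auto simp: vec.span_singleton)
  qed
  finally show ?thesis .
qed

lemma plucker_span:
  assumes "u' \<in> vec.span {u, w}" "w' \<in> vec.span {u, w}"
  shows "\<exists>c. \<forall>i j. plucker u' w' i j = c * plucker u w i j"
proof -
  obtain a b a' b' where "u' = a *s u + b *s w" "w' = a' *s u + b' *s w"
    using assms unfolding span_pair by blast
  then show ?thesis
    by (intro exI[of _ "a * b' - a' * b"]) (simp add: plucker_def algebra_simps)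
qed

lemma pairs2_iff: "(u, w) \<in> pairs2 \<longleftrightarrow> u \<noteq> w \<and> vec.independent {u, w}" for u w :: "complex ^ 'n"
proof
  assume "(u, w) \<in> pairs2"
  then obtain i j where ij: "plucker u w i j \<noteq> 0" unfolding pairs2_def by blast
  then have "u \<noteq> w" "w \<noteq> 0" by (auto simp: plucker_def)
  moreover have "u \<notin> vec.span {w}" using ij by (auto simp: vec.span_singleton plucker_def)
  ultimately show "u \<noteq> w \<and> vec.independent {u, w}"
    by (simp add: vec.independent_insert)
next
  assume ind: "u \<noteq> w \<and> vec.independent {u, w}"
  then have w: "w \<noteq> 0" and u: "u \<notin> vec.span {w}"
    by (auto simp: vec.independent_insert vec.dependent_single split: if_splits)
  obtain i where i: "w $ i \<noteq> 0" using w by (auto simp: vec_eq_iff)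
  show "(u, w) \<in> pairs2"
  proof (rule ccontr)
    assume "(u, w) \<notin> pairs2"
    then have z: "u $ k * w $ i - u $ i * w $ k = 0" for k unfolding pairs2_def plucker_def by auto
    have "u = (u $ i / w $ i) *s w"
      unfolding vec_eq_iff using z i by (auto simp: field_simps)
    then show False using u by (metis rangeI vec.span_singleton)
  qed
qed

text \<open>The equations are the 3x3 minors of v, u, w expanded along v. Conversely, Cramer's rule
  at a nonzero minor in columns i and j yields the coefficients.\<close>

lemma span_pair_iff:
  assumes "(u, w) \<in> pairs2"
  shows "v \<in> vec.span {u, w} \<longleftrightarrow>
    (\<forall>i j k. v $ i * plucker u w j k - v $ j * plucker u w i k + v $ k * plucker u w i j = 0)"
proof
  assume "v \<in> vec.span {u, w}"
  then obtain a b where "v = a *s u + b *s w" unfolding span_pair by blast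
  then show "\<forall>i j k. v $ i * plucker u w j k - v $ j * plucker u w i k + v $ k * plucker u w i j = 0"
    by (simp add: plucker_def algebra_simps)
next
  assume v: "\<forall>i j k. v $ i * plucker u w j k - v $ j * plucker u w i k + v $ k * plucker u w i j = 0"
  obtain i j where ij: "plucker u w i j \<noteq> 0" using assms unfolding pairs2_def by blast
  let ?d = "plucker u w i j"
  have "v = ((v $ i * w $ j - v $ j * w $ i) / ?d) *s u + ((v $ j * u $ i - v $ i * u $ j) / ?d) *s w"
    unfolding vec_eq_iff
  proof
    fix k
    have "v $ k * ?d = (v $ i * w $ j - v $ j * w $ i) * u $ k + (v $ j * u $ i - v $ i * u $ j) * w $ k"
      using v[rule_format, of i j k] unfolding plucker_def by algebra
    then show "v $ k = (((v $ i * w $ j - v $ j * w $ i) / ?d) *s u + ((v $ j * u $ i - v $ i * u $ j) / ?d) *s w) $ k"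
      using ij by (simp add: add_divide_distrib[symmetric] nonzero_eq_divide_eq)
  qed
  then show "v \<in> vec.span {u, w}" unfolding span_pair by blast
qed

text \<open>Injectivity of the Pluecker embedding: by \<open>span_pair_iff\<close> the plane is cut
  out by linear equations with the Pluecker coordinates as coefficients.\<close>

lemma span_pair_eq_iff:
  assumes "(u, w) \<in> pairs2" "(u', w') \<in> pairs2"
  shows "vec.span {u, w} = vec.span {u', w'} \<longleftrightarrow>
    (\<exists>c. c \<noteq> 0 \<and> (\<forall>i j. plucker u' w' i j = c * plucker u w i j))"
proof
  assume eq: "vec.span {u, w} = vec.span {u', w'}"
  have "u' \<in> vec.span {u, w}" "w' \<in> vec.span {u, w}" unfolding eq by (auto intro: vec.span_base)
  from plucker_span[OF this] obtain c where c: "\<And>i j. plucker u' w' i j = c * plucker u w i j" by blast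
  moreover have "c \<noteq> 0" using assms(2) c unfolding pairs2_def by auto
  ultimately show "\<exists>c. c \<noteq> 0 \<and> (\<forall>i j. plucker u' w' i j = c * plucker u w i j)" by blast
next
  assume "\<exists>c. c \<noteq> 0 \<and> (\<forall>i j. plucker u' w' i j = c * plucker u w i j)"
  then obtain c where c: "c \<noteq> 0" "\<And>i j. plucker u' w' i j = c * plucker u w i j" by blast
  have e: "v $ i * plucker u' w' j k - v $ j * plucker u' w' i k + v $ k * plucker u' w' i j
     = c * (v $ i * plucker u w j k - v $ j * plucker u w i k + v $ k * plucker u w i j)" for v i j k
    unfolding c by (simp add: algebra_simps)
  show "vec.span {u, w} = vec.span {u', w'}"
    unfolding set_eq_iff span_pair_iff[OF assms(1)] span_pair_iff[OF assms(2)] e using c(1) by simp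
qed

section \<open>Quotient presentations and Hausdorff property of the Grassmannians\<close>

definition gr_norm :: "complex ^ 'n \<Rightarrow> complex ^ 'n \<Rightarrow> real" where
  "gr_norm u w = (\<Sum>i\<in>UNIV. \<Sum>j\<in>UNIV. (cmod (plucker u w i j))\<^sup>2)"

lemma gr_norm_pos: "(u, w) \<in> pairs2 \<Longrightarrow> gr_norm u w > 0"
proof -
  assume "(u, w) \<in> pairs2"
  then obtain i j where "plucker u w i j \<noteq> 0" unfolding pairs2_def by blast
  then have "gr_norm u w \<noteq> 0"
    unfolding gr_norm_def by (auto simp: sum_nonneg_eq_0_iff sum_nonneg)
  moreover have "gr_norm u w \<ge> 0" unfolding gr_norm_def by (auto intro!: sum_nonneg)
  ultimately show ?thesis by simp
qed

text \<open>Frames, which are extensional functions on \<open>{..<2}\<close>, are identified with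
  pairs of vectors by a homeomorphism, so that later arguments take place in a Euclidean
  space.\<close>

lemma quotient_map_grassmannian_2:
  "quotient_map (top_of_set pairs2) (grassmannian 2 :: (complex ^ 'n) set topology)
     (\<lambda>(u, w). vec.span {u, w})"
proof -
  let ?X = "subtopology (product_topology (\<lambda>_. euclidean) {..<2}) (frames 2)
    :: (nat \<Rightarrow> complex ^ 'n) topology"
  let ?f = "\<lambda>(u, w). \<lambda>i\<in>{..<2::nat}. if i = 0 then u else w :: complex ^ 'n"
  have two: "{..<2::nat} = {0, 1}" by auto
  have im: "?f (u, w) ` {..<2} = {u, w}" for u w unfolding two by auto
  have fr: "?f (u, w) \<in> frames 2 \<longleftrightarrow> (u, w) \<in> pairs2" for u w
    unfolding frames_def pairs2_iff mem_Collect_eq im unfolding two by (auto simp: inj_on_def)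
  have "homeomorphic_maps (top_of_set pairs2) ?X ?f (\<lambda>b. (b 0, b 1))"
    unfolding homeomorphic_maps_def
  proof (intro conjI ballI)
    show "continuous_map (top_of_set pairs2) ?X ?f"
      unfolding continuous_map_in_subtopology continuous_map_componentwise
    proof (intro conjI ballI)
      show "?f ` topspace (top_of_set pairs2) \<subseteq> extensional {..<2}" by auto
      show "continuous_map (top_of_set pairs2) euclidean (\<lambda>x. ?f x k)" if "k \<in> {..<2}" for k
        using that by (auto simp: case_prod_unfold two intro!: continuous_intros)
      show "?f \<in> topspace (top_of_set pairs2) \<rightarrow> frames 2"
        using fr by auto
    qed
    have "continuous_map ?X euclidean (\<lambda>b. b k)" if "k \<in> {..<2}" for k
      using that by (intro continuous_map_from_subtopology continuous_map_product_projection)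
    then have "continuous_map ?X (prod_topology euclidean euclidean) (\<lambda>b. (b 0, b 1))"
      by (intro continuous_map_pairedI) auto
    moreover have "(b 0, b 1) \<in> pairs2" if "b \<in> frames 2" for b :: "nat \<Rightarrow> complex ^ 'n"
    proof -
      have "b = ?f (b 0, b 1)"
        using that unfolding frames_def two by (auto simp: fun_eq_iff PiE_def extensional_def)
      then show ?thesis using fr[of "b 0" "b 1"] that by simp
    qed
    ultimately show "continuous_map ?X (top_of_set pairs2) (\<lambda>b. (b 0, b 1))"
      by (auto simp: continuous_map_in_subtopology)
    show "(\<lambda>b. (b 0, b 1)) (?f x) = x" if "x \<in> topspace (top_of_set pairs2)" for x
      by (cases x) (simp add: two)
    show "?f ((\<lambda>b. (b 0, b 1)) y) = y" if "y \<in> topspace ?X" for y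
      using that unfolding frames_def two by (auto simp: fun_eq_iff PiE_def extensional_def)
  qed
  then have "quotient_map (top_of_set pairs2) ?X ?f"
    unfolding homeomorphic_maps_map homeomorphic_map_def by (elim conjE)
  then have "quotient_map (top_of_set pairs2) (grassmannian 2) ((\<lambda>b. vec.span (b ` {..<2})) \<circ> ?f)"
    unfolding grassmannian_def by (rule quotient_map_compose[OF _ quotient_map_quotient_topology])
  moreover have "(\<lambda>b. vec.span (b ` {..<2})) \<circ> ?f = (\<lambda>(u, w). vec.span {u, w})"
    using im by (auto simp: fun_eq_iff)
  ultimately show ?thesis by simp
qed

lemma quotient_map_grassmannian_1:
  "quotient_map (top_of_set {u. u \<noteq> 0}) (grassmannian 1 :: (complex ^ 'n) set topology)
     (\<lambda>u. vec.span {u})"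
proof -
  let ?X = "subtopology (product_topology (\<lambda>_. euclidean) {..<1}) (frames 1)
    :: (nat \<Rightarrow> complex ^ 'n) topology"
  let ?f = "\<lambda>u. \<lambda>i\<in>{..<1::nat}. u :: complex ^ 'n"
  have one: "{..<1::nat} = {0}" by auto
  have im: "?f u ` {..<1} = {u}" for u unfolding one by auto
  have fr: "?f u \<in> frames 1 \<longleftrightarrow> u \<noteq> 0" for u
    unfolding frames_def mem_Collect_eq im unfolding one by auto
  have "homeomorphic_maps (top_of_set {u. u \<noteq> 0}) ?X ?f (\<lambda>b. b 0)"
    unfolding homeomorphic_maps_def
  proof (intro conjI ballI)
    show "continuous_map (top_of_set {u. u \<noteq> 0}) ?X ?f"
      unfolding continuous_map_in_subtopology continuous_map_componentwise
    proof (intro conjI ballI)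
      show "?f ` topspace (top_of_set {u. u \<noteq> 0}) \<subseteq> extensional {..<1}" by auto
      show "continuous_map (top_of_set {u. u \<noteq> 0}) euclidean (\<lambda>x. ?f x k)" if "k \<in> {..<1}" for k
        using that by (auto simp: one intro!: continuous_intros)
      show "?f \<in> topspace (top_of_set {u. u \<noteq> 0}) \<rightarrow> frames 1"
        using fr by auto
    qed
    have "continuous_map ?X euclidean (\<lambda>b. b 0)"
      by (intro continuous_map_from_subtopology continuous_map_product_projection) simp
    moreover have "b 0 \<noteq> 0" if "b \<in> frames 1" for b :: "nat \<Rightarrow> complex ^ 'n"
    proof -
      have "b = ?f (b 0)"
        using that unfolding frames_def one by (auto simp: fun_eq_iff PiE_def extensional_def)
      then show ?thesis using fr[of "b 0"] that by simp
    qed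
    ultimately show "continuous_map ?X (top_of_set {u. u \<noteq> 0}) (\<lambda>b. b 0)"
      by (auto simp: continuous_map_in_subtopology)
    show "(\<lambda>b. b 0) (?f x) = x" if "x \<in> topspace (top_of_set {u. u \<noteq> 0})" for x
      by simp
    show "?f ((\<lambda>b. b 0) y) = y" if "y \<in> topspace ?X" for y
      using that unfolding frames_def one by (auto simp: fun_eq_iff PiE_def extensional_def)
  qed
  then have "quotient_map (top_of_set {u. u \<noteq> 0}) ?X ?f"
    unfolding homeomorphic_maps_map homeomorphic_map_def by (elim conjE)
  then have "quotient_map (top_of_set {u. u \<noteq> 0}) (grassmannian 1) ((\<lambda>b. vec.span (b ` {..<1})) \<circ> ?f)"
    unfolding grassmannian_def by (rule quotient_map_compose[OF _ quotient_map_quotient_topology])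
  moreover have "(\<lambda>b. vec.span (b ` {..<1})) \<circ> ?f = (\<lambda>u. vec.span {u})"
    using im by (auto simp: fun_eq_iff)
  ultimately show ?thesis by simp
qed

lemma continuous_on_plucker [continuous_intros]:
  assumes "continuous_on S f" "continuous_on S g"
  shows "continuous_on S (\<lambda>x. plucker (f x) (g x) i j)"
  unfolding plucker_def by (intro continuous_intros assms)

lemma continuous_on_gr_norm [continuous_intros]:
  assumes "continuous_on S f" "continuous_on S g"
  shows "continuous_on S (\<lambda>x. gr_norm (f x) (g x))"
  unfolding gr_norm_def by (intro continuous_intros assms)

text \<open>The separating functions are, up to a constant, the entries of the orthogonal projection
  onto the Pluecker line. They do not change when the Pluecker vector is rescaled, and they
  determine it up to a scalar.\<close>

lemma Hausdorff_grassmannian_2: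
  "Hausdorff_space (grassmannian 2 :: (complex ^ 'n) set topology)" (is "Hausdorff_space ?G")
proof (rule Hausdorff_space_separating)
  fix W W' :: "(complex ^ 'n) set"
  assume W: "W \<in> topspace ?G" and W': "W' \<in> topspace ?G" and ne: "W \<noteq> W'"
  have surj: "(\<lambda>(u, w). vec.span {u, w}) ` pairs2 = topspace ?G"
    using quotient_imp_surjective_map[OF quotient_map_grassmannian_2] by simp
  obtain u w where uw: "(u, w) \<in> pairs2" "W = vec.span {u, w}" using W unfolding surj[symmetric] by auto
  obtain u' w' where uw': "(u', w') \<in> pairs2" "W' = vec.span {u', w'}" using W' unfolding surj[symmetric] by auto
  let ?h = "\<lambda>i j k l (u, w). plucker u w i j * cnj (plucker u w k l) / of_real (gr_norm u w)
    :: complex"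
  have cont: "continuous_map (top_of_set pairs2) euclidean (?h i j k l)" for i j k l :: 'n
  proof -
    have "of_real (gr_norm (fst x) (snd x)) \<noteq> (0 :: complex)" if "x \<in> pairs2" for x :: "(complex ^ 'n) \<times> (complex ^ 'n)"
      using gr_norm_pos[of "fst x" "snd x"] that by (metis less_irrefl of_real_eq_0_iff prod.collapse)
    then have "continuous_on pairs2 (?h i j k l)"
      unfolding case_prod_unfold by (intro continuous_intros) auto
    then show ?thesis by simp
  qed
  have inv: "?h i j k l x = ?h i j k l y"
    if "x \<in> pairs2" "y \<in> pairs2" "(\<lambda>(u, w). vec.span {u, w}) x = (\<lambda>(u, w). vec.span {u, w}) y" for i j k l x y
  proof -
    have xy: "(fst x, snd x) \<in> pairs2" "(fst y, snd y) \<in> pairs2"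
      "vec.span {fst x, snd x} = vec.span {fst y, snd y}"
      using that by (simp_all add: case_prod_unfold)
    obtain c where c: "c \<noteq> 0" "\<And>i j. plucker (fst y) (snd y) i j = c * plucker (fst x) (snd x) i j"
      using xy(3) unfolding span_pair_eq_iff[OF xy(1,2)] by blast
    have "gr_norm (fst y) (snd y) = (cmod c)\<^sup>2 * gr_norm (fst x) (snd x)"
      unfolding gr_norm_def c(2) by (simp add: norm_mult power_mult_distrib sum_distrib_left)
    moreover have "of_real ((cmod c)\<^sup>2) = c * cnj c" by (rule complex_norm_square)
    ultimately show ?thesis unfolding case_prod_unfold c(2) using c(1) by simp
  qed
  show "\<exists>f. continuous_map ?G (euclidean :: complex topology) f \<and> f W \<noteq> f W'"
  proof (rule ccontr)
    assume no: "\<not> ?thesis"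
    have eq: "?h i j k l (u, w) = ?h i j k l (u', w')" for i j k l
    proof -
      obtain g where g: "continuous_map ?G euclidean g"
        "\<And>x. x \<in> topspace (top_of_set pairs2) \<Longrightarrow> g ((\<lambda>(u, w). vec.span {u, w}) x) = ?h i j k l x"
      proof (rule quotient_map_lift_exists[OF quotient_map_grassmannian_2 cont[of i j k l]])
        fix x y :: "(complex ^ 'n) \<times> (complex ^ 'n)"
        assume "x \<in> topspace (top_of_set pairs2)" "y \<in> topspace (top_of_set pairs2)"
          "(\<lambda>(u, w). vec.span {u, w}) x = (\<lambda>(u, w). vec.span {u, w}) y"
        then show "?h i j k l x = ?h i j k l y"
          unfolding topspace_euclidean_subtopology by (rule inv)
      qed blast
      then show ?thesis using no g(2)[of "(u, w)"] g(2)[of "(u', w')"] uw uw' by auto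
    qed
    obtain k l where kl: "plucker u w k l \<noteq> 0" using uw unfolding pairs2_def by blast
    let ?N = "of_real (gr_norm u w) :: complex" and ?N' = "of_real (gr_norm u' w') :: complex"
    have N: "?N \<noteq> 0" "?N' \<noteq> 0" using gr_norm_pos uw(1) uw'(1) by fastforce+
    have kl': "plucker u' w' k l \<noteq> 0" using eq[of k l k l] kl N by auto
    define c where "c = (cnj (plucker u w k l) / ?N) / (cnj (plucker u' w' k l) / ?N')"
    have "c \<noteq> 0" using kl kl' N unfolding c_def by simp
    moreover have "plucker u' w' i j = c * plucker u w i j" for i j
      using eq[of i j k l] kl' N unfolding c_def by (simp add: field_simps)
    ultimately have "W = W'" unfolding uw uw' using span_pair_eq_iff[OF uw(1) uw'(1)] by blast
    then show False using ne by simp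
  qed
qed

lemma norm_vector_scalar_mult: "norm (c *s x) = cmod c * norm x" for x :: "complex ^ 'n"
  unfolding norm_vec_def by (simp add: norm_mult L2_set_right_distrib)

lemma span_single_eq_iff:
  fixes u u' :: "complex ^ 'n"
  assumes "u \<noteq> 0" "u' \<noteq> 0"
  shows "vec.span {u} = vec.span {u'} \<longleftrightarrow> (\<exists>c. c \<noteq> 0 \<and> u' = c *s u)"
proof
  assume "vec.span {u} = vec.span {u'}"
  then have "u' \<in> vec.span {u}" by (auto intro: vec.span_base)
  then obtain c where "u' = c *s u" by (auto simp: vec.span_singleton)
  then show "\<exists>c. c \<noteq> 0 \<and> u' = c *s u" using assms by auto
next
  assume "\<exists>c. c \<noteq> 0 \<and> u' = c *s u"
  then obtain c where c: "c \<noteq> 0" "u' = c *s u" by blast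
  have "vec.span {u'} \<subseteq> vec.span {u}"
    unfolding vec.span_singleton c(2) by auto
  moreover have "vec.span {u} \<subseteq> vec.span {u'}"
  proof -
    have "u \<in> vec.span {u'}" unfolding vec.span_singleton c(2)
      by (rule range_eqI[of _ _ "1 / c"]) (use c(1) in simp)
    then show ?thesis by (intro vec.span_minimal vec.subspace_span) auto
  qed
  ultimately show "vec.span {u} = vec.span {u'}" by blast
qed

lemma Hausdorff_grassmannian_1:
  "Hausdorff_space (grassmannian 1 :: (complex ^ 'n) set topology)" (is "Hausdorff_space ?G")
proof (rule Hausdorff_space_separating)
  fix W W' :: "(complex ^ 'n) set"
  assume W: "W \<in> topspace ?G" and W': "W' \<in> topspace ?G" and ne: "W \<noteq> W'"
  have surj: "(\<lambda>u. vec.span {u}) ` {u. u \<noteq> 0} = topspace ?G"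
    using quotient_imp_surjective_map[OF quotient_map_grassmannian_1] by simp
  obtain u where u: "u \<noteq> 0" "W = vec.span {u}" using W unfolding surj[symmetric] by auto
  obtain u' where u': "u' \<noteq> 0" "W' = vec.span {u'}" using W' unfolding surj[symmetric] by auto
  let ?h = "\<lambda>i k u. u $ i * cnj (u $ k) / of_real ((norm u)\<^sup>2) :: complex"
  have cont: "continuous_map (top_of_set {u. u \<noteq> 0}) euclidean (?h i k)" for i k :: 'n
    by (auto intro!: continuous_intros)
  have inv: "?h i k x = ?h i k y"
    if xy: "x \<noteq> 0" "y \<noteq> 0" "vec.span {x} = vec.span {y}" for i k x y
  proof -
    obtain c where c: "c \<noteq> 0" "y = c *s x" using xy(3) unfolding span_single_eq_iff[OF xy(1,2)] by blast
    have "(norm y)\<^sup>2 = (cmod c)\<^sup>2 * (norm x)\<^sup>2"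
      unfolding c(2) norm_vector_scalar_mult by (simp add: power_mult_distrib)
    moreover have "of_real ((cmod c)\<^sup>2) = c * cnj c" by (rule complex_norm_square)
    ultimately show ?thesis unfolding c(2) using c(1) by simp
  qed
  show "\<exists>f. continuous_map ?G (euclidean :: complex topology) f \<and> f W \<noteq> f W'"
  proof (rule ccontr)
    assume no: "\<not> ?thesis"
    have eq: "?h i k u = ?h i k u'" for i k
    proof -
      obtain g where g: "continuous_map ?G euclidean g"
        "\<And>x. x \<in> topspace (top_of_set {u. u \<noteq> 0}) \<Longrightarrow> g (vec.span {x}) = ?h i k x"
      proof (rule quotient_map_lift_exists[OF quotient_map_grassmannian_1 cont[of i k]])
        fix x y :: "complex ^ 'n"
        assume "x \<in> topspace (top_of_set {u. u \<noteq> 0})" "y \<in> topspace (top_of_set {u. u \<noteq> 0})"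
          "vec.span {x} = vec.span {y}"
        then show "?h i k x = ?h i k y"
          unfolding topspace_euclidean_subtopology mem_Collect_eq by (rule inv)
      qed blast
      then show ?thesis using no g(2)[of u] g(2)[of u'] u u' by auto
    qed
    obtain k where k: "u $ k \<noteq> 0" using u by (auto simp: vec_eq_iff)
    let ?N = "of_real ((norm u)\<^sup>2) :: complex" and ?N' = "of_real ((norm u')\<^sup>2) :: complex"
    have N: "?N \<noteq> 0" "?N' \<noteq> 0" using u u' by auto
    have k': "u' $ k \<noteq> 0" using eq[of k k] k N by auto
    define c where "c = (cnj (u $ k) / ?N) / (cnj (u' $ k) / ?N')"
    have "c \<noteq> 0" using k k' N unfolding c_def by simp
    moreover have "u' $ i = c * u $ i" for i
      using eq[of i k] k' N unfolding c_def by (simp add: field_simps)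
    then have "u' = c *s u" by (simp add: vec_eq_iff)
    ultimately have "W = W'" unfolding u u' using span_single_eq_iff[OF u(1) u'(1)] by blast
    then show False using ne by simp
  qed
qed

lemma continuous_map_grassmannian_1:
  assumes "continuous_map X euclidean u" "\<And>x. x \<in> topspace X \<Longrightarrow> u x \<noteq> 0"
  shows "continuous_map X (grassmannian 1 :: (complex ^ 'n) set topology) (\<lambda>x. vec.span {u x})"
proof -
  have "continuous_map X (top_of_set {u. u \<noteq> 0}) u"
    using assms by (auto simp: continuous_map_in_subtopology)
  from continuous_map_compose[OF this quotient_imp_continuous_map[OF quotient_map_grassmannian_1]]
  show ?thesis by (simp add: o_def)
qed

lemma continuous_map_grassmannian_2:
  assumes "continuous_map X euclidean u" "continuous_map X euclidean w"
    "\<And>x. x \<in> topspace X \<Longrightarrow> (u x, w x) \<in> pairs2"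
  shows "continuous_map X (grassmannian 2 :: (complex ^ 'n) set topology) (\<lambda>x. vec.span {u x, w x})"
proof -
  have "continuous_map X (prod_topology euclidean euclidean) (\<lambda>x. (u x, w x))"
    using assms by (intro continuous_map_pairedI)
  then have "continuous_map X (top_of_set pairs2) (\<lambda>x. (u x, w x))"
    using assms by (auto simp: continuous_map_in_subtopology)
  from continuous_map_compose[OF this quotient_imp_continuous_map[OF quotient_map_grassmannian_2]]
  show ?thesis by (simp add: o_def)
qed

section \<open>Torus scalings with prescribed moments\<close>

text \<open>The scaling is a minimum of the coercive function \<open>F\<close> below (the Kempf-Ness functional of the
  torus action).\<close>

lemma exists_torus_scaling:
  fixes a :: "'n::finite \<Rightarrow> 'n \<Rightarrow> real" and x :: "'n \<Rightarrow> real"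
  assumes a: "\<And>i j. i \<noteq> j \<Longrightarrow> a i j > 0" "\<And>i j. a i j = a j i" "\<And>i. a i i = 0"
    and x: "\<And>i. 0 < x i" "\<And>i. x i < 1" "sum x UNIV = 2"
  shows "\<exists>s :: 'n \<Rightarrow> real. \<forall>k. 2 * (\<Sum>j\<in>UNIV. a k j * exp (s k + s j)) =
    x k * (\<Sum>i\<in>UNIV. \<Sum>j\<in>UNIV. a i j * exp (s i + s j))"
proof -
  have ex_other: "\<exists>j. j \<noteq> i" for i :: 'n
  proof (rule ccontr)
    assume "\<not> ?thesis"
    then have "UNIV = {i}" by auto
    then have "sum x UNIV = x i" by (metis sum.insert[of "{}" i x] finite.emptyI empty_iff sum.empty add_0_right)
    then show False using x(2)[of i] x(3) by simp
  qed
  \<comment> \<open>A critical point of F, the logarithm of G minus the pairing with x, is exactly a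
    solution of the required equations.\<close>
  define G where "G s = (\<Sum>i\<in>UNIV. \<Sum>j\<in>UNIV. a i j * exp (s $ i + s $ j))" for s :: "real ^ 'n"
  define F where "F s = ln (G s) - (\<Sum>i\<in>UNIV. x i * s $ i)" for s :: "real ^ 'n"
  define \<delta> where "\<delta> = Min ((\<lambda>i. min (x i) (1 - x i)) ` UNIV)"
  have \<delta>: "\<delta> > 0" unfolding \<delta>_def using x by (subst Min_gr_iff) auto
  have \<delta>le: "\<delta> \<le> x i" "\<delta> \<le> 1 - x i" for i
  proof -
    have "\<delta> \<le> min (x i) (1 - x i)" unfolding \<delta>_def by (rule Min_le) auto
    then show "\<delta> \<le> x i" "\<delta> \<le> 1 - x i" by auto
  qed
  \<comment> \<open>The diagonal values, which are 0, are replaced by 1 so that the minimum is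
    positive.\<close>
  define \<alpha> where "\<alpha> = Min ((\<lambda>(i, j). if i = j then 1 else a i j) ` UNIV)"
  have \<alpha>: "\<alpha> > 0" unfolding \<alpha>_def using a by (subst Min_gr_iff) auto
  have \<alpha>le: "\<alpha> \<le> a i j" if "i \<noteq> j" for i j
  proof -
    have "\<alpha> \<le> (\<lambda>(i, j). if i = j then 1 else a i j) (i, j)" unfolding \<alpha>_def
      by (rule Min_le[OF _ rangeI]) simp
    then show ?thesis using that by simp
  qed
  have x0: "x i \<ge> 0" for i using x(1)[of i] by simp
  have a0: "a i j \<ge> 0" for i j using a(1)[of i j] a(3)[of i] by (cases "i = j") auto
  have Gge: "G s \<ge> \<alpha> * exp (s $ i + s $ j)" if ij: "i \<noteq> j" for s i j
  proof -
    have "\<alpha> * exp (s $ i + s $ j) \<le> a i j * exp (s $ i + s $ j)" using \<alpha>le[OF ij] by simp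
    also have "\<dots> \<le> (\<Sum>j\<in>UNIV. a i j * exp (s $ i + s $ j))"
      by (rule member_le_sum) (use a0 in auto)
    also have "\<dots> \<le> G s" unfolding G_def
      by (rule member_le_sum[of i UNIV "\<lambda>i. \<Sum>j\<in>UNIV. a i j * exp (s $ i + s $ j)"])
        (simp_all add: a0 sum_nonneg)
    finally show ?thesis .
  qed
  obtain i0 j0 :: 'n where ij0: "j0 \<noteq> i0" using ex_other by blast
  have Gpos: "G s > 0" for s
    using Gge[OF ij0, of s] \<alpha> by (smt (verit) exp_gt_zero mult_pos_pos)
  have Gne: "G s \<noteq> 0" for s using Gpos[of s] by simp
  \<comment> \<open>Coercivity on the hyperplane of sum zero. Let s i and s j be the two largest
    entries. The summand exp (s i + s j) bounds G from below, and s i + s j exceeds the sum of all x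
    l * s l by at least \<delta> times any spread s i - s l, because all x l lie between \<delta>
    and 1 - \<delta>.\<close>
  have lower: "F s \<ge> ln \<alpha> + \<delta> * \<bar>s $ k\<bar>" if s0: "(\<Sum>i\<in>UNIV. s $ i) = 0" for s k
  proof -
    have "finite (range (($) s))" "range (($) s) \<noteq> {}" by auto
    then have "Max (range (($) s)) \<in> range (($) s)" by (rule Max_in)
    then obtain i where "Max (range (($) s)) = s $ i" by (rule imageE)
    then have i: "s $ l \<le> s $ i" for l using Max_ge[of "range (($) s)" "s $ l"] by simp
    obtain o1 where "o1 \<noteq> i" using ex_other by blast
    then have "finite (($) s ` (- {i}))" "($) s ` (- {i}) \<noteq> {}" by auto
    then have "Max (($) s ` (- {i})) \<in> ($) s ` (- {i})" by (rule Max_in)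
    then obtain j where j0: "Max (($) s ` (- {i})) = s $ j" "j \<noteq> i" by auto
    then have j: "s $ l \<le> s $ j" if "l \<noteq> i" for l
      using that Max_ge[of "($) s ` (- {i})" "s $ l"] by simp
    have eq: "s $ i + s $ j - (\<Sum>l\<in>UNIV. x l * s $ l)
       = (1 - x i) * (s $ i - s $ j) + (\<Sum>l\<in>-{i}. x l * (s $ j - s $ l))"
    proof -
      have sp: "sum f UNIV = f i + sum f (- {i})" for f :: "'n \<Rightarrow> real"
        by (metis Compl_eq_Diff_UNIV finite_class.finite_UNIV iso_tuple_UNIV_I sum.remove)
      have sx: "sum x (- {i}) = 2 - x i" using sp[of x] x(3) by simp
      have "(\<Sum>l\<in>-{i}. x l * (s $ j - s $ l)) = sum x (- {i}) * s $ j - (\<Sum>l\<in>-{i}. x l * s $ l)"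
        by (simp add: right_diff_distrib sum_subtractf sum_distrib_right)
      then show ?thesis unfolding sx sp[of "\<lambda>l. x l * s $ l"] by (simp add: algebra_simps)
    qed
    have ge: "s $ i + s $ j - (\<Sum>l\<in>UNIV. x l * s $ l) \<ge> \<delta> * (s $ i - s $ l)" for l
    proof -
      have nn: "(\<Sum>l\<in>-{i}. x l * (s $ j - s $ l)) \<ge> 0"
        by (intro sum_nonneg mult_nonneg_nonneg x0) (use j in auto)
      have i1: "(1 - x i) * (s $ i - s $ j) \<ge> \<delta> * (s $ i - s $ j)"
        using \<delta>le i by (intro mult_right_mono) auto
      show ?thesis
      proof (cases "l = i")
        case True
        have "\<delta> * (s $ i - s $ j) \<ge> 0" using \<delta> i[of j] by simp
        then show ?thesis unfolding eq using nn i1 True by simp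
      next
        case False
        have "x l * (s $ j - s $ l) \<le> (\<Sum>l\<in>-{i}. x l * (s $ j - s $ l))"
          by (rule member_le_sum) (use False x0 j in auto)
        moreover have "\<delta> * (s $ j - s $ l) \<le> x l * (s $ j - s $ l)"
          using \<delta>le j[OF False] by (intro mult_right_mono) auto
        ultimately show ?thesis unfolding eq using i1 by (simp add: algebra_simps)
      qed
    qed
    have "\<exists>l. s $ i - s $ l \<ge> \<bar>s $ k\<bar>"
    proof (cases "s $ k \<ge> 0")
      case True
      have "\<exists>l. s $ l \<le> 0"
      proof (rule ccontr)
        assume "\<not> ?thesis"
        then have "(\<Sum>i\<in>UNIV. s $ i) > 0" by (intro sum_pos) (auto simp: not_le)
        then show False using s0 by simp
      qed
      then obtain l where "s $ l \<le> 0" by blast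
      then show ?thesis using True i[of k] by (intro exI[of _ l]) auto
    next
      case False
      have "s $ i \<ge> 0"
      proof (rule ccontr)
        assume "\<not> ?thesis"
        then have "s $ l < 0" for l using i[of l] by simp
        then have "(\<Sum>i\<in>UNIV. s $ i) < 0" using sum_strict_mono[of UNIV "($) s" "\<lambda>_. 0"] by auto
        then show False using s0 by simp
      qed
      then show ?thesis using False by (intro exI[of _ k]) auto
    qed
    then obtain l where "s $ i - s $ l \<ge> \<bar>s $ k\<bar>" by blast
    then have "\<delta> * \<bar>s $ k\<bar> \<le> \<delta> * (s $ i - s $ l)" using \<delta> by simp
    moreover have "ln (\<alpha> * exp (s $ i + s $ j)) \<le> ln (G s)"
      using Gge[of i j s] j0 \<alpha> Gpos by (intro ln_mono) auto
    moreover have "ln (\<alpha> * exp (s $ i + s $ j)) = ln \<alpha> + (s $ i + s $ j)"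
      using \<alpha> by (simp add: ln_mult)
    ultimately show ?thesis unfolding F_def using ge[of l] by linarith
  qed
  \<comment> \<open>Adding c to all entries adds 2 * c to both terms of F, since x has sum 2. Hence
    a minimum on the hyperplane of sum zero is a global one.\<close>
  have shift: "F (s + (\<chi> i. c)) = F s" for s c
  proof -
    have "G (s + (\<chi> i. c)) = exp (2 * c) * G s"
      unfolding G_def sum_distrib_left by (intro sum.cong refl) (simp add: exp_add[symmetric] algebra_simps)
    then have "ln (G (s + (\<chi> i. c))) = 2 * c + ln (G s)" using Gpos[of s] by (simp add: ln_mult)
    moreover have "(\<Sum>i\<in>UNIV. x i * (s + (\<chi> i. c)) $ i) = (\<Sum>i\<in>UNIV. x i * s $ i) + 2 * c"
      by (simp add: algebra_simps sum.distrib flip: sum_distrib_left x(3))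
    ultimately show ?thesis unfolding F_def by simp
  qed
  \<comment> \<open>As soon as some entry exceeds R in absolute value, the lower bound is at least F
    0; so the minimum may be sought in a cube.\<close>
  define R where "R = max 0 ((F 0 - ln \<alpha>) / \<delta>)"
  define K where "K = cbox (\<chi> i. - R) (\<chi> i. R) \<inter> {s :: real ^ 'n. (\<Sum>i\<in>UNIV. s $ i) = 0}"
  have "compact K" unfolding K_def
    by (intro compact_Int_closed compact_cbox closed_Collect_eq continuous_intros)
  moreover have K0: "0 \<in> K" unfolding K_def by (auto simp: mem_box_cart R_def)
  moreover have "continuous_on K G" unfolding G_def by (intro continuous_intros)
  then have "continuous_on K F"
    unfolding F_def by (intro continuous_intros) (simp_all add: Gne)
  ultimately obtain s0 where s0: "s0 \<in> K" "\<And>s. s \<in> K \<Longrightarrow> F s0 \<le> F s"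
    using continuous_attains_inf[of K F] by blast
  have min0: "F s0 \<le> F s" if sm: "(\<Sum>i\<in>UNIV. s $ i) = 0" for s
  proof (cases "s \<in> K")
    case False
    have "s \<in> K" if "\<And>k. \<bar>s $ k\<bar> \<le> R"
      using that sm unfolding K_def by (auto simp: mem_box_cart abs_le_iff minus_le_iff)
    with False obtain k where "\<not> \<bar>s $ k\<bar> \<le> R" by blast
    then have "(F 0 - ln \<alpha>) / \<delta> \<le> \<bar>s $ k\<bar>" unfolding R_def by auto
    then have "F 0 - ln \<alpha> \<le> \<delta> * \<bar>s $ k\<bar>" using \<delta> by (simp add: field_simps)
    then show ?thesis using lower[OF sm, of k] s0(2)[OF K0] by simp
  qed (use s0 in auto)
  have min: "F s0 \<le> F s" for s
  proof -
    define c where "c = - (\<Sum>i\<in>UNIV. s $ i) / real CARD('n)"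
    have "(\<Sum>i\<in>UNIV. (s + (\<chi> i. c)) $ i) = 0" unfolding c_def
      by (simp add: sum.distrib sum_subtractf)
    then show ?thesis using min0[of "s + (\<chi> i. c)"] shift by simp
  qed
  have "2 * (\<Sum>j\<in>UNIV. a k j * exp (s0 $ k + s0 $ j)) = x k * G s0" for k
  proof -
    define d where "d i = (if i = k then 1 else 0 :: real)" for i
    define g where "g \<tau> = F (s0 + \<tau> *\<^sub>R (\<chi> i. d i))" for \<tau>
    define D where "D = (\<Sum>i\<in>UNIV. \<Sum>j\<in>UNIV. a i j * (exp (s0 $ i + s0 $ j) * (d i + d j)))"
    have "((\<lambda>\<tau>. \<Sum>i\<in>UNIV. \<Sum>j\<in>UNIV. a i j * exp (s0 $ i + \<tau> * d i + (s0 $ j + \<tau> * d j)))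
        has_real_derivative D) (at 0)"
      unfolding D_def by (intro DERIV_sum) (auto intro!: derivative_eq_intros)
    then have dG: "((\<lambda>\<tau>. G (s0 + \<tau> *\<^sub>R (\<chi> i. d i))) has_real_derivative D) (at 0)"
      unfolding G_def by simp
    have "((\<lambda>\<tau>. \<Sum>i\<in>UNIV. x i * (s0 $ i + \<tau> * d i)) has_real_derivative (\<Sum>i\<in>UNIV. x i * d i)) (at 0)"
      by (intro DERIV_sum) (auto intro!: derivative_eq_intros)
    moreover have "((\<lambda>\<tau>. ln (G (s0 + \<tau> *\<^sub>R (\<chi> i. d i)))) has_real_derivative (D / G s0)) (at 0)"
      using dG Gpos[of s0] by (auto intro!: derivative_eq_intros)
    ultimately have "(g has_real_derivative (D / G s0 - (\<Sum>i\<in>UNIV. x i * d i))) (at 0)"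
      unfolding g_def F_def by (auto intro!: derivative_intros)
    moreover have "\<forall>y. \<bar>0 - y\<bar> < 1 \<longrightarrow> g 0 \<le> g y" unfolding g_def using min by simp
    ultimately have "D / G s0 - (\<Sum>i\<in>UNIV. x i * d i) = 0"
      by (rule DERIV_local_min[OF _ zero_less_one])
    moreover have "(\<Sum>i\<in>UNIV. x i * d i) = x k" unfolding d_def by (simp add: if_distrib cong: if_cong)
    ultimately have "D = x k * G s0" using Gpos[of s0] by (simp add: field_simps)
    moreover have "D = 2 * (\<Sum>j\<in>UNIV. a k j * exp (s0 $ k + s0 $ j))"
    proof -
      let ?e = "\<lambda>i j. a i j * exp (s0 $ i + s0 $ j)"
      have "D = (\<Sum>i\<in>UNIV. \<Sum>j\<in>UNIV. ?e i j * d i) + (\<Sum>i\<in>UNIV. \<Sum>j\<in>UNIV. ?e i j * d j)"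
        unfolding D_def by (simp add: algebra_simps sum.distrib)
      also have "(\<Sum>i\<in>UNIV. \<Sum>j\<in>UNIV. ?e i j * d j) = (\<Sum>i\<in>UNIV. \<Sum>j\<in>UNIV. ?e i j * d i)"
        by (subst sum.swap) (simp add: a(2) add.commute)
      also have "(\<Sum>i\<in>UNIV. \<Sum>j\<in>UNIV. ?e i j * d i) = (\<Sum>i\<in>UNIV. (\<Sum>j\<in>UNIV. ?e i j) * d i)"
        by (simp add: sum_distrib_right)
      also have "\<dots> = (\<Sum>j\<in>UNIV. ?e k j)" unfolding d_def by (simp add: if_distrib cong: if_cong)
      finally show ?thesis by simp
    qed
    ultimately show ?thesis by simp
  qed
  then show ?thesis unfolding G_def by (intro exI[of _ "($) s0"]) auto
qed

section \<open>Orthonormal frames and the orbit space\<close>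

definition herm :: "complex ^ 'n \<Rightarrow> complex ^ 'n \<Rightarrow> complex" where
  "herm u w = (\<Sum>i\<in>UNIV. cnj (u $ i) * w $ i)"

definition stiefel :: "((complex ^ 'n) \<times> (complex ^ 'n)) set" where
  "stiefel = {(u, w). norm u = 1 \<and> norm w = 1 \<and> herm u w = 0}"

lemma herm_self: "herm u u = of_real ((norm u)\<^sup>2)"
proof -
  have "(norm u)\<^sup>2 = (\<Sum>i\<in>UNIV. (cmod (u $ i))\<^sup>2)"
    unfolding norm_vec_def L2_set_def by (simp add: sum_nonneg)
  then have "complex_of_real ((norm u)\<^sup>2) = (\<Sum>i\<in>UNIV. u $ i * cnj (u $ i))"
    by (simp only: of_real_sum complex_norm_square)
  then show ?thesis unfolding herm_def by (simp add: mult.commute)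
qed

text \<open>Lagrange's identity for the Gram determinant; the factor 2 comes from summing over
  ordered pairs.\<close>

lemma gr_norm_lagrange:
  "gr_norm u w = 2 * ((norm u)\<^sup>2 * (norm w)\<^sup>2 - (cmod (herm u w))\<^sup>2)"
proof -
  have "complex_of_real (gr_norm u w) =
     (\<Sum>i\<in>UNIV. \<Sum>j\<in>UNIV. (u $ i * w $ j - u $ j * w $ i) * (cnj (u $ i) * cnj (w $ j) - cnj (u $ j) * cnj (w $ i)))"
    unfolding gr_norm_def plucker_def of_real_sum complex_norm_square by simp
  also have "\<dots> = (\<Sum>i\<in>UNIV. \<Sum>j\<in>UNIV. (cnj (u $ i) * u $ i) * (cnj (w $ j) * w $ j))
     - (\<Sum>i\<in>UNIV. \<Sum>j\<in>UNIV. cnj (u $ j) * w $ j * (cnj (w $ i) * u $ i))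
     - (\<Sum>i\<in>UNIV. \<Sum>j\<in>UNIV. cnj (u $ i) * w $ i * (cnj (w $ j) * u $ j))
     + (\<Sum>i\<in>UNIV. \<Sum>j\<in>UNIV. (cnj (w $ i) * w $ i) * (cnj (u $ j) * u $ j))"
    by (simp add: algebra_simps sum.distrib sum_subtractf)
  also have "\<dots> = herm u u * herm w w - herm u w * herm w u - herm u w * herm w u + herm w w * herm u u"
    unfolding herm_def sum_product by (subst (2) sum.swap) simp
  also have "herm w u = cnj (herm u w)" unfolding herm_def by (simp add: mult.commute)
  also have "herm u u * herm w w - herm u w * cnj (herm u w) - herm u w * cnj (herm u w) + herm w w * herm u u =
     of_real (2 * ((norm u)\<^sup>2 * (norm w)\<^sup>2 - (cmod (herm u w))\<^sup>2))"
    unfolding herm_self complex_norm_square[symmetric] of_real_mult[symmetric] of_real_diff[symmetric] of_real_add[symmetric]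
    by (simp add: algebra_simps)
  finally show ?thesis unfolding of_real_eq_iff .
qed

lemma stiefel_gr_norm: "(u, w) \<in> stiefel \<Longrightarrow> gr_norm u w = 2"
  unfolding stiefel_def gr_norm_lagrange by auto

lemma stiefel_subset_pairs2: "stiefel \<subseteq> pairs2"
proof clarify
  fix u w :: "complex ^ 'n" assume "(u, w) \<in> stiefel"
  then have "gr_norm u w \<noteq> 0" using stiefel_gr_norm by fastforce
  then show "(u, w) \<in> pairs2" unfolding gr_norm_def pairs2_def by (auto intro: ccontr)
qed

lemma stiefel_normalized: "(u, w) \<in> stiefel \<Longrightarrow> normalized (plucker u w)"
  using stiefel_gr_norm[of u w] unfolding normalized_def weight_def gr_norm_def by simp

lemma compact_stiefel: "compact (stiefel :: ((complex ^ 'n) \<times> (complex ^ 'n)) set)"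
  unfolding compact_eq_bounded_closed
proof
  have "stiefel \<subseteq> cball 0 1 \<times> (cball 0 1 :: (complex ^ 'n) set)"
    by (auto simp: stiefel_def)
  then show "bounded (stiefel :: ((complex ^ 'n) \<times> (complex ^ 'n)) set)"
    by (rule bounded_subset[rotated]) (intro bounded_Times bounded_cball)
  show "closed (stiefel :: ((complex ^ 'n) \<times> (complex ^ 'n)) set)"
    unfolding stiefel_def case_prod_unfold herm_def
    by (intro closed_Collect_conj closed_Collect_eq continuous_intros)
qed

definition gram_schmidt :: "complex ^ 'n \<Rightarrow> complex ^ 'n \<Rightarrow> (complex ^ 'n) \<times> (complex ^ 'n)" where
  "gram_schmidt u w = (let w' = w - (herm u w / of_real ((norm u)\<^sup>2)) *s u
     in (of_real (1 / norm u) *s u, of_real (1 / norm w') *s w'))"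

lemma gram_schmidt:
  assumes "(u, w) \<in> pairs2"
  shows "gram_schmidt u w \<in> stiefel"
    and "\<exists>c. c \<noteq> 0 \<and> (\<forall>i j. plucker (fst (gram_schmidt u w)) (snd (gram_schmidt u w)) i j = c * plucker u w i j)"
proof -
  define w' where "w' = w - (herm u w / of_real ((norm u)\<^sup>2)) *s u"
  have gs: "gram_schmidt u w = (of_real (1 / norm u) *s u, of_real (1 / norm w') *s w')"
    unfolding gram_schmidt_def w'_def Let_def ..
  have pl: "plucker u w' i j = plucker u w i j" for i j
    unfolding plucker_def w'_def by (simp add: algebra_simps)
  have u: "u \<noteq> 0" using assms by (auto simp: pairs2_def plucker_def)
  have w': "w' \<noteq> 0"
  proof
    assume "w' = 0"
    then have "plucker u w i j = 0" for i j using pl[of i j] by (simp add: plucker_def)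
    then show False using assms by (auto simp: pairs2_def)
  qed
  have "herm u w' = 0"
  proof -
    have "herm u (w - c *s u) = herm u w - c * herm u u" for c
      unfolding herm_def by (simp add: algebra_simps sum_subtractf sum_distrib_left)
    then have "herm u w' = herm u w - herm u w / of_real ((norm u)\<^sup>2) * herm u u"
      unfolding w'_def .
    then show ?thesis unfolding herm_self using u by simp
  qed
  then have "herm (of_real (1 / norm u) *s u) (of_real (1 / norm w') *s w') = 0"
    unfolding herm_def by (simp add: mult_ac flip: sum_divide_distrib sum_distrib_left)
  then show "gram_schmidt u w \<in> stiefel"
    unfolding gs stiefel_def using u w' by (simp add: norm_vector_scalar_mult norm_divide)
  show "\<exists>c. c \<noteq> 0 \<and> (\<forall>i j. plucker (fst (gram_schmidt u w)) (snd (gram_schmidt u w)) i j = c * plucker u w i j)"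
    unfolding gs fst_conv snd_conv
  proof (intro exI conjI allI)
    show "complex_of_real (1 / norm u) * of_real (1 / norm w') \<noteq> 0" using u w' by simp
    show "plucker (of_real (1 / norm u) *s u) (of_real (1 / norm w') *s w') i j
      = complex_of_real (1 / norm u) * of_real (1 / norm w') * plucker u w i j" for i j
      unfolding pl[symmetric] by (simp add: plucker_def algebra_simps)
  qed
qed

lemma tendsto_vector_scalar_mult [tendsto_intros]:
  fixes f :: "'a \<Rightarrow> complex" and g :: "'a \<Rightarrow> complex ^ 'n"
  assumes "(f \<longlongrightarrow> c) F" "(g \<longlongrightarrow> x) F"
  shows "((\<lambda>t. f t *s g t) \<longlongrightarrow> c *s x) F"
  unfolding vector_scalar_mult_def by (intro tendsto_intros assms)

lemma tendsto_gram_schmidt: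
  assumes "(f \<longlongrightarrow> u) F" "(g \<longlongrightarrow> w) F" "(u, w) \<in> stiefel"
  shows "((\<lambda>t. gram_schmidt (f t) (g t)) \<longlongrightarrow> (u, w)) F"
proof -
  have uw: "norm u = 1" "norm w = 1" "herm u w = 0" using assms(3) by (auto simp: stiefel_def)
  have h: "((\<lambda>t. herm (f t) (g t)) \<longlongrightarrow> 0) F"
    unfolding uw(3)[symmetric] unfolding herm_def by (intro tendsto_intros assms)
  have "((\<lambda>t. g t - (herm (f t) (g t) / of_real ((norm (f t))\<^sup>2)) *s f t) \<longlongrightarrow> w - (0 / of_real ((norm u)\<^sup>2)) *s u) F"
    by (intro tendsto_intros assms h) (use uw in auto)
  then have w': "((\<lambda>t. g t - (herm (f t) (g t) / of_real ((norm (f t))\<^sup>2)) *s f t) \<longlongrightarrow> w) F"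
    by simp
  have "((\<lambda>t. gram_schmidt (f t) (g t)) \<longlongrightarrow> (of_real (1 / norm u) *s u, of_real (1 / norm w) *s w)) F"
    unfolding gram_schmidt_def Let_def by (intro tendsto_intros assms w') (use uw in auto)
  then show ?thesis using uw by simp
qed

text \<open>A nonzero polynomial has finitely many roots, so 0 is not a limit point of them. The
  Pluecker coordinates of the perturbations below are quadratic in t.\<close>

lemma eventually_quadratic_nonzero:
  fixes a b c :: complex
  assumes "a \<noteq> 0 \<or> b \<noteq> 0 \<or> c \<noteq> 0"
  shows "\<forall>\<^sub>F t in at_right (0 :: real). a + of_real t * b + (of_real t)\<^sup>2 * c \<noteq> 0"
proof -
  let ?S = "{t :: real. a + of_real t * b + (of_real t)\<^sup>2 * c = 0}"
  have "of_real ` ?S \<subseteq> {z. poly [:a, b, c:] z = 0}"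
    by (auto simp: algebra_simps power2_eq_square)
  moreover have "[:a, b, c:] \<noteq> 0" using assms by auto
  ultimately have "finite (complex_of_real ` ?S)" using poly_roots_finite finite_subset by blast
  then have "finite ?S" by (rule finite_imageD) (auto simp: inj_on_def)
  then have "\<not> 0 islimpt ?S" by (rule islimpt_finite)
  then have "\<forall>\<^sub>F t in at 0. t \<notin> ?S" unfolding islimpt_iff_eventually by simp
  then have "\<forall>\<^sub>F t in at_right 0. t \<notin> ?S"
    by (rule filter_leD[OF at_le[OF subset_UNIV]])
  then show ?thesis by simp
qed

lemma ex_injective_complex_vector: "\<exists>x :: complex ^ 'n. \<forall>i j. i \<noteq> j \<longrightarrow> x $ i \<noteq> x $ j"
proof -
  obtain h :: "'n \<Rightarrow> nat" where "bij_betw h UNIV {0..<CARD('n)}"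
    using ex_bij_betw_finite_nat[of "UNIV :: 'n set"] by auto
  then have "inj h" by (auto simp: bij_betw_def)
  then show ?thesis by (intro exI[of _ "\<chi> i. of_nat (h i)"]) (auto simp: inj_eq)
qed

text \<open>Move u in the direction (1, ..., 1) and w in a direction x with distinct entries. The
  coefficient of t squared in each coordinate is x j - x i, so all of them are nonzero for small t >
  0, and orthonormalizing only rescales them.\<close>

lemma stiefel_generic_dense:
  "stiefel \<subseteq> closure {(u, w) \<in> stiefel. \<forall>i j :: 'n::finite. i \<noteq> j \<longrightarrow> plucker u w i j \<noteq> 0}"
    (is "_ \<subseteq> closure ?S")
proof clarify
  fix u w :: "complex ^ 'n" assume uw: "(u, w) \<in> stiefel"
  obtain x :: "complex ^ 'n" where x: "\<And>i j. i \<noteq> j \<Longrightarrow> x $ i \<noteq> x $ j"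
    using ex_injective_complex_vector by blast
  define f where "f t = u + of_real t *s (\<chi> i. 1)" for t :: real
  define g where "g t = w + of_real t *s x" for t :: real
  have "(f \<longlongrightarrow> u + of_real 0 *s (\<chi> i. 1)) (at_right 0)" "(g \<longlongrightarrow> w + of_real 0 *s x) (at_right 0)"
    unfolding f_def g_def by (intro tendsto_intros)+
  then have lim: "((\<lambda>t. gram_schmidt (f t) (g t)) \<longlongrightarrow> (u, w)) (at_right 0)"
    by (intro tendsto_gram_schmidt uw) auto
  have "plucker (f t) (g t) i j = plucker u w i j + of_real t * (u $ i * x $ j + w $ j - u $ j * x $ i - w $ i)
      + (of_real t)\<^sup>2 * (x $ j - x $ i)" for t i j
    unfolding plucker_def f_def g_def by (simp add: algebra_simps power2_eq_square)
  then have "\<forall>\<^sub>F t in at_right 0. plucker (f t) (g t) i j \<noteq> 0" if "i \<noteq> j" for i j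
    using eventually_quadratic_nonzero[of _ _ "x $ j - x $ i"] x[OF that] by simp
  then have "\<forall>\<^sub>F t in at_right 0. \<forall>i j. i \<noteq> j \<longrightarrow> plucker (f t) (g t) i j \<noteq> 0"
    by (intro eventually_all_finite) (simp add: eventually_mono)
  then have "\<forall>\<^sub>F t in at_right 0. gram_schmidt (f t) (g t) \<in> closure ?S"
  proof (rule eventually_mono)
    fix t assume nz: "\<forall>i j. i \<noteq> j \<longrightarrow> plucker (f t) (g t) i j \<noteq> 0"
    show "gram_schmidt (f t) (g t) \<in> closure ?S"
    proof (cases "\<exists>i j :: 'n. i \<noteq> j")
      case True
      then have "(f t, g t) \<in> pairs2" using nz unfolding pairs2_def by auto
      from gram_schmidt[OF this] nz have "gram_schmidt (f t) (g t) \<in> ?S"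
        by (auto simp: case_prod_unfold)
      then show ?thesis by (rule closure_subset[THEN subsetD])
    next
      \<comment> \<open>With a single index all Pluecker coordinates vanish and there is no
        orthonormal pair.\<close>
      case False
      have "plucker u w i j = 0" for i j
      proof -
        have "i = j" using False by blast
        then show ?thesis by (simp add: plucker_def)
      qed
      then have "(u, w) \<notin> pairs2" unfolding pairs2_def by simp
      then show ?thesis using stiefel_subset_pairs2 uw by blast
    qed
  qed
  then show "(u, w) \<in> closure ?S"
    using lim by (intro Lim_in_closed_set[OF closed_closure]) auto
qed

lemma quotient_map_stiefel:
  "quotient_map (top_of_set stiefel) (grassmannian 2 :: (complex ^ 'n) set topology)
     (\<lambda>(u, w). vec.span {u, w})"
proof (rule T1_Spaces.continuous_imp_quotient_map)
  show "continuous_map (top_of_set stiefel) (grassmannian 2 :: (complex ^ 'n) set topology)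
     (\<lambda>(u, w). vec.span {u, w})"
    unfolding case_prod_unfold
    by (rule continuous_map_grassmannian_2) (use stiefel_subset_pairs2 in \<open>auto intro!: continuous_intros\<close>)
  show "compact_space (top_of_set (stiefel :: ((complex ^ 'n) \<times> (complex ^ 'n)) set))"
    by (simp add: compact_space_subtopology compact_stiefel)
  show "Hausdorff_space (grassmannian 2 :: (complex ^ 'n) set topology)"
    by (rule Hausdorff_grassmannian_2)
  show "(\<lambda>(u, w). vec.span {u, w}) ` topspace (top_of_set stiefel)
     = topspace (grassmannian 2 :: (complex ^ 'n) set topology)"
  proof -
    have "vec.span {u, w} \<in> (\<lambda>(u, w). vec.span {u, w}) ` stiefel" if uw: "(u, w) \<in> pairs2" for u w :: "complex ^ 'n"
    proof -
      obtain u' w' where g: "gram_schmidt u w = (u', w')" by force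
      have "(u', w') \<in> stiefel" using gram_schmidt(1)[OF uw] g by simp
      moreover have "vec.span {u, w} = vec.span {u', w'}"
        using gram_schmidt(2)[OF uw] span_pair_eq_iff[OF uw, of u' w'] calculation stiefel_subset_pairs2 g by auto
      ultimately show ?thesis by (auto intro!: image_eqI[of _ _ "(u', w')"])
    qed
    then have "(\<lambda>(u, w). vec.span {u, w}) ` (pairs2 :: ((complex ^ 'n) \<times> (complex ^ 'n)) set)
        \<subseteq> (\<lambda>(u, w). vec.span {u, w}) ` stiefel"
      by auto
    moreover have "(\<lambda>(u, w). vec.span {u, w}) ` stiefel \<subseteq> (\<lambda>(u, w). vec.span {u, w}) ` (pairs2 :: ((complex ^ 'n) \<times> (complex ^ 'n)) set)"
      by (intro image_mono stiefel_subset_pairs2)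
    moreover have "(\<lambda>(u, w). vec.span {u, w}) ` pairs2 = topspace (grassmannian 2 :: (complex ^ 'n) set topology)"
      using quotient_imp_surjective_map[OF quotient_map_grassmannian_2] by simp
    ultimately show ?thesis by simp
  qed
qed

section \<open>Torus orbits in Pluecker coordinates\<close>

definition diag_scale :: "complex ^ 'n \<Rightarrow> complex ^ 'n \<Rightarrow> complex ^ 'n" where
  "diag_scale t v = (\<chi> i. t $ i * v $ i)"

lemma plucker_diag_scale:
  "plucker (diag_scale t u) (diag_scale t w) i j = t $ i * t $ j * plucker u w i j"
  unfolding plucker_def diag_scale_def by (simp add: algebra_simps)

lemma diag_scale_span: "diag_scale t ` vec.span {u, w} = vec.span {diag_scale t u, diag_scale t w}"
proof -
  have "diag_scale t (a *s u + b *s w) = a *s diag_scale t u + b *s diag_scale t w" for a b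
    by (simp add: diag_scale_def vec_eq_iff algebra_simps)
  then show ?thesis unfolding span_pair by (auto simp: image_iff) metis
qed

lemma torus_act_eq: "torus_act t W = diag_scale t ` W"
  unfolding torus_act_def diag_scale_def ..

lemma torus_act_mult: "torus_act s (torus_act t W) = torus_act (diag_scale s t) W"
  unfolding torus_act_eq image_image by (simp add: diag_scale_def mult.assoc)

lemma torus_mult: "\<lbrakk>s \<in> torus; t \<in> torus\<rbrakk> \<Longrightarrow> diag_scale s t \<in> torus"
  by (simp add: torus_def diag_scale_def norm_mult prod.distrib)

lemma torus_inverse:
  assumes "t \<in> torus"
  shows "(\<chi> i. inverse (t $ i)) \<in> torus" "diag_scale (\<chi> i. inverse (t $ i)) t = 1"
proof -
  have "t $ i \<noteq> 0" for i using assms by (auto simp: torus_def dest: spec[of _ i])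
  then show "diag_scale (\<chi> i. inverse (t $ i)) t = 1" by (simp add: diag_scale_def vec_eq_iff)
  show "(\<chi> i. inverse (t $ i)) \<in> torus"
    using assms prod_inversef[of "($) t" UNIV] by (simp add: torus_def norm_inverse o_def)
qed

lemma torus_orbit_eq_iff:
  "(\<lambda>t. torus_act t W) ` torus = (\<lambda>t. torus_act t W') ` torus \<longleftrightarrow> (\<exists>t\<in>torus. W' = torus_act t W)"
proof
  have one: "1 \<in> torus" "torus_act 1 V = V" for V
    by (auto simp: torus_def torus_act_eq diag_scale_def)
  {
    assume "(\<lambda>t. torus_act t W) ` torus = (\<lambda>t. torus_act t W') ` torus"
    moreover have "W' \<in> (\<lambda>t. torus_act t W') ` torus" using one by (metis imageI)
    ultimately have "W' \<in> (\<lambda>t. torus_act t W) ` torus" by simp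
    then show "\<exists>t\<in>torus. W' = torus_act t W" by blast
  next
    assume "\<exists>t\<in>torus. W' = torus_act t W"
    then obtain t where t: "t \<in> torus" "W' = torus_act t W" by blast
    let ?t' = "\<chi> i. inverse (t $ i)"
    have W: "W = torus_act ?t' W'"
      unfolding t(2) torus_act_mult torus_inverse(2)[OF t(1)] one(2) ..
    show "(\<lambda>t. torus_act t W) ` torus = (\<lambda>t. torus_act t W') ` torus"
    proof
      show "(\<lambda>t. torus_act t W) ` torus \<subseteq> (\<lambda>t. torus_act t W') ` torus"
      proof clarify
        fix s :: "complex ^ 5" assume s: "s \<in> torus"
        have "torus_act s W = torus_act (diag_scale s ?t') W'"
          unfolding torus_act_mult[symmetric] W[symmetric] ..
        then show "torus_act s W \<in> (\<lambda>t. torus_act t W') ` torus"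
          by (rule image_eqI) (rule torus_mult[OF s torus_inverse(1)[OF t(1)]])
      qed
      show "(\<lambda>t. torus_act t W') ` torus \<subseteq> (\<lambda>t. torus_act t W) ` torus"
        unfolding t(2) torus_act_mult using torus_mult[OF _ t(1)] by blast
    qed
  }
qed

definition orbit_class :: "(complex ^ 5) \<times> (complex ^ 5) \<Rightarrow> (complex ^ 5) set set" where
  "orbit_class b = (\<lambda>t. torus_act t (vec.span {fst b, snd b})) ` torus"

abbreviation plucker_of :: "(complex ^ 'n) \<times> (complex ^ 'n) \<Rightarrow> 'n \<Rightarrow> 'n \<Rightarrow> complex" where
  "plucker_of b \<equiv> plucker (fst b) (snd b)"

lemma quotient_map_orbit_class: "quotient_map (top_of_set stiefel) Gr25_mod_T orbit_class"
proof -
  have "quotient_map (top_of_set stiefel) Gr25_mod_T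
     ((\<lambda>W. (\<lambda>t. torus_act t W) ` torus) \<circ> (\<lambda>(u, w). vec.span {u, w}))"
    unfolding Gr25_mod_T_def
    by (rule quotient_map_compose[OF quotient_map_stiefel quotient_map_quotient_topology])
  moreover have "((\<lambda>W. (\<lambda>t. torus_act t W) ` torus) \<circ> (\<lambda>(u, w). vec.span {u, w})) = orbit_class"
    by (auto simp: fun_eq_iff orbit_class_def)
  ultimately show ?thesis by simp
qed

text \<open>The phases t need not have product 1. Dividing them by a fifth root r of their product
  puts them into the torus and changes the Pluecker vector by a scalar only, which leaves the plane
  alone.\<close>

lemma orbit_class_eqI:
  assumes b: "b \<in> stiefel" and b': "b' \<in> stiefel"
    and t: "\<And>i. cmod (t i) = 1" "\<And>i j. plucker_of b' i j = t i * t j * plucker_of b i j"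
  shows "orbit_class b = orbit_class b'"
proof -
  define z where "z = (\<Prod>i\<in>UNIV. t i)"
  have z: "cmod z = 1" unfolding z_def by (simp add: t flip: prod_norm)
  define r where "r = cis (Arg z / 5)"
  have "z \<noteq> 0" using z by auto
  then have "cis (Arg z) = z" using z by (simp add: cis_Arg sgn_eq)
  then have r: "cmod r = 1" "r ^ 5 = z"
    unfolding r_def by (simp_all add: Complex.DeMoivre)
  have r0: "r \<noteq> 0" using r by auto
  define s where "s = (\<chi> i. t i / r)"
  have "(\<Prod>i\<in>UNIV. t i / r) = 1"
    using r0 r(2) \<open>z \<noteq> 0\<close> by (simp add: prod_dividef z_def)
  then have s: "s \<in> torus" unfolding torus_def s_def by (simp add: t r norm_divide)
  have p: "(fst b, snd b) \<in> pairs2" "(fst b', snd b') \<in> pairs2"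
    using b b' stiefel_subset_pairs2 by auto
  have pl: "plucker_of b' i j = r\<^sup>2 * plucker (diag_scale s (fst b)) (diag_scale s (snd b)) i j" for i j
    unfolding plucker_diag_scale t(2) s_def using r0 by (simp add: power2_eq_square)
  obtain i0 j0 where "plucker_of b' i0 j0 \<noteq> 0" using p(2) unfolding pairs2_def by auto
  then have "plucker (diag_scale s (fst b)) (diag_scale s (snd b)) i0 j0 \<noteq> 0" unfolding pl by auto
  then have ps: "(diag_scale s (fst b), diag_scale s (snd b)) \<in> pairs2"
    unfolding pairs2_def by blast
  have "vec.span {diag_scale s (fst b), diag_scale s (snd b)} = vec.span {fst b', snd b'}"
    unfolding span_pair_eq_iff[OF ps p(2)] using pl r0 by (intro exI[of _ "r\<^sup>2"]) auto
  then show ?thesis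
    unfolding orbit_class_def torus_orbit_eq_iff unfolding torus_act_eq diag_scale_span using s by auto
qed

text \<open>Equality of planes gives proportional Pluecker vectors; the factor c enters the column
  scalings through its square root. Since both vectors are normalized, c has absolute value 1 and
  the moments agree.\<close>

lemma orbit_class_eqD:
  assumes b: "b \<in> stiefel" and b': "b' \<in> stiefel" and eq: "orbit_class b = orbit_class b'"
  shows "torus_equiv (plucker_of b) (plucker_of b')" "weight (plucker_of b) = weight (plucker_of b')"
proof -
  have "\<exists>t\<in>torus. vec.span {fst b', snd b'} = vec.span {diag_scale t (fst b), diag_scale t (snd b)}"
    using eq unfolding orbit_class_def torus_orbit_eq_iff unfolding torus_act_eq diag_scale_span .
  then obtain t where t: "t \<in> torus"
    "vec.span {fst b', snd b'} = vec.span {diag_scale t (fst b), diag_scale t (snd b)}" ..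
  have t1: "cmod (t $ i) = 1" for i using t(1) by (simp add: torus_def)
  have p: "(fst b, snd b) \<in> pairs2" "(fst b', snd b') \<in> pairs2"
    using b b' stiefel_subset_pairs2 by auto
  have t0: "t $ i \<noteq> 0" for i using t1[of i] by auto
  have "(diag_scale t (fst b), diag_scale t (snd b)) \<in> pairs2"
    using p(1) t0 unfolding pairs2_def by (auto simp: plucker_diag_scale case_prod_beta)
  from span_pair_eq_iff[OF this p(2)] t(2)
  obtain c where c: "c \<noteq> 0" "\<And>i j. plucker_of b' i j = c * (t $ i * t $ j * plucker_of b i j)"
    unfolding plucker_diag_scale by auto
  show "torus_equiv (plucker_of b) (plucker_of b')"
    unfolding torus_equiv_def
  proof (intro exI conjI allI)
    show "csqrt c * t $ i \<noteq> 0" for i using c t0 by simp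
    show "plucker_of b' i j = csqrt c * t $ i * (csqrt c * t $ j) * plucker_of b i j" for i j
    proof -
      have "plucker_of b' i j = (csqrt c)\<^sup>2 * (t $ i * t $ j * plucker_of b i j)" using c by simp
      then show ?thesis unfolding power2_eq_square by (simp only: mult_ac)
    qed
  qed
  have cm: "cmod (plucker_of b' i j) = cmod c * cmod (plucker_of b i j)" for i j
    unfolding c(2) by (simp add: norm_mult t1)
  have w: "weight (plucker_of b') i = (cmod c)\<^sup>2 * weight (plucker_of b) i" for i
    unfolding weight_def cm by (simp add: power_mult_distrib sum_distrib_left)
  have "normalized (plucker_of b)" "normalized (plucker_of b')"
    using stiefel_normalized[of "fst b" "snd b"] stiefel_normalized[of "fst b'" "snd b'"] b b' by auto
  then have "2 = (cmod c)\<^sup>2 * 2"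
    using normalized_sum[of "plucker_of b"] normalized_sum[of "plucker_of b'"]
    by (simp add: w flip: sum_distrib_left)
  then show "weight (plucker_of b) = weight (plucker_of b')" using w by auto
qed

lemma orbit_class_eq_iff:
  assumes "b \<in> stiefel" "b' \<in> stiefel"
  shows "orbit_class b = orbit_class b' \<longleftrightarrow>
    torus_equiv (plucker_of b) (plucker_of b') \<and> weight (plucker_of b) = weight (plucker_of b')"
proof -
  have "normalized (plucker_of b)" "normalized (plucker_of b')"
    using stiefel_normalized[of "fst b" "snd b"] stiefel_normalized[of "fst b'" "snd b'"] assms by auto
  from torus_equiv_unitary[OF this] show ?thesis
    using orbit_class_eqI[OF assms] orbit_class_eqD[OF assms] by metis
qed

text \<open>A positive scaling from \<open>exists_torus_scaling\<close> makes the moment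
  proportional to x. Orthonormalizing the scaled pair multiplies the Pluecker vector by a constant,
  and the normalization, together with x having sum 2, makes the proportion an equality.\<close>

lemma exists_stiefel_weight:
  fixes u w :: "complex ^ 'n" and x :: "real ^ 'n"
  assumes nz: "\<And>i j. i \<noteq> j \<Longrightarrow> plucker u w i j \<noteq> 0"
    and x: "\<And>i. 0 < x $ i" "\<And>i. x $ i < 1" "(\<Sum>i\<in>UNIV. x $ i) = 2"
  shows "\<exists>b\<in>stiefel. weight (plucker_of b) = ($) x \<and> torus_equiv (plucker u w) (plucker_of b)"
proof -
  define a where "a i j = (cmod (plucker u w i j))\<^sup>2" for i j
  have sym: "a i j = a j i" for i j
    unfolding a_def plucker_def by (simp add: norm_minus_commute)
  obtain s where s: "\<And>k. 2 * (\<Sum>j\<in>UNIV. a k j * exp (s k + s j)) =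
      x $ k * (\<Sum>i\<in>UNIV. \<Sum>j\<in>UNIV. a i j * exp (s i + s j))"
    using exists_torus_scaling[of a "($) x"] nz x sym by (auto simp: a_def plucker_def)
  \<comment> \<open>The exponents are halved because the weights are built from squared absolute
    values.\<close>
  define t where "t = (\<chi> i. complex_of_real (exp (s i / 2)))"
  have t0: "t $ i \<noteq> 0" for i by (simp add: t_def)
  define u' w' where "u' = diag_scale t u" and "w' = diag_scale t w"
  have pl': "plucker u' w' i j = t $ i * t $ j * plucker u w i j" for i j
    unfolding u'_def w'_def by (rule plucker_diag_scale)
  obtain i0 j0 :: 'n where "i0 \<noteq> j0"
  proof (rule ccontr)
    assume "\<not> thesis"
    with that have "i = i0" for i :: 'n by blast
    then have "UNIV = {i0 :: 'n}" by auto
    then have "(\<Sum>i\<in>UNIV. x $ i) = (\<Sum>i\<in>{i0}. x $ i)" by (rule arg_cong)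
    then show False using x(2)[of i0] x(3) by simp
  qed
  then have "plucker u' w' i0 j0 \<noteq> 0" using pl' t0 nz by simp
  then have "(u', w') \<in> pairs2" unfolding pairs2_def by auto
  from gram_schmidt[OF this] obtain b c where b: "b \<in> stiefel" and c: "c \<noteq> 0"
    and pl: "\<And>i j. plucker_of b i j = c * plucker u' w' i j" by metis
  have cm: "(cmod (plucker_of b i j))\<^sup>2 = (cmod c)\<^sup>2 * (a i j * exp (s i + s j))" for i j
  proof -
    have "cmod (plucker_of b i j) = cmod c * (exp (s i / 2) * exp (s j / 2) * cmod (plucker u w i j))"
      unfolding pl pl' t_def by (simp add: norm_mult)
    also have "exp (s i / 2) * exp (s j / 2) = exp ((s i + s j) / 2)"
      by (simp add: exp_add[symmetric] add_divide_distrib)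
    finally have "(cmod (plucker_of b i j))\<^sup>2 = (cmod c)\<^sup>2 * ((exp ((s i + s j) / 2))\<^sup>2 * a i j)"
      unfolding a_def by (simp add: power_mult_distrib)
    also have "(exp ((s i + s j) / 2))\<^sup>2 = exp (s i + s j)"
      by (simp add: power2_eq_square exp_add[symmetric])
    finally show ?thesis by (simp add: mult.commute)
  qed
  define N where "N = (\<Sum>i\<in>UNIV. \<Sum>j\<in>UNIV. a i j * exp (s i + s j))"
  have wt: "weight (plucker_of b) k = (cmod c)\<^sup>2 * (x $ k * N / 2)" for k
    unfolding weight_def cm sum_distrib_left[symmetric] N_def s[symmetric] by simp
  have "normalized (plucker_of b)"
    using stiefel_normalized[of "fst b" "snd b"] b by simp
  then have "2 = (\<Sum>k\<in>UNIV. (cmod c)\<^sup>2 * (x $ k * N / 2))"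
    using normalized_sum[of "plucker_of b"] by (simp add: wt)
  also have "\<dots> = (cmod c)\<^sup>2 * ((\<Sum>k\<in>UNIV. x $ k) * N / 2)"
    by (simp add: sum_distrib_left sum_distrib_right sum_divide_distrib)
  finally have "(cmod c)\<^sup>2 * N = 2" using x(3) by simp
  then have "weight (plucker_of b) k = x $ k" for k unfolding wt by (simp add: algebra_simps)
  moreover have "torus_equiv (plucker u w) (plucker_of b)"
    unfolding torus_equiv_def
  proof (intro exI conjI allI)
    show "csqrt c * t $ i \<noteq> 0" for i using c t0 by simp
    show "plucker_of b i j = csqrt c * t $ i * (csqrt c * t $ j) * plucker u w i j" for i j
    proof -
      have "plucker_of b i j = (csqrt c)\<^sup>2 * (t $ i * t $ j * plucker u w i j)" using pl pl' by simp
      then show ?thesis unfolding power2_eq_square by (simp only: mult_ac)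
    qed
  qed
  ultimately show ?thesis using b by auto
qed

section \<open>Representatives for the points of the del Pezzo surface\<close>

lemma pts_eq: "pts = - {5}"
  unfolding pts_def using UNIV_5 by auto

lemma ex_off_3: "\<exists>x::5. x \<notin> {a, b, c}"
  using ex_distinct_5[of "{a, b, c}"] card_insert_le_m1[of 4 "{b, c}" a] card_insert_le_m1[of 3 "{c}" b]
  by simp

lemma obtain_complement:
  assumes "k \<noteq> (5::5)"
  obtains i j l where "distinct [5, k, i, j, l]"
proof -
  obtain i where "i \<notin> {5, k}" using ex_distinct_5[of "{5, k}"] assms by auto
  moreover obtain j where "j \<notin> {5, k, i}" using ex_distinct_5[of "{5, k, i}"] assms calculation by auto
  moreover obtain l where "l \<notin> {5, k, i, j}"
    using ex_distinct_5[of "{5, k, i, j}"] assms calculation by auto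
  ultimately show ?thesis using that[of i j l] assms by auto
qed

lemma sum_zero_at:
  fixes v :: "complex ^ 5"
  assumes "v $ 5 = 0" "distinct [5, k, i, j, l]"
  shows "(\<Sum>i\<in>UNIV. v $ i) = v $ k + v $ i + v $ j + v $ l"
  using sum_5_distinct[OF assms(2), of "($) v"] assms(1) by simp

text \<open>Five labelled points of the projective line: \<open>q\<close> is placed at infinity, the others at the
  entries of \<open>m\<close>.\<close>

definition config :: "5 \<Rightarrow> complex ^ 5 \<Rightarrow> 5 \<Rightarrow> 5 \<Rightarrow> complex" where
  "config q m = plucker (\<chi> i. if i = q then 0 else 1) (\<chi> i. if i = q then 1 else m $ i)"

lemma config_simps:
  "\<lbrakk>i \<noteq> q; j \<noteq> q\<rbrakk> \<Longrightarrow> config q m i j = m $ j - m $ i"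
  "i \<noteq> q \<Longrightarrow> config q m i q = 1"
  "i \<noteq> q \<Longrightarrow> config q m q i = -1"
  by (auto simp: config_def plucker_def)

lemma plucker_vector_config [simp]: "plucker_vector (config q m)"
  by (simp add: config_def)

text \<open>\<open>collapsed q v\<close> says that \<open>v\<close>, viewed modulo the vector (1, 1, 1, 1), represents the
  blown-up point \<open>p q\<close>.\<close>

definition collapsed :: "5 \<Rightarrow> complex ^ 5 \<Rightarrow> bool" where
  "collapsed q v \<longleftrightarrow> q \<noteq> 5 \<and> (\<forall>i j. i \<notin> {5, q} \<and> j \<notin> {5, q} \<longrightarrow> v $ i = v $ j)"

lemma collapsedD: "\<lbrakk>collapsed q v; i \<notin> {5, q}; j \<notin> {5, q}\<rbrakk> \<Longrightarrow> v $ i = v $ j"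
  unfolding collapsed_def by blast

text \<open>The vectors of sum zero are a slice for the quotient of the 4-space by the constants, so
  every class has exactly one balanced representative. Entry 5 belongs to the point at infinity and
  is fixed as 0.\<close>

definition balanced :: "complex ^ 5 \<Rightarrow> bool" where
  "balanced v \<longleftrightarrow> v $ 5 = 0 \<and> (\<Sum>i\<in>UNIV. v $ i) = 0"

text \<open>A compact space of representatives for \<open>dP\<^sub>5\<close>: \<open>v\<close> represents a point of the plane,
  identified with the projectivization of \<open>\<complex>\<^sup>4\<close> modulo (1, 1, 1, 1), and \<open>m $ k\<close> the line through
  \<open>p k\<close> spanned by \<open>p k\<close> and \<open>m $ k\<close>.\<close>

definition dP5_lift :: "((complex ^ 5) \<times> (complex ^ 5 ^ 5)) set" where
  "dP5_lift = {(v, m). balanced v \<and> norm v = 1 \<and> m $ 5 = 0 \<and>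
     (\<forall>k. k \<noteq> 5 \<longrightarrow> balanced (m $ k) \<and> m $ k $ k = 0 \<and> norm (m $ k) = 1 \<and>
       (\<forall>i j l. i \<notin> {5, k} \<and> j \<notin> {5, k} \<and> l \<notin> {5, k} \<longrightarrow>
          (v $ i - v $ j) * (m $ k $ l - m $ k $ j) = (v $ l - v $ j) * (m $ k $ i - m $ k $ j)))}"

text \<open>The cross ratio of \<open>cross_data y k\<close> is the \<open>k\<close>-th conic bundle at \<open>y\<close>. For \<open>k = 5\<close> and a point \<open>y\<close> of
  the exceptional curve over \<open>p q\<close>, the tangent direction at \<open>p q\<close> takes the place of the point.\<close>

definition cross_data :: "(complex ^ 5) \<times> (complex ^ 5 ^ 5) \<Rightarrow> 5 \<Rightarrow> 5 \<Rightarrow> 5 \<Rightarrow> complex" where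
  "cross_data y k = (if k \<noteq> 5 then config 5 (snd y $ k)
     else if \<exists>q. collapsed q (fst y) then (let q = SOME q. collapsed q (fst y) in config q (snd y $ q))
     else config 5 (fst y))"

lemma dP5_liftD:
  assumes "(v, m) \<in> dP5_lift"
  shows "balanced v" "norm v = 1" "m $ 5 = 0"
    "k \<noteq> 5 \<Longrightarrow> balanced (m $ k)" "k \<noteq> 5 \<Longrightarrow> m $ k $ k = 0" "k \<noteq> 5 \<Longrightarrow> norm (m $ k) = 1"
    "\<lbrakk>k \<noteq> 5; i \<notin> {5, k}; j \<notin> {5, k}; l \<notin> {5, k}\<rbrakk> \<Longrightarrow>
      (v $ i - v $ j) * (m $ k $ l - m $ k $ j) = (v $ l - v $ j) * (m $ k $ i - m $ k $ j)"
  using assms unfolding dP5_lift_def by auto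

lemma compact_dP5_lift: "compact dP5_lift"
  unfolding compact_eq_bounded_closed
proof
  have "dP5_lift \<subseteq> cball 0 1 \<times> cball 0 (real CARD(5))"
  proof clarify
    fix v m assume vm: "(v, m) \<in> dP5_lift"
    have "norm m \<le> (\<Sum>k\<in>UNIV. norm (m $ k))" unfolding norm_vec_def by (rule L2_set_le_sum) auto
    also have "\<dots> \<le> (\<Sum>k\<in>(UNIV :: 5 set). 1)"
    proof (rule sum_mono)
      fix k show "norm (m $ k) \<le> 1"
        using dP5_liftD(3)[OF vm] dP5_liftD(6)[OF vm, of k] by (cases "k = 5") auto
    qed
    finally show "v \<in> cball 0 1 \<and> m \<in> cball 0 (real CARD(5))"
      using dP5_liftD(2)[OF vm] by simp
  qed
  then show "bounded dP5_lift"
    by (rule bounded_subset[rotated]) (intro bounded_Times bounded_cball)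
  show "closed dP5_lift"
    unfolding dP5_lift_def balanced_def case_prod_unfold
    by (intro closed_Collect_conj closed_Collect_all closed_Collect_imp closed_Collect_eq
        continuous_intros open_Collect_const)
qed

lemma balanced_nonconstant:
  assumes "balanced v" "v \<noteq> 0"
  shows "\<exists>i j. i \<noteq> 5 \<and> j \<noteq> 5 \<and> v $ i \<noteq> v $ j"
proof (rule ccontr)
  assume "\<not> ?thesis"
  moreover have "(1::5) \<noteq> 5" by simp
  ultimately have c: "v $ i = v $ 1" if "i \<noteq> 5" for i using that by metis
  have "(\<Sum>i\<in>UNIV. v $ i) = 4 * v $ 1"
    unfolding sum_5 using assms(1) c[of 2] c[of 3] c[of 4] by (simp add: balanced_def)
  then have "v $ 1 = 0" using assms(1) by (simp add: balanced_def)
  then have "v $ i = 0" for i using c[of i] assms(1) by (cases "i = 5") (auto simp: balanced_def)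
  then show False using assms(2) by (simp add: vec_eq_iff)
qed

lemma balanced_nonconstant_off:
  assumes "balanced m" "m \<noteq> 0" "m $ k = 0" "k \<noteq> 5"
  shows "\<not> collapsed k m"
proof
  assume c: "collapsed k m"
  obtain i j l where d: "distinct [5, k, i, j, l]" using obtain_complement[OF assms(4)] .
  then have "m $ j = m $ i" "m $ l = m $ i" using collapsedD[OF c, of j i] collapsedD[OF c, of l i] by auto
  then have "3 * m $ i = 0" using sum_zero_at[OF _ d, of m] assms by (simp add: balanced_def)
  then have "m $ i = 0" by simp
  then have "m $ x = 0" for x
    using UNIV_5_distinct[OF d] assms \<open>m $ j = m $ i\<close> \<open>m $ l = m $ i\<close>
    by (metis UNIV_I balanced_def emptyE insertE)
  then show False using assms(2) by (simp add: vec_eq_iff)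
qed

text \<open>The sets of indices off q and off q' overlap, so the two constants would agree and v
  would be constant.\<close>

lemma collapsed_unique:
  assumes "balanced v" "v \<noteq> 0" "collapsed q v" "collapsed q' v"
  shows "q = q'"
proof (rule ccontr)
  assume ne: "q \<noteq> q'"
  obtain r where r: "r \<notin> {5, q, q'}" using ex_off_3[of 5 q q'] by blast
  have "v $ i = v $ r" if "i \<noteq> 5" for i
  proof (cases "i = q")
    case True
    show ?thesis by (rule collapsedD[OF assms(4)]) (use True r ne that in auto)
  next
    case False
    show ?thesis by (rule collapsedD[OF assms(3)]) (use False r ne that in auto)
  qed
  then show False using balanced_nonconstant[OF assms(1,2)] by metis
qed

lemma dP5_lift_nonzero:
  assumes "(v, m) \<in> dP5_lift"
  shows "v \<noteq> 0" "k \<noteq> 5 \<Longrightarrow> m $ k \<noteq> 0" "\<not> collapsed k (m $ k)"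
proof -
  show "v \<noteq> 0" using dP5_liftD(2)[OF assms] by auto
  show m: "m $ k \<noteq> 0" if "k \<noteq> 5" using dP5_liftD(6)[OF assms that] by auto
  show "\<not> collapsed k (m $ k)"
  proof (cases "k = 5")
    case False
    then show ?thesis using balanced_nonconstant_off[OF dP5_liftD(4)[OF assms] m dP5_liftD(5)[OF assms]] by blast
  qed (simp add: collapsed_def)
qed

text \<open>Since m is not constant off k, the cross-multiplied proportionality can be solved for v.
  The factor \<beta> vanishes exactly when v represents the blown-up point itself.\<close>

lemma proportional_off:
  assumes m: "\<not> collapsed k m" "k \<noteq> 5"
    and eq: "\<And>i j l. \<lbrakk>i \<notin> {5, k}; j \<notin> {5, k}; l \<notin> {5, k}\<rbrakk> \<Longrightarrow>
      (v $ i - v $ j) * (m $ l - m $ j) = (v $ l - v $ j) * (m $ i - m $ j)"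
  obtains \<beta> where "\<And>i j. \<lbrakk>i \<notin> {5, k}; j \<notin> {5, k}\<rbrakk> \<Longrightarrow> v $ i - v $ j = \<beta> * (m $ i - m $ j)"
    "\<beta> = 0 \<longleftrightarrow> collapsed k v"
proof -
  obtain l j where lj: "l \<notin> {5, k}" "j \<notin> {5, k}" "m $ l \<noteq> m $ j"
    using m unfolding collapsed_def by auto
  define \<beta> where "\<beta> = (v $ l - v $ j) / (m $ l - m $ j)"
  have 1: "v $ i - v $ j = \<beta> * (m $ i - m $ j)" if "i \<notin> {5, k}" for i
    using eq[OF that lj(2,1)] lj(3) unfolding \<beta>_def by (simp add: field_simps)
  have 2: "v $ i - v $ i' = \<beta> * (m $ i - m $ i')" if "i \<notin> {5, k}" "i' \<notin> {5, k}" for i i'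
  proof -
    have "v $ i - v $ i' = (v $ i - v $ j) - (v $ i' - v $ j)" by simp
    then show ?thesis unfolding 1[OF that(1)] 1[OF that(2)] by (simp add: algebra_simps)
  qed
  have "\<beta> = 0 \<longleftrightarrow> collapsed k v"
  proof
    assume "\<beta> = 0"
    then show "collapsed k v" using 2 m(2) unfolding collapsed_def by simp
  next
    assume "collapsed k v"
    then show "\<beta> = 0" using collapsedD[of k v l j] lj unfolding \<beta>_def by simp
  qed
  then show ?thesis using that 2 by blast
qed

lemma dP5_lift_ratio:
  assumes vm: "(v, m) \<in> dP5_lift" and k: "k \<noteq> 5"
  obtains \<beta> where "\<And>i j. \<lbrakk>i \<notin> {5, k}; j \<notin> {5, k}\<rbrakk> \<Longrightarrow> v $ i - v $ j = \<beta> * (m $ k $ i - m $ k $ j)"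
    "\<beta> = 0 \<longleftrightarrow> collapsed k v"
  using proportional_off[OF dP5_lift_nonzero(3)[OF vm] k dP5_liftD(7)[OF vm k]] by blast

lemma cross_data_not_5: "k \<noteq> 5 \<Longrightarrow> cross_data (v, m) k = config 5 (m $ k)"
  by (simp add: cross_data_def)

lemma cross_data_5:
  assumes "(v, m) \<in> dP5_lift"
  shows "collapsed q v \<Longrightarrow> cross_data (v, m) 5 = config q (m $ q)"
    "(\<And>q. \<not> collapsed q v) \<Longrightarrow> cross_data (v, m) 5 = config 5 v"
proof -
  assume q: "collapsed q v"
  then have "(SOME q. collapsed q v) = q"
    using collapsed_unique[OF dP5_liftD(1)[OF assms] dP5_lift_nonzero(1)[OF assms]] by blast
  then show "cross_data (v, m) 5 = config q (m $ q)"
    using q unfolding cross_data_def Let_def by auto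
qed (simp add: cross_data_def)

lemma stable_off_config:
  assumes "\<not> collapsed k m" "k \<noteq> 5"
  shows "stable_off k (config 5 m)"
  unfolding stable_off_def
proof (intro conjI allI impI)
  fix a b c assume d: "distinct [k, a, b, c]"
  show "config 5 m a b \<noteq> 0 \<or> config 5 m a c \<noteq> 0"
  proof (cases "5 \<in> {a, b, c}")
    case True
    then show ?thesis using d by (auto simp: config_simps)
  next
    case False
    have D: "distinct [5, k, a, b, c]" using d False assms(2) by auto
    show ?thesis
    proof (rule ccontr)
      assume "\<not> ?thesis"
      then have "m $ b = m $ a" "m $ c = m $ a" using D by (auto simp: config_simps)
      then have "m $ i = m $ a" if "i \<notin> {5, k}" for i
        using UNIV_5_distinct[OF D] that by auto
      then have "collapsed k m" using assms(2) unfolding collapsed_def by metis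
      then show False using assms(1) by simp
    qed
  qed
qed simp

text \<open>This is what the case distinction in \<open>cross_data\<close> achieves. Three finite
  points of a configuration could collide only if the defining vector were constant off one index.
  For the directions \<open>m $ k\<close> this is excluded by balance and unit norm; at a blown-up
  point q, where it does happen to v, the direction \<open>m $ q\<close> takes over with q at
  infinity.\<close>

lemma stable_off_cross_data:
  assumes "(v, m) \<in> dP5_lift"
  shows "stable_off k (cross_data (v, m) k)"
proof (cases "k = 5")
  case False
  then show ?thesis
    using stable_off_config[OF dP5_lift_nonzero(3)[OF assms]] by (simp add: cross_data_not_5)
next
  case k: True
  show ?thesis
  proof (cases "\<exists>q. collapsed q v")
    case True
    then obtain q where q: "collapsed q v" by blast
    then have q5: "q \<noteq> 5" unfolding collapsed_def by simp
    have "stable_off 5 (config q (m $ q))"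
      unfolding stable_off_def
    proof (intro conjI allI impI)
      fix a b c :: 5 assume d: "distinct [5, a, b, c]"
      show "config q (m $ q) a b \<noteq> 0 \<or> config q (m $ q) a c \<noteq> 0"
      proof (cases "q \<in> {a, b, c}")
        case True
        then show ?thesis using d by (auto simp: config_simps)
      next
        case False
        have D: "distinct [5, q, a, b, c]" using d False q5 by auto
        show ?thesis
        proof (rule ccontr)
          assume "\<not> ?thesis"
          then have "m $ q $ b = m $ q $ a" "m $ q $ c = m $ q $ a" using D by (auto simp: config_simps)
          then have "m $ q $ i = m $ q $ a" if "i \<notin> {5, q}" for i
            using UNIV_5_distinct[OF D] that by auto
          then have "collapsed q (m $ q)" using q5 unfolding collapsed_def by metis
          then show False using dP5_lift_nonzero(3)[OF assms] by simp
        qed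
      qed
    qed simp
    then show ?thesis using cross_data_5(1)[OF assms q] k by simp
  next
    case False
    have "stable_off 5 (config 5 v)"
      unfolding stable_off_def
    proof (intro conjI allI impI)
      fix a b c :: 5 assume d: "distinct [5, a, b, c]"
      obtain q where q: "q \<notin> {5, a, b, c}" using ex_distinct_5[of "{5, a, b, c}"] d by auto
      have D: "distinct [5, q, a, b, c]" using d q by auto
      show "config 5 v a b \<noteq> 0 \<or> config 5 v a c \<noteq> 0"
      proof (rule ccontr)
        assume "\<not> ?thesis"
        then have "v $ b = v $ a" "v $ c = v $ a" using D by (auto simp: config_simps)
        then have "v $ i = v $ a" if "i \<notin> {5, q}" for i
          using UNIV_5_distinct[OF D] that by auto
        then have "collapsed q v" using D unfolding collapsed_def by (metis distinct_length_2_or_more)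
        then show False using False by blast
      qed
    qed simp
    then show ?thesis using cross_data_5(2)[OF assms] False k by simp
  qed
qed

text \<open>Polynomial substitutes for the fifth cross ratio, whose definition by cases is not
  continuous: for each \<open>y\<close> one of the four expressions is a nonzero multiple of it.\<close>

lemma cross_data_5_multiple:
  assumes vm: "(v, m) \<in> dP5_lift"
  obtains \<tau> where "\<And>k i j l. distinct [5, k, i, j, l] \<Longrightarrow>
      (m $ k $ j - m $ k $ i) * (v $ k - v $ l) = \<tau> k * (cross_data (v, m) 5 i j * cross_data (v, m) 5 l k)"
    "\<exists>k. k \<noteq> 5 \<and> \<tau> k \<noteq> 0"
proof (cases "\<exists>q. collapsed q v")
  case False
  have C: "cross_data (v, m) 5 = config 5 v" using cross_data_5(2)[OF vm] False by blast
  have "\<exists>\<tau>. \<tau> \<noteq> 0 \<and> (\<forall>i j l. distinct [5, k, i, j, l] \<longrightarrow>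
      (m $ k $ j - m $ k $ i) * (v $ k - v $ l) = \<tau> * (config 5 v i j * config 5 v l k))" if k: "k \<noteq> 5" for k
  proof -
    obtain \<beta> where \<beta>: "\<And>i j. \<lbrakk>i \<notin> {5, k}; j \<notin> {5, k}\<rbrakk> \<Longrightarrow> v $ i - v $ j = \<beta> * (m $ k $ i - m $ k $ j)"
      "\<beta> = 0 \<longleftrightarrow> collapsed k v" using dP5_lift_ratio[OF vm k] by blast
    have "\<beta> \<noteq> 0" using \<beta>(2) False by blast
    then show ?thesis
      using \<beta>(1) by (intro exI[of _ "1 / \<beta>"]) (auto simp: config_simps)
  qed
  then have "\<forall>k. \<exists>\<tau>. k \<noteq> 5 \<longrightarrow> \<tau> \<noteq> 0 \<and> (\<forall>i j l. distinct [5, k, i, j, l] \<longrightarrow>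
      (m $ k $ j - m $ k $ i) * (v $ k - v $ l) = \<tau> * (config 5 v i j * config 5 v l k))"
    by blast
  then obtain \<tau> where \<tau>: "\<forall>k. k \<noteq> 5 \<longrightarrow> \<tau> k \<noteq> 0 \<and> (\<forall>i j l. distinct [5, k, i, j, l] \<longrightarrow>
      (m $ k $ j - m $ k $ i) * (v $ k - v $ l) = \<tau> k * (config 5 v i j * config 5 v l k))"
    by (rule choice[THEN exE])
  show ?thesis
  proof (rule that[of \<tau>])
    show "\<exists>k. k \<noteq> 5 \<and> \<tau> k \<noteq> 0" using \<tau> by (intro exI[of _ 1]) auto
    show "(m $ k $ j - m $ k $ i) * (v $ k - v $ l) = \<tau> k * (cross_data (v, m) 5 i j * cross_data (v, m) 5 l k)"
      if d: "distinct [5, k, i, j, l]" for k i j l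
    proof -
      have "k \<noteq> 5" using d by auto
      then show ?thesis using \<tau> d unfolding C by blast
    qed
  qed
next
  case True
  then obtain q where q: "collapsed q v" by blast
  then have q5: "q \<noteq> 5" unfolding collapsed_def by simp
  have C: "cross_data (v, m) 5 = config q (m $ q)" using cross_data_5(1)[OF vm q] .
  obtain r where r: "r \<notin> {5, q}" using ex_off_3[of 5 q q] by blast
  have vr: "v $ i = v $ r" if "i \<notin> {5, q}" for i
    by (rule collapsedD[OF q that]) (use r in simp)
  have qr: "v $ q \<noteq> v $ r"
  proof
    assume "v $ q = v $ r"
    then have "v $ i = v $ r" if "i \<noteq> 5" for i using vr[of i] that by (cases "i = q") auto
    then show False using balanced_nonconstant[OF dP5_liftD(1)[OF vm] dP5_lift_nonzero(1)[OF vm]] by metis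
  qed
  \<comment> \<open>Over the blown-up point q only the expression with k = q survives. In the others
    one of the two differences is between equal entries.\<close>
  define \<tau> where "\<tau> k = (if k = q then v $ q - v $ r else 0)" for k
  have "(m $ k $ j - m $ k $ i) * (v $ k - v $ l) = \<tau> k * (config q (m $ q) i j * config q (m $ q) l k)"
    if d: "distinct [5, k, i, j, l]" for k i j l
  proof (cases "k = q")
    case True
    then show ?thesis using d vr[of l] by (auto simp: config_simps \<tau>_def)
  next
    case False
    have k5: "k \<noteq> 5" using d by auto
    have "\<not> collapsed k v"
      using False collapsed_unique[OF dP5_liftD(1)[OF vm] dP5_lift_nonzero(1)[OF vm] q] by blast
    moreover obtain \<beta> where \<beta>: "\<And>i j. \<lbrakk>i \<notin> {5, k}; j \<notin> {5, k}\<rbrakk> \<Longrightarrow> v $ i - v $ j = \<beta> * (m $ k $ i - m $ k $ j)"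
      "\<beta> = 0 \<longleftrightarrow> collapsed k v" using dP5_lift_ratio[OF vm k5] by blast
    ultimately have b0: "\<beta> \<noteq> 0" by blast
    have "(m $ k $ j - m $ k $ i) * (v $ k - v $ l) = 0"
    proof (cases "l = q")
      case True
      then have "v $ j - v $ i = 0" using d vr[of i] vr[of j] by auto
      then show ?thesis using \<beta>(1)[of j i] d b0 by auto
    next
      case l: False
      then show ?thesis using d vr[of k] vr[of l] False by auto
    qed
    then show ?thesis using False by (simp add: \<tau>_def)
  qed
  moreover have "\<tau> q \<noteq> 0" using qr by (simp add: \<tau>_def)
  ultimately show ?thesis using that[of \<tau>] q5 unfolding C by blast
qed

text \<open>Both products of a cross ratio are invariant under the Klein four-group acting on the
  four indices, since signs change in pairs. It acts transitively, so k can be moved to the last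
  position.\<close>

lemma cross_ratio_eq_5I:
  assumes p: "plucker_vector p" and C: "plucker_vector C" and k: "k \<noteq> 5"
    and eq: "\<And>i j l. distinct [5, k, i, j, l] \<Longrightarrow>
      p i j * p l k * (C i l * C j k) = p i l * p j k * (C i j * C l k)"
  shows "cross_ratio_eq 5 p C"
  unfolding cross_ratio_eq_def
proof (intro allI impI)
  fix a b c d assume D: "distinct [5, a, b, c, d :: 5]"
  have A: "p b a * p d c = p a b * p c d" "p c a * p d b = p a c * p b d"
    "p d c * p b a = p a b * p c d" "p d b * p c a = p a c * p b d"
    "C b a * C d c = C a b * C c d" "C c a * C d b = C a c * C b d"
    "C d c * C b a = C a b * C c d" "C d b * C c a = C a c * C b d" for a b c d
    using plucker_vector_antisym[OF p, of b a] plucker_vector_antisym[OF p, of d c]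
      plucker_vector_antisym[OF p, of c a] plucker_vector_antisym[OF p, of d b]
      plucker_vector_antisym[OF C, of b a] plucker_vector_antisym[OF C, of d c]
      plucker_vector_antisym[OF C, of c a] plucker_vector_antisym[OF C, of d b] by simp_all
  have "k \<in> {5, a, b, c, d}" using UNIV_5_distinct[OF D] by auto
  then consider "k = d" | "k = c" | "k = b" | "k = a" using k by auto
  then show "p a b * p c d * (C a c * C b d) = p a c * p b d * (C a b * C c d)"
  proof cases
    case 1 then show ?thesis using eq[of a b c] D by auto
  next
    case 2
    then have "p b a * p d c * (C b d * C a c) = p b d * p a c * (C b a * C d c)"
      using eq[of b a d] D by auto
    then show ?thesis unfolding A by (simp add: mult.commute)
  next
    case 3
    then have "p c d * p a b * (C c a * C d b) = p c a * p d b * (C c d * C a b)"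
      using eq[of c d a] D by auto
    then show ?thesis unfolding A by (simp add: mult_ac)
  next
    case 4
    then have "p d c * p b a * (C d b * C c a) = p d b * p c a * (C d c * C b a)"
      using eq[of d c b] D by auto
    then show ?thesis unfolding A by (simp add: mult_ac)
  qed
qed

text \<open>The right side consists of polynomial equations, so the fifth condition is closed
  although \<open>cross_data\<close> is defined by cases. Each equation is \<tau> k times a cross
  ratio equation, and one nonzero \<tau> k is enough to recover all of them.\<close>

lemma cross_ratio_eq_5_iff:
  assumes vm: "(v, m) \<in> dP5_lift" and p: "plucker_vector p"
  shows "cross_ratio_eq 5 p (cross_data (v, m) 5) \<longleftrightarrow>
    (\<forall>k i j l. distinct [5, k, i, j, l] \<longrightarrow>
      p i j * p l k * ((m $ k $ l - m $ k $ i) * (v $ k - v $ j)) =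
      p i l * p j k * ((m $ k $ j - m $ k $ i) * (v $ k - v $ l)))"
    (is "_ \<longleftrightarrow> ?R")
proof -
  let ?C = "cross_data (v, m) 5"
  obtain \<tau> where \<tau>: "\<And>k i j l. distinct [5, k, i, j, l] \<Longrightarrow>
      (m $ k $ j - m $ k $ i) * (v $ k - v $ l) = \<tau> k * (?C i j * ?C l k)"
    "\<exists>k. k \<noteq> 5 \<and> \<tau> k \<noteq> 0" using cross_data_5_multiple[OF vm] by blast
  have e: "p i j * p l k * ((m $ k $ l - m $ k $ i) * (v $ k - v $ j)) = \<tau> k * (p i j * p l k * (?C i l * ?C j k))"
    "p i l * p j k * ((m $ k $ j - m $ k $ i) * (v $ k - v $ l)) = \<tau> k * (p i l * p j k * (?C i j * ?C l k))"
    if d: "distinct [5, k, i, j, l]" for k i j l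
    using \<tau>(1)[of k i j l] \<tau>(1)[of k i l j] d by auto
  show ?thesis
  proof
    assume cr: "cross_ratio_eq 5 p ?C"
    show ?R
    proof (intro allI impI)
      fix k i j l :: 5 assume d: "distinct [5, k, i, j, l]"
      have "distinct [5, i, j, l, k]" using d by auto
      from cross_ratio_eqD[OF cr this]
      show "p i j * p l k * ((m $ k $ l - m $ k $ i) * (v $ k - v $ j)) =
        p i l * p j k * ((m $ k $ j - m $ k $ i) * (v $ k - v $ l))"
        unfolding e[OF d] by simp
    qed
  next
    assume R: ?R
    obtain k where k: "k \<noteq> 5" "\<tau> k \<noteq> 0" using \<tau>(2) by blast
    have "plucker_vector ?C" using stable_off_cross_data[OF vm, of 5] by (simp add: stable_off_def)
    from p this k(1) show "cross_ratio_eq 5 p ?C"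
    proof (rule cross_ratio_eq_5I)
      fix i j l assume d: "distinct [5, k, i, j, l]"
      have "\<tau> k * (p i j * p l k * (?C i l * ?C j k)) = \<tau> k * (p i l * p j k * (?C i j * ?C l k))"
        using R[rule_format, OF d] unfolding e[OF d] .
      then show "p i j * p l k * (?C i l * ?C j k) = p i l * p j k * (?C i j * ?C l k)"
        using k(2) by simp
    qed
  qed
qed

lemma cross_ratio_eq_scaled:
  assumes "\<And>i j. \<lbrakk>i \<noteq> k; j \<noteq> k\<rbrakk> \<Longrightarrow> q i j = c i * c j * p i j"
  shows "cross_ratio_eq k p q"
  unfolding cross_ratio_eq_def
proof (intro allI impI)
  fix a b e d assume D: "distinct [k, a, b, e, d]"
  have "q a e = c a * c e * p a e" "q b d = c b * c d * p b d" "q a b = c a * c b * p a b" "q e d = c e * c d * p e d"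
    using assms D by auto
  then show "p a b * p e d * (q a e * q b d) = p a e * p b d * (q a b * q e d)"
    by (simp add: mult_ac)
qed

definition generic :: "complex ^ 5 \<Rightarrow> bool" where
  "generic v \<longleftrightarrow> (\<forall>i j. i \<noteq> 5 \<and> j \<noteq> 5 \<and> i \<noteq> j \<longrightarrow> v $ i \<noteq> v $ j)"

lemma generic_not_collapsed: "generic v \<Longrightarrow> \<not> collapsed q v"
proof
  assume g: "generic v" and c: "collapsed q v"
  then have q: "q \<noteq> 5" by (simp add: collapsed_def)
  obtain i j l where "distinct [5, q, i, j, l]" using obtain_complement[OF q] .
  then show False using g collapsedD[OF c, of i j] unfolding generic_def by auto
qed

lemma generic_config_nonzero: "\<lbrakk>generic v; i \<noteq> j\<rbrakk> \<Longrightarrow> config 5 v i j \<noteq> 0"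
  unfolding generic_def
  by (cases "i = 5"; cases "j = 5") (auto simp: config_simps)

text \<open>Off k, the entries of v and of \<open>m $ k\<close> differ by an affine map of the line,
  which preserves cross ratios with infinity. Its factor 1 / \<beta> is written as g * g and
  balanced by 1 / g at index 5, so that the entries 1 of \<open>config\<close> are kept.\<close>

lemma generic_cross_ratio_eq:
  assumes vm: "(v, m) \<in> dP5_lift" and g: "generic v"
  shows "cross_ratio_eq k (config 5 v) (cross_data (v, m) k)"
proof (cases "k = 5")
  case True
  then show ?thesis
    using cross_data_5(2)[OF vm] generic_not_collapsed[OF g]
    by (auto simp: cross_ratio_eq_def)
next
  case False
  obtain \<beta> where \<beta>: "\<And>i j. \<lbrakk>i \<notin> {5, k}; j \<notin> {5, k}\<rbrakk> \<Longrightarrow> v $ i - v $ j = \<beta> * (m $ k $ i - m $ k $ j)"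
    "\<beta> = 0 \<longleftrightarrow> collapsed k v" using dP5_lift_ratio[OF vm False] by blast
  have b0: "\<beta> \<noteq> 0" using \<beta>(2) generic_not_collapsed[OF g] by blast
  define g where "g = csqrt (1 / \<beta>)"
  have g2: "g * g = 1 / \<beta>" unfolding g_def by (metis power2_csqrt power2_eq_square)
  then have g0: "g \<noteq> 0" using b0 by auto
  define c where "c i = (if i = 5 then 1 / g else g)" for i :: 5
  have "config 5 (m $ k) i j = c i * c j * config 5 v i j" if "i \<noteq> k" "j \<noteq> k" for i j
  proof -
    consider "i = 5" "j = 5" | "i = 5" "j \<noteq> 5" | "i \<noteq> 5" "j = 5" | "i \<noteq> 5" "j \<noteq> 5" by blast
    then show ?thesis
    proof cases
      case 1 then show ?thesis by (simp add: plucker_vector_diag)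
    next
      case 4
      then have "v $ j - v $ i = \<beta> * (m $ k $ j - m $ k $ i)" using \<beta>(1)[of j i] that by auto
      then show ?thesis using 4 g2 b0 by (simp add: config_simps c_def)
    qed (use g0 in \<open>auto simp: config_simps c_def\<close>)
  qed
  then have "cross_ratio_eq k (config 5 v) (config 5 (m $ k))" by (rule cross_ratio_eq_scaled)
  then show ?thesis using False by (simp add: cross_data_not_5)
qed

section \<open>Density of the generic representatives\<close>

lemma collapsedI:
  "\<lbrakk>q \<noteq> 5; \<And>i j. \<lbrakk>i \<notin> {5, q}; j \<notin> {5, q}\<rbrakk> \<Longrightarrow> v $ i = v $ j\<rbrakk> \<Longrightarrow> collapsed q v"
  unfolding collapsed_def by blast

text \<open>The linear projection from the k-th blown-up point: it annihilates the constants and the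
  k-th unit vector, and its image, the balanced vectors vanishing at k, parametrizes the lines
  through that point. The denominator 3 is the number of indices off {5, k}.\<close>

definition line_dir :: "5 \<Rightarrow> complex ^ 5 \<Rightarrow> complex ^ 5" where
  "line_dir k v = (\<chi> i. if i \<in> {5, k} then 0 else v $ i - (\<Sum>j\<in>-{5, k}. v $ j) / 3)"

lemma line_dir_diff:
  "\<lbrakk>i \<notin> {5, k}; j \<notin> {5, k}\<rbrakk> \<Longrightarrow> line_dir k v $ i - line_dir k v $ j = v $ i - v $ j"
  by (simp add: line_dir_def)

lemma line_dir_add: "line_dir k (v + w) = line_dir k v + line_dir k w"
  by (simp add: line_dir_def vec_eq_iff sum.distrib add_divide_distrib)

lemma line_dir_scale: "line_dir k (a *s v) = a *s line_dir k v"
  by (simp add: line_dir_def vec_eq_iff sum_distrib_left[symmetric] algebra_simps)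

lemma line_dir_balanced:
  assumes "k \<noteq> 5"
  shows "balanced (line_dir k v)" "line_dir k v $ k = 0"
proof -
  show "line_dir k v $ k = 0" by (simp add: line_dir_def)
  obtain i j l where d: "distinct [5, k, i, j, l]" using obtain_complement[OF assms] .
  have S: "- {5, k} = {i, j, l}" using UNIV_5_distinct[OF d] d by auto
  have z: "line_dir k v $ 5 = 0" "line_dir k v $ k = 0" by (simp_all add: line_dir_def)
  have "(\<Sum>j\<in>-{5, k}. v $ j) = v $ i + v $ j + v $ l" unfolding S using d by auto
  then have L: "line_dir k v $ x = v $ x - (v $ i + v $ j + v $ l) / 3" if "x \<in> {i, j, l}" for x
    using that d by (auto simp: line_dir_def)
  have "(\<Sum>i\<in>UNIV. line_dir k v $ i) = 0"
    unfolding sum_5_distinct[OF d] z L[of i, simplified] L[of j, simplified] L[of l, simplified]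
    by (simp add: field_simps)
  with z(1) show "balanced (line_dir k v)" by (simp add: balanced_def)
qed

lemma line_dir_fixed:
  assumes "balanced m" "m $ k = 0" "k \<noteq> 5"
  shows "line_dir k m = m"
proof -
  have "(\<Sum>j\<in>UNIV. m $ j) = (\<Sum>j\<in>-{5, k}. m $ j) + (\<Sum>j\<in>{5, k}. m $ j)"
    using sum.subset_diff[of "{5, k}" UNIV "($) m"] by (simp add: Compl_eq_Diff_UNIV)
  then have "(\<Sum>j\<in>-{5, k}. m $ j) = 0" using assms unfolding balanced_def by auto
  then show ?thesis using assms by (auto simp: line_dir_def vec_eq_iff balanced_def)
qed

lemma line_dir_eq_0_iff:
  assumes "k \<noteq> 5"
  shows "line_dir k v = 0 \<longleftrightarrow> collapsed k v"
proof
  assume z: "line_dir k v = 0"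
  show "collapsed k v"
  proof (rule collapsedI[OF assms])
    fix i j assume "i \<notin> {5, k}" "j \<notin> {5, k}"
    from line_dir_diff[OF this, of v] show "v $ i = v $ j" unfolding z by simp
  qed
next
  assume c: "collapsed k v"
  have "collapsed k (line_dir k v)"
  proof (rule collapsedI[OF assms])
    fix i j assume ij: "i \<notin> {5, k}" "j \<notin> {5, k}"
    show "line_dir k v $ i = line_dir k v $ j"
      using line_dir_diff[OF ij, of v] collapsedD[OF c ij] by simp
  qed
  then show "line_dir k v = 0"
    using balanced_nonconstant_off[OF line_dir_balanced(1)[OF assms] _ line_dir_balanced(2)[OF assms] assms] by blast
qed

lemma line_dir_dP5_lift:
  assumes vm: "(v, m) \<in> dP5_lift" and k: "k \<noteq> 5"
  shows "\<exists>\<beta>. line_dir k v = \<beta> *s (m $ k) \<and> (\<beta> = 0 \<longleftrightarrow> collapsed k v)"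
proof -
  obtain \<beta> where \<beta>: "\<And>i j. \<lbrakk>i \<notin> {5, k}; j \<notin> {5, k}\<rbrakk> \<Longrightarrow> v $ i - v $ j = \<beta> * (m $ k $ i - m $ k $ j)"
    "\<beta> = 0 \<longleftrightarrow> collapsed k v" using dP5_lift_ratio[OF vm k] by blast
  let ?d = "v + (-\<beta>) *s (m $ k)"
  have "collapsed k ?d"
  proof (rule collapsedI[OF k])
    fix i j assume "i \<notin> {5, k}" "j \<notin> {5, k}"
    from \<beta>(1)[OF this] show "?d $ i = ?d $ j" by (simp add: algebra_simps)
  qed
  then have "line_dir k ?d = 0" using line_dir_eq_0_iff[OF k] by blast
  then have "line_dir k v = \<beta> *s line_dir k (m $ k)"
    unfolding line_dir_add line_dir_scale by (simp add: vec_eq_iff add_eq_0_iff2)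
  then show ?thesis using \<beta>(2) line_dir_fixed[OF dP5_liftD(4)[OF vm k] dP5_liftD(5)[OF vm k] k] by auto
qed

lemma tendsto_line_dir [tendsto_intros]:
  "(f \<longlongrightarrow> v) F \<Longrightarrow> ((\<lambda>t. line_dir k (f t)) \<longlongrightarrow> line_dir k v) F"
  unfolding line_dir_def by (auto intro!: vec_tendstoI tendsto_intros)

definition unitize :: "complex ^ 'n \<Rightarrow> complex ^ 'n" where
  "unitize v = of_real (1 / norm v) *s v"

lemma norm_unitize: "v \<noteq> 0 \<Longrightarrow> norm (unitize v) = 1"
  by (simp add: unitize_def norm_vector_scalar_mult norm_divide)

lemma unitize_unit: "norm v = 1 \<Longrightarrow> unitize v = v"
  by (simp add: unitize_def)

lemma tendsto_unitize [tendsto_intros]: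
  assumes "(f \<longlongrightarrow> v) F" "v \<noteq> 0"
  shows "((\<lambda>t. unitize (f t)) \<longlongrightarrow> unitize v) F"
  unfolding unitize_def by (intro tendsto_intros assms) (use assms in auto)

lemma balanced_scale: "balanced v \<Longrightarrow> balanced (a *s v)"
  by (simp add: balanced_def sum_distrib_left[symmetric])

lemma balanced_add: "\<lbrakk>balanced v; balanced w\<rbrakk> \<Longrightarrow> balanced (v + w)"
  by (simp add: balanced_def sum.distrib)

text \<open>Lifts a point outside the exceptional curves. Unit representatives are determined up to
  phase only; the scalars s select the phases, so that a curve of lifts can converge to a prescribed
  representative.\<close>

definition lift_of :: "(5 \<Rightarrow> complex) \<Rightarrow> complex ^ 5 \<Rightarrow> (complex ^ 5) \<times> (complex ^ 5 ^ 5)" where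
  "lift_of s c = (unitize c, \<chi> k. if k = 5 then 0 else unitize (s k *s line_dir k c))"

lemma lift_of_in_dP5_lift:
  assumes c: "balanced c" "c \<noteq> 0" and s: "\<And>k. k \<noteq> 5 \<Longrightarrow> s k *s line_dir k c \<noteq> 0"
  shows "lift_of s c \<in> dP5_lift"
  unfolding lift_of_def dP5_lift_def mem_Collect_eq case_prod_conv
proof (intro conjI allI impI)
  show "balanced (unitize c)" unfolding unitize_def by (rule balanced_scale[OF c(1)])
  show "norm (unitize c) = 1" by (rule norm_unitize[OF c(2)])
  show "(\<chi> k. if k = 5 then 0 else unitize (s k *s line_dir k c)) $ 5 = 0" by simp
  fix k :: 5 assume k: "k \<noteq> 5"
  let ?m = "(\<chi> k. if k = 5 then 0 else unitize (s k *s line_dir k c)) $ k"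
  have m: "?m = unitize (s k *s line_dir k c)" using k by simp
  show "balanced ?m" unfolding m by (simp add: unitize_def balanced_scale line_dir_balanced(1)[OF k])
  show "?m $ k = 0" unfolding m by (simp add: unitize_def line_dir_balanced(2)[OF k])
  show "norm ?m = 1" unfolding m using s[OF k] by (rule norm_unitize)
  fix i j l assume "i \<notin> {5, k} \<and> j \<notin> {5, k} \<and> l \<notin> {5, k}"
  then have e: "line_dir k c $ l - line_dir k c $ j = c $ l - c $ j"
    "line_dir k c $ i - line_dir k c $ j = c $ i - c $ j"
    using line_dir_diff[of l k j c] line_dir_diff[of i k j c] by auto
  obtain a where a: "?m = a *s line_dir k c" unfolding m by (metis unitize_def vector_smult_assoc)
  obtain b where b: "unitize c = b *s c" unfolding unitize_def by blast
  have "?m $ l - ?m $ j = a * (c $ l - c $ j)" "?m $ i - ?m $ j = a * (c $ i - c $ j)"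
    unfolding a e[symmetric] by (simp_all add: right_diff_distrib)
  moreover have "unitize c $ i - unitize c $ j = b * (c $ i - c $ j)" "unitize c $ l - unitize c $ j = b * (c $ l - c $ j)"
    unfolding b by (simp_all add: right_diff_distrib)
  ultimately show "(unitize c $ i - unitize c $ j) * (?m $ l - ?m $ j) = (unitize c $ l - unitize c $ j) * (?m $ i - ?m $ j)"
    by simp
qed

text \<open>If suitably rescaled line directions along c converge to the components of m, the lifts
  of c converge to (v, m), since \<open>unitize\<close> is continuous away from 0 and fixes unit
  vectors. The scalar r in the conclusion records that the lift rescales c.\<close>

lemma dP5_lift_approx:
  assumes vm: "(v, m) \<in> dP5_lift" and c: "(c \<longlongrightarrow> v) (at_right (0::real))"
    and bal: "\<And>t. balanced (c t)"
    and s: "\<And>k. k \<noteq> 5 \<Longrightarrow> ((\<lambda>t. s t k *s line_dir k (c t)) \<longlongrightarrow> m $ k) (at_right 0)"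
    and Q: "\<forall>\<^sub>F t in at_right 0. Q (c t)"
  shows "(v, m) \<in> closure {y \<in> dP5_lift. \<exists>c r. Q c \<and> r \<noteq> 0 \<and> fst y = r *s c}" (is "_ \<in> closure ?S")
proof -
  have "unitize v = v" using unitize_unit dP5_liftD(2)[OF vm] by blast
  then have 1: "((\<lambda>t. unitize (c t)) \<longlongrightarrow> v) (at_right 0)"
    using tendsto_unitize[OF c dP5_lift_nonzero(1)[OF vm]] by simp
  have "((\<lambda>t. (if k = 5 then 0 else unitize (s t k *s line_dir k (c t)))) \<longlongrightarrow> m $ k) (at_right 0)" for k
  proof (cases "k = 5")
    case True then show ?thesis using dP5_liftD(3)[OF vm] by simp
  next
    case False
    have "unitize (m $ k) = m $ k" using unitize_unit dP5_liftD(6)[OF vm False] by blast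
    then show ?thesis using tendsto_unitize[OF s[OF False] dP5_lift_nonzero(2)[OF vm False]] False by simp
  qed
  then have "((\<lambda>t. (\<chi> k. if k = 5 then 0 else unitize (s t k *s line_dir k (c t))) $ k) \<longlongrightarrow> m $ k) (at_right 0)" for k
    by simp
  then have "((\<lambda>t. \<chi> k. if k = 5 then 0 else unitize (s t k *s line_dir k (c t))) \<longlongrightarrow> m) (at_right 0)"
    by (rule vec_tendstoI)
  with 1 have lim: "((\<lambda>t. lift_of (s t) (c t)) \<longlongrightarrow> (v, m)) (at_right 0)"
    unfolding lift_of_def by (rule tendsto_Pair)
  have "\<forall>\<^sub>F t in at_right 0. c t \<noteq> 0"
    using tendsto_imp_eventually_ne[OF c dP5_lift_nonzero(1)[OF vm]] .
  moreover have "\<forall>\<^sub>F t in at_right 0. \<forall>k. k \<noteq> 5 \<longrightarrow> s t k *s line_dir k (c t) \<noteq> 0"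
  proof (rule eventually_all_finite)
    fix k
    show "\<forall>\<^sub>F t in at_right 0. k \<noteq> 5 \<longrightarrow> s t k *s line_dir k (c t) \<noteq> 0"
    proof (cases "k = 5")
      case False
      then show ?thesis using tendsto_imp_eventually_ne[OF s[OF False] dP5_lift_nonzero(2)[OF vm False]] by simp
    qed simp
  qed
  ultimately have "\<forall>\<^sub>F t in at_right 0. lift_of (s t) (c t) \<in> closure ?S"
    using Q
  proof eventually_elim
    case (elim t)
    have "lift_of (s t) (c t) \<in> dP5_lift"
      using lift_of_in_dP5_lift[OF bal] elim by blast
    moreover have "fst (lift_of (s t) (c t)) = of_real (1 / norm (c t)) *s c t"
      by (simp add: lift_of_def unitize_def)
    moreover have "complex_of_real (1 / norm (c t)) \<noteq> 0" using elim by simp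
    ultimately have "lift_of (s t) (c t) \<in> ?S" using elim by blast
    then show ?case by (rule closure_subset[THEN subsetD])
  qed
  then show ?thesis using lim by (intro Lim_in_closed_set[OF closed_closure]) auto
qed

text \<open>Here constant scalars suffice: \<open>line_dir k v\<close> is a nonzero multiple \<beta>
  k of \<open>m $ k\<close>, and the factor 1 / \<beta> k undoes it.\<close>

lemma dP5_lift_approx_off:
  assumes vm: "(v, m) \<in> dP5_lift" and c: "(c \<longlongrightarrow> v) (at_right (0::real))"
    and bal: "\<And>t. balanced (c t)" and nc: "\<And>q. \<not> collapsed q v"
    and Q: "\<forall>\<^sub>F t in at_right 0. Q (c t)"
  shows "(v, m) \<in> closure {y \<in> dP5_lift. \<exists>c r. Q c \<and> r \<noteq> 0 \<and> fst y = r *s c}"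
proof -
  have "\<forall>k. \<exists>\<beta>. k \<noteq> 5 \<longrightarrow> line_dir k v = \<beta> *s (m $ k) \<and> \<beta> \<noteq> 0"
    using line_dir_dP5_lift[OF vm] nc by blast
  then obtain \<beta> where \<beta>: "\<forall>k. k \<noteq> 5 \<longrightarrow> line_dir k v = \<beta> k *s (m $ k) \<and> \<beta> k \<noteq> 0"
    by (rule choice[THEN exE])
  show ?thesis
  proof (rule dP5_lift_approx[OF vm c bal _ Q])
    fix k :: 5 assume k: "k \<noteq> 5"
    have "((\<lambda>t. (1 / \<beta> k) *s line_dir k (c t)) \<longlongrightarrow> (1 / \<beta> k) *s line_dir k v) (at_right 0)"
      by (intro tendsto_intros c)
    moreover have "(1 / \<beta> k) *s line_dir k v = m $ k" using \<beta> k by auto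
    ultimately show "((\<lambda>t. (1 / \<beta> k) *s line_dir k (c t)) \<longlongrightarrow> m $ k) (at_right 0)" by simp
  qed
qed

text \<open>At a blown-up point the prescribed direction is realized by approaching v along
  \<epsilon> * h. The projection \<open>line_dir q\<close> annihilates v, so after division by
  \<epsilon> it sees h alone, which tends to \<open>m $ q\<close>.\<close>

lemma dP5_lift_approx_at:
  assumes vm: "(v, m) \<in> dP5_lift" and q: "collapsed q v"
    and \<epsilon>: "(\<epsilon> \<longlongrightarrow> 0) (at_right (0::real))" "\<forall>\<^sub>F t in at_right 0. \<epsilon> t \<noteq> 0"
    and h: "(h \<longlongrightarrow> m $ q) (at_right 0)" "\<And>t. balanced (h t)"
    and Q: "\<forall>\<^sub>F t in at_right 0. Q (v + \<epsilon> t *s h t)"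
  shows "(v, m) \<in> closure {y \<in> dP5_lift. \<exists>c r. Q c \<and> r \<noteq> 0 \<and> fst y = r *s c}"
proof -
  have q5: "q \<noteq> 5" using q by (simp add: collapsed_def)
  let ?c = "\<lambda>t. v + \<epsilon> t *s h t"
  have "(?c \<longlongrightarrow> v + 0 *s (m $ q)) (at_right 0)" by (intro tendsto_intros \<epsilon> h)
  then have c: "(?c \<longlongrightarrow> v) (at_right 0)" by simp
  have "\<forall>k. \<exists>\<beta>. k \<noteq> 5 \<and> k \<noteq> q \<longrightarrow> line_dir k v = \<beta> *s (m $ k) \<and> \<beta> \<noteq> 0"
    using line_dir_dP5_lift[OF vm] collapsed_unique[OF dP5_liftD(1)[OF vm] dP5_lift_nonzero(1)[OF vm] q] by blast
  then obtain \<beta> where \<beta>: "\<forall>k. k \<noteq> 5 \<and> k \<noteq> q \<longrightarrow> line_dir k v = \<beta> k *s (m $ k) \<and> \<beta> k \<noteq> 0"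
    by (rule choice[THEN exE])
  define s where "s t k = (if k = q then 1 / \<epsilon> t else 1 / \<beta> k)" for t k
  have bal: "balanced (?c t)" for t using dP5_liftD(1)[OF vm] h(2) by (intro balanced_add balanced_scale)
  show ?thesis
  proof (rule dP5_lift_approx[OF vm c bal _ Q])
    fix k :: 5 assume k: "k \<noteq> 5"
    show "((\<lambda>t. s t k *s line_dir k (?c t)) \<longlongrightarrow> m $ k) (at_right 0)"
    proof (cases "k = q")
      case True
      have "line_dir q v = 0" using q line_dir_eq_0_iff[OF q5] by blast
      then have "\<forall>\<^sub>F t in at_right 0. line_dir q (h t) = s t k *s line_dir k (?c t)"
        unfolding True line_dir_add line_dir_scale s_def by (intro eventually_mono[OF \<epsilon>(2)]) simp
      moreover have "((\<lambda>t. line_dir q (h t)) \<longlongrightarrow> line_dir q (m $ q)) (at_right 0)"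
        by (intro tendsto_intros h)
      then have "((\<lambda>t. line_dir q (h t)) \<longlongrightarrow> m $ q) (at_right 0)"
        using line_dir_fixed[OF dP5_liftD(4)[OF vm q5] dP5_liftD(5)[OF vm q5] q5] by simp
      ultimately show ?thesis unfolding True by (rule Lim_transform_eventually[rotated])
    next
      case False
      have "((\<lambda>t. (1 / \<beta> k) *s line_dir k (?c t)) \<longlongrightarrow> (1 / \<beta> k) *s line_dir k v) (at_right 0)"
        by (intro tendsto_intros c)
      moreover have "(1 / \<beta> k) *s line_dir k v = m $ k" using \<beta> k False by auto
      ultimately show ?thesis using False by (simp add: s_def)
    qed
  qed
qed

lemma ex_balanced_generic: "\<exists>\<xi>. balanced \<xi> \<and> generic \<xi>"
proof -
  obtain x :: "complex ^ 5" where x: "\<And>i j. i \<noteq> j \<Longrightarrow> x $ i \<noteq> x $ j"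
    using ex_injective_complex_vector by blast
  define a where "a = (x $ 1 + x $ 2 + x $ 3 + x $ 4) / 4"
  let ?\<xi> = "\<chi> i. if i = 5 then 0 else x $ i - a"
  have "4 * a = x $ 1 + x $ 2 + x $ 3 + x $ 4" by (simp add: a_def)
  then have "balanced ?\<xi>" unfolding balanced_def sum_5 by (simp add: algebra_simps)
  moreover have "generic ?\<xi>" using x unfolding generic_def by auto
  ultimately show ?thesis by blast
qed

text \<open>Perturb v by t * (w + t * \<xi>) with \<xi> generic: the quadratic term separates all
  entries. On an exceptional curve w is the direction \<open>m $ q\<close>, so that the limit has
  the right tangent; elsewhere w = 0.\<close>

lemma dP5_lift_generic_dense: "dP5_lift \<subseteq> closure {y \<in> dP5_lift. generic (fst y)}"
proof clarify
  fix v m assume vm: "(v, m) \<in> dP5_lift"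
  obtain \<xi> where \<xi>: "balanced \<xi>" "generic \<xi>" using ex_balanced_generic by blast
  have gen: "\<forall>\<^sub>F t in at_right 0. generic (v + of_real t *s (w + of_real t *s \<xi>))" for w
    unfolding generic_def
  proof (intro eventually_all_finite)
    fix i j :: 5
    let ?c = "\<lambda>t. v + of_real t *s (w + of_real t *s \<xi>)"
    have e: "?c t $ i - ?c t $ j =
      v $ i - v $ j + of_real t * (w $ i - w $ j) + (of_real t)\<^sup>2 * (\<xi> $ i - \<xi> $ j)" for t
      by (simp add: algebra_simps power2_eq_square)
    show "\<forall>\<^sub>F t in at_right 0. i \<noteq> 5 \<and> j \<noteq> 5 \<and> i \<noteq> j \<longrightarrow> ?c t $ i \<noteq> ?c t $ j"
    proof (cases "i \<noteq> 5 \<and> j \<noteq> 5 \<and> i \<noteq> j")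
      case True
      then have "\<xi> $ i - \<xi> $ j \<noteq> 0" using \<xi>(2) unfolding generic_def by auto
      then have "\<forall>\<^sub>F t in at_right 0.
          v $ i - v $ j + of_real t * (w $ i - w $ j) + (of_real t)\<^sup>2 * (\<xi> $ i - \<xi> $ j) \<noteq> 0"
        by (intro eventually_quadratic_nonzero) blast
      then show ?thesis unfolding e[symmetric] by (rule eventually_mono) simp
    qed auto
  qed
  have lim: "((\<lambda>t::real. w + of_real t *s \<xi>) \<longlongrightarrow> w) (at_right 0)" for w
  proof -
    have "((\<lambda>t::real. w + of_real t *s \<xi>) \<longlongrightarrow> w + of_real 0 *s \<xi>) (at_right 0)" by (intro tendsto_intros)
    then show ?thesis by simp
  qed
  have "(v, m) \<in> closure {y \<in> dP5_lift. \<exists>c r. generic c \<and> r \<noteq> 0 \<and> fst y = r *s c}"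
  proof (cases "\<exists>q. collapsed q v")
    case True
    then obtain q where q: "collapsed q v" by blast
    then have q5: "q \<noteq> 5" by (simp add: collapsed_def)
    have t0: "((\<lambda>t::real. complex_of_real t) \<longlongrightarrow> 0) (at_right 0)"
      using tendsto_of_real[OF tendsto_ident_at[of 0 "{0<..}"]] by simp
    have tn: "\<forall>\<^sub>F t in at_right 0. complex_of_real t \<noteq> 0"
      unfolding of_real_eq_0_iff by (simp add: eventually_at_filter)
    show ?thesis
      using dP5_lift_approx_at[OF vm q t0 tn lim _ gen[of "m $ q"]]
        balanced_add[OF dP5_liftD(4)[OF vm q5] balanced_scale[OF \<xi>(1)]] by blast
  next
    case False
    let ?c = "\<lambda>t::real. v + of_real t *s (0 + of_real t *s \<xi>)"
    have "(?c \<longlongrightarrow> v + of_real 0 *s (0 + of_real 0 *s \<xi>)) (at_right 0)" by (intro tendsto_intros)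
    then have c: "(?c \<longlongrightarrow> v) (at_right 0)" by simp
    have bal: "balanced (?c t)" for t
      using balanced_add[OF dP5_liftD(1)[OF vm] balanced_scale[OF balanced_scale[OF \<xi>(1)]]] by simp
    show ?thesis using dP5_lift_approx_off[OF vm c bal _ gen[of 0]] False by blast
  qed
  moreover have "{y \<in> dP5_lift. \<exists>c r. generic c \<and> r \<noteq> 0 \<and> fst y = r *s c} \<subseteq> {y \<in> dP5_lift. generic (fst y)}"
    by (auto simp: generic_def)
  ultimately show "(v, m) \<in> closure {y \<in> dP5_lift. generic (fst y)}"
    using closure_mono by blast
qed

section \<open>The orbit space as a quotient\<close>

text \<open>The correspondence used in place of a map. Limits of related points are again related,
  so it can be controlled on dense subsets; in b it is unique up to the torus.\<close>

definition moment_rel :: "(((real ^ 5) \<times> (complex ^ 5) \<times> (complex ^ 5 ^ 5)) \<times> (complex ^ 5) \<times> (complex ^ 5)) set" where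
  "moment_rel = {((x, y), b). y \<in> dP5_lift \<and> b \<in> stiefel \<and> (\<forall>i. weight (plucker_of b) i = x $ i) \<and>
     (\<forall>k. cross_ratio_eq k (plucker_of b) (cross_data y k))}"

lemma moment_relD:
  assumes "((x, y), b) \<in> moment_rel"
  shows "y \<in> dP5_lift" "b \<in> stiefel" "normalized (plucker_of b)" "weight (plucker_of b) i = x $ i"
    "cross_ratio_eq k (plucker_of b) (cross_data y k)"
  using assms stiefel_normalized[of "fst b" "snd b"] by (auto simp: moment_rel_def)

lemma weight_in_hypersimplex:
  assumes "normalized p"
  shows "(\<chi> i. weight p i) \<in> hypersimplex"
  using weight_nonneg[of p] weight_le_1[OF assms] normalized_sum[OF assms]
  by (simp add: hypersimplex_def)

lemma moment_rel_hypersimplex: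
  assumes "((x, y), b) \<in> moment_rel"
  shows "x \<in> hypersimplex"
proof -
  have "x = (\<chi> i. weight (plucker_of b) i)" using moment_relD(4)[OF assms] by (simp add: vec_eq_iff)
  then show ?thesis using weight_in_hypersimplex[OF moment_relD(3)[OF assms]] by simp
qed

lemma compact_hypersimplex: "compact hypersimplex"
proof -
  have "hypersimplex = cbox 0 1 \<inter> {x. (\<Sum>i\<in>UNIV. x $ i) = 2}"
    by (auto simp: hypersimplex_def mem_box_cart)
  moreover have "compact (cbox 0 1 \<inter> {x :: real ^ 5. (\<Sum>i\<in>UNIV. x $ i) = 2})"
    by (intro compact_Int_closed compact_cbox closed_Collect_eq continuous_intros)
  ultimately show ?thesis by simp
qed

lemma continuous_on_config [continuous_intros]:
  assumes "continuous_on S f"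
  shows "continuous_on S (\<lambda>x. config q (f x) i j)"
proof -
  have f: "continuous_on S (\<lambda>x. f x $ i)" for i by (intro continuous_intros assms)
  show ?thesis
    by (cases "i = q"; cases "j = q")
      (auto simp: config_simps plucker_vector_diag intro!: continuous_intros f)
qed

text \<open>All conditions are written as polynomial equations in (x, v, m, b): those for k
  different from 5 directly, the fifth by means of \<open>cross_ratio_eq_5_iff\<close>.\<close>

lemma compact_moment_rel: "compact moment_rel"
proof -
  define S where "S = {((x, v, m), b). (\<forall>i. weight (plucker_of b) i = x $ i) \<and>
     (\<forall>k a c d e. distinct [k, a, c, d, e] \<longrightarrow> k \<noteq> 5 \<longrightarrow>
        plucker_of b a c * plucker_of b d e * (config 5 (m $ k) a d * config 5 (m $ k) c e) =
        plucker_of b a d * plucker_of b c e * (config 5 (m $ k) a c * config 5 (m $ k) d e)) \<and>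
     (\<forall>k i j l. distinct [5, k, i, j, l] \<longrightarrow>
      plucker_of b i j * plucker_of b l k * ((m $ k $ l - m $ k $ i) * (v $ k - v $ j)) =
      plucker_of b i l * plucker_of b j k * ((m $ k $ j - m $ k $ i) * (v $ k - v $ l)))}"
  have "moment_rel = ((hypersimplex \<times> dP5_lift) \<times> stiefel) \<inter> S"
  proof (intro set_eqI)
    fix z :: "((real ^ 5) \<times> (complex ^ 5) \<times> (complex ^ 5 ^ 5)) \<times> (complex ^ 5) \<times> (complex ^ 5)"
    obtain x v m b where z: "z = ((x, v, m), b)" by (metis prod.exhaust)
    have "(\<forall>k. cross_ratio_eq k (plucker_of b) (cross_data (v, m) k)) \<longleftrightarrow>
        (\<forall>k. k \<noteq> 5 \<longrightarrow> cross_ratio_eq k (plucker_of b) (config 5 (m $ k))) \<and>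
        cross_ratio_eq 5 (plucker_of b) (cross_data (v, m) 5)"
      using cross_data_not_5 by metis
    then show "z \<in> moment_rel \<longleftrightarrow> z \<in> ((hypersimplex \<times> dP5_lift) \<times> stiefel) \<inter> S"
      using moment_rel_hypersimplex[of x "(v, m)" b] cross_ratio_eq_5_iff[of v m "plucker_of b"]
      unfolding z moment_rel_def S_def cross_ratio_eq_def[of k "plucker_of b" "config 5 (m $ k)" for k]
      by auto
  qed
  moreover have "closed S"
    unfolding S_def case_prod_unfold weight_def
    by (intro closed_Collect_conj closed_Collect_all closed_Collect_imp open_Collect_const
        closed_Collect_eq continuous_intros)
  moreover have "compact ((hypersimplex \<times> dP5_lift) \<times> (stiefel :: ((complex ^ 5) \<times> (complex ^ 5)) set))"
    by (intro compact_Times compact_hypersimplex compact_dP5_lift compact_stiefel)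
  ultimately show ?thesis using compact_Int_closed by metis
qed

section \<open>Relative interiors of the hypersimplex and its octahedra\<close>

definition simplex_face :: "5 set \<Rightarrow> (real ^ 5) set" where
  "simplex_face I = {x \<in> hypersimplex. \<forall>i. i \<notin> I \<longrightarrow> x $ i = 0}"

lemma hypersimplex_eq_face: "hypersimplex = simplex_face UNIV"
  by (simp add: simplex_face_def)

lemma octahedron_eq_face: "octahedron i = simplex_face (- {i})"
  by (auto simp: simplex_face_def octahedron_def)

lemma hypersimplexD:
  assumes "x \<in> hypersimplex"
  shows "0 \<le> x $ i" "x $ i \<le> 1" "(\<Sum>i\<in>UNIV. x $ i) = 2"
  using assms by (auto simp: hypersimplex_def)

lemma convex_simplex_face: "convex (simplex_face I)"
proof (rule convexI)
  fix x y :: "real ^ 5" and u w :: real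
  assume xy: "x \<in> simplex_face I" "y \<in> simplex_face I" and uw: "0 \<le> u" "0 \<le> w" "u + w = 1"
  have "0 \<le> u * x $ i + w * y $ i" "u * x $ i + w * y $ i \<le> 1" for i
    using xy uw convex_bound_le[of "x $ i" 1 "y $ i" u w] by (auto simp: simplex_face_def hypersimplex_def)
  moreover have "(\<Sum>i\<in>UNIV. u * x $ i + w * y $ i) = 2 * (u + w)"
    using xy by (simp add: sum.distrib sum_distrib_left[symmetric] simplex_face_def hypersimplex_def)
  ultimately show "u *\<^sub>R x + w *\<^sub>R y \<in> simplex_face I"
    using xy uw by (simp add: simplex_face_def hypersimplex_def)
qed

text \<open>By convexity, z is relatively interior iff every segment from a point of the face to z
  can be prolonged beyond z. Prolonging from the centre gives the strict inequalities, with
  \<open>card I > 2\<close> placing the centre coordinate 2 / card I strictly below 1. Conversely,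
  the least slack d of the coordinates of z is a possible amount of prolongation.\<close>

lemma rel_interior_simplex_face:
  assumes "card I > 2"
  shows "rel_interior (simplex_face I) = {x \<in> simplex_face I. \<forall>i\<in>I. 0 < x $ i \<and> x $ i < 1}"
proof -
  define c :: real where "c = 2 / card I"
  have c: "0 < c" "c < 1" using assms by (auto simp: c_def)
  have center: "(\<chi> i. if i \<in> I then c else 0) \<in> simplex_face I"
  proof -
    have "(\<Sum>i\<in>UNIV. if i \<in> I then c else 0) = 2"
      using assms by (auto simp: sum.If_cases c_def)
    then show ?thesis using c by (simp add: simplex_face_def hypersimplex_def less_imp_le)
  qed
  have ne: "simplex_face I \<noteq> {}" using center by auto
  show ?thesis
  proof (intro set_eqI iffI)
    fix z assume z: "z \<in> rel_interior (simplex_face I)"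
    then have zI: "z \<in> simplex_face I" using rel_interior_subset by blast
    obtain e where e: "e > 1" "(1 - e) *\<^sub>R (\<chi> i. if i \<in> I then c else 0) + e *\<^sub>R z \<in> simplex_face I"
      using z center convex_rel_interior_iff[OF convex_simplex_face ne] by blast
    have "0 < z $ i \<and> z $ i < 1" if "i \<in> I" for i
    proof -
      have b: "0 \<le> (1 - e) * c + e * z $ i" "(1 - e) * c + e * z $ i \<le> 1"
        using e(2) that hypersimplexD(1,2)[of "(1 - e) *\<^sub>R (\<chi> i. if i \<in> I then c else 0) + e *\<^sub>R z" i]
        by (auto simp: simplex_face_def)
      have "0 < (e - 1) * c" "(e - 1) * c < e - 1" using e(1) c by auto
      moreover have "(1 - e) * c = - ((e - 1) * c)" by (simp add: algebra_simps)
      ultimately have "0 < e * z $ i" "e * z $ i < e" using b by linarith+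
      then show ?thesis using e(1) by (simp add: zero_less_mult_iff)
    qed
    then show "z \<in> {x \<in> simplex_face I. \<forall>i\<in>I. 0 < x $ i \<and> x $ i < 1}" using zI by blast
  next
    fix z assume "z \<in> {x \<in> simplex_face I. \<forall>i\<in>I. 0 < x $ i \<and> x $ i < 1}"
    then have zI: "z \<in> simplex_face I" and z: "\<And>i. i \<in> I \<Longrightarrow> 0 < z $ i" "\<And>i. i \<in> I \<Longrightarrow> z $ i < 1" by auto
    define d where "d = Min (insert 1 ((\<lambda>i. min (z $ i) (1 - z $ i)) ` I))"
    have d: "d > 0" unfolding d_def using z by (subst Min_gr_iff) auto
    have dle: "d \<le> z $ i" "d \<le> 1 - z $ i" if "i \<in> I" for i
    proof -
      have "d \<le> min (z $ i) (1 - z $ i)" unfolding d_def by (rule Min_le) (use that in auto)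
      then show "d \<le> z $ i" "d \<le> 1 - z $ i" by auto
    qed
    have "\<exists>e>1. (1 - e) *\<^sub>R x + e *\<^sub>R z \<in> simplex_face I" if x: "x \<in> simplex_face I" for x
    proof (intro exI[of _ "1 + d"] conjI)
      show "1 + d > 1" using d by simp
      have xz: "0 \<le> x $ i" "x $ i \<le> 1" "0 \<le> z $ i" "z $ i \<le> 1" for i
        using x zI hypersimplexD(1,2)[of x i] hypersimplexD(1,2)[of z i] by (auto simp: simplex_face_def)
      have "0 \<le> - d * x $ i + (1 + d) * z $ i \<and> - d * x $ i + (1 + d) * z $ i \<le> 1" for i
      proof (cases "i \<in> I")
        case True
        have "d * x $ i \<le> d" "0 \<le> d * x $ i" "0 \<le> d * z $ i" "d * z $ i \<le> d"
          using d xz[of i] by (simp_all add: mult_left_le)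
        moreover have "- d * x $ i + (1 + d) * z $ i = z $ i + d * z $ i - d * x $ i"
          by (simp add: algebra_simps)
        ultimately show ?thesis using dle[OF True] by linarith
      next
        case False
        then show ?thesis using x zI by (auto simp: simplex_face_def)
      qed
      moreover have "(\<Sum>i\<in>UNIV. - d * x $ i + (1 + d) * z $ i) = 2"
      proof -
        have "(\<Sum>i\<in>UNIV. - d * x $ i + (1 + d) * z $ i) = - d * 2 + (1 + d) * 2"
          unfolding sum.distrib sum_distrib_left[symmetric]
          using x zI hypersimplexD(3)[of x] hypersimplexD(3)[of z] by (simp add: simplex_face_def)
        then show ?thesis by simp
      qed
      ultimately show "(1 - (1 + d)) *\<^sub>R x + (1 + d) *\<^sub>R z \<in> simplex_face I"
        using x zI by (simp add: simplex_face_def hypersimplex_def)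
    qed
    then show "z \<in> rel_interior (simplex_face I)"
      using convex_rel_interior_iff[OF convex_simplex_face ne] by blast
  qed
qed

lemma rel_interior_hypersimplex:
  "rel_interior hypersimplex = {x \<in> hypersimplex. \<forall>i. 0 < x $ i \<and> x $ i < 1}"
  using rel_interior_simplex_face[of UNIV] by (simp add: hypersimplex_eq_face[symmetric])

lemma rel_interior_octahedron:
  "rel_interior (octahedron k) =
    {x \<in> hypersimplex. x $ k = 0 \<and> (\<forall>i. i \<noteq> k \<longrightarrow> 0 < x $ i \<and> x $ i < 1)}"
proof -
  have "card (- {k}) = 4" by (simp add: Compl_eq_Diff_UNIV card_Diff_singleton)
  then show ?thesis
    unfolding octahedron_eq_face using rel_interior_simplex_face[of "- {k}"]
    by (auto simp: simplex_face_def)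
qed

lemma rel_frontier_hypersimplex:
  "rel_frontier hypersimplex = hypersimplex - rel_interior hypersimplex"
  by (simp add: rel_frontier_def closure_closed compact_imp_closed compact_hypersimplex)

text \<open>The image is closed by compactness, so an interior x and a generic y suffice. There all
  Pluecker coordinates of the configuration are nonzero and \<open>exists_stiefel_weight\<close>
  applies.\<close>

lemma fst_moment_rel: "fst ` moment_rel = hypersimplex \<times> dP5_lift"
proof
  show "fst ` moment_rel \<subseteq> hypersimplex \<times> dP5_lift"
    using moment_rel_hypersimplex moment_relD(1) by fastforce
  have "closed (fst ` moment_rel)"
    by (intro compact_imp_closed compact_continuous_image compact_moment_rel continuous_intros)
  moreover have "rel_interior hypersimplex \<times> {y \<in> dP5_lift. generic (fst y)} \<subseteq> fst ` moment_rel"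
  proof clarify
    fix x v m assume x: "x \<in> rel_interior hypersimplex" and vm: "(v, m) \<in> dP5_lift" "generic (fst (v, m))"
    have g: "generic v" using vm by simp
    have x': "\<And>i. 0 < x $ i" "\<And>i. x $ i < 1" "(\<Sum>i\<in>UNIV. x $ i) = 2"
      using x unfolding rel_interior_hypersimplex by (auto simp: hypersimplexD)
    obtain b where b: "b \<in> stiefel" "weight (plucker_of b) = ($) x" "torus_equiv (config 5 v) (plucker_of b)"
      using exists_stiefel_weight[OF generic_config_nonzero[OF g, unfolded config_def] x']
      unfolding config_def by blast
    have "cross_ratio_eq k (plucker_of b) (cross_data (v, m) k)" for k
      using cross_ratio_eq_torus_equiv[OF b(3) generic_cross_ratio_eq[OF vm(1) g]] .
    then have "((x, v, m), b) \<in> moment_rel" using b vm unfolding moment_rel_def by simp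
    then show "(x, v, m) \<in> fst ` moment_rel" by force
  qed
  ultimately have "closure (rel_interior hypersimplex) \<times> closure {y \<in> dP5_lift. generic (fst y)} \<subseteq> fst ` moment_rel"
    unfolding closure_Times[symmetric] by (intro closure_minimal)
  moreover have "hypersimplex \<subseteq> closure (rel_interior hypersimplex)"
    using convex_closure_rel_interior[OF convex_simplex_face, of UNIV] closure_subset
    by (simp add: hypersimplex_eq_face[symmetric])
  ultimately show "hypersimplex \<times> dP5_lift \<subseteq> fst ` moment_rel"
    using dP5_lift_generic_dense by blast
qed

text \<open>Again the image is closed, and for a frame with nonvanishing coordinates the point of
  the del Pezzo surface can be read off from the configuration of its five columns.\<close>

lemma snd_moment_rel: "snd ` moment_rel = stiefel"
proof
  show "snd ` moment_rel \<subseteq> stiefel" using moment_relD(2) by fastforce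
  have "closed (snd ` moment_rel)"
    by (intro compact_imp_closed compact_continuous_image compact_moment_rel continuous_intros)
  moreover have "{(u, w) \<in> stiefel. \<forall>i j :: 5. i \<noteq> j \<longrightarrow> plucker u w i j \<noteq> 0} \<subseteq> snd ` moment_rel"
  proof clarify
    fix u w :: "complex ^ 5" assume uw: "(u, w) \<in> stiefel" and nz: "\<forall>i j. i \<noteq> j \<longrightarrow> plucker u w i j \<noteq> 0"
    define p where "p = plucker u w"
    have pv: "plucker_vector p" unfolding p_def by simp
    have pnz: "p i j \<noteq> 0" if "i \<noteq> j" for i j using nz that unfolding p_def by blast
    \<comment> \<open>Up to translation, p 1 i / p i 5 is the affine coordinate of column i once
      column 5 is placed at infinity; subtracting the mean a balances the vector.\<close>
    define a where "a = (p 1 1 / p 1 5 + p 1 2 / p 2 5 + p 1 3 / p 3 5 + p 1 4 / p 4 5) / 4"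
    define c :: "complex ^ 5" where "c = (\<chi> i. if i = 5 then 0 else p 1 i / p i 5 - a)"
    have "4 * (z / 4) = z" for z :: complex by simp
    then have "4 * a = p 1 1 / p 1 5 + p 1 2 / p 2 5 + p 1 3 / p 3 5 + p 1 4 / p 4 5"
      unfolding a_def .
    then have bal: "balanced c" unfolding balanced_def sum_5 c_def by (simp add: algebra_simps)
    have diff: "c $ j - c $ i = p 1 5 * p i j / (p i 5 * p j 5)" if "i \<noteq> 5" "j \<noteq> 5" for i j
    proof -
      have n5: "p i 5 \<noteq> 0" "p j 5 \<noteq> 0" using pnz that by auto
      have "c $ j - c $ i = p 1 j / p j 5 - p 1 i / p i 5" using that by (simp add: c_def)
      also have "\<dots> = (p 1 j * p i 5 - p 1 i * p j 5) / (p i 5 * p j 5)"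
        using n5 by (simp add: field_simps)
      also have "p 1 j * p i 5 - p 1 i * p j 5 = p 1 5 * p i j"
        using plucker_vector_rel[OF pv, of 1 i j 5] by (simp add: algebra_simps)
      finally show ?thesis .
    qed
    have g: "generic c"
      unfolding generic_def
    proof (intro allI impI)
      fix i j :: 5 assume "i \<noteq> 5 \<and> j \<noteq> 5 \<and> i \<noteq> j"
      then have "c $ j - c $ i \<noteq> 0" using diff[of i j] pnz by simp
      then show "c $ i \<noteq> c $ j" by auto
    qed
    then have "c $ 1 \<noteq> c $ 2" unfolding generic_def by simp
    then have c0: "c \<noteq> 0" by auto
    define y where "y = lift_of (\<lambda>_. 1) c"
    have y: "y \<in> dP5_lift"
      unfolding y_def
      by (rule lift_of_in_dP5_lift[OF bal c0]) (use line_dir_eq_0_iff generic_not_collapsed[OF g] in auto)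
    obtain v m where vm: "y = (v, m)" by force
    define r where "r = complex_of_real (1 / norm c)"
    have v: "v = r *s c" using vm by (simp add: y_def lift_of_def unitize_def r_def)
    have r0: "r \<noteq> 0" using c0 by (simp add: r_def)
    have gv: "generic v" using g r0 unfolding generic_def v by simp
    \<comment> \<open>The finite entries of \<open>config 5 v\<close> are r * p 1 5 * p i j / (p i 5
      * p j 5). Scaling column i by \<gamma> * p i 5 therefore requires \<gamma> squared to be the
      inverse of r * p 1 5, and the factor 1 / \<gamma> at index 5 turns the entries 1 into p i
      5.\<close>
    define \<gamma> where "\<gamma> = csqrt (1 / (r * p 1 5))"
    have p15: "p 1 5 \<noteq> 0" using pnz by simp
    have g2: "\<gamma> * \<gamma> = 1 / (r * p 1 5)" unfolding \<gamma>_def by (metis power2_csqrt power2_eq_square)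
    have g0: "\<gamma> \<noteq> 0" using g2 r0 p15 by auto
    define t where "t i = (if i = 5 then 1 / \<gamma> else \<gamma> * p i 5)" for i
    have "torus_equiv (config 5 v) p"
      unfolding torus_equiv_def
    proof (intro exI conjI allI)
      show "t i \<noteq> 0" for i using g0 pnz unfolding t_def by auto
      show "p i j = t i * t j * config 5 v i j" for i j
      proof -
        consider "i = 5" "j = 5" | "i = 5" "j \<noteq> 5" | "i \<noteq> 5" "j = 5" | "i \<noteq> 5" "j \<noteq> 5" by blast
        then show ?thesis
        proof cases
          case 1 then show ?thesis using pv by (simp add: plucker_vector_diag)
        next
          case 2
          then show ?thesis using g0 plucker_vector_antisym[OF pv, of 5 j] by (simp add: config_simps t_def)
        next
          case 3 then show ?thesis using g0 by (simp add: config_simps t_def)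
        next
          case 4
          have n5: "p i 5 \<noteq> 0" "p j 5 \<noteq> 0" using pnz 4 by auto
          have "config 5 v i j = r * (c $ j - c $ i)" using 4 by (simp add: config_simps v algebra_simps)
          also have "\<dots> = r * (p 1 5 * p i j / (p i 5 * p j 5))" unfolding diff[OF 4] ..
          finally have "t i * t j * config 5 v i j = (\<gamma> * \<gamma>) * (r * p 1 5) * p i j"
            using 4 n5 by (simp add: t_def field_simps)
          then show ?thesis unfolding g2 using r0 p15 by simp
        qed
      qed
    qed
    then have "cross_ratio_eq k p (cross_data (v, m) k)" for k
      using cross_ratio_eq_torus_equiv generic_cross_ratio_eq[OF y[unfolded vm] gv] by blast
    then have "(((\<chi> i. weight p i), v, m), (u, w)) \<in> moment_rel"
      using uw y vm unfolding moment_rel_def p_def by simp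
    then show "(u, w) \<in> snd ` moment_rel" by force
  qed
  ultimately have "closure {(u, w) \<in> stiefel. \<forall>i j :: 5. i \<noteq> j \<longrightarrow> plucker u w i j \<noteq> 0} \<subseteq> snd ` moment_rel"
    by (intro closure_minimal)
  then show "stiefel \<subseteq> snd ` moment_rel" using stiefel_generic_dense by blast
qed

text \<open>A boundary moment has a weight 1, or at least two weights 0, or lies in the interior of
  an octahedron. Only in the last case does a cross ratio survive, namely that of the conic bundle
  belonging to the octahedron.\<close>

lemma torus_equiv_boundary:
  fixes p p' :: "5 \<Rightarrow> 5 \<Rightarrow> complex"
  assumes p: "normalized p" and p': "normalized p'" and w: "weight p = weight p'"
    and bd: "\<not> (\<forall>i. 0 < weight p i \<and> weight p i < 1)"
    and cr: "\<And>k. \<lbrakk>weight p k = 0; \<And>i. i \<noteq> k \<Longrightarrow> 0 < weight p i \<and> weight p i < 1\<rbrakk>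
      \<Longrightarrow> cross_ratio_eq k p p'"
  shows "torus_equiv p p'"
proof (cases "\<exists>i. weight p i = 1")
  case True
  then show ?thesis using torus_equiv_weight_1[OF p p' w] by blast
next
  case False
  then have lt: "weight p i < 1" for i using weight_le_1[OF p, of i] by (metis less_eq_real_def)
  then obtain k where k: "weight p k = 0"
    using bd weight_nonneg[of p] by (metis less_eq_real_def)
  show ?thesis
  proof (cases "\<exists>k'. k' \<noteq> k \<and> weight p k' = 0")
    case True
    then obtain k' where k': "k' \<noteq> k" "weight p k' = 0" by blast
    obtain a where a: "a \<notin> {k, k'}" using ex_off_3[of k k' k] by blast
    obtain b where b: "b \<notin> {k, k', a}" using ex_off_3[of k k' a] by blast
    obtain c where c: "c \<notin> {k, k', a, b}" using ex_distinct_5[of "{k, k', a, b}"] k' a b by auto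
    have "distinct [a, b, c, k, k']" using k' a b c by auto
    from torus_equiv_three_weights[OF p p' w this k k'(2) lt] show ?thesis .
  next
    case False
    then have pos: "0 < weight p i" if "i \<noteq> k" for i
      using that weight_nonneg[of p i] by (metis less_eq_real_def)
    show ?thesis using torus_equiv_four_weights[OF p p' w pos k lt cr[OF k]] pos lt by blast
  qed
qed

text \<open>Stated for two points y and y' so as to serve twice: with y = y' it shows that the orbit
  over (x, y) is well defined, and in general it provides the identifications made by the orbit
  space.\<close>

lemma moment_rel_unique:
  assumes b: "((x, y), b) \<in> moment_rel" and b': "((x, y'), b') \<in> moment_rel"
    and same: "(\<forall>k. cross_ratio_eq k (cross_data y k) (cross_data y' k)) \<or> (\<exists>m n. m \<noteq> n \<and> x $ m + x $ n \<ge> 1 \<and> on_divisor m n (cross_data y) \<and> on_divisor m n (cross_data y')) \<or>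
      (\<exists>i. x $ i = 0 \<or> x $ i = 1)"
    and bd: "\<And>k. x \<in> rel_interior (octahedron k) \<Longrightarrow> cross_ratio_eq k (cross_data y k) (cross_data y' k)"
  shows "orbit_class b = orbit_class b'"
proof -
  note B = moment_relD[OF b] and B' = moment_relD[OF b']
  have st: "stable_off k (cross_data y k)" "stable_off k (cross_data y' k)" for k
    using stable_off_cross_data[of "fst y" "snd y" k] stable_off_cross_data[of "fst y'" "snd y'" k] B(1) B'(1) by auto
  have w: "weight (plucker_of b) = weight (plucker_of b')" using B(4) B'(4) by auto
  have "torus_equiv (plucker_of b) (plucker_of b')"
  proof (cases "\<forall>i. 0 < weight (plucker_of b) i \<and> weight (plucker_of b) i < 1")
    case True
    then have int: "\<And>i. 0 < weight (plucker_of b) i" "\<And>i. weight (plucker_of b) i < 1" by auto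
    have "\<not> (\<exists>i. x $ i = 0 \<or> x $ i = 1)" using int unfolding B(4) by (metis less_irrefl)
    then consider "\<And>k. cross_ratio_eq k (cross_data y k) (cross_data y' k)" | m n where "m \<noteq> n" "weight (plucker_of b) m + weight (plucker_of b) n \<ge> 1"
      "on_divisor m n (cross_data y)" "on_divisor m n (cross_data y')"
      using same unfolding B(4) by blast
    then show ?thesis
    proof cases
      case 1
      have "cross_ratio_eq k (plucker_of b') (cross_data y k)" for k
        using cross_ratio_eq_trans[OF st(2) B'(5)] 1 cross_ratio_eq_sym by blast
      then show ?thesis using torus_equiv_interior[OF B(3) B'(3) w int st(1) B(5)] by blast
    next
      case 2
      then show ?thesis using torus_equiv_divisor[OF B(3) B'(3) w int st B(5) B'(5)] by blast
    qed
  next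
    case False
    show ?thesis
    proof (rule torus_equiv_boundary[OF B(3) B'(3) w False])
      fix k assume k: "weight (plucker_of b) k = 0"
        "\<And>i. i \<noteq> k \<Longrightarrow> 0 < weight (plucker_of b) i \<and> weight (plucker_of b) i < 1"
      then have "x \<in> rel_interior (octahedron k)"
        using moment_rel_hypersimplex[OF b] unfolding rel_interior_octahedron B(4) by blast
      then have c: "cross_ratio_eq k (cross_data y k) (cross_data y' k)" by (rule bd)
      have "cross_ratio_eq k (plucker_of b) (cross_data y' k)"
        using cross_ratio_eq_trans[OF st(1) B(5) c] .
      then show "cross_ratio_eq k (plucker_of b) (plucker_of b')"
        using cross_ratio_eq_trans[OF st(2)] B'(5) cross_ratio_eq_sym by blast
    qed
  qed
  then show ?thesis using orbit_class_eq_iff[OF B(2) B'(2)] w by blast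
qed

definition orbit_map :: "(real ^ 5) \<times> (complex ^ 5) \<times> (complex ^ 5 ^ 5) \<Rightarrow> (complex ^ 5) set set" where
  "orbit_map a = orbit_class (SOME b. (a, b) \<in> moment_rel)"

lemma cross_ratio_eq_refl: "cross_ratio_eq k p p"
  unfolding cross_ratio_eq_def by (simp add: mult_ac)

lemma orbit_map_eq:
  assumes "(a, b) \<in> moment_rel"
  shows "orbit_map a = orbit_class b"
proof -
  obtain x y where a: "a = (x, y)" by (cases a)
  have "(a, SOME b. (a, b) \<in> moment_rel) \<in> moment_rel" using assms by (rule someI)
  then show ?thesis
    unfolding orbit_map_def a using assms[unfolded a]
    by (intro moment_rel_unique[of x y _ y]) (auto simp: cross_ratio_eq_refl)
qed

text \<open>Continuity is obtained without a formula. Both projections of the compact correspondence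
  are quotient maps, and \<open>orbit_map \<circ> fst\<close> agrees on it with
  \<open>orbit_class \<circ> snd\<close>; hence \<open>orbit_map\<close> is itself a quotient
  map.\<close>

lemma quotient_map_orbit_map:
  "quotient_map (top_of_set (hypersimplex \<times> dP5_lift)) Gr25_mod_T orbit_map"
proof -
  let ?A = "top_of_set (hypersimplex \<times> dP5_lift)" and ?R = "top_of_set moment_rel"
  have fst_c: "continuous_map ?R ?A fst"
    using fst_moment_rel by (auto simp: continuous_map_in_subtopology intro!: continuous_intros)
  have comp: "compact_space ?R" by (simp add: compact_space_subtopology compact_moment_rel)
  have fst_q: "quotient_map ?R ?A fst"
    by (rule T1_Spaces.continuous_imp_quotient_map[OF fst_c comp])
      (simp_all add: Hausdorff_space_subtopology fst_moment_rel)
  have "continuous_map ?R (top_of_set stiefel) snd"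
    using snd_moment_rel by (auto simp: continuous_map_in_subtopology intro!: continuous_intros)
  then have "quotient_map ?R (top_of_set stiefel) snd"
    by (rule T1_Spaces.continuous_imp_quotient_map[OF _ comp])
      (simp_all add: Hausdorff_space_subtopology snd_moment_rel)
  then have "quotient_map ?R Gr25_mod_T (orbit_class \<circ> snd)"
    by (rule quotient_map_compose[OF _ quotient_map_orbit_class])
  moreover have "(orbit_class \<circ> snd) z = (orbit_map \<circ> fst) z" if "z \<in> topspace ?R" for z
    using that orbit_map_eq[of "fst z" "snd z"] by simp
  ultimately have "quotient_map ?R Gr25_mod_T (orbit_map \<circ> fst)"
    using quotient_map_eq by blast
  then show ?thesis using quotient_map_compose_eq[OF fst_q] by blast
qed

section \<open>The del Pezzo surface as a quotient\<close>

lemma not_pairs2: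
  assumes "(u, w) \<notin> pairs2"
  shows "\<exists>a b. (a \<noteq> 0 \<or> b \<noteq> 0) \<and> a *s u + b *s w = 0"
proof (cases "u = 0")
  case True
  then show ?thesis by (intro exI[of _ 1] exI[of _ 0]) simp
next
  case False
  then obtain i where i: "u $ i \<noteq> 0" by (auto simp: vec_eq_iff)
  have "u $ i * w $ j - u $ j * w $ i = 0" for j using assms unfolding pairs2_def plucker_def by auto
  then have "w $ i *s u + (- u $ i) *s w = 0" by (simp add: vec_eq_iff algebra_simps)
  then show ?thesis using i by (intro exI[of _ "w $ i"] exI[of _ "- u $ i"]) simp
qed

lemma pairs2I: "plucker u w i j \<noteq> 0 \<Longrightarrow> (u, w) \<in> pairs2"
  unfolding pairs2_def by blast

lemma pairs2_relation:
  assumes "(u, w) \<in> pairs2" "a *s u + b *s w = 0"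
  shows "a = 0" "b = 0"
proof -
  obtain i j where ij: "plucker u w i j \<noteq> 0" using assms(1) unfolding pairs2_def by blast
  have z: "a * u $ k + b * w $ k = 0" for k using assms(2) by (simp add: vec_eq_iff)
  have "a * plucker u w i j = (a * u $ i + b * w $ i) * w $ j - (a * u $ j + b * w $ j) * w $ i"
    "b * plucker u w i j = (a * u $ j + b * w $ j) * u $ i - (a * u $ i + b * w $ i) * u $ j"
    unfolding plucker_def by (simp_all add: algebra_simps)
  then show "a = 0" "b = 0" using ij unfolding z by auto
qed

lemma topspace_grassmannian_2:
  "topspace (grassmannian 2 :: (complex ^ 'n) set topology) = (\<lambda>(u, w). vec.span {u, w}) ` pairs2"
  by (rule quotient_imp_surjective_map[OF quotient_map_grassmannian_2, symmetric,
        unfolded topspace_euclidean_subtopology])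

lemma topspace_grassmannian_1:
  "topspace (grassmannian 1 :: (complex ^ 'n) set topology) = (\<lambda>u. vec.span {u}) ` {u. u \<noteq> 0}"
  by (rule quotient_imp_surjective_map[OF quotient_map_grassmannian_1, symmetric,
        unfolded topspace_euclidean_subtopology])

lemma grassmannian_2_through:
  assumes W: "W \<in> topspace (grassmannian 2 :: (complex ^ 'n) set topology)" and a: "a \<in> W" "a \<noteq> 0"
  obtains w where "(a, w) \<in> pairs2" "W = vec.span {a, w}"
proof -
  obtain u1 u2 where u: "(u1, u2) \<in> pairs2" "W = vec.span {u1, u2}"
    using W unfolding topspace_grassmannian_2 by auto
  obtain \<alpha> \<beta> where ab: "a = \<alpha> *s u1 + \<beta> *s u2" using a(1) unfolding u span_pair by blast
  obtain i j where ij: "plucker u1 u2 i j \<noteq> 0" using u(1) unfolding pairs2_def by blast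
  show ?thesis
  proof (cases "\<alpha> = 0")
    case False
    have pl: "plucker a u2 i j = \<alpha> * plucker u1 u2 i j" for i j
      unfolding ab plucker_def by (simp add: algebra_simps)
    have p: "(a, u2) \<in> pairs2" by (rule pairs2I[of _ _ i j]) (use pl ij False in simp)
    moreover have "W = vec.span {a, u2}"
      unfolding u(2) span_pair_eq_iff[OF u(1) p] using pl False by blast
    ultimately show ?thesis by (rule that)
  next
    case True
    then have b: "- \<beta> \<noteq> 0" using a(2) ab by auto
    have pl: "plucker a u1 i j = (- \<beta>) * plucker u1 u2 i j" for i j
      unfolding ab plucker_def using True by (simp add: algebra_simps)
    have p: "(a, u1) \<in> pairs2" by (rule pairs2I[of _ _ i j]) (use pl ij b in simp)
    moreover have "W = vec.span {a, u1}"
      unfolding u(2) span_pair_eq_iff[OF u(1) p] using pl b by blast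
    ultimately show ?thesis by (rule that)
  qed
qed

lemma span_pair_scale:
  assumes "(a, w) \<in> pairs2" "c \<noteq> 0"
  shows "(a, c *s w + b *s a) \<in> pairs2" "vec.span {a, c *s w + b *s a} = vec.span {a, w}"
proof -
  have pl: "plucker a (c *s w + b *s a) i j = c * plucker a w i j" for i j
    unfolding plucker_def by (simp add: algebra_simps)
  obtain i j where "plucker a w i j \<noteq> 0" using assms(1) unfolding pairs2_def by blast
  then show p: "(a, c *s w + b *s a) \<in> pairs2" using pl[of i j] assms(2) by (intro pairs2I[of _ _ i j]) simp
  show "vec.span {a, c *s w + b *s a} = vec.span {a, w}"
    using span_pair_eq_iff[OF assms(1) p] pl assms(2) by blast
qed

section \<open>Vectors modulo constants\<close>

definition unit_vec :: "5 \<Rightarrow> complex ^ 5" where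
  "unit_vec k = (\<chi> i. if i = k then 1 else 0)"

definition equiv_mod_const :: "complex ^ 5 \<Rightarrow> complex ^ 5 \<Rightarrow> bool" where
  "equiv_mod_const v w \<longleftrightarrow> (\<exists>c. \<forall>i. i \<noteq> 5 \<longrightarrow> v $ i = w $ i + c)"

lemma equiv_mod_const_balanced:
  assumes "equiv_mod_const v w" "balanced v" "balanced w"
  shows "v = w"
proof -
  obtain c where c: "\<And>i. i \<noteq> 5 \<Longrightarrow> v $ i = w $ i + c"
    using assms(1) unfolding equiv_mod_const_def by blast
  have "(\<Sum>i\<in>UNIV. v $ i) = (\<Sum>i\<in>UNIV. w $ i) + 4 * c"
    unfolding sum_5 using c[of 1] c[of 2] c[of 3] c[of 4] assms by (simp add: balanced_def)
  then have "c = 0" using assms by (simp add: balanced_def)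
  then have "v $ i = w $ i" for i using c[of i] assms by (cases "i = 5") (auto simp: balanced_def)
  then show ?thesis by (simp add: vec_eq_iff)
qed

lemma line_dir_cong:
  assumes "equiv_mod_const v w" "k \<noteq> 5"
  shows "line_dir k v = line_dir k w"
proof -
  obtain c where c: "\<And>i. i \<noteq> 5 \<Longrightarrow> v $ i = w $ i + c"
    using assms(1) unfolding equiv_mod_const_def by blast
  have "collapsed k (v + (- 1) *s w)"
    by (rule collapsedI[OF assms(2)]) (use c in auto)
  then have "line_dir k (v + (- 1) *s w) = 0"
    using line_dir_eq_0_iff[OF assms(2)] by blast
  then have "line_dir k v + (- 1) *s line_dir k w = 0"
    unfolding line_dir_add line_dir_scale .
  then show ?thesis by (simp add: vec_eq_iff)
qed

lemma equiv_mod_const_line_dir: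
  assumes "k \<noteq> 5"
  shows "\<exists>a. equiv_mod_const v (line_dir k v + a *s unit_vec k)"
proof -
  let ?c = "(\<Sum>j\<in>-{5, k}. v $ j) / 3"
  have "v $ i = (line_dir k v + (v $ k - ?c) *s unit_vec k) $ i + ?c" if "i \<noteq> 5" for i
    using that by (cases "i = k") (auto simp: line_dir_def unit_vec_def)
  then show ?thesis unfolding equiv_mod_const_def by blast
qed

lemma collapsed_imp_unit_vec:
  assumes "collapsed k v"
  shows "\<exists>a. equiv_mod_const v (a *s unit_vec k)"
  using equiv_mod_const_line_dir[of k v] line_dir_eq_0_iff[of k v] assms
  by (auto simp: collapsed_def)

lemma equiv_mod_const_unit_vec_imp:
  assumes "equiv_mod_const v (a *s unit_vec k)" "k \<noteq> 5"
  shows "collapsed k v"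
proof -
  obtain c where c: "\<And>i. i \<noteq> 5 \<Longrightarrow> v $ i = (a *s unit_vec k) $ i + c"
    using assms(1) unfolding equiv_mod_const_def by blast
  show ?thesis by (rule collapsedI[OF assms(2)]) (use c in \<open>auto simp: unit_vec_def\<close>)
qed

lemma span_subset_iff: "vec.span {u :: complex ^ 'n} \<subseteq> vec.span S \<longleftrightarrow> u \<in> vec.span S"
  by (meson vec.span_base vec.span_minimal vec.subspace_span empty_subsetI insert_subset singletonI subsetD)

text \<open>A projective frame. Four points, no three on a line, have representatives with sum zero
  of which any three are independent; v is then sent to the sum of the v k * a k, and this map
  \<open>J\<close> identifies the 4-space modulo constants with the 3-space, unit vectors going to
  blown-up points.\<close>

locale del_pezzo_points =
  fixes p :: "5 \<Rightarrow> (complex ^ 3) set" and a :: "5 \<Rightarrow> complex ^ 3"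
  assumes p_eq: "k \<noteq> 5 \<Longrightarrow> p k = vec.span {a k}"
    and sum_a: "a 1 + a 2 + a 3 + a 4 = 0"
    and indep_a: "x *s a 1 + y *s a 2 + z *s a 3 = 0 \<Longrightarrow> x = 0 \<and> y = 0 \<and> z = 0"
begin

definition J :: "complex ^ 5 \<Rightarrow> complex ^ 3" where
  "J v = v $ 1 *s a 1 + v $ 2 *s a 2 + v $ 3 *s a 3 + v $ 4 *s a 4"

lemma J_add: "J (v + w) = J v + J w"
  by (simp add: J_def vec_eq_iff algebra_simps)

lemma J_scale: "J (c *s v) = c *s J v"
  by (simp add: J_def vec_eq_iff algebra_simps)

lemma J_unit_vec: "k \<noteq> 5 \<Longrightarrow> J (unit_vec k) = a k"
  using exhaust_5[of k] by (auto simp: J_def unit_vec_def)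

lemma J_eq: "J v = (v $ 1 - v $ 4) *s a 1 + (v $ 2 - v $ 4) *s a 2 + (v $ 3 - v $ 4) *s a 3"
proof -
  have a4: "a 4 = - (a 1 + a 2 + a 3)" using sum_a unfolding add_eq_0_iff .
  show ?thesis unfolding J_def a4 by (simp add: vec_eq_iff algebra_simps)
qed

lemma J_eq_0_iff: "J v = 0 \<longleftrightarrow> equiv_mod_const v 0"
proof
  assume "J v = 0"
  then have "v $ 1 - v $ 4 = 0 \<and> v $ 2 - v $ 4 = 0 \<and> v $ 3 - v $ 4 = 0"
    unfolding J_eq by (rule indep_a)
  then have "v $ i = 0 $ i + v $ 4" if "i \<noteq> 5" for i using exhaust_5[of i] that by auto
  then show "equiv_mod_const v 0" unfolding equiv_mod_const_def by blast
next
  assume "equiv_mod_const v 0"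
  then obtain c where "\<And>i. i \<noteq> 5 \<Longrightarrow> v $ i = c" unfolding equiv_mod_const_def by auto
  then have "v $ 1 = c" "v $ 2 = c" "v $ 3 = c" "v $ 4 = c" by simp_all
  then show "J v = 0" unfolding J_eq by simp
qed

lemma J_eq_iff: "J v = J w \<longleftrightarrow> equiv_mod_const v w"
proof -
  have "J v = J w \<longleftrightarrow> J (v + (- 1) *s w) = 0" unfolding J_add J_scale by (simp add: vec_eq_iff)
  also have "\<dots> \<longleftrightarrow> equiv_mod_const (v + (- 1) *s w) 0" by (rule J_eq_0_iff)
  also have "\<dots> \<longleftrightarrow> equiv_mod_const v w"
    unfolding equiv_mod_const_def by (simp add: diff_eq_eq add.commute)
  finally show ?thesis .
qed

text \<open>N is the inverse of the matrix with columns a 1, a 2, a 3. It expresses differences of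
  entries of v as linear forms in \<open>J v\<close>, as needed to write conics as quadratic
  forms.\<close>

lemma coordinates:
  obtains N :: "complex ^ 3 ^ 3" where
    "\<And>v :: complex ^ 5. N *v J v = (\<chi> i. if i = 1 then v $ 1 - v $ 4 else if i = 2 then v $ 2 - v $ 4 else v $ 3 - v $ 4)"
    "\<And>x. \<exists>v. J v = x"
proof -
  define A :: "complex ^ 3 ^ 3" where
    "A = (\<chi> r s. if s = 1 then a 1 $ r else if s = 2 then a 2 $ r else a 3 $ r)"
  have A: "A *v u = u $ 1 *s a 1 + u $ 2 *s a 2 + u $ 3 *s a 3" for u
    by (simp add: A_def matrix_vector_mult_def vec_eq_iff sum_3 mult.commute)
  have "u = 0" if "A *v u = 0" for u
  proof -
    have "u $ 1 = 0 \<and> u $ 2 = 0 \<and> u $ 3 = 0" using that unfolding A by (rule indep_a)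
    then show ?thesis by (simp add: vec_eq_iff forall_3)
  qed
  then obtain N where N: "N ** A = mat 1" using matrix_left_invertible_ker[of A] by blast
  then have N': "A ** N = mat 1" using matrix_left_right_inverse by blast
  show ?thesis
  proof (rule that[of N])
    fix v :: "complex ^ 5"
    let ?u = "(\<chi> i. if i = 1 then v $ 1 - v $ 4 else if i = 2 then v $ 2 - v $ 4 else v $ 3 - v $ 4) :: complex ^ 3"
    have "J v = A *v ?u" unfolding A J_eq by simp
    then show "N *v J v = ?u" using N by (simp add: matrix_vector_mul_assoc)
  next
    fix x
    let ?u = "N *v x"
    let ?v = "(\<chi> i. if i = 1 then ?u $ 1 else if i = 2 then ?u $ 2 else if i = 3 then ?u $ 3 else 0) :: complex ^ 5"
    have "J ?v = A *v ?u" unfolding A J_eq by simp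
    also have "\<dots> = x" using N' by (simp add: matrix_vector_mul_assoc)
    finally show "\<exists>v. J v = x" by blast
  qed
qed

lemma J_surj: "\<exists>v. J v = x"
  using coordinates by metis

lemma J_surj_balanced: "\<exists>v. balanced v \<and> J v = x"
proof -
  obtain v where v: "J v = x" using J_surj by blast
  define c where "c = (v $ 1 + v $ 2 + v $ 3 + v $ 4) / 4"
  let ?v = "\<chi> i. if i = 5 then 0 else v $ i - c"
  have "4 * (z / 4) = z" for z :: complex by simp
  then have "4 * c = v $ 1 + v $ 2 + v $ 3 + v $ 4" unfolding c_def .
  then have "balanced ?v" unfolding balanced_def sum_5 by (simp add: algebra_simps)
  moreover have "J ?v = J v" unfolding J_eq_iff equiv_mod_const_def by (intro exI[of _ "- c"]) simp
  ultimately show ?thesis using v by blast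
qed

lemma J_balanced_nonzero: "\<lbrakk>balanced v; v \<noteq> 0\<rbrakk> \<Longrightarrow> J v \<noteq> 0"
  using J_eq_0_iff[of v] equiv_mod_const_balanced[of v 0] by (auto simp: balanced_def)

lemma a_nonzero: "k \<noteq> 5 \<Longrightarrow> a k \<noteq> 0"
proof
  assume k: "k \<noteq> 5" and "a k = 0"
  then have e: "equiv_mod_const (unit_vec k) 0" using J_unit_vec[OF k] J_eq_0_iff[of "unit_vec k"] by simp
  then obtain c where c: "\<And>i. i \<noteq> 5 \<Longrightarrow> unit_vec k $ i = c" unfolding equiv_mod_const_def by auto
  obtain i where "i \<notin> {5, k}" using ex_off_3[of 5 k k] by blast
  then show False using c[of i] c[OF k] by (auto simp: unit_vec_def)
qed

lemma line_pairs2: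
  assumes "k \<noteq> 5" "\<not> collapsed k m"
  shows "(a k, J m) \<in> pairs2"
proof (rule ccontr)
  assume "(a k, J m) \<notin> pairs2"
  then obtain x y where xy: "x \<noteq> 0 \<or> y \<noteq> 0" "x *s a k + y *s J m = 0" using not_pairs2 by blast
  then have e: "J (y *s m) = J ((- x) *s unit_vec k)"
    unfolding J_scale J_unit_vec[OF assms(1)] by (simp add: vec_eq_iff add_eq_0_iff)
  then have c: "collapsed k (y *s m)"
    unfolding J_eq_iff using equiv_mod_const_unit_vec_imp assms(1) by blast
  have "y = 0"
  proof (rule ccontr)
    assume "y \<noteq> 0"
    have "collapsed k m"
    proof (rule collapsedI[OF assms(1)])
      fix i j assume "i \<notin> {5, k}" "j \<notin> {5, k}"
      from collapsedD[OF c this] show "m $ i = m $ j" using \<open>y \<noteq> 0\<close> by simp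
    qed
    then show False using assms(2) by simp
  qed
  then show False using xy a_nonzero[OF assms(1)] by (auto simp: vec_eq_iff)
qed

text \<open>Modulo constants, \<open>line_dir k\<close> annihilates exactly the multiples of the
  k-th unit vector, which \<open>J\<close> sends to multiples of \<open>a k\<close>. So incidence
  with a line through \<open>p k\<close> becomes proportionality of directions.\<close>

lemma J_in_line_iff:
  assumes k: "k \<noteq> 5" and m: "line_dir k m = m"
  shows "J v \<in> vec.span {a k, J m} \<longleftrightarrow> (\<exists>b. line_dir k v = b *s m)"
proof
  assume "J v \<in> vec.span {a k, J m}"
  then obtain x y where "J v = x *s a k + y *s J m" unfolding span_pair by blast
  then have "J v = J (x *s unit_vec k + y *s m)" unfolding J_add J_scale J_unit_vec[OF k] .
  then have "line_dir k v = line_dir k (x *s unit_vec k + y *s m)"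
    unfolding J_eq_iff using line_dir_cong k by blast
  also have "\<dots> = x *s line_dir k (unit_vec k) + y *s m" unfolding line_dir_add line_dir_scale m ..
  also have "line_dir k (unit_vec k) = 0"
    unfolding line_dir_eq_0_iff[OF k] by (rule collapsedI[OF k]) (auto simp: unit_vec_def)
  finally show "\<exists>b. line_dir k v = b *s m" by auto
next
  assume "\<exists>b. line_dir k v = b *s m"
  then obtain b where b: "line_dir k v = b *s m" by blast
  obtain x where "equiv_mod_const v (b *s m + x *s unit_vec k)"
    using equiv_mod_const_line_dir[OF k, of v] unfolding b by blast
  then have "J v = J (b *s m + x *s unit_vec k)" unfolding J_eq_iff .
  then have "J v = x *s a k + b *s J m" unfolding J_add J_scale J_unit_vec[OF k] by (simp add: add.commute)
  then show "J v \<in> vec.span {a k, J m}" unfolding span_pair by blast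
qed

text \<open>Forgets the phases of the unit vectors v and \<open>m $ k\<close>; its fibres are the
  different unit representatives of one point of the surface.\<close>

definition \<rho> :: "(complex ^ 5) \<times> (complex ^ 5 ^ 5) \<Rightarrow> (complex ^ 3) set \<times> (5 \<Rightarrow> (complex ^ 3) set)" where
  "\<rho> y = (vec.span {J (fst y)}, \<lambda>k\<in>pts. vec.span {a k, J (snd y $ k)})"

lemma topspace_dP5:
  "topspace (dP5 p) = {(x, L). x \<in> topspace CP2 \<and> L \<in> (\<Pi>\<^sub>E k\<in>pts. topspace CP2_dual) \<and>
     (\<forall>k\<in>pts. p k \<subseteq> L k \<and> x \<subseteq> L k)}"
  unfolding dP5_def by auto

lemma dP5_lift_line_dir:
  assumes "(v, m) \<in> dP5_lift" "k \<noteq> 5"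
  shows "line_dir k (m $ k) = m $ k"
  using line_dir_fixed[OF dP5_liftD(4)[OF assms] dP5_liftD(5)[OF assms] assms(2)] .

lemma dP5_lift_pairs2: "\<lbrakk>(v, m) \<in> dP5_lift; k \<noteq> 5\<rbrakk> \<Longrightarrow> (a k, J (m $ k)) \<in> pairs2"
  using line_pairs2 dP5_lift_nonzero(3) by blast

lemma dP5_lift_J_nonzero: "(v, m) \<in> dP5_lift \<Longrightarrow> J v \<noteq> 0"
  using J_balanced_nonzero dP5_liftD(1) dP5_lift_nonzero(1) by blast

lemma J_in_line:
  assumes "(v, m) \<in> dP5_lift" "k \<noteq> 5"
  shows "J v \<in> vec.span {a k, J (m $ k)}"
  unfolding J_in_line_iff[OF assms(2) dP5_lift_line_dir[OF assms]]
  using line_dir_dP5_lift[OF assms] by blast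

lemma \<rho>_in_dP5:
  assumes "y \<in> dP5_lift"
  shows "\<rho> y \<in> topspace (dP5 p)"
proof -
  obtain v m where y: "y = (v, m)" by (cases y)
  note vm = assms[unfolded y]
  have "vec.span {J v} \<in> topspace CP2"
    unfolding topspace_grassmannian_1 using dP5_lift_J_nonzero[OF vm] by blast
  moreover have "vec.span {a k, J (m $ k)} \<in> topspace CP2_dual" if "k \<noteq> 5" for k
    unfolding topspace_grassmannian_2 using dP5_lift_pairs2[OF vm that] by auto
  moreover have "p k \<subseteq> vec.span {a k, J (m $ k)}" if "k \<noteq> 5" for k
    unfolding p_eq[OF that] span_subset_iff by (simp add: vec.span_base)
  moreover have "vec.span {J v} \<subseteq> vec.span {a k, J (m $ k)}" if "k \<noteq> 5" for k
    unfolding span_subset_iff using J_in_line[OF vm that] .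
  ultimately show ?thesis unfolding topspace_dP5 \<rho>_def y by (auto simp: pts_eq)
qed

lemma \<rho>_surj:
  assumes "z \<in> topspace (dP5 p)"
  shows "\<exists>y\<in>dP5_lift. \<rho> y = z"
proof -
  obtain x L where z: "z = (x, L)" by (cases z)
  have x: "x \<in> topspace CP2" and L: "L \<in> (\<Pi>\<^sub>E k\<in>pts. topspace CP2_dual)"
    and inc: "\<And>k. k \<noteq> 5 \<Longrightarrow> p k \<subseteq> L k" "\<And>k. k \<noteq> 5 \<Longrightarrow> x \<subseteq> L k"
    using assms unfolding z topspace_dP5 by (auto simp: pts_eq)
  obtain u where u: "u \<noteq> 0" "x = vec.span {u}" using x unfolding topspace_grassmannian_1 by auto
  obtain v0 where v0: "balanced v0" "J v0 = u" using J_surj_balanced by blast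
  have v00: "v0 \<noteq> 0"
  proof
    assume "v0 = 0"
    then have "J v0 = 0" by (simp add: J_def)
    then show False using v0 u by simp
  qed
  define v where "v = unitize v0"
  have v: "balanced v" "norm v = 1" "vec.span {J v} = x"
  proof -
    show "balanced v" unfolding v_def unitize_def by (rule balanced_scale[OF v0(1)])
    show n: "norm v = 1" unfolding v_def by (rule norm_unitize[OF v00])
    have "J v = of_real (1 / norm v0) *s u" unfolding v_def unitize_def J_scale v0(2) ..
    moreover have "complex_of_real (1 / norm v0) \<noteq> 0" using v00 by simp
    moreover have "v \<noteq> 0" using n by auto
    then have "J v \<noteq> 0" using J_balanced_nonzero[OF \<open>balanced v\<close>] by blast
    ultimately show "vec.span {J v} = x" using span_single_eq_iff[of u "J v"] u by auto
  qed
  have "\<exists>m. k \<noteq> 5 \<longrightarrow> line_dir k m = m \<and> norm m = 1 \<and> vec.span {a k, J m} = L k" for k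
  proof (cases "k = 5")
    case k: False
    have Lk: "L k \<in> topspace CP2_dual" using L k by (auto simp: pts_eq)
    have "a k \<in> L k" using inc(1)[OF k] unfolding p_eq[OF k] by (auto intro: vec.span_base)
    then obtain w where w: "(a k, w) \<in> pairs2" "L k = vec.span {a k, w}"
      using grassmannian_2_through[OF Lk _ a_nonzero[OF k]] by blast
    obtain w0 where w0: "J w0 = w" using J_surj by blast
    \<comment> \<open>Discarding the component of w along \<open>a k\<close> does not change the
      line and yields a balanced direction vanishing at k.\<close>
    define m0 where "m0 = line_dir k w0"
    obtain b where "equiv_mod_const w0 (m0 + b *s unit_vec k)"
      using equiv_mod_const_line_dir[OF k] unfolding m0_def by blast
    then have "J w0 = J (m0 + b *s unit_vec k)" unfolding J_eq_iff .
    then have w': "w = J m0 + b *s a k" unfolding w0 J_add J_scale J_unit_vec[OF k] .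
    have m00: "m0 \<noteq> 0"
    proof
      assume "m0 = 0"
      then have "w = b *s a k" using w' by (simp add: J_def)
      then have "b *s a k + (- 1) *s w = 0" by (simp add: vec_eq_iff)
      from pairs2_relation(2)[OF w(1) this] show False by simp
    qed
    have m0l: "line_dir k m0 = m0"
      unfolding m0_def by (rule line_dir_fixed[OF line_dir_balanced[OF k] k])
    define c where "c = complex_of_real (1 / norm m0)"
    have c: "c \<noteq> 0" using m00 by (simp add: c_def)
    have um: "unitize m0 = c *s m0" by (simp add: unitize_def c_def)
    have Ju: "J (unitize m0) = c *s w + (- (c * b)) *s a k"
      unfolding um J_scale w' by (simp add: vec_eq_iff algebra_simps)
    have "vec.span {a k, J (unitize m0)} = L k"
      unfolding Ju w(2) by (rule span_pair_scale(2)[OF w(1) c])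
    moreover have "line_dir k (unitize m0) = unitize m0" unfolding um line_dir_scale m0l ..
    ultimately show ?thesis using norm_unitize[OF m00] by blast
  qed simp
  then have "\<forall>k. \<exists>m. k \<noteq> 5 \<longrightarrow> line_dir k m = m \<and> norm m = 1 \<and> vec.span {a k, J m} = L k" by blast
  then obtain f where f: "\<forall>k. k \<noteq> 5 \<longrightarrow> line_dir k (f k) = f k \<and> norm (f k) = 1 \<and> vec.span {a k, J (f k)} = L k"
    by (rule choice[THEN exE])
  define m where "m = (\<chi> k. if k = 5 then 0 else f k)"
  have mk: "m $ k = f k" if "k \<noteq> 5" for k using that by (simp add: m_def)
  have "(v, m) \<in> dP5_lift"
    unfolding dP5_lift_def mem_Collect_eq case_prod_conv
  proof (intro conjI allI impI)
    show "balanced v" "norm v = 1" by (rule v)+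
    show "m $ 5 = 0" by (simp add: m_def)
    fix k :: 5 assume k: "k \<noteq> 5"
    have fk: "line_dir k (m $ k) = m $ k" "norm (m $ k) = 1" "vec.span {a k, J (m $ k)} = L k"
      using f k unfolding mk[OF k] by blast+
    show "norm (m $ k) = 1" by (rule fk)
    show "balanced (m $ k)" "m $ k $ k = 0" using line_dir_balanced[OF k, of "m $ k"] unfolding fk(1) .
    have "J v \<in> vec.span {a k, J (m $ k)}"
      using inc(2)[OF k] v(3) unfolding fk(3) by (metis span_subset_iff vec.span_base singletonI subsetD)
    then obtain b where b: "line_dir k v = b *s (m $ k)" unfolding J_in_line_iff[OF k fk(1)] by blast
    fix i j l assume "i \<notin> {5, k} \<and> j \<notin> {5, k} \<and> l \<notin> {5, k}"
    then have "v $ i - v $ j = line_dir k v $ i - line_dir k v $ j" "v $ l - v $ j = line_dir k v $ l - line_dir k v $ j"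
      using line_dir_diff[of i k j v] line_dir_diff[of l k j v] by auto
    then have e: "v $ i - v $ j = b * (m $ k $ i - m $ k $ j)" "v $ l - v $ j = b * (m $ k $ l - m $ k $ j)"
      unfolding b by (simp_all add: right_diff_distrib)
    show "(v $ i - v $ j) * (m $ k $ l - m $ k $ j) = (v $ l - v $ j) * (m $ k $ i - m $ k $ j)"
      unfolding e by simp
  qed
  moreover have "\<rho> (v, m) = z"
  proof -
    have "(\<lambda>k\<in>pts. vec.span {a k, J (m $ k)}) = L"
    proof
      fix k show "(\<lambda>k\<in>pts. vec.span {a k, J (m $ k)}) k = L k"
        using L f mk[of k] by (cases "k = 5") (auto simp: pts_eq PiE_def extensional_def)
    qed
    then show ?thesis unfolding \<rho>_def z using v(3) by simp
  qed
  ultimately show ?thesis by blast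
qed

lemma continuous_on_J [continuous_intros]:
  assumes "continuous_on S f"
  shows "continuous_on S (\<lambda>x. J (f x))"
  unfolding J_def vector_scalar_mult_def by (intro continuous_intros assms)

lemma continuous_map_\<rho>: "continuous_map (top_of_set dP5_lift) (dP5 p) \<rho>"
  unfolding dP5_def continuous_map_in_subtopology
proof
  have "continuous_map (top_of_set dP5_lift) CP2 (\<lambda>y. vec.span {J (fst y)})"
    by (rule continuous_map_grassmannian_1)
      (use dP5_lift_J_nonzero in \<open>auto intro!: continuous_intros\<close>)
  moreover have "continuous_map (top_of_set dP5_lift) (product_topology (\<lambda>_. CP2_dual) pts)
     (\<lambda>y. \<lambda>k\<in>pts. vec.span {a k, J (snd y $ k)})"
    unfolding continuous_map_componentwise
  proof (intro conjI ballI)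
    fix k assume k: "k \<in> pts"
    then have "continuous_map (top_of_set dP5_lift) CP2_dual (\<lambda>y. vec.span {a k, J (snd y $ k)})"
      by (intro continuous_map_grassmannian_2)
        (use dP5_lift_pairs2 in \<open>auto simp: pts_eq intro!: continuous_intros\<close>)
    then show "continuous_map (top_of_set dP5_lift) CP2_dual (\<lambda>y. (\<lambda>k\<in>pts. vec.span {a k, J (snd y $ k)}) k)"
      using k by simp
  qed auto
  ultimately show "continuous_map (top_of_set dP5_lift) (prod_topology CP2 (product_topology (\<lambda>_. CP2_dual) pts)) \<rho>"
    unfolding \<rho>_def by (rule continuous_map_pairedI)
  show "\<rho> \<in> topspace (top_of_set dP5_lift) \<rightarrow> {(x, L). \<forall>i\<in>pts. p i \<subseteq> L i \<and> x \<subseteq> L i}"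
  proof
    fix y assume "y \<in> topspace (top_of_set dP5_lift)"
    then show "\<rho> y \<in> {(x, L). \<forall>i\<in>pts. p i \<subseteq> L i \<and> x \<subseteq> L i}"
      using \<rho>_in_dP5[of y] unfolding topspace_dP5 by (simp add: case_prod_beta)
  qed
qed

lemma Hausdorff_dP5: "Hausdorff_space (dP5 p)"
  unfolding dP5_def
  by (intro Hausdorff_space_subtopology)
    (simp add: Hausdorff_space_prod_topology Hausdorff_space_product_topology
      Hausdorff_grassmannian_1 Hausdorff_grassmannian_2 del: One_nat_def)

lemma \<rho>_image: "\<rho> ` dP5_lift = topspace (dP5 p)"
  using \<rho>_in_dP5 \<rho>_surj by blast

lemma compact_space_lift: "compact_space (top_of_set dP5_lift)"
  by (simp add: compact_space_subtopology compact_dP5_lift)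

lemma closed_image_\<rho>:
  assumes "closed T" "T \<subseteq> dP5_lift"
  shows "closedin (dP5 p) (\<rho> ` T)"
proof -
  have "closedin (top_of_set dP5_lift) T" using assms by (simp add: closed_subset)
  then have "compactin (top_of_set dP5_lift) T" using compact_space_lift closedin_compact_space by blast
  then have "compactin (dP5 p) (\<rho> ` T)" using continuous_map_\<rho> image_compactin by blast
  then show ?thesis using Hausdorff_dP5 compactin_imp_closedin by blast
qed

lemma \<rho>_closure:
  assumes "y \<in> dP5_lift" "y \<in> closure S" "S \<subseteq> dP5_lift" "\<rho> ` S \<subseteq> T"
  shows "\<rho> y \<in> dP5 p closure_of T"
proof -
  have "y \<in> top_of_set dP5_lift closure_of S"
    using assms by (simp add: closure_of_subtopology Int_absorb1)
  then have "\<rho> y \<in> dP5 p closure_of (\<rho> ` S)"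
    using continuous_map_image_closure_subset[OF continuous_map_\<rho>] by blast
  then show ?thesis using closure_of_mono[OF assms(4)] by blast
qed

end

section \<open>The conic bundles\<close>

lemma grassmannian_2_eq_span:
  assumes W: "W \<in> topspace (grassmannian 2 :: (complex ^ 'n) set topology)"
    and aw: "(a, w) \<in> pairs2" "a \<in> W" "w \<in> W"
  shows "W = vec.span {a, w}"
proof -
  obtain u1 u2 where u: "(u1, u2) \<in> pairs2" "W = vec.span {u1, u2}"
    using W unfolding topspace_grassmannian_2 by auto
  obtain c where c: "\<And>i j. plucker a w i j = c * plucker u1 u2 i j"
    using plucker_span[OF aw(2,3)[unfolded u(2)]] by blast
  have "c \<noteq> 0"
  proof
    assume "c = 0"
    then have "(a, w) \<notin> pairs2" using c unfolding pairs2_def by simp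
    then show False using aw(1) by blast
  qed
  then show ?thesis unfolding u(2) span_pair_eq_iff[OF u(1) aw(1)] using c by blast
qed

lemma pairs2_distinct_spans:
  assumes "u \<noteq> 0" "w \<noteq> 0" "vec.span {u} \<noteq> vec.span {w}"
  shows "(u, w) \<in> pairs2"
proof (rule ccontr)
  assume "(u, w) \<notin> pairs2"
  then obtain x y where xy: "x \<noteq> 0 \<or> y \<noteq> 0" "x *s u + y *s w = 0" using not_pairs2 by blast
  have e: "x *s u = (- y) *s w" using xy(2) by (simp add: vec_eq_iff add_eq_0_iff2)
  have "y \<noteq> 0" using xy assms(1) by auto
  have "x \<noteq> 0" using xy assms(2) by auto
  have "w = (- x / y) *s u"
    using xy(2) \<open>y \<noteq> 0\<close> by (simp add: vec_eq_iff field_simps add_eq_0_iff2)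
  moreover have "- x / y \<noteq> 0" using \<open>x \<noteq> 0\<close> \<open>y \<noteq> 0\<close> by simp
  ultimately have "vec.span {u} = vec.span {w}" using span_single_eq_iff[OF assms(1,2)] by blast
  then show False using assms(3) by blast
qed

lemma subspace_grassmannian:
  "W \<in> topspace (grassmannian k :: (complex ^ 'n) set topology) \<Longrightarrow> vec.subspace W"
  unfolding topspace_grassmannian by simp

lemma grassmannian_2_eqI:
  assumes "W \<in> topspace (grassmannian 2 :: (complex ^ 'n) set topology)" "W' \<in> topspace (grassmannian 2)"
    and x: "x \<in> topspace (grassmannian 1)" "y \<in> topspace (grassmannian 1)" "x \<noteq> y"
    and "x \<subseteq> W" "y \<subseteq> W" "x \<subseteq> W'" "y \<subseteq> W'"
  shows "W = W'"
proof -
  obtain u w where u: "u \<noteq> 0" "x = vec.span {u}" "w \<noteq> 0" "y = vec.span {w}"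
    using x(1,2) unfolding topspace_grassmannian_1 by auto
  have p: "(u, w) \<in> pairs2" using pairs2_distinct_spans[OF u(1,3)] x(3) u by blast
  have "u \<in> x" "w \<in> y" unfolding u by (auto intro: vec.span_base)
  then show ?thesis
    using grassmannian_2_eq_span[OF assms(1) p] grassmannian_2_eq_span[OF assms(2) p] assms by blast
qed

lemma points_of_line_inject:
  assumes L: "L \<in> topspace (grassmannian 2 :: (complex ^ 'n) set topology)" and L': "L' \<in> topspace (grassmannian 2)"
    and eq: "{x \<in> topspace (grassmannian 1). x \<subseteq> L} = {x \<in> topspace (grassmannian 1). x \<subseteq> L'}"
  shows "L = L'"
proof -
  obtain u w where u: "(u, w) \<in> pairs2" "L = vec.span {u, w}"
    using L unfolding topspace_grassmannian_2 by auto
  have "u \<noteq> 0" "w \<noteq> 0" using u(1) unfolding pairs2_def plucker_def by auto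
  then have "vec.span {z} \<in> {x \<in> topspace (grassmannian 1). x \<subseteq> L}" if "z \<in> {u, w}" for z
    using that unfolding topspace_grassmannian_1 u(2)
    by (auto intro!: vec.span_mono simp del: insert_subset)
  then have "vec.span {u} \<subseteq> L'" "vec.span {w} \<subseteq> L'" unfolding eq by blast+
  then have "u \<in> L'" "w \<in> L'" by (meson vec.span_base singletonI subsetD)+
  then show ?thesis using grassmannian_2_eq_span[OF L' u(1)] u(2) by blast
qed

section \<open>Algebra of the pencil of conics\<close>

lemma torus_equiv_config_scale:
  assumes "c \<noteq> 0"
  shows "torus_equiv (config q m) (config q (c *s m))"
proof -
  define g where "g = csqrt c"
  have g2: "g * g = c" unfolding g_def by (metis power2_csqrt power2_eq_square)
  then have g0: "g \<noteq> 0" using assms by auto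
  define t where "t i = (if i = q then 1 / g else g)" for i
  have "config q (c *s m) i j = t i * t j * config q m i j" for i j
  proof -
    consider "i = q" "j = q" | "i = q" "j \<noteq> q" | "i \<noteq> q" "j = q" | "i \<noteq> q" "j \<noteq> q" by blast
    then show ?thesis
    proof cases
      case 4
      then show ?thesis by (simp add: config_simps t_def right_diff_distrib flip: g2)
    qed (use g0 in \<open>auto simp: config_simps t_def plucker_vector_diag\<close>)
  qed
  then show ?thesis unfolding torus_equiv_def using g0 by (intro exI[of _ t]) (auto simp: t_def)
qed

definition pencil_eq :: "complex \<Rightarrow> complex \<Rightarrow> (5 \<Rightarrow> 5 \<Rightarrow> complex) \<Rightarrow> bool" where
  "pencil_eq \<alpha> \<beta> C \<longleftrightarrow> \<alpha> * (C 1 3 * C 2 4) + \<beta> * (C 1 2 * C 3 4) = 0"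

text \<open>The pencil of conics through the four points, spanned by two of its three line pairs: v
  1 = v 3 is the line through p 2 and p 4, and so on. In these terms the member through a point is
  given by the cross ratio of the entries 1, 2, 3, 4.\<close>

definition conic_form :: "complex \<Rightarrow> complex \<Rightarrow> complex ^ 5 \<Rightarrow> complex" where
  "conic_form \<alpha> \<beta> v = \<alpha> * ((v $ 1 - v $ 3) * (v $ 2 - v $ 4)) + \<beta> * ((v $ 1 - v $ 2) * (v $ 3 - v $ 4))"

lemma pencil_eq_config_5: "pencil_eq \<alpha> \<beta> (config 5 v) \<longleftrightarrow> conic_form \<alpha> \<beta> v = 0"
  unfolding pencil_eq_def conic_form_def by (simp add: config_simps algebra_simps)

lemma conic_form_scale: "conic_form \<alpha> \<beta> (c *s v) = c\<^sup>2 * conic_form \<alpha> \<beta> v"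
  unfolding conic_form_def by (simp add: algebra_simps power2_eq_square)

lemma conic_form_cong: "equiv_mod_const v w \<Longrightarrow> conic_form \<alpha> \<beta> v = conic_form \<alpha> \<beta> w"
  unfolding equiv_mod_const_def conic_form_def by (auto simp: algebra_simps)

lemma stable_off_5_products:
  "stable_off 5 C \<Longrightarrow> C 1 2 * C 3 4 \<noteq> 0 \<or> C 1 3 * C 2 4 \<noteq> 0"
  by (rule stable_offD) auto

lemma pencil_eq_cong:
  assumes "stable_off 5 C'" "cross_ratio_eq 5 C C'" "pencil_eq \<alpha> \<beta> C'"
  shows "pencil_eq \<alpha> \<beta> C"
proof -
  define x y x' y' where xy: "x = C 1 2 * C 3 4" "y = C 1 3 * C 2 4" "x' = C' 1 2 * C' 3 4" "y' = C' 1 3 * C' 2 4"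
  have 1: "x * y' = y * x'" using cross_ratio_eqD[OF assms(2), of 1 2 3 4] unfolding xy by simp
  have 2: "x' \<noteq> 0 \<or> y' \<noteq> 0" using stable_off_5_products[OF assms(1)] unfolding xy .
  have 3: "\<alpha> * y' + \<beta> * x' = 0" using assms(3) unfolding pencil_eq_def xy .
  have "x' * (\<alpha> * y + \<beta> * x) = 0" "y' * (\<alpha> * y + \<beta> * x) = 0" using 1 3 by algebra+
  then have "\<alpha> * y + \<beta> * x = 0" using 2 by auto
  then show ?thesis unfolding pencil_eq_def xy .
qed

text \<open>Up to sign, all orderings of 1, 2, 3, 4 lead to three products, and the Pluecker
  relation expresses the third as the difference of the other two. So one equation implies all of
  them.\<close>

lemma cross_ratio_eq_5_single:
  assumes C: "plucker_vector C" and C': "plucker_vector C'"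
    and eq: "C 1 2 * C 3 4 * (C' 1 3 * C' 2 4) = C 1 3 * C 2 4 * (C' 1 2 * C' 3 4)"
  shows "cross_ratio_eq 5 C C'"
proof (rule cross_ratio_eq_5I[OF C C', of 4])
  define x y x' y' where xy: "x = C 1 2 * C 3 4" "y = C 1 3 * C 2 4" "x' = C' 1 2 * C' 3 4" "y' = C' 1 3 * C' 2 4"
  have e: "x * y' = y * x'" using eq unfolding xy .
  have z: "C 1 4 * C 2 3 = y - x" "C' 1 4 * C' 2 3 = y' - x'"
    using plucker_vector_rel[OF C, of 1 2 3 4] plucker_vector_rel[OF C', of 1 2 3 4]
    unfolding xy by (simp_all add: algebra_simps)
  have anti: "C 2 1 = - C 1 2" "C 3 1 = - C 1 3" "C 3 2 = - C 2 3"
    "C' 2 1 = - C' 1 2" "C' 3 1 = - C' 1 3" "C' 3 2 = - C' 2 3"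
    by (rule plucker_vector_antisym[OF C] plucker_vector_antisym[OF C'])+
  have prods: "C 1 2 * C 3 4 = x" "C 2 1 * C 3 4 = - x" "C 1 3 * C 2 4 = y" "C 3 1 * C 2 4 = - y"
    "C 2 3 * C 1 4 = y - x" "C 3 2 * C 1 4 = x - y"
    "C' 1 2 * C' 3 4 = x'" "C' 2 1 * C' 3 4 = - x'" "C' 1 3 * C' 2 4 = y'" "C' 3 1 * C' 2 4 = - y'"
    "C' 2 3 * C' 1 4 = y' - x'" "C' 3 2 * C' 1 4 = x' - y'"
    using z unfolding anti xy by (simp_all add: mult.commute)
  fix i j l :: 5 assume d: "distinct [5, 4, i, j, l]"
  have "i \<in> {1, 2, 3}" "j \<in> {1, 2, 3}" "l \<in> {1, 2, 3}"
    using d exhaust_5[of i] exhaust_5[of j] exhaust_5[of l] by auto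
  then consider "i = 1" "j = 2" "l = 3" | "i = 1" "j = 3" "l = 2" | "i = 2" "j = 1" "l = 3"
    | "i = 2" "j = 3" "l = 1" | "i = 3" "j = 1" "l = 2" | "i = 3" "j = 2" "l = 1"
    using d by auto
  then show "C i j * C l 4 * (C' i l * C' j 4) = C i l * C j 4 * (C' i j * C' l 4)"
    by cases (simp_all only: prods, (use e in \<open>simp add: algebra_simps\<close>)+)
qed simp

text \<open>Expansion of a conic at a blown-up point. The constant term vanishes because the conic
  passes through the point, and the linear term is the pencil expression of the configuration with k
  at infinity. This is why \<open>cross_data\<close> replaces the point by its tangent direction
  there.\<close>

lemma conic_form_near:
  assumes k: "k \<noteq> 5" and v: "\<And>i. i \<notin> {5, k} \<Longrightarrow> v $ i = v0"
  shows "conic_form \<alpha> \<beta> (v + \<epsilon> *s h) =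
    \<epsilon> * (v $ k - v0) * (\<alpha> * (config k h 1 3 * config k h 2 4) + \<beta> * (config k h 1 2 * config k h 3 4))
    + \<epsilon>\<^sup>2 * conic_form \<alpha> \<beta> h"
proof -
  have n: "(1::5) \<noteq> 2" "(1::5) \<noteq> 3" "(1::5) \<noteq> 4" "(2::5) \<noteq> 3" "(2::5) \<noteq> 4" "(3::5) \<noteq> 4" by simp_all
  consider "k = 1" | "k = 2" | "k = 3" | "k = 4" using exhaust_5[of k] k by auto
  then show ?thesis
  proof cases
    case 1
    then have w: "v $ 2 = v0" "v $ 3 = v0" "v $ 4 = v0" by (simp_all add: v)
    show ?thesis unfolding conic_form_def 1 using n
      by (simp add: config_simps w algebra_simps power2_eq_square)
  next
    case 2
    then have w: "v $ 1 = v0" "v $ 3 = v0" "v $ 4 = v0" by (simp_all add: v)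
    show ?thesis unfolding conic_form_def 2 using n
      by (simp add: config_simps w algebra_simps power2_eq_square)
  next
    case 3
    then have w: "v $ 1 = v0" "v $ 2 = v0" "v $ 4 = v0" by (simp_all add: v)
    show ?thesis unfolding conic_form_def 3 using n
      by (simp add: config_simps w algebra_simps power2_eq_square)
  next
    case 4
    then have w: "v $ 1 = v0" "v $ 2 = v0" "v $ 3 = v0" by (simp_all add: v)
    show ?thesis unfolding conic_form_def 4 using n
      by (simp add: config_simps w algebra_simps power2_eq_square)
  qed
qed

text \<open>The linear form cutting out the tangent at the k-th base point. It is linear in h
  because in each of the two products one factor involves k and equals 1 or -1.\<close>

definition tangent_form :: "complex \<Rightarrow> complex \<Rightarrow> 5 \<Rightarrow> complex ^ 5 \<Rightarrow> complex" where
  "tangent_form \<alpha> \<beta> k h = \<alpha> * (config k h 1 3 * config k h 2 4) + \<beta> * (config k h 1 2 * config k h 3 4)"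

lemma tangent_form_linear:
  assumes "k \<noteq> 5"
  shows "tangent_form \<alpha> \<beta> k (h + c *s w) = tangent_form \<alpha> \<beta> k h + c * tangent_form \<alpha> \<beta> k w"
proof -
  consider "k = 1" | "k = 2" | "k = 3" | "k = 4" using exhaust_5[of k] assms by auto
  then show ?thesis
    by cases (simp_all add: tangent_form_def config_simps algebra_simps)
qed

lemma tangent_form_line_dir:
  assumes "k \<noteq> 5"
  shows "tangent_form \<alpha> \<beta> k (line_dir k w) = tangent_form \<alpha> \<beta> k w"
proof -
  have "config k (line_dir k w) i j = config k w i j" if "i \<noteq> 5" "j \<noteq> 5" for i j
    using line_dir_diff[of j k i w] that
    by (cases "i = k"; cases "j = k") (auto simp: config_simps plucker_vector_diag)
  then show ?thesis unfolding tangent_form_def by simp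
qed

text \<open>All members of the pencil are smooth at the base points: two suitable unit vectors
  detect \<alpha> and \<beta> separately, and \<open>line_dir\<close> makes them balanced without
  changing the form.\<close>

lemma tangent_form_nonzero:
  assumes k: "k \<noteq> 5" and ab: "\<alpha> \<noteq> 0 \<or> \<beta> \<noteq> 0"
  shows "\<exists>w. balanced w \<and> tangent_form \<alpha> \<beta> k w \<noteq> 0"
proof (rule ccontr)
  assume "\<not> ?thesis"
  then have z: "tangent_form \<alpha> \<beta> k (unit_vec j) = 0" for j
    using tangent_form_line_dir[OF k] line_dir_balanced(1)[OF k] by metis
  consider "k = 1" | "k = 2" | "k = 3" | "k = 4" using exhaust_5[of k] k by auto
  then have "\<alpha> = 0 \<and> \<beta> = 0"
  proof cases
    case 1
    then show ?thesis using z[of 2] z[of 3] by (simp add: tangent_form_def config_simps unit_vec_def)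
  next
    case 2
    then show ?thesis using z[of 1] z[of 4] by (simp add: tangent_form_def config_simps unit_vec_def)
  next
    case 3
    then show ?thesis using z[of 4] z[of 1] by (simp add: tangent_form_def config_simps unit_vec_def)
  next
    case 4
    then show ?thesis using z[of 3] z[of 2] by (simp add: tangent_form_def config_simps unit_vec_def)
  qed
  then show False using ab by blast
qed

lemma tendsto_conic_form [tendsto_intros]:
  "(f \<longlongrightarrow> v) F \<Longrightarrow> ((\<lambda>t. conic_form \<alpha> \<beta> (f t)) \<longlongrightarrow> conic_form \<alpha> \<beta> v) F"
  unfolding conic_form_def by (intro tendsto_intros)

lemma tendsto_of_real_at_right_0: "((\<lambda>t. complex_of_real t) \<longlongrightarrow> 0) (at_right 0)"
  using tendsto_of_real[OF tendsto_ident_at[of 0 "{0<..}"]] by simp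

lemma eventually_of_real_at_right_0: "\<forall>\<^sub>F t in at_right 0. complex_of_real t \<noteq> 0"
  unfolding of_real_eq_0_iff by (simp add: eventually_at_filter)

section \<open>The bundles of lines through a blown-up point\<close>

context del_pezzo_points
begin

text \<open>Away from \<open>p k\<close> a point x determines the line joining it to
  \<open>p k\<close>, and the condition on \<open>snd z k\<close> is closed; this gives one
  inclusion. For the other, a point of the exceptional curve with direction L is the limit of points
  of L, approached along v + t * \<open>m $ k\<close>.\<close>

lemma proper_transform_line:
  assumes k: "k \<noteq> 5" and L: "L \<in> topspace CP2_dual" "p k \<subseteq> L"
  shows "proper_transform p {p k} {x \<in> topspace CP2. x \<subseteq> L} = {z \<in> topspace (dP5 p). snd z k = L}"
proof
  have pk: "p k \<in> topspace CP2"
    unfolding p_eq[OF k] topspace_grassmannian_1 using a_nonzero[OF k] by blast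
  have kp: "k \<in> pts" using k by (simp add: pts_eq)
  have "continuous_map (dP5 p) CP2_dual (\<lambda>z. snd z k)"
    unfolding dP5_def
    by (intro continuous_map_from_subtopology
        continuous_map_compose[OF continuous_map_snd continuous_map_product_projection[OF kp], unfolded o_def])
  moreover have "closedin CP2_dual {L}"
    using closedin_Hausdorff_sing_eq[OF Hausdorff_grassmannian_2] L(1) by blast
  ultimately have "closedin (dP5 p) {z \<in> topspace (dP5 p). snd z k \<in> {L}}"
    by (rule closedin_continuous_map_preimage)
  then have cl: "closedin (dP5 p) {z \<in> topspace (dP5 p). snd z k = L}" by simp
  show "proper_transform p {p k} {x \<in> topspace CP2. x \<subseteq> L} \<subseteq> {z \<in> topspace (dP5 p). snd z k = L}"
    unfolding proper_transform_def
  proof (rule closure_of_minimal[OF _ cl], rule subsetI)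
    fix z assume zS: "z \<in> {y \<in> topspace (dP5 p). fst y \<in> {x \<in> topspace CP2. x \<subseteq> L} - {p k}}"
    obtain x M where zx: "z = (x, M)" by (cases z)
    then have z: "(x, M) \<in> topspace (dP5 p)" "x \<in> topspace CP2" "x \<subseteq> L" "x \<noteq> p k"
      using zS by auto
    have M: "M k \<in> topspace CP2_dual" "p k \<subseteq> M k" "x \<subseteq> M k"
      using z(1) kp unfolding topspace_dP5 by auto
    have "M k = L"
      using grassmannian_2_eqI[OF M(1) L(1) z(2) pk z(4) M(3) M(2) z(3) L(2)] .
    then show "z \<in> {z \<in> topspace (dP5 p). snd z k = L}" using z zx by simp
  qed
  show "{z \<in> topspace (dP5 p). snd z k = L} \<subseteq> proper_transform p {p k} {x \<in> topspace CP2. x \<subseteq> L}"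
  proof (rule subsetI)
    fix z assume zL: "z \<in> {z \<in> topspace (dP5 p). snd z k = L}"
    obtain x M where zx: "z = (x, M)" by (cases z)
    then have z: "(x, M) \<in> topspace (dP5 p)" "L = snd (x, M) k" using zL by auto
    let ?S = "{y \<in> topspace (dP5 p). fst y \<in> {x \<in> topspace CP2. x \<subseteq> L} - {p k}}"
    obtain y where y: "y \<in> dP5_lift" "\<rho> y = (x, M)" using \<rho>_surj[OF z(1)] by blast
    obtain v m where "y = (v, m)" by (cases y)
    with y have vm: "(v, m) \<in> dP5_lift" "\<rho> (v, m) = (x, M)" by simp_all
    have Lk: "L = vec.span {a k, J (m $ k)}" unfolding z(2) vm(2)[symmetric] using kp by (simp add: \<rho>_def)
    have inS: "\<rho> y \<in> ?S" if y: "y \<in> dP5_lift" "J (fst y) \<in> L" "\<not> collapsed k (fst y)" for y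
    proof -
      have "fst (\<rho> y) \<noteq> p k"
      proof
        assume "fst (\<rho> y) = p k"
        then have "vec.span {J (fst y)} = vec.span {a k}" by (simp add: \<rho>_def p_eq[OF k])
        then obtain c where "J (fst y) = c *s a k"
          using span_single_eq_iff[of "a k" "J (fst y)"] a_nonzero[OF k] dP5_lift_J_nonzero[of "fst y" "snd y"] y(1) by auto
        then have "J (fst y) = J (c *s unit_vec k)" by (simp add: J_scale J_unit_vec[OF k])
        then show False using y(3) equiv_mod_const_unit_vec_imp k unfolding J_eq_iff by blast
      qed
      moreover have "fst (\<rho> y) \<subseteq> L" using y(2) unfolding \<rho>_def Lk by (simp add: span_subset_iff)
      moreover have "\<rho> y \<in> topspace (dP5 p)" using \<rho>_in_dP5[OF y(1)] .
      moreover have "fst (\<rho> y) \<in> topspace CP2"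
        using calculation(3) unfolding topspace_dP5 by (auto simp: case_prod_beta)
      ultimately show ?thesis by simp
    qed
    let ?U = "{y \<in> dP5_lift. J (fst y) \<in> L \<and> \<not> collapsed k (fst y)}"
    have "(v, m) \<in> closure ?U"
    proof (cases "collapsed k v")
      case False
      then have "(v, m) \<in> ?U" using vm(1) J_in_line[OF vm(1) k] unfolding Lk by simp
      then show ?thesis by (rule closure_subset[THEN subsetD])
    next
      case c: True
      define Q where "Q c \<longleftrightarrow> J c \<in> L \<and> \<not> collapsed k c" for c
      have Q: "Q (v + of_real t *s (m $ k))" if t: "complex_of_real t \<noteq> 0" for t
        unfolding Q_def
      proof
        have "J v \<in> L" using J_in_line[OF vm(1) k] unfolding Lk .
        moreover have "J (m $ k) \<in> L" unfolding Lk by (simp add: vec.span_base)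
        ultimately show "J (v + of_real t *s (m $ k)) \<in> L"
          unfolding J_add J_scale Lk by (intro vec.span_add vec.span_scale)
        show "\<not> collapsed k (v + of_real t *s (m $ k))"
        proof
          assume c': "collapsed k (v + of_real t *s (m $ k))"
          have "collapsed k (m $ k)"
          proof (rule collapsedI[OF k])
            fix i j assume ij: "i \<notin> {5, k}" "j \<notin> {5, k}"
            show "m $ k $ i = m $ k $ j"
              using collapsedD[OF c ij] collapsedD[OF c' ij] t by simp
          qed
          then show False using dP5_lift_nonzero(3)[OF vm(1)] by blast
        qed
      qed
      have "(v, m) \<in> closure {y \<in> dP5_lift. \<exists>c r. Q c \<and> r \<noteq> 0 \<and> fst y = r *s c}"
      proof (rule dP5_lift_approx_at[where \<epsilon> = complex_of_real and h = "\<lambda>_. m $ k", OF vm(1) c])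
        show "(complex_of_real \<longlongrightarrow> 0) (at_right 0)" by (rule tendsto_of_real_at_right_0)
        show "\<forall>\<^sub>F t in at_right 0. complex_of_real t \<noteq> 0" by (rule eventually_of_real_at_right_0)
        then show "\<forall>\<^sub>F t in at_right 0. Q (v + of_real t *s (m $ k))" by (rule eventually_mono) (rule Q)
      qed (use dP5_liftD(4)[OF vm(1) k] in auto)
      moreover have "{y \<in> dP5_lift. \<exists>c r. Q c \<and> r \<noteq> 0 \<and> fst y = r *s c} \<subseteq> ?U"
      proof clarify
        fix w n c r assume y: "(w, n) \<in> dP5_lift" "Q c" "r \<noteq> 0" "fst (w, n) = r *s c"
        have "J w \<in> L" using y unfolding Q_def Lk by (simp add: J_scale vec.span_scale)
        moreover have "\<not> collapsed k w"
        proof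
          assume cw: "collapsed k w"
          have "collapsed k c"
          proof (rule collapsedI[OF k])
            fix i j assume ij: "i \<notin> {5, k}" "j \<notin> {5, k}"
            show "c $ i = c $ j" using collapsedD[OF cw ij] y(3,4) by simp
          qed
          then show False using y(2) unfolding Q_def by blast
        qed
        ultimately show "J (fst (w, n)) \<in> L \<and> \<not> collapsed k (fst (w, n))" by simp
      qed
      ultimately show ?thesis using closure_mono by blast
    qed
    moreover have "?U \<subseteq> dP5_lift" by blast
    moreover have "\<rho> ` ?U \<subseteq> ?S"
      by (rule image_subsetI, rule inS) auto
    ultimately have "\<rho> (v, m) \<in> dP5 p closure_of ?S"
      using \<rho>_closure[OF vm(1)] by blast
    then show "z \<in> proper_transform p {p k} {x \<in> topspace CP2. x \<subseteq> L}"
      unfolding proper_transform_def vm(2) zx .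
  qed
qed

text \<open>The proper transforms are the fibres of the k-th line coordinate, so exactly one member
  of the pencil meets the description.\<close>

lemma conic_bundle_line:
  assumes k: "k \<noteq> 5" and z: "z \<in> topspace (dP5 p)"
  shows "conic_bundle p k z = {x \<in> topspace CP2. x \<subseteq> snd z k}"
proof -
  have kp: "k \<in> pts" using k by (simp add: pts_eq)
  have L: "snd z k \<in> topspace CP2_dual" "p k \<subseteq> snd z k"
    using z kp unfolding topspace_dP5 by (auto simp: case_prod_beta)
  have "conic_bundle p k z =
    (THE C. C \<in> lines_through (p k) \<and> z \<in> proper_transform p {p k} C)"
    using k by (simp add: conic_bundle_def pencil_map_def)
  also have "\<dots> = {x \<in> topspace CP2. x \<subseteq> snd z k}"
  proof (rule the_equality)
    show "{x \<in> topspace CP2. x \<subseteq> snd z k} \<in> lines_through (p k) \<and>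
      z \<in> proper_transform p {p k} {x \<in> topspace CP2. x \<subseteq> snd z k}"
      unfolding proper_transform_line[OF k L] lines_through_def using L z by blast
    fix C assume C: "C \<in> lines_through (p k) \<and> z \<in> proper_transform p {p k} C"
    then obtain L' where L': "L' \<in> topspace CP2_dual" "p k \<subseteq> L'" "C = {x \<in> topspace CP2. x \<subseteq> L'}"
      unfolding lines_through_def by blast
    show "C = {x \<in> topspace CP2. x \<subseteq> snd z k}"
      using C unfolding L'(3) proper_transform_line[OF k L'(1,2)] by simp
  qed
  finally show ?thesis .
qed

text \<open>With 5 at infinity, the cross ratio off k is the ratio of differences of entries of
  \<open>m $ k\<close>. Equality therefore means that the two directions are proportional.\<close>

lemma line_eq_iff:
  assumes vm: "(v, m) \<in> dP5_lift" and vm': "(v', m') \<in> dP5_lift" and k: "k \<noteq> 5"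
  shows "vec.span {a k, J (m $ k)} = vec.span {a k, J (m' $ k)} \<longleftrightarrow>
    cross_ratio_eq k (cross_data (v, m) k) (cross_data (v', m') k)"
proof
  assume "vec.span {a k, J (m $ k)} = vec.span {a k, J (m' $ k)}"
  then have "J (m' $ k) \<in> vec.span {a k, J (m $ k)}" by (simp add: vec.span_base)
  then obtain b where "line_dir k (m' $ k) = b *s (m $ k)"
    unfolding J_in_line_iff[OF k dP5_lift_line_dir[OF vm k]] by blast
  then have b: "m' $ k = b *s (m $ k)" unfolding dP5_lift_line_dir[OF vm' k] .
  then have "b \<noteq> 0" using dP5_lift_nonzero(2)[OF vm' k] by auto
  from torus_equiv_config_scale[OF this, of 5 "m $ k"]
  have "torus_equiv (config 5 (m $ k)) (config 5 (m' $ k))" unfolding b .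
  from cross_ratio_eq_torus_equiv[OF this cross_ratio_eq_refl]
  show "cross_ratio_eq k (cross_data (v, m) k) (cross_data (v', m') k)"
    unfolding cross_data_not_5[OF k] using cross_ratio_eq_sym by blast
next
  assume "cross_ratio_eq k (cross_data (v, m) k) (cross_data (v', m') k)"
  then have cr: "cross_ratio_eq k (config 5 (m $ k)) (config 5 (m' $ k))" unfolding cross_data_not_5[OF k] .
  have eq: "(m' $ k $ i - m' $ k $ j) * (m $ k $ l - m $ k $ j) = (m' $ k $ l - m' $ k $ j) * (m $ k $ i - m $ k $ j)"
    if ijl: "i \<notin> {5, k}" "j \<notin> {5, k}" "l \<notin> {5, k}" for i j l
  proof (cases "i = j \<or> i = l \<or> j = l")
    case False
    then have "distinct [k, j, i, l, 5]" using ijl k by auto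
    from cross_ratio_eqD[OF cr this] show ?thesis
      using ijl by (simp add: config_simps mult.commute)
  qed auto
  obtain \<beta> where \<beta>: "\<And>i j. \<lbrakk>i \<notin> {5, k}; j \<notin> {5, k}\<rbrakk> \<Longrightarrow> m' $ k $ i - m' $ k $ j = \<beta> * (m $ k $ i - m $ k $ j)"
    "\<beta> = 0 \<longleftrightarrow> collapsed k (m' $ k)"
    using proportional_off[OF dP5_lift_nonzero(3)[OF vm] k eq] by blast
  have "collapsed k (m' $ k + (- \<beta>) *s (m $ k))"
  proof (rule collapsedI[OF k])
    fix i j assume "i \<notin> {5, k}" "j \<notin> {5, k}"
    from \<beta>(1)[OF this] show "(m' $ k + (- \<beta>) *s (m $ k)) $ i = (m' $ k + (- \<beta>) *s (m $ k)) $ j"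
      by (simp add: algebra_simps)
  qed
  then have "line_dir k (m' $ k + (- \<beta>) *s (m $ k)) = 0" using line_dir_eq_0_iff[OF k] by blast
  then have b: "m' $ k = \<beta> *s (m $ k)"
    unfolding line_dir_add line_dir_scale dP5_lift_line_dir[OF vm k] dP5_lift_line_dir[OF vm' k]
    by (simp add: vec_eq_iff add_eq_0_iff2)
  then have "\<beta> \<noteq> 0" using dP5_lift_nonzero(2)[OF vm' k] by auto
  from span_pair_scale(2)[OF dP5_lift_pairs2[OF vm k] this, of 0]
  show "vec.span {a k, J (m $ k)} = vec.span {a k, J (m' $ k)}" unfolding b J_scale by simp
qed

lemma conic_bundle_eq_iff_line:
  assumes y: "y \<in> dP5_lift" "y' \<in> dP5_lift" and k: "k \<noteq> 5"
  shows "conic_bundle p k (\<rho> y) = conic_bundle p k (\<rho> y') \<longleftrightarrow>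
    cross_ratio_eq k (cross_data y k) (cross_data y' k)"
proof -
  obtain v m v' m' where vm: "y = (v, m)" "y' = (v', m')" by (metis prod.exhaust)
  have kp: "k \<in> pts" using k by (simp add: pts_eq)
  have L: "snd (\<rho> y) k \<in> topspace CP2_dual" "snd (\<rho> y') k \<in> topspace CP2_dual"
    using \<rho>_in_dP5[OF y(1)] \<rho>_in_dP5[OF y(2)] kp unfolding topspace_dP5 by (auto simp: case_prod_beta)
  have "conic_bundle p k (\<rho> y) = conic_bundle p k (\<rho> y') \<longleftrightarrow> snd (\<rho> y) k = snd (\<rho> y') k"
    unfolding conic_bundle_line[OF k \<rho>_in_dP5[OF y(1)]] conic_bundle_line[OF k \<rho>_in_dP5[OF y(2)]]
    using points_of_line_inject[OF L] by auto
  also have "\<dots> \<longleftrightarrow> vec.span {a k, J (m $ k)} = vec.span {a k, J (m' $ k)}"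
    using kp by (simp add: \<rho>_def vm)
  also have "\<dots> \<longleftrightarrow> cross_ratio_eq k (cross_data y k) (cross_data y' k)"
    using line_eq_iff[of v m v' m' k] y k unfolding vm by blast
  finally show ?thesis .
qed

end

section \<open>The bundle of conics through the blown-up points\<close>

context del_pezzo_points
begin

definition conic :: "complex \<Rightarrow> complex \<Rightarrow> (complex ^ 3) set set" where
  "conic \<alpha> \<beta> = {x \<in> topspace CP2. \<forall>w. J w \<in> x \<longrightarrow> conic_form \<alpha> \<beta> w = 0}"

lemma span_in_conic_iff:
  assumes "J v \<noteq> 0"
  shows "vec.span {J v} \<in> conic \<alpha> \<beta> \<longleftrightarrow> conic_form \<alpha> \<beta> v = 0"
proof
  assume "vec.span {J v} \<in> conic \<alpha> \<beta>"
  then show "conic_form \<alpha> \<beta> v = 0" unfolding conic_def by (simp add: vec.span_base)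
next
  assume z: "conic_form \<alpha> \<beta> v = 0"
  have "conic_form \<alpha> \<beta> w = 0" if w: "J w \<in> vec.span {J v}" for w
  proof -
    obtain c where "J w = c *s J v" using w by (auto simp: vec.span_singleton)
    then have "J w = J (c *s v)" by (simp add: J_scale)
    then have "conic_form \<alpha> \<beta> w = conic_form \<alpha> \<beta> (c *s v)"
      unfolding J_eq_iff by (rule conic_form_cong)
    then show ?thesis using z by (simp add: conic_form_scale)
  qed
  moreover have "vec.span {J v} \<in> topspace CP2"
    unfolding topspace_grassmannian_1 using assms by blast
  ultimately show "vec.span {J v} \<in> conic \<alpha> \<beta>" unfolding conic_def by blast
qed

lemma conic_form_unit_vec: "k \<noteq> 5 \<Longrightarrow> conic_form \<alpha> \<beta> (unit_vec k) = 0"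
  using exhaust_5[of k] by (auto simp: conic_form_def unit_vec_def)

lemma conic_nontrivial:
  assumes "\<And>w. conic_form \<alpha> \<beta> w = 0"
  shows "\<alpha> = 0 \<and> \<beta> = 0"
  using assms[of "unit_vec 1 + unit_vec 2"] assms[of "unit_vec 1 + unit_vec 3"]
  by (simp add: conic_form_def unit_vec_def)

lemma conic_scale:
  assumes "c \<noteq> 0"
  shows "conic (c * \<alpha>) (c * \<beta>) = conic \<alpha> \<beta>"
proof -
  have "conic_form (c * \<alpha>) (c * \<beta>) w = c * conic_form \<alpha> \<beta> w" for w
    unfolding conic_form_def by (simp add: algebra_simps)
  then show ?thesis unfolding conic_def using assms by simp
qed

lemma zero_set_eq_conic:
  assumes "\<And>w. q (J w) = conic_form \<alpha> \<beta> w"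
  shows "{x \<in> topspace CP2. \<forall>v\<in>x. q v = 0} = conic \<alpha> \<beta>"
proof -
  have "(\<forall>v\<in>x. q v = 0) \<longleftrightarrow> (\<forall>w. J w \<in> x \<longrightarrow> conic_form \<alpha> \<beta> w = 0)" for x
    using assms J_surj by metis
  then show ?thesis unfolding conic_def by simp
qed

lemma conic_in_conics_through:
  assumes ab: "\<alpha> \<noteq> 0 \<or> \<beta> \<noteq> 0"
  shows "conic \<alpha> \<beta> \<in> conics_through (p ` pts)"
proof -
  obtain N :: "complex ^ 3 ^ 3" where N:
    "\<And>v. N *v J v = (\<chi> i. if i = 1 then v $ 1 - v $ 4 else if i = 2 then v $ 2 - v $ 4 else v $ 3 - v $ 4)"
    "\<And>x. \<exists>v. J v = x"
    by (rule coordinates) blast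
  \<comment> \<open>The linear forms that evaluate on \<open>J v\<close> to v 1 - v 3, v 2 - v 4, v
    1 - v 2 and v 3 - v 4, the four lines making up the two basic line pairs. The matrix A
    symmetrizes their products.\<close>
  define f g h l where "f = N $ 1 - N $ 3" and "g = N $ 2" and "h = N $ 1 - N $ 2" and "l = N $ 3"
  define A :: "complex ^ 3 ^ 3" where
    "A = (\<chi> i j. (\<alpha> * (f $ i * g $ j + f $ j * g $ i) + \<beta> * (h $ i * l $ j + h $ j * l $ i)) / 2)"
  let ?q = "\<lambda>v. \<Sum>i\<in>UNIV. \<Sum>j\<in>UNIV. A $ i $ j * v $ i * v $ j"
  have sym: "transpose A = A" by (simp add: A_def transpose_def vec_eq_iff algebra_simps)
  have prod: "(\<Sum>i\<in>UNIV. \<Sum>j\<in>UNIV. (x $ i * y $ j) * (v $ i * v $ j)) =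
    (\<Sum>i\<in>UNIV. x $ i * v $ i) * (\<Sum>j\<in>UNIV. y $ j * v $ j)" for x y v :: "complex ^ 3"
    unfolding sum_product by (simp add: mult_ac)
  have q: "?q v = \<alpha> * ((\<Sum>i\<in>UNIV. f $ i * v $ i) * (\<Sum>j\<in>UNIV. g $ j * v $ j))
      + \<beta> * ((\<Sum>i\<in>UNIV. h $ i * v $ i) * (\<Sum>j\<in>UNIV. l $ j * v $ j))" for v
  proof -
    have "A $ i $ j * v $ i * v $ j = \<alpha> / 2 * ((f $ i * g $ j) * (v $ i * v $ j)) + \<alpha> / 2 * ((g $ i * f $ j) * (v $ i * v $ j))
      + \<beta> / 2 * ((h $ i * l $ j) * (v $ i * v $ j)) + \<beta> / 2 * ((l $ i * h $ j) * (v $ i * v $ j))" for i j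
      by (simp add: A_def field_simps)
    then have "?q v = \<alpha> / 2 * (\<Sum>i\<in>UNIV. \<Sum>j\<in>UNIV. (f $ i * g $ j) * (v $ i * v $ j))
      + \<alpha> / 2 * (\<Sum>i\<in>UNIV. \<Sum>j\<in>UNIV. (g $ i * f $ j) * (v $ i * v $ j))
      + \<beta> / 2 * (\<Sum>i\<in>UNIV. \<Sum>j\<in>UNIV. (h $ i * l $ j) * (v $ i * v $ j))
      + \<beta> / 2 * (\<Sum>i\<in>UNIV. \<Sum>j\<in>UNIV. (l $ i * h $ j) * (v $ i * v $ j))"
      by (simp only: sum.distrib sum_distrib_left)
    moreover have "s / 2 * (w * x) + s / 2 * (x * w) + t / 2 * (y * z) + t / 2 * (z * y) = s * (w * x) + t * (y * z)"
      for s t w x y z :: complex by (simp add: field_simps)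
    ultimately show ?thesis unfolding prod by simp
  qed
  have qJ: "?q (J w) = conic_form \<alpha> \<beta> w" for w
  proof -
    have e: "(\<Sum>j\<in>UNIV. N $ i $ j * J w $ j) = (N *v J w) $ i" for i
      by (simp add: matrix_vector_mult_def)
    have "(\<Sum>i\<in>UNIV. f $ i * J w $ i) = w $ 1 - w $ 3" "(\<Sum>i\<in>UNIV. g $ i * J w $ i) = w $ 2 - w $ 4"
      "(\<Sum>i\<in>UNIV. h $ i * J w $ i) = w $ 1 - w $ 2" "(\<Sum>i\<in>UNIV. l $ i * J w $ i) = w $ 3 - w $ 4"
      unfolding f_def g_def h_def l_def
      by (simp_all add: left_diff_distrib sum_subtractf e N)
    then show ?thesis unfolding q conic_form_def by simp
  qed
  have "A \<noteq> 0"
  proof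
    assume "A = 0"
    then have "conic_form \<alpha> \<beta> w = 0" for w using qJ[of w] by simp
    then show False using conic_nontrivial[of \<alpha> \<beta>] ab by blast
  qed
  moreover have "p ` pts \<subseteq> conic \<alpha> \<beta>"
  proof clarify
    fix k assume "k \<in> pts"
    then have k: "k \<noteq> 5" by (simp add: pts_eq)
    have "J (unit_vec k) \<noteq> 0" using J_unit_vec[OF k] a_nonzero[OF k] by simp
    from span_in_conic_iff[OF this] show "p k \<in> conic \<alpha> \<beta>"
      using conic_form_unit_vec[OF k] by (simp add: J_unit_vec[OF k] p_eq[OF k])
  qed
  ultimately show ?thesis
    unfolding conics_through_def mem_Collect_eq
    by (intro conjI exI[of _ A] sym zero_set_eq_conic[of ?q, OF qJ, symmetric])
qed

text \<open>In the basis a 1, a 2, a 3 the bilinear form has zero diagonal because the conic passes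
  through these points. Vanishing at a 4, which is minus their sum, imposes b12 + b13 + b23 = 0; two
  parameters remain.\<close>

lemma conics_through_imp_conic:
  assumes C: "C \<in> conics_through (p ` pts)"
  shows "\<exists>\<alpha> \<beta>. (\<alpha> \<noteq> 0 \<or> \<beta> \<noteq> 0) \<and> C = conic \<alpha> \<beta>"
proof -
  obtain A :: "complex ^ 3 ^ 3" where A: "A \<noteq> 0" "transpose A = A" "p ` pts \<subseteq> C"
    and CA: "C = {x \<in> topspace CP2. \<forall>v\<in>x. (\<Sum>i\<in>UNIV. \<Sum>j\<in>UNIV. A $ i $ j * v $ i * v $ j) = 0}"
    using C unfolding conics_through_def by blast
  define B where "B x y = (\<Sum>i\<in>UNIV. \<Sum>j\<in>UNIV. A $ i $ j * x $ i * y $ j)" for x y :: "complex ^ 3"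
  have As: "A $ i $ j = A $ j $ i" for i j
  proof -
    have "transpose A $ i $ j = A $ j $ i" by (simp add: transpose_def)
    then show ?thesis unfolding A(2) .
  qed
  have Bs: "B x y = B y x" for x y
    unfolding B_def by (subst sum.swap) (simp add: As mult_ac)
  have Badd: "B (x + y) z = B x z + B y z" and Bsc: "B (c *s x) z = c * B x z" for x y z c
    unfolding B_def by (simp_all add: algebra_simps sum.distrib sum_distrib_left)
  have Badd': "B z (x + y) = B z x + B z y" and Bsc': "B z (c *s x) = c * B z x" for x y z c
    using Badd Bsc Bs by metis+
  have a0: "B (a k) (a k) = 0" if "k \<noteq> 5" for k
  proof -
    have "p k \<in> C" using A(3) that by (auto simp: pts_eq)
    then show ?thesis unfolding CA p_eq[OF that] B_def by (simp add: vec.span_base)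
  qed
  have a123: "B (a 1) (a 1) = 0" "B (a 2) (a 2) = 0" "B (a 3) (a 3) = 0" by (rule a0, simp)+
  define b12 b13 b23 where b: "b12 = B (a 1) (a 2)" "b13 = B (a 1) (a 3)" "b23 = B (a 2) (a 3)"
  have comb: "B (x *s a 1 + y *s a 2 + z *s a 3) (x *s a 1 + y *s a 2 + z *s a 3) =
      2 * (x * y * b12 + x * z * b13 + y * z * b23)" for x y z
    unfolding Badd Badd' Bsc Bsc' a123 Bs[of "a 2" "a 1"] Bs[of "a 3" "a 1"] Bs[of "a 3" "a 2"] b
    by (simp add: algebra_simps)
  have "a 4 = (- 1) *s a 1 + (- 1) *s a 2 + (- 1) *s a 3"
    using sum_a by (simp add: add_eq_0_iff vec_eq_iff algebra_simps)
  then have "B (a 4) (a 4) = 2 * (b12 + b13 + b23)" using comb[of "-1" "-1" "-1"] by simp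
  moreover have "B (a 4) (a 4) = 0" by (rule a0) simp
  ultimately have "b12 + b13 + b23 = 0" by (metis mult_eq_0_iff zero_neq_numeral)
  then have b23: "b23 = - b12 - b13" by (simp add: add_eq_0_iff)
  have BJ: "B (J w) (J w) = conic_form (2 * b12) (2 * b13) w" for w
    unfolding J_eq comb conic_form_def b23 by (simp add: algebra_simps)
  have "2 * b12 \<noteq> 0 \<or> 2 * b13 \<noteq> 0"
  proof (rule ccontr)
    assume "\<not> ?thesis"
    then have "B (J w) (J w) = 0" for w unfolding BJ by (simp add: conic_form_def)
    then have z: "B x x = 0" for x using J_surj by metis
    have "B x y = 0" for x y
    proof -
      have "B (x + y) (x + y) = B x x + B y y + 2 * B x y"
        unfolding Badd Badd' Bs[of y x] by simp
      then show ?thesis using z by simp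
    qed
    moreover have "B (axis i 1) (axis j 1) = A $ i $ j" for i j
    proof -
      have "A $ r $ s * axis i 1 $ r * axis j 1 $ s = (if s = j then (if r = i then A $ r $ s else 0) else 0)" for r s
        by (simp add: axis_def)
      then show ?thesis unfolding B_def by simp
    qed
    ultimately have "A = 0" by (simp add: vec_eq_iff)
    then show False using A(1) by blast
  qed
  moreover have "C = conic (2 * b12) (2 * b13)"
    unfolding CA using zero_set_eq_conic[of "\<lambda>v. B v v", OF BJ] unfolding B_def .
  ultimately show ?thesis by blast
qed

lemma \<rho>_not_base_point_iff:
  assumes "y \<in> dP5_lift"
  shows "fst (\<rho> y) \<notin> p ` pts \<longleftrightarrow> (\<forall>q. \<not> collapsed q (fst y))"
proof -
  have J0: "J (fst y) \<noteq> 0" using dP5_lift_J_nonzero[of "fst y" "snd y"] assms by simp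
  have "vec.span {J (fst y)} = p q \<longleftrightarrow> collapsed q (fst y)" if q: "q \<noteq> 5" for q
  proof
    assume "vec.span {J (fst y)} = p q"
    then obtain c where "J (fst y) = c *s a q"
      using span_single_eq_iff[OF a_nonzero[OF q] J0] unfolding p_eq[OF q] by auto
    then have "J (fst y) = J (c *s unit_vec q)" by (simp add: J_scale J_unit_vec[OF q])
    then show "collapsed q (fst y)" using equiv_mod_const_unit_vec_imp q unfolding J_eq_iff by blast
  next
    assume "collapsed q (fst y)"
    then obtain c where "equiv_mod_const (fst y) (c *s unit_vec q)" using collapsed_imp_unit_vec by blast
    then have e: "J (fst y) = c *s a q" unfolding J_eq_iff[symmetric] by (simp add: J_scale J_unit_vec[OF q])
    then have "c \<noteq> 0" using J0 by auto
    then show "vec.span {J (fst y)} = p q"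
      unfolding p_eq[OF q] using span_single_eq_iff[OF a_nonzero[OF q] J0] e by metis
  qed
  moreover have "fst (\<rho> y) \<in> p ` pts \<longleftrightarrow> (\<exists>q. q \<noteq> 5 \<and> vec.span {J (fst y)} = p q)"
    by (auto simp: \<rho>_def pts_eq)
  moreover have "q \<noteq> 5" if "collapsed q (fst y)" for q using that by (simp add: collapsed_def)
  ultimately show ?thesis by blast
qed

text \<open>Representatives of one point differ by a nonzero scalar in each component, and scaling
  the entries of a configuration is a torus action.\<close>

lemma \<rho>_eq_imp_cross_ratio_eq:
  assumes y: "y \<in> dP5_lift" "y' \<in> dP5_lift" and eq: "\<rho> y = \<rho> y'"
  shows "cross_ratio_eq k (cross_data y k) (cross_data y' k)"
proof -
  obtain v m v' m' where vm: "y = (v, m)" "y' = (v', m')" by (metis prod.exhaust)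
  note V = y(1)[unfolded vm] and V' = y(2)[unfolded vm]
  show ?thesis
  proof (cases "k = 5")
    case False
    then show ?thesis using conic_bundle_eq_iff_line[OF y False] eq by simp
  next
    case True
    have "vec.span {J v} = vec.span {J v'}" using eq by (simp add: \<rho>_def vm)
    then obtain c where c: "c \<noteq> 0" "J v' = c *s J v"
      using span_single_eq_iff[OF dP5_lift_J_nonzero[OF V] dP5_lift_J_nonzero[OF V']] by blast
    have "equiv_mod_const v' (c *s v)" using c(2) by (simp add: J_scale flip: J_eq_iff)
    then have vc: "v' = c *s v"
      using equiv_mod_const_balanced dP5_liftD(1)[OF V] dP5_liftD(1)[OF V'] balanced_scale by blast
    have col: "collapsed q v' \<longleftrightarrow> collapsed q v" for q
      unfolding collapsed_def vc using c(1) by simp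
    have "torus_equiv (cross_data y 5) (cross_data y' 5)"
    proof (cases "\<exists>q. collapsed q v")
      case q: True
      then obtain q where q: "collapsed q v" by blast
      then have q5: "q \<noteq> 5" by (simp add: collapsed_def)
      have "snd (\<rho> y) q = snd (\<rho> y') q" using eq by simp
      then have "vec.span {a q, J (m $ q)} = vec.span {a q, J (m' $ q)}"
        using q5 by (simp add: \<rho>_def vm pts_eq)
      then have "J (m' $ q) \<in> vec.span {a q, J (m $ q)}" by (simp add: vec.span_base)
      then obtain b where "line_dir q (m' $ q) = b *s (m $ q)"
        unfolding J_in_line_iff[OF q5 dP5_lift_line_dir[OF V q5]] by blast
      then have b: "m' $ q = b *s (m $ q)" unfolding dP5_lift_line_dir[OF V' q5] .
      then have "b \<noteq> 0" using dP5_lift_nonzero(2)[OF V' q5] by auto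
      then show ?thesis
        unfolding vm cross_data_5(1)[OF V q] cross_data_5(1)[OF V' q[folded col]] b
        by (rule torus_equiv_config_scale)
    next
      case nq: False
      then have nq': "\<not> collapsed q v" "\<not> collapsed q v'" for q using col by blast+
      show ?thesis
        unfolding vm cross_data_5(2)[OF V nq'(1)] cross_data_5(2)[OF V' nq'(2)]
        unfolding vc by (rule torus_equiv_config_scale[OF c(1)])
    qed
    from cross_ratio_eq_torus_equiv[OF this cross_ratio_eq_refl] show ?thesis
      unfolding True using cross_ratio_eq_sym by blast
  qed
qed

text \<open>The four expressions are the multiples \<tau> k of the pencil expression, and some
  \<tau> k is nonzero. This removes the case distinction of \<open>cross_data\<close> and shows that
  the locus is closed.\<close>

lemma pencil_eq_polynomial_iff:
  assumes vm: "(v, m) \<in> dP5_lift"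
  shows "pencil_eq \<alpha> \<beta> (cross_data (v, m) 5) \<longleftrightarrow>
     \<alpha> * ((m $ 4 $ 3 - m $ 4 $ 1) * (v $ 4 - v $ 2)) + \<beta> * ((m $ 4 $ 2 - m $ 4 $ 1) * (v $ 4 - v $ 3)) = 0 \<and>
     \<alpha> * ((m $ 3 $ 4 - m $ 3 $ 2) * (v $ 3 - v $ 1)) + \<beta> * ((m $ 3 $ 1 - m $ 3 $ 2) * (v $ 3 - v $ 4)) = 0 \<and>
     \<alpha> * ((m $ 2 $ 1 - m $ 2 $ 3) * (v $ 2 - v $ 4)) + \<beta> * ((m $ 2 $ 4 - m $ 2 $ 3) * (v $ 2 - v $ 1)) = 0 \<and>
     \<alpha> * ((m $ 1 $ 2 - m $ 1 $ 4) * (v $ 1 - v $ 3)) + \<beta> * ((m $ 1 $ 3 - m $ 1 $ 4) * (v $ 1 - v $ 2)) = 0"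
    (is "_ \<longleftrightarrow> ?R")
proof -
  let ?C = "cross_data (v, m) 5"
  obtain \<tau> where \<tau>: "\<And>k i j l. distinct [5, k, i, j, l] \<Longrightarrow>
      (m $ k $ j - m $ k $ i) * (v $ k - v $ l) = \<tau> k * (?C i j * ?C l k)"
    "\<exists>k. k \<noteq> 5 \<and> \<tau> k \<noteq> 0" using cross_data_5_multiple[OF vm] by blast
  have C: "plucker_vector ?C" using stable_off_cross_data[OF vm, of 5] by (simp add: stable_off_def)
  have anti: "?C 2 1 = - ?C 1 2" "?C 3 1 = - ?C 1 3" "?C 3 2 = - ?C 2 3" "?C 4 1 = - ?C 1 4"
    "?C 4 2 = - ?C 2 4" "?C 4 3 = - ?C 3 4"
    by (rule plucker_vector_antisym[OF C])+
  let ?e = "\<alpha> * (?C 1 3 * ?C 2 4) + \<beta> * (?C 1 2 * ?C 3 4)"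
  have "\<alpha> * ((m $ 4 $ 3 - m $ 4 $ 1) * (v $ 4 - v $ 2)) + \<beta> * ((m $ 4 $ 2 - m $ 4 $ 1) * (v $ 4 - v $ 3)) = \<tau> 4 * ?e"
    using \<tau>(1)[of 4 1 3 2] \<tau>(1)[of 4 1 2 3] by (simp add: algebra_simps)
  moreover have "\<alpha> * ((m $ 3 $ 4 - m $ 3 $ 2) * (v $ 3 - v $ 1)) + \<beta> * ((m $ 3 $ 1 - m $ 3 $ 2) * (v $ 3 - v $ 4)) = \<tau> 3 * ?e"
    using \<tau>(1)[of 3 2 4 1] \<tau>(1)[of 3 2 1 4] unfolding anti by (simp add: algebra_simps)
  moreover have "\<alpha> * ((m $ 2 $ 1 - m $ 2 $ 3) * (v $ 2 - v $ 4)) + \<beta> * ((m $ 2 $ 4 - m $ 2 $ 3) * (v $ 2 - v $ 1)) = \<tau> 2 * ?e"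
    using \<tau>(1)[of 2 3 1 4] \<tau>(1)[of 2 3 4 1] unfolding anti by (simp add: algebra_simps)
  moreover have "\<alpha> * ((m $ 1 $ 2 - m $ 1 $ 4) * (v $ 1 - v $ 3)) + \<beta> * ((m $ 1 $ 3 - m $ 1 $ 4) * (v $ 1 - v $ 2)) = \<tau> 1 * ?e"
    using \<tau>(1)[of 1 4 2 3] \<tau>(1)[of 1 4 3 2] unfolding anti by (simp add: algebra_simps)
  moreover have "\<tau> 1 \<noteq> 0 \<or> \<tau> 2 \<noteq> 0 \<or> \<tau> 3 \<noteq> 0 \<or> \<tau> 4 \<noteq> 0" using \<tau>(2) exhaust_5 by metis
  ultimately show ?thesis unfolding pencil_eq_def by auto
qed

lemma closed_pencil_locus: "closed {y \<in> dP5_lift. pencil_eq \<alpha> \<beta> (cross_data y 5)}"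
proof -
  let ?P = "{(v :: complex ^ 5, m :: complex ^ 5 ^ 5).
     \<alpha> * ((m $ 4 $ 3 - m $ 4 $ 1) * (v $ 4 - v $ 2)) + \<beta> * ((m $ 4 $ 2 - m $ 4 $ 1) * (v $ 4 - v $ 3)) = 0 \<and>
     \<alpha> * ((m $ 3 $ 4 - m $ 3 $ 2) * (v $ 3 - v $ 1)) + \<beta> * ((m $ 3 $ 1 - m $ 3 $ 2) * (v $ 3 - v $ 4)) = 0 \<and>
     \<alpha> * ((m $ 2 $ 1 - m $ 2 $ 3) * (v $ 2 - v $ 4)) + \<beta> * ((m $ 2 $ 4 - m $ 2 $ 3) * (v $ 2 - v $ 1)) = 0 \<and>
     \<alpha> * ((m $ 1 $ 2 - m $ 1 $ 4) * (v $ 1 - v $ 3)) + \<beta> * ((m $ 1 $ 3 - m $ 1 $ 4) * (v $ 1 - v $ 2)) = 0}"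
  have "{y \<in> dP5_lift. pencil_eq \<alpha> \<beta> (cross_data y 5)} = dP5_lift \<inter> ?P"
    using pencil_eq_polynomial_iff by auto
  moreover have "closed ?P"
    unfolding case_prod_unfold by (intro closed_Collect_conj closed_Collect_eq continuous_intros)
  ultimately show ?thesis
    using compact_imp_closed[OF compact_dP5_lift] by (simp add: closed_Int)
qed

text \<open>On an exceptional curve the hypothesis says that \<open>m $ q\<close> is tangent to the
  conic. Points v + \<epsilon> * h of the conic with \<epsilon> tending to 0 and h to
  \<open>m $ q\<close> are needed. If the quadratic term vanishes at \<open>m $ q\<close>, the
  tangent line lies in the conic and h = \<open>m $ q\<close> will do; otherwise the tangent is
  rotated slightly into a secant.\<close>

lemma pencil_eq_imp_closure:
  assumes vm: "(v, m) \<in> dP5_lift" and pe: "pencil_eq \<alpha> \<beta> (cross_data (v, m) 5)" and ab: "\<alpha> \<noteq> 0 \<or> \<beta> \<noteq> 0"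
  shows "(v, m) \<in> closure {y \<in> dP5_lift. conic_form \<alpha> \<beta> (fst y) = 0 \<and> (\<forall>q. \<not> collapsed q (fst y))}"
    (is "_ \<in> closure ?U")
proof (cases "\<exists>q. collapsed q v")
  case False
  then have nq: "\<not> collapsed q v" for q by blast
  have "conic_form \<alpha> \<beta> v = 0" using pe unfolding cross_data_5(2)[OF vm nq] pencil_eq_config_5 .
  then have "(v, m) \<in> ?U" using vm nq by simp
  then show ?thesis by (rule closure_subset[THEN subsetD])
next
  case True
  then obtain q where q: "collapsed q v" by blast
  then have q5: "q \<noteq> 5" by (simp add: collapsed_def)
  obtain r where r: "r \<notin> {5, q}" using ex_off_3[of 5 q q] by blast
  have vr: "v $ i = v $ r" if "i \<notin> {5, q}" for i
    by (rule collapsedD[OF q that]) (use r in simp)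
  define d where "d = v $ q - v $ r"
  have d0: "d \<noteq> 0"
  proof
    assume "d = 0"
    then have "v $ i = v $ r" if "i \<noteq> 5" for i using vr[of i] that unfolding d_def by (cases "i = q") auto
    then show False using balanced_nonconstant[OF dP5_liftD(1)[OF vm] dP5_lift_nonzero(1)[OF vm]] by metis
  qed
  have near: "conic_form \<alpha> \<beta> (v + \<epsilon> *s h) = \<epsilon> * d * tangent_form \<alpha> \<beta> q h + \<epsilon>\<^sup>2 * conic_form \<alpha> \<beta> h" for \<epsilon> h
    using conic_form_near[OF q5, of v "v $ r" \<alpha> \<beta> \<epsilon> h] vr unfolding d_def tangent_form_def by blast
  have tm: "tangent_form \<alpha> \<beta> q (m $ q) = 0"
    using pe unfolding cross_data_5(1)[OF vm q] pencil_eq_def tangent_form_def .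
  have bm: "balanced (m $ q)" using dP5_liftD(4)[OF vm q5] .
  define Q where "Q c \<longleftrightarrow> conic_form \<alpha> \<beta> c = 0 \<and> (\<forall>q. \<not> collapsed q c)" for c
  have not_collapsed: "\<forall>\<^sub>F t in at_right (0::real). \<forall>q'. \<not> collapsed q' (v + \<epsilon> t *s h t)"
    if \<epsilon>: "(\<epsilon> \<longlongrightarrow> 0) (at_right 0)" "\<forall>\<^sub>F t in at_right 0. \<epsilon> t \<noteq> 0" and h: "(h \<longlongrightarrow> m $ q) (at_right 0)" for \<epsilon> h
  proof (rule eventually_all_finite)
    fix q'
    show "\<forall>\<^sub>F t in at_right 0. \<not> collapsed q' (v + \<epsilon> t *s h t)"
    proof (cases "q' = q")
      case True
      have "((\<lambda>t. line_dir q (h t)) \<longlongrightarrow> m $ q) (at_right 0)"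
        using tendsto_line_dir[OF h, of q] unfolding dP5_lift_line_dir[OF vm q5] .
      from tendsto_imp_eventually_ne[OF this dP5_lift_nonzero(2)[OF vm q5]] \<epsilon>(2)
      show ?thesis
      proof eventually_elim
        case (elim t)
        have "line_dir q (v + \<epsilon> t *s h t) = \<epsilon> t *s line_dir q (h t)"
          using q line_dir_eq_0_iff[OF q5, of v] unfolding line_dir_add line_dir_scale by simp
        then have "line_dir q (v + \<epsilon> t *s h t) \<noteq> 0" using elim by simp
        then show ?case using line_dir_eq_0_iff[OF q5] True by blast
      qed
    next
      case False
      show ?thesis
      proof (cases "q' = 5")
        case True then show ?thesis by (simp add: collapsed_def)
      next
        case n5: False
        have "\<not> collapsed q' v"
          using collapsed_unique[OF dP5_liftD(1)[OF vm] dP5_lift_nonzero(1)[OF vm] q] False by blast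
        then have n0: "line_dir q' v \<noteq> 0" using line_dir_eq_0_iff[OF n5] by blast
        have "((\<lambda>t. v + \<epsilon> t *s h t) \<longlongrightarrow> v + 0 *s (m $ q)) (at_right 0)" by (intro tendsto_intros \<epsilon> h)
        then have "((\<lambda>t. v + \<epsilon> t *s h t) \<longlongrightarrow> v) (at_right 0)" by simp
        from tendsto_imp_eventually_ne[OF tendsto_line_dir[OF this] n0]
        show ?thesis by (rule eventually_mono) (use line_dir_eq_0_iff[OF n5] in blast)
      qed
    qed
  qed
  have "(v, m) \<in> closure {y \<in> dP5_lift. \<exists>c r. Q c \<and> r \<noteq> 0 \<and> fst y = r *s c}"
  proof (cases "conic_form \<alpha> \<beta> (m $ q) = 0")
    case True
    have lim: "((\<lambda>t::real. m $ q) \<longlongrightarrow> m $ q) (at_right 0)" by simp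
    show ?thesis
    proof (rule dP5_lift_approx_at[where \<epsilon> = complex_of_real and h = "\<lambda>_. m $ q", OF vm q])
      show "\<forall>\<^sub>F t in at_right 0. Q (v + of_real t *s (m $ q))"
        using not_collapsed[OF tendsto_of_real_at_right_0 eventually_of_real_at_right_0 lim]
        by (rule eventually_mono) (simp add: Q_def near tm True)
    qed (use bm tendsto_of_real_at_right_0 eventually_of_real_at_right_0 in auto)
  next
    case False
    obtain w where w: "balanced w" "tangent_form \<alpha> \<beta> q w \<noteq> 0" using tangent_form_nonzero[OF q5 ab] by blast
    define h where "h t = m $ q + of_real t *s w" for t :: real
    \<comment> \<open>The second intersection of the conic with the line through v in direction h t.
      It tends to v because the linear term at h t is proportional to t.\<close>
    define \<epsilon> where "\<epsilon> t = - (of_real t * (d * tangent_form \<alpha> \<beta> q w)) / conic_form \<alpha> \<beta> (h t)" for t :: real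
    have "(h \<longlongrightarrow> m $ q + 0 *s w) (at_right 0)"
      unfolding h_def by (intro tendsto_intros tendsto_of_real_at_right_0)
    then have h: "(h \<longlongrightarrow> m $ q) (at_right 0)" by simp
    have c: "((\<lambda>t. conic_form \<alpha> \<beta> (h t)) \<longlongrightarrow> conic_form \<alpha> \<beta> (m $ q)) (at_right 0)"
      by (intro tendsto_intros h)
    have "(\<epsilon> \<longlongrightarrow> - (0 * (d * tangent_form \<alpha> \<beta> q w)) / conic_form \<alpha> \<beta> (m $ q)) (at_right 0)"
      unfolding \<epsilon>_def by (intro tendsto_intros tendsto_of_real_at_right_0 c False)
    then have e0: "(\<epsilon> \<longlongrightarrow> 0) (at_right 0)" by simp
    have cn: "\<forall>\<^sub>F t in at_right 0. conic_form \<alpha> \<beta> (h t) \<noteq> 0"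
      using tendsto_imp_eventually_ne[OF c False] .
    have en: "\<forall>\<^sub>F t in at_right 0. \<epsilon> t \<noteq> 0"
      using cn eventually_of_real_at_right_0 by eventually_elim (use d0 w(2) in \<open>simp add: \<epsilon>_def\<close>)
    show ?thesis
    proof (rule dP5_lift_approx_at[OF vm q e0 en h])
      show "balanced (h t)" for t unfolding h_def by (intro balanced_add balanced_scale bm w(1))
      show "\<forall>\<^sub>F t in at_right 0. Q (v + \<epsilon> t *s h t)"
        using not_collapsed[OF e0 en h] cn
      proof eventually_elim
        case (elim t)
        have "tangent_form \<alpha> \<beta> q (h t) = of_real t * tangent_form \<alpha> \<beta> q w"
          unfolding h_def tangent_form_linear[OF q5] tm by simp
        then have "conic_form \<alpha> \<beta> (v + \<epsilon> t *s h t) =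
          \<epsilon> t * (of_real t * (d * tangent_form \<alpha> \<beta> q w) + \<epsilon> t * conic_form \<alpha> \<beta> (h t))"
          unfolding near by (simp add: algebra_simps power2_eq_square)
        also have "of_real t * (d * tangent_form \<alpha> \<beta> q w) + \<epsilon> t * conic_form \<alpha> \<beta> (h t) = 0"
          using elim unfolding \<epsilon>_def by simp
        finally show ?case using elim unfolding Q_def by simp
      qed
    qed
  qed
  moreover have "{y \<in> dP5_lift. \<exists>c r. Q c \<and> r \<noteq> 0 \<and> fst y = r *s c} \<subseteq> ?U"
  proof clarify
    fix w n c r assume y: "(w, n) \<in> dP5_lift" "Q c" "r \<noteq> 0" "fst (w, n) = r *s c"
    then have w: "w = r *s c" by simp
    have "collapsed q w \<longleftrightarrow> collapsed q c" for q unfolding collapsed_def w using y(3) by simp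
    moreover have "conic_form \<alpha> \<beta> w = 0" using y(2) unfolding w Q_def by (simp add: conic_form_scale)
    ultimately show "conic_form \<alpha> \<beta> (fst (w, n)) = 0 \<and> (\<forall>q. \<not> collapsed q (fst (w, n)))"
      using y(2) unfolding Q_def by simp
  qed
  ultimately show ?thesis using closure_mono by blast
qed

text \<open>The image of the closed pencil locus is closed and contains the conic away from the base
  points, so it contains the closure; the pencil equation depends only on the image under \<rho>.
  The converse is \<open>pencil_eq_imp_closure\<close>.\<close>

lemma proper_transform_conic:
  assumes y: "y \<in> dP5_lift" and ab: "\<alpha> \<noteq> 0 \<or> \<beta> \<noteq> 0"
  shows "\<rho> y \<in> proper_transform p (p ` pts) (conic \<alpha> \<beta>) \<longleftrightarrow> pencil_eq \<alpha> \<beta> (cross_data y 5)"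
proof -
  let ?S = "{z \<in> topspace (dP5 p). fst z \<in> conic \<alpha> \<beta> - p ` pts}"
  let ?T = "{y \<in> dP5_lift. pencil_eq \<alpha> \<beta> (cross_data y 5)}"
  have S: "\<rho> y \<in> ?S \<longleftrightarrow> conic_form \<alpha> \<beta> (fst y) = 0 \<and> (\<forall>q. \<not> collapsed q (fst y))" if y: "y \<in> dP5_lift" for y
  proof -
    have "J (fst y) \<noteq> 0" using dP5_lift_J_nonzero[of "fst y" "snd y"] y by simp
    from span_in_conic_iff[OF this]
    have "fst (\<rho> y) \<in> conic \<alpha> \<beta> \<longleftrightarrow> conic_form \<alpha> \<beta> (fst y) = 0" by (simp add: \<rho>_def)
    then show ?thesis using \<rho>_not_base_point_iff[OF y] \<rho>_in_dP5[OF y] by blast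
  qed
  show ?thesis
  proof
    assume "\<rho> y \<in> proper_transform p (p ` pts) (conic \<alpha> \<beta>)"
    moreover have "dP5 p closure_of ?S \<subseteq> \<rho> ` ?T"
    proof (rule closure_of_minimal)
      show "closedin (dP5 p) (\<rho> ` ?T)" by (rule closed_image_\<rho>[OF closed_pencil_locus]) blast
      show "?S \<subseteq> \<rho> ` ?T"
      proof (rule subsetI)
        fix z assume z: "z \<in> ?S"
        then obtain y where y: "y \<in> dP5_lift" "\<rho> y = z" using \<rho>_surj by blast
        have nc: "conic_form \<alpha> \<beta> (fst y) = 0" "\<not> collapsed q (fst y)" for q
          using S[OF y(1)] z y(2) by auto
        have "(fst y, snd y) \<in> dP5_lift" using y(1) by simp
        from cross_data_5(2)[OF this nc(2)] have "cross_data y 5 = config 5 (fst y)" by simp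
        then have "pencil_eq \<alpha> \<beta> (cross_data y 5)" using nc(1) by (simp add: pencil_eq_config_5)
        then show "z \<in> \<rho> ` ?T" using y by blast
      qed
    qed
    ultimately obtain y' where y': "y' \<in> dP5_lift" "pencil_eq \<alpha> \<beta> (cross_data y' 5)" "\<rho> y = \<rho> y'"
      unfolding proper_transform_def by blast
    have "stable_off 5 (cross_data y' 5)" using stable_off_cross_data[of "fst y'" "snd y'"] y'(1) by simp
    then show "pencil_eq \<alpha> \<beta> (cross_data y 5)"
      using pencil_eq_cong \<rho>_eq_imp_cross_ratio_eq[OF y y'(1,3)] y'(2) by blast
  next
    assume pe: "pencil_eq \<alpha> \<beta> (cross_data y 5)"
    let ?U = "{y \<in> dP5_lift. conic_form \<alpha> \<beta> (fst y) = 0 \<and> (\<forall>q. \<not> collapsed q (fst y))}"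
    have "y \<in> closure ?U" using pencil_eq_imp_closure[of "fst y" "snd y"] y pe ab by simp
    moreover have "\<rho> ` ?U \<subseteq> ?S" using S by blast
    moreover have "?U \<subseteq> dP5_lift" by blast
    ultimately show "\<rho> y \<in> proper_transform p (p ` pts) (conic \<alpha> \<beta>)"
      unfolding proper_transform_def using \<rho>_closure[OF y] by blast
  qed
qed

text \<open>Stability of the fifth configuration makes the pencil equation a nontrivial linear
  equation for (\<alpha>, \<beta>), so the member through the point is unique up to a
  scalar.\<close>

lemma conic_bundle_5:
  assumes y: "y \<in> dP5_lift" and ab: "\<alpha> \<noteq> 0 \<or> \<beta> \<noteq> 0" and pe: "pencil_eq \<alpha> \<beta> (cross_data y 5)"
  shows "conic_bundle p 5 (\<rho> y) = conic \<alpha> \<beta>"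
proof -
  have "conic_bundle p 5 (\<rho> y) =
    (THE C. C \<in> conics_through (p ` pts) \<and> \<rho> y \<in> proper_transform p (p ` pts) C)"
    by (simp add: conic_bundle_def pencil_map_def)
  also have "\<dots> = conic \<alpha> \<beta>"
  proof (rule the_equality)
    show "conic \<alpha> \<beta> \<in> conics_through (p ` pts) \<and> \<rho> y \<in> proper_transform p (p ` pts) (conic \<alpha> \<beta>)"
      using conic_in_conics_through[OF ab] proper_transform_conic[OF y ab] pe by blast
    fix C assume C: "C \<in> conics_through (p ` pts) \<and> \<rho> y \<in> proper_transform p (p ` pts) C"
    then obtain \<alpha>' \<beta>' where ab': "\<alpha>' \<noteq> 0 \<or> \<beta>' \<noteq> 0" "C = conic \<alpha>' \<beta>'"
      using conics_through_imp_conic by blast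
    have pe': "pencil_eq \<alpha>' \<beta>' (cross_data y 5)" using C proper_transform_conic[OF y ab'(1)] ab'(2) by blast
    define s t where "s = cross_data y 5 1 3 * cross_data y 5 2 4" "t = cross_data y 5 1 2 * cross_data y 5 3 4"
    have st: "s \<noteq> 0 \<or> t \<noteq> 0"
      using stable_off_5_products[of "cross_data y 5"] stable_off_cross_data[of "fst y" "snd y" 5] y
      unfolding s_t_def by auto
    have e: "\<alpha> * s + \<beta> * t = 0" "\<alpha>' * s + \<beta>' * t = 0" using pe pe' unfolding pencil_eq_def s_t_def by auto
    then have "s * (\<alpha> * \<beta>' - \<alpha>' * \<beta>) = 0" "t * (\<alpha> * \<beta>' - \<alpha>' * \<beta>) = 0" by algebra+
    then have det: "\<alpha> * \<beta>' = \<alpha>' * \<beta>" using st by auto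
    have "\<exists>c. c \<noteq> 0 \<and> \<alpha>' = c * \<alpha> \<and> \<beta>' = c * \<beta>"
    proof (cases "\<alpha> = 0")
      case True
      then have b: "\<beta> \<noteq> 0" "\<alpha>' = 0" using ab det by auto
      then show ?thesis using ab' True by (intro exI[of _ "\<beta>' / \<beta>"]) auto
    next
      case False
      then have "\<beta>' = \<alpha>' / \<alpha> * \<beta>" using det by (simp add: field_simps)
      moreover have "\<alpha>' \<noteq> 0" using False det ab'(1) by auto
      ultimately show ?thesis using False by (intro exI[of _ "\<alpha>' / \<alpha>"]) auto
    qed
    then show "C = conic \<alpha> \<beta>" using ab'(2) conic_scale by blast
  qed
  finally show ?thesis .
qed

lemma conic_bundle_eq_iff:
  assumes y: "y \<in> dP5_lift" "y' \<in> dP5_lift"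
  shows "conic_bundle p k (\<rho> y) = conic_bundle p k (\<rho> y') \<longleftrightarrow>
    cross_ratio_eq k (cross_data y k) (cross_data y' k)"
proof (cases "k = 5")
  case False
  then show ?thesis using conic_bundle_eq_iff_line[OF y] by blast
next
  case True
  let ?C = "cross_data y 5" and ?C' = "cross_data y' 5"
  have st: "stable_off 5 ?C" "stable_off 5 ?C'"
    using stable_off_cross_data[of "fst y" "snd y" 5] stable_off_cross_data[of "fst y'" "snd y'" 5] y by auto
  then have pv: "plucker_vector ?C" "plucker_vector ?C'" by (auto simp: stable_off_def)
  \<comment> \<open>Coefficients of the member through y, solving its pencil equation.\<close>
  let ?\<alpha> = "?C 1 2 * ?C 3 4" and ?\<beta> = "- (?C 1 3 * ?C 2 4)"
  have ab: "?\<alpha> \<noteq> 0 \<or> ?\<beta> \<noteq> 0" using stable_off_5_products[OF st(1)] by auto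
  have pe: "pencil_eq ?\<alpha> ?\<beta> ?C" unfolding pencil_eq_def by (simp add: mult.commute)
  show ?thesis unfolding True
  proof
    assume eq: "conic_bundle p 5 (\<rho> y) = conic_bundle p 5 (\<rho> y')"
    let ?\<alpha>' = "?C' 1 2 * ?C' 3 4" and ?\<beta>' = "- (?C' 1 3 * ?C' 2 4)"
    have ab': "?\<alpha>' \<noteq> 0 \<or> ?\<beta>' \<noteq> 0" using stable_off_5_products[OF st(2)] by auto
    have pe': "pencil_eq ?\<alpha>' ?\<beta>' ?C'" unfolding pencil_eq_def by (simp add: mult.commute)
    have "conic ?\<alpha> ?\<beta> = conic ?\<alpha>' ?\<beta>'"
      using eq unfolding conic_bundle_5[OF y(1) ab pe] conic_bundle_5[OF y(2) ab' pe'] .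
    then have "pencil_eq ?\<alpha> ?\<beta> ?C'"
      using proper_transform_conic[OF y(2) ab] proper_transform_conic[OF y(2) ab'] pe' by simp
    then have "?C 1 2 * ?C 3 4 * (?C' 1 3 * ?C' 2 4) = ?C 1 3 * ?C 2 4 * (?C' 1 2 * ?C' 3 4)"
      unfolding pencil_eq_def by simp
    then show "cross_ratio_eq 5 ?C ?C'" by (rule cross_ratio_eq_5_single[OF pv])
  next
    assume "cross_ratio_eq 5 ?C ?C'"
    then have "pencil_eq ?\<alpha> ?\<beta> ?C'"
      using pencil_eq_cong[OF st(1) _ pe] cross_ratio_eq_sym by blast
    then show "conic_bundle p 5 (\<rho> y) = conic_bundle p 5 (\<rho> y')"
      using conic_bundle_5[OF y(1) ab pe] conic_bundle_5[OF y(2) ab] by simp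
  qed
qed

text \<open>The lines through the blown-up points agree. If the underlying points of the plane
  differed, all four lines would be the line joining them, and it would contain every a k, hence the
  whole space.\<close>

lemma \<rho>_eqI:
  assumes y: "y \<in> dP5_lift" "y' \<in> dP5_lift"
    and cr: "\<And>k. cross_ratio_eq k (cross_data y k) (cross_data y' k)"
  shows "\<rho> y = \<rho> y'"
proof -
  obtain v m v' m' where vm: "y = (v, m)" "y' = (v', m')" by (metis prod.exhaust)
  have L: "vec.span {a k, J (m $ k)} = vec.span {a k, J (m' $ k)}" if "k \<noteq> 5" for k
    using line_eq_iff[of v m v' m' k] y cr that unfolding vm by blast
  have snd_eq: "snd (\<rho> y) = snd (\<rho> y')"
    unfolding \<rho>_def vm using L by (auto simp: pts_eq fun_eq_iff)
  let ?L = "\<lambda>k. snd (\<rho> y) k"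
  have T: "\<rho> y \<in> topspace (dP5 p)" "\<rho> y' \<in> topspace (dP5 p)" using \<rho>_in_dP5 y by auto
  have inc: "?L k \<in> topspace CP2_dual" "p k \<subseteq> ?L k" "fst (\<rho> y) \<subseteq> ?L k" "fst (\<rho> y') \<subseteq> ?L k" if "k \<noteq> 5" for k
    using T snd_eq that unfolding topspace_dP5 by (auto simp: pts_eq case_prod_beta PiE_iff)
  have P: "fst (\<rho> y) \<in> topspace CP2" "fst (\<rho> y') \<in> topspace CP2"
    using T unfolding topspace_dP5 by (auto simp: case_prod_beta)
  have "fst (\<rho> y) = fst (\<rho> y')"
  proof (rule ccontr)
    assume ne: "fst (\<rho> y) \<noteq> fst (\<rho> y')"
    have same: "?L k = ?L 1" if k: "k \<noteq> 5" for k
      by (rule grassmannian_2_eqI[OF inc(1)[OF k] inc(1) P ne inc(3)[OF k] inc(4)[OF k] inc(3,4)]) auto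
    have "a k \<in> ?L 1" if k: "k \<noteq> 5" for k
      using inc(2)[OF k] unfolding same[OF k] p_eq[OF k] span_subset_iff by (auto intro: vec.span_base)
    then have "J w \<in> ?L 1" for w
      unfolding J_def using subspace_grassmannian[OF inc(1), of 1]
      by (intro vec.subspace_add vec.subspace_scale) auto
    then have "?L 1 = UNIV" using J_surj by (metis UNIV_eq_I)
    moreover have "vec.dim (?L 1) = 2" using inc(1)[of 1] unfolding topspace_grassmannian by simp
    moreover have "vec.dim (UNIV :: (complex ^ 3) set) = 3" by (simp add: vec.dim_UNIV card_cart_basis)
    ultimately show False by simp
  qed
  then show ?thesis using snd_eq by (simp add: prod_eq_iff)
qed

end

section \<open>Radial expansion of the hypersimplex\<close>

lemma top_of_set_Times: "top_of_set (S \<times> T) = prod_topology (top_of_set S) (top_of_set T)"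
  by (metis prod_topology_euclidean subtopology_Times)

text \<open>On the divisor of m and n the bundle with index k outside {m, n} is constant: the
  pairing that joins m with n vanishes for B and B' alike, so the cross ratio is 0, infinity or 1
  for both.\<close>

lemma cross_ratio_eq_on_divisor:
  assumes D: "on_divisor m n B" "on_divisor m n B'" "m \<noteq> n" and k: "k \<notin> {m, n}"
    and pv: "plucker_vector (B k)" "plucker_vector (B' k)"
  shows "cross_ratio_eq k (B k) (B' k)"
  unfolding cross_ratio_eq_def
proof (intro allI impI)
  fix a b c d assume d: "distinct [k, a, b, c, d]"
  have mn: "m \<in> {a, b, c, d}" "n \<in> {a, b, c, d}" using UNIV_5_distinct[OF d] k by auto
  have z: "B k x y * B k u w = 0 \<and> B' k x y * B' k u w = 0"
    if xy: "{m, n} = {x, y} \<or> {m, n} = {u, w}" and D': "distinct [k, x, y, u, w]" for x y u w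
  proof -
    have *: "C k x y * C k u w = 0" if C: "on_divisor m n C" "plucker_vector (C k)" for C
    proof -
      have 1: "C k m n * C k u w = 0" if "{m, n} = {x, y}"
      proof -
        have "distinct [m, n, k, u, w]" using that D' D(3) k by (auto simp: doubleton_eq_iff)
        then show ?thesis using C(1) unfolding on_divisor_def by blast
      qed
      have 2: "C k m n * C k x y = 0" if "{m, n} = {u, w}"
      proof -
        have "distinct [m, n, k, x, y]" using that D' D(3) k by (auto simp: doubleton_eq_iff)
        then show ?thesis using C(1) unfolding on_divisor_def by blast
      qed
      show ?thesis
        using xy 1 2 plucker_vector_zero_sym[OF C(2), of n m] by (auto simp: doubleton_eq_iff)
    qed
    show ?thesis using *[OF D(1) pv(1)] *[OF D(2) pv(2)] by blast
  qed
  consider "{m, n} = {a, b} \<or> {m, n} = {c, d}" | "{m, n} = {a, c} \<or> {m, n} = {b, d}"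
    | "{m, n} = {a, d} \<or> {m, n} = {b, c}"
    using mn D(3) by auto
  then show "B k a b * B k c d * (B' k a c * B' k b d) = B k a c * B k b d * (B' k a b * B' k c d)"
  proof cases
    case 1
    have "B k a b * B k c d = 0 \<and> B' k a b * B' k c d = 0" by (rule z[OF 1]) (use d in auto)
    then show ?thesis by auto
  next
    case 2
    have "B k a c * B k b d = 0 \<and> B' k a c * B' k b d = 0" by (rule z[OF 2]) (use d in auto)
    then show ?thesis by auto
  next
    case 3
    have "B k a d * B k b c = 0 \<and> B' k a d * B' k b c = 0" by (rule z[OF 3]) (use d in auto)
    then have "B k a b * B k c d = B k a c * B k b d" "B' k a b * B' k c d = B' k a c * B' k b d"
      using plucker_vector_rel[OF pv(1), of a b c d] plucker_vector_rel[OF pv(2), of a b c d] by auto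
    then show ?thesis by simp
  qed
qed

text \<open>The gauge of the hypersimplex with respect to its barycentre (2/5, ..., 2/5).\<close>

definition coord_gauge :: "real \<Rightarrow> real" where
  "coord_gauge r = max ((2/5 - r) / (2/5)) ((r - 2/5) / (3/5))"

definition simplex_gauge :: "real ^ 5 \<Rightarrow> real" where
  "simplex_gauge x = max (coord_gauge (x $ 1)) (max (coord_gauge (x $ 2)) (max (coord_gauge (x $ 3))
     (max (coord_gauge (x $ 4)) (coord_gauge (x $ 5)))))"

text \<open>The factor 1 + 5 * t grows from 1 to 6 and is capped at the reciprocal of the gauge,
  where the ray from the barycentre meets the boundary.\<close>

definition push_scale :: "real \<Rightarrow> real ^ 5 \<Rightarrow> real" where
  "push_scale t x = (1 + 5 * t) / max 1 ((1 + 5 * t) * simplex_gauge x)"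

text \<open>Radial expansion from the barycentre, stopped at the boundary. At time 1 it moves every
  point with \<open>x m + x n \<ge> 1\<close> to the boundary, since such points have gauge at least 1/6.\<close>

definition push :: "real \<Rightarrow> real ^ 5 \<Rightarrow> real ^ 5" where
  "push t x = (\<chi> i. 2/5 + push_scale t x * (x $ i - 2/5))"

lemma coord_gauge_le: "coord_gauge (x $ i) \<le> simplex_gauge x"
  using exhaust_5[of i] unfolding simplex_gauge_def by (elim disjE) (simp_all add: le_max_iff_disj)

lemma simplex_gauge_attained: "\<exists>i. simplex_gauge x = coord_gauge (x $ i)"
proof -
  have "max r s = r \<or> max r s = s" for r s :: real by (simp add: max_def)
  then show ?thesis unfolding simplex_gauge_def by metis
qed

lemma simplex_gauge_le_1:
  assumes "x \<in> hypersimplex"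
  shows "simplex_gauge x \<le> 1"
proof -
  obtain i where "simplex_gauge x = coord_gauge (x $ i)" using simplex_gauge_attained by blast
  then show ?thesis using hypersimplexD(1,2)[OF assms, of i] by (auto simp: coord_gauge_def)
qed

lemma push_scale_ge_1:
  assumes "x \<in> hypersimplex" "t \<in> {0..1}"
  shows "push_scale t x \<ge> 1"
proof -
  have "max 1 ((1 + 5 * t) * simplex_gauge x) \<le> 1 + 5 * t"
    using simplex_gauge_le_1[OF assms(1)] assms(2) mult_left_le[of "simplex_gauge x" "1 + 5 * t"] by auto
  then show ?thesis unfolding push_scale_def by simp
qed

lemma push_in_hypersimplex:
  assumes "x \<in> hypersimplex" "t \<in> {0..1}"
  shows "push t x \<in> hypersimplex"
proof -
  have s1: "push_scale t x \<ge> 1" using push_scale_ge_1[OF assms] .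
  have sg: "push_scale t x * simplex_gauge x \<le> 1"
  proof -
    have "(1 + 5 * t) * simplex_gauge x / max 1 ((1 + 5 * t) * simplex_gauge x) \<le> 1"
      by (subst divide_le_eq_1_pos) (auto simp: less_max_iff_disj)
    then show ?thesis unfolding push_scale_def by simp
  qed
  have "0 \<le> push t x $ i \<and> push t x $ i \<le> 1" for i
  proof -
    have "push_scale t x * coord_gauge (x $ i) \<le> push_scale t x * simplex_gauge x"
      using coord_gauge_le s1 by (intro mult_left_mono) auto
    then have g: "push_scale t x * coord_gauge (x $ i) \<le> 1" using sg by simp
    have "push_scale t x * ((2/5 - x $ i) / (2/5)) \<le> push_scale t x * coord_gauge (x $ i)"
      "push_scale t x * ((x $ i - 2/5) / (3/5)) \<le> push_scale t x * coord_gauge (x $ i)"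
      unfolding coord_gauge_def
      by (rule mult_left_mono[OF max.cobounded1], use s1 in simp)
        (rule mult_left_mono[OF max.cobounded2], use s1 in simp)
    then have "push_scale t x * ((2/5 - x $ i) / (2/5)) \<le> 1" "push_scale t x * ((x $ i - 2/5) / (3/5)) \<le> 1"
      using g by linarith+
    then show ?thesis by (simp add: push_def algebra_simps)
  qed
  moreover have "(\<Sum>i\<in>UNIV. push t x $ i) = 2"
  proof -
    have "(\<Sum>i\<in>UNIV. push t x $ i) = 2 + push_scale t x * ((\<Sum>i\<in>UNIV. x $ i) - 2)"
      by (simp add: push_def sum.distrib sum_distrib_left[symmetric] sum_subtractf)
    then show ?thesis using hypersimplexD(3)[OF assms(1)] by simp
  qed
  ultimately show ?thesis by (simp add: hypersimplex_def)
qed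

lemma push_eq_self: "push_scale t x = 1 \<Longrightarrow> push t x = x"
  by (simp add: push_def vec_eq_iff)

lemma push_0: "x \<in> hypersimplex \<Longrightarrow> push 0 x = x"
  using simplex_gauge_le_1[of x] by (intro push_eq_self) (simp add: push_scale_def)

lemma push_boundary:
  assumes "x \<in> hypersimplex" "t \<in> {0..1}" "x $ i = 0 \<or> x $ i = 1"
  shows "push t x = x"
proof -
  have "1 \<le> coord_gauge (x $ i)" using assms(3) by (auto simp: coord_gauge_def)
  then have "simplex_gauge x = 1"
    using coord_gauge_le[of x i] simplex_gauge_le_1[OF assms(1)] by linarith
  then show ?thesis using assms(2) by (intro push_eq_self) (simp add: push_scale_def)
qed

text \<open>At the barycentre the two coordinates sum to 4/5, which is less than 1. Expansion away
  from it can only increase an excess over 4/5.\<close>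

lemma push_pair:
  assumes "x \<in> hypersimplex" "t \<in> {0..1}" "x $ m + x $ n \<ge> 1"
  shows "push t x $ m + push t x $ n \<ge> 1"
proof -
  have "1/5 \<le> 1 * (x $ m + x $ n - 4/5)" using assms(3) by simp
  also have "\<dots> \<le> push_scale t x * (x $ m + x $ n - 4/5)"
    using push_scale_ge_1[OF assms(1,2)] assms(3) by (intro mult_right_mono) auto
  finally show ?thesis by (simp add: push_def algebra_simps)
qed

lemma push_1_boundary:
  assumes "x \<in> hypersimplex" "x $ m + x $ n \<ge> 1"
  shows "\<exists>i. push 1 x $ i = 0 \<or> push 1 x $ i = 1"
proof -
  \<comment> \<open>A coordinate 1/2 has gauge (1/2 - 2/5) / (3/5) = 1/6, so the factor 6 available
    at time 1 reaches the boundary.\<close>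
  have "x $ m \<ge> 1/2 \<or> x $ n \<ge> 1/2" using assms(2) by auto
  then obtain l where "x $ l \<ge> 1/2" by blast
  then have "coord_gauge (x $ l) \<ge> 1/6" by (simp add: coord_gauge_def)
  then have g: "simplex_gauge x \<ge> 1/6" using coord_gauge_le[of x l] by linarith
  then have s: "push_scale 1 x = 1 / simplex_gauge x" by (simp add: push_scale_def)
  obtain i where i: "simplex_gauge x = coord_gauge (x $ i)" using simplex_gauge_attained by blast
  have P: "push 1 x $ i = 2/5 + 1 / simplex_gauge x * (x $ i - 2/5)"
    by (simp only: push_def s vec_lambda_beta)
  from i consider "simplex_gauge x = (2/5 - x $ i) / (2/5)" | "simplex_gauge x = (x $ i - 2/5) / (3/5)"
    unfolding coord_gauge_def max_def by metis
  then have "push 1 x $ i = 0 \<or> push 1 x $ i = 1"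
  proof cases
    case 1
    then have e: "x $ i - 2/5 = - (2/5) * simplex_gauge x" by simp
    show ?thesis unfolding P e using g by simp
  next
    case 2
    then have e: "x $ i - 2/5 = 3/5 * simplex_gauge x" by simp
    show ?thesis unfolding P e using g by simp
  qed
  then show ?thesis by blast
qed

lemma continuous_on_push: "continuous_on UNIV (\<lambda>(t, x). push t x)"
proof -
  have "continuous_on UNIV (\<lambda>z :: real \<times> (real ^ 5). simplex_gauge (snd z))"
    unfolding simplex_gauge_def coord_gauge_def by (intro continuous_intros) auto
  moreover have "max 1 r \<noteq> 0" for r :: real by (simp add: max_def)
  ultimately show ?thesis
    unfolding case_prod_unfold push_def push_scale_def
    by (intro continuous_on_vec_lambda continuous_intros) auto
qed

section \<open>Identifications made by the orbit space\<close>

definition simplex_interior :: "real ^ 5 \<Rightarrow> bool" where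
  "simplex_interior x \<longleftrightarrow> (\<forall>i. x $ i \<noteq> 0 \<and> x $ i \<noteq> 1)"

lemma simplex_interior_iff:
  "x \<in> hypersimplex \<Longrightarrow> x \<in> rel_interior hypersimplex \<longleftrightarrow> simplex_interior x"
  unfolding rel_interior_hypersimplex simplex_interior_def
  using hypersimplexD(1,2)[of x] by (auto simp: order.strict_iff_order)

lemma octahedron_interior_unique:
  "\<lbrakk>x \<in> rel_interior (octahedron i); x $ k = 0\<rbrakk> \<Longrightarrow> k = i"
  unfolding rel_interior_octahedron by (cases "k = i") auto

lemma octahedron_interiorD: "x \<in> rel_interior (octahedron i) \<Longrightarrow> x $ i = 0"
  unfolding rel_interior_octahedron by simp

lemma simplex_interior_not_octahedron: "simplex_interior x \<Longrightarrow> x \<notin> rel_interior (octahedron k)"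
  using octahedron_interiorD[of x k] simplex_interior_def[of x] by blast

lemma not_simplex_interiorE:
  assumes "\<not> simplex_interior x"
  obtains i where "x $ i = 0 \<or> x $ i = 1"
  using assms unfolding simplex_interior_def by blast

lemma stable_off_cross_data': "y \<in> dP5_lift \<Longrightarrow> stable_off k (cross_data y k)"
  using stable_off_cross_data[of "fst y" "snd y" k] by simp

lemma orbit_map_eqI:
  assumes x: "x \<in> hypersimplex" and y: "y \<in> dP5_lift" "y' \<in> dP5_lift"
    and same: "(\<forall>k. cross_ratio_eq k (cross_data y k) (cross_data y' k)) \<or>
      (\<exists>m n. m \<noteq> n \<and> x $ m + x $ n \<ge> 1 \<and> on_divisor m n (cross_data y) \<and> on_divisor m n (cross_data y')) \<or>
      (\<exists>i. x $ i = 0 \<or> x $ i = 1)"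
    and bd: "\<And>k. x \<in> rel_interior (octahedron k) \<Longrightarrow> cross_ratio_eq k (cross_data y k) (cross_data y' k)"
  shows "orbit_map (x, y) = orbit_map (x, y')"
proof -
  have "(x, y) \<in> fst ` moment_rel" "(x, y') \<in> fst ` moment_rel"
    unfolding fst_moment_rel using x y by auto
  then obtain b b' where b: "((x, y), b) \<in> moment_rel" "((x, y'), b') \<in> moment_rel" by force
  show ?thesis
    unfolding orbit_map_eq[OF b(1)] orbit_map_eq[OF b(2)] by (rule moment_rel_unique[OF b same bd])
qed

text \<open>A frame b over (x, y) also satisfies the cross ratio equations of y'. Where its Pluecker
  vector is stable, the cross ratios of y and y' can be compared through it; where it is not,
  \<open>unstable_imp_divisor\<close> places both points on a common divisor.\<close>

lemma orbit_map_eqD: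
  assumes x: "x \<in> hypersimplex" "x' \<in> hypersimplex" and y: "y \<in> dP5_lift" "y' \<in> dP5_lift"
    and eq: "orbit_map (x, y) = orbit_map (x', y')"
  shows "x = x'"
    and "simplex_interior x \<Longrightarrow> (\<forall>k. cross_ratio_eq k (cross_data y k) (cross_data y' k)) \<or>
      (\<exists>m n. m \<noteq> n \<and> x $ m + x $ n \<ge> 1 \<and> on_divisor m n (cross_data y) \<and> on_divisor m n (cross_data y'))"
    and "x \<in> rel_interior (octahedron k) \<Longrightarrow> cross_ratio_eq k (cross_data y k) (cross_data y' k)"
proof -
  have "(x, y) \<in> fst ` moment_rel" "(x', y') \<in> fst ` moment_rel"
    unfolding fst_moment_rel using x y by auto
  then obtain b b' where b: "((x, y), b) \<in> moment_rel" and b': "((x', y'), b') \<in> moment_rel" by force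
  note B = moment_relD[OF b] and B' = moment_relD[OF b']
  have "orbit_class b = orbit_class b'" using eq unfolding orbit_map_eq[OF b] orbit_map_eq[OF b'] .
  from orbit_class_eqD[OF B(2) B'(2) this]
  have te: "torus_equiv (plucker_of b) (plucker_of b')" and w: "weight (plucker_of b) = weight (plucker_of b')" .
  show "x = x'" using B(4) B'(4) w by (simp add: vec_eq_iff)
  have cr': "cross_ratio_eq k (plucker_of b) (cross_data y' k)" for k
    using cross_ratio_eq_torus_equiv[OF torus_equiv_sym[OF te] B'(5)] .
  have via: "cross_ratio_eq k (cross_data y k) (cross_data y' k)" if "stable_off k (plucker_of b)" for k
    using cross_ratio_eq_trans[OF that _ cr'] B(5) cross_ratio_eq_sym by blast
  have xw: "x $ i \<ge> 0" "x $ i \<le> 1" for i using hypersimplexD(1,2)[OF x(1)] by auto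
  {
    assume int: "simplex_interior x"
    have pos: "weight (plucker_of b) i > 0" and lt: "weight (plucker_of b) i < 1" for i
      using int xw[of i] unfolding B(4) simplex_interior_def by (auto simp: order.strict_iff_order)
    show "(\<forall>k. cross_ratio_eq k (cross_data y k) (cross_data y' k)) \<or>
      (\<exists>m n. m \<noteq> n \<and> x $ m + x $ n \<ge> 1 \<and> on_divisor m n (cross_data y) \<and> on_divisor m n (cross_data y'))"
    proof (cases "\<exists>i j k. distinct [i, j, k] \<and> plucker_of b i j = 0 \<and> plucker_of b i k = 0")
      case True
      then obtain i j k where ijk: "distinct [i, j, k]" "plucker_of b i j = 0" "plucker_of b i k = 0" by blast
      from unstable_imp_divisor[OF B(3) pos lt ijk] show ?thesis
        unfolding B(4) using B(5) cr' by blast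
    next
      case False
      then have "stable_off k (plucker_of b)" for k unfolding stable_off_def by auto
      then show ?thesis using via by blast
    qed
  next
    assume k: "x \<in> rel_interior (octahedron k)"
    have "stable_off k (plucker_of b)"
    proof (rule stable_off_weight[OF B(3)])
      show "weight (plucker_of b) k = 0" using k unfolding B(4) rel_interior_octahedron by simp
      show "0 < weight (plucker_of b) i" if "i \<noteq> k" for i
        using k that unfolding B(4) rel_interior_octahedron by simp
      show "weight (plucker_of b) i < 1" for i
        using k unfolding B(4) rel_interior_octahedron by (cases "i = k") auto
    qed
    then show "cross_ratio_eq k (cross_data y k) (cross_data y' k)" by (rule via)
  }
qed

text \<open>Since x k = 0 and the other coordinates are below 1, k cannot be m or n. So the bundle
  belonging to the octahedron is constant on the divisor.\<close>

lemma cross_ratio_eq_at_octahedron: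
  assumes x: "x \<in> rel_interior (octahedron k)" and mn: "m \<noteq> n" "x $ m + x $ n \<ge> 1"
    and D: "on_divisor m n (cross_data y)" "on_divisor m n (cross_data y')"
    and y: "y \<in> dP5_lift" "y' \<in> dP5_lift"
  shows "cross_ratio_eq k (cross_data y k) (cross_data y' k)"
proof (rule cross_ratio_eq_on_divisor[OF D mn(1)])
  show "k \<notin> {m, n}" using x mn unfolding rel_interior_octahedron by auto
  show "plucker_vector (cross_data y k)" "plucker_vector (cross_data y' k)"
    using stable_off_cross_data'[OF y(1), of k] stable_off_cross_data'[OF y(2), of k]
    by (auto simp: stable_off_def)
qed

lemma equiv_glue: "equiv (hypersimplex \<times> topspace (dP5 p)) (glue p)"
proof -
  have oct: "i = j" if "x \<in> rel_interior (octahedron i)" "x \<in> rel_interior (octahedron j)" for x i j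
    using octahedron_interior_unique[OF that(2) octahedron_interiorD[OF that(1)]] .
  have int: "\<not> (x \<in> rel_interior hypersimplex \<and> x \<in> rel_interior (octahedron i))" for x i
  proof
    assume "x \<in> rel_interior hypersimplex \<and> x \<in> rel_interior (octahedron i)"
    then have "\<forall>i. 0 < x $ i \<and> x $ i < 1" "x $ i = 0"
      unfolding rel_interior_hypersimplex rel_interior_octahedron by simp_all
    then show False by (metis less_irrefl)
  qed
  show ?thesis
  proof (rule equivI)
    show "glue p \<subseteq> (hypersimplex \<times> topspace (dP5 p)) \<times> (hypersimplex \<times> topspace (dP5 p))"
      unfolding glue_def by auto
    show "refl_on (hypersimplex \<times> topspace (dP5 p)) (glue p)"
      unfolding refl_on_def glue_def rel_frontier_hypersimplex by auto
    show "sym (glue p)" unfolding sym_def glue_def by auto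
    show "trans (glue p)"
      unfolding trans_def glue_def rel_frontier_hypersimplex using oct int by (auto; metis)
  qed
qed

section \<open>Comparison of the two quotients\<close>

context del_pezzo_points
begin

definition X_class :: "(real ^ 5) \<times> (complex ^ 5) \<times> (complex ^ 5 ^ 5) \<Rightarrow>
    ((real ^ 5) \<times> (complex ^ 3) set \<times> (5 \<Rightarrow> (complex ^ 3) set)) set" where
  "X_class s = glue p `` {(fst s, \<rho> (snd s))}"

lemma quotient_map_X_class:
  "quotient_map (top_of_set (hypersimplex \<times> dP5_lift)) (X_space p) X_class"
proof -
  let ?A = "top_of_set (hypersimplex \<times> dP5_lift)" and ?B = "prod_topology (top_of_set hypersimplex) (dP5 p)"
  have A: "?A = prod_topology (top_of_set hypersimplex) (top_of_set dP5_lift)"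
    by (rule top_of_set_Times)
  have "quotient_map ?A ?B (\<lambda>a. (fst a, \<rho> (snd a)))"
  proof (rule T1_Spaces.continuous_imp_quotient_map)
    show "continuous_map ?A ?B (\<lambda>a. (fst a, \<rho> (snd a)))"
      unfolding A
      by (rule continuous_map_pairedI[OF continuous_map_fst
          continuous_map_compose[OF continuous_map_snd continuous_map_\<rho>, unfolded o_def]])
    show "compact_space ?A"
      by (simp add: compact_space_subtopology compact_Times compact_hypersimplex compact_dP5_lift)
    show "Hausdorff_space ?B"
      by (simp add: Hausdorff_space_prod_topology Hausdorff_dP5 Hausdorff_space_subtopology)
    show "(\<lambda>a. (fst a, \<rho> (snd a))) ` topspace ?A = topspace ?B"
    proof -
      have "(\<lambda>s. (fst s, \<rho> (snd s))) ` (hypersimplex \<times> dP5_lift) = hypersimplex \<times> \<rho> ` dP5_lift"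
        by force
      then show ?thesis by (simp add: \<rho>_image)
    qed
  qed
  then have "quotient_map ?A (X_space p) ((\<lambda>z. glue p `` {z}) \<circ> (\<lambda>a. (fst a, \<rho> (snd a))))"
    unfolding X_space_def by (rule quotient_map_compose[OF _ quotient_map_quotient_topology])
  moreover have "(\<lambda>z. glue p `` {z}) \<circ> (\<lambda>a. (fst a, \<rho> (snd a))) = X_class"
    by (auto simp: X_class_def fun_eq_iff)
  ultimately show ?thesis by simp
qed

lemma X_class_eq_iff:
  assumes "x \<in> hypersimplex" "x' \<in> hypersimplex" "y \<in> dP5_lift" "y' \<in> dP5_lift"
  shows "X_class (x, y) = X_class (x', y') \<longleftrightarrow> x = x' \<and>
    (simplex_interior x \<and> \<rho> y = \<rho> y' \<or>
     (\<exists>k. x \<in> rel_interior (octahedron k) \<and> cross_ratio_eq k (cross_data y k) (cross_data y' k)) \<or>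
     \<not> simplex_interior x \<and> (\<forall>k. x \<notin> rel_interior (octahedron k)))"
proof -
  have "X_class (x, y) = X_class (x', y') \<longleftrightarrow> ((x, \<rho> y), (x', \<rho> y')) \<in> glue p"
    unfolding X_class_def fst_conv snd_conv
    by (rule eq_equiv_class_iff[OF equiv_glue]) (use assms \<rho>_in_dP5 in auto)
  then show ?thesis
    unfolding glue_def rel_frontier_hypersimplex
    using assms \<rho>_in_dP5[OF assms(3)] \<rho>_in_dP5[OF assms(4)] simplex_interior_iff[OF assms(1)]
      conic_bundle_eq_iff[OF assms(3,4)] by auto
qed

lemma X_space_homotopy_equivalent: "X_space p homotopy_equivalent_space Gr25_mod_T"
proof -
  let ?A = "top_of_set (hypersimplex \<times> dP5_lift)"
  define \<Phi> where "\<Phi> z = (push (fst z) (fst (snd z)), snd (snd z))"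
    for z :: "real \<times> (real ^ 5) \<times> (complex ^ 5) \<times> (complex ^ 5 ^ 5)"
  show ?thesis
  proof (rule homotopy_equivalent_space_by_quotients[OF quotient_map_X_class quotient_map_orbit_map])
    fix s s' assume "s \<in> topspace ?A" "s' \<in> topspace ?A" and eq: "X_class s = X_class s'"
    then obtain x y x' y' where s: "s = (x, y)" "s' = (x', y')" "x \<in> hypersimplex" "x' \<in> hypersimplex"
      "y \<in> dP5_lift" "y' \<in> dP5_lift" by auto
    have xx: "x' = x" and c: "simplex_interior x \<and> \<rho> y = \<rho> y' \<or>
     (\<exists>k. x \<in> rel_interior (octahedron k) \<and> cross_ratio_eq k (cross_data y k) (cross_data y' k)) \<or>
     \<not> simplex_interior x \<and> (\<forall>k. x \<notin> rel_interior (octahedron k))"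
      using eq X_class_eq_iff[OF s(3-6)] unfolding s(1,2) by auto
    show "orbit_map s = orbit_map s'"
      unfolding s(1,2) xx
    proof (rule orbit_map_eqI[OF s(3,5,6)])
      show "(\<forall>k. cross_ratio_eq k (cross_data y k) (cross_data y' k)) \<or>
        (\<exists>m n. m \<noteq> n \<and> x $ m + x $ n \<ge> 1 \<and> on_divisor m n (cross_data y) \<and> on_divisor m n (cross_data y')) \<or>
        (\<exists>i. x $ i = 0 \<or> x $ i = 1)"
      proof (cases "simplex_interior x")
        case True
        then have "\<rho> y = \<rho> y'"
          using c simplex_interior_not_octahedron[OF True] by blast
        then have "\<forall>k. cross_ratio_eq k (cross_data y k) (cross_data y' k)"
          using \<rho>_eq_imp_cross_ratio_eq[OF s(5,6)] by (intro allI)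
        then show ?thesis by (rule disjI1)
      next
        case False
        then have "\<exists>i. x $ i = 0 \<or> x $ i = 1" by (rule not_simplex_interiorE) (rule exI)
        then show ?thesis by (intro disjI2)
      qed
      show "cross_ratio_eq k (cross_data y k) (cross_data y' k)" if k: "x \<in> rel_interior (octahedron k)" for k
        using c
      proof (elim disjE conjE exE)
        assume "\<rho> y = \<rho> y'"
        then show ?thesis by (rule \<rho>_eq_imp_cross_ratio_eq[OF s(5,6)])
      next
        fix k' assume k': "x \<in> rel_interior (octahedron k')" "cross_ratio_eq k' (cross_data y k') (cross_data y' k')"
        have "k = k'" by (rule octahedron_interior_unique[OF k'(1) octahedron_interiorD[OF k]])
        show ?thesis unfolding \<open>k = k'\<close> by (rule k'(2))
      next
        assume "\<forall>k. x \<notin> rel_interior (octahedron k)"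
        then show ?thesis using k by blast
      qed
    qed
  next
    have c: "continuous_on ({0..1} \<times> hypersimplex \<times> dP5_lift) \<Phi>"
    proof -
      have "continuous_on ({0..1} \<times> hypersimplex \<times> dP5_lift)
          ((\<lambda>(t, x). push t x) \<circ> (\<lambda>z. (fst z, fst (snd z))))"
        by (intro continuous_on_compose continuous_intros continuous_on_subset[OF continuous_on_push]) auto
      then have "continuous_on ({0..1} \<times> hypersimplex \<times> dP5_lift) (\<lambda>z. push (fst z) (fst (snd z)))"
        by (simp add: o_def)
      then show ?thesis unfolding \<Phi>_def by (intro continuous_intros)
    qed
    have "\<Phi> ` ({0..1} \<times> hypersimplex \<times> dP5_lift) \<subseteq> hypersimplex \<times> dP5_lift"
      using push_in_hypersimplex by (auto simp: \<Phi>_def)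
    moreover have "prod_topology (top_of_set {0..1::real}) ?A = top_of_set ({0..1} \<times> hypersimplex \<times> dP5_lift)"
      unfolding top_of_set_Times ..
    ultimately show "continuous_map (prod_topology (top_of_set {0..1}) ?A) ?A \<Phi>"
      using c by (auto simp: continuous_map_in_subtopology)
  next
    fix s assume "s \<in> topspace ?A"
    then show "\<Phi> (0, s) = s" by (auto simp: \<Phi>_def push_0)
  next
    fix t :: real and s s' assume t: "t \<in> {0..1}" and "s \<in> topspace ?A" "s' \<in> topspace ?A" and eq: "X_class s = X_class s'"
    then obtain x y x' y' where s: "s = (x, y)" "s' = (x', y')" "x \<in> hypersimplex" "x' \<in> hypersimplex"
      "y \<in> dP5_lift" "y' \<in> dP5_lift" by auto
    have xx: "x' = x" using X_class_eq_iff[OF s(3-6), THEN iffD1, OF eq[unfolded s(1,2)]] by blast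
    \<comment> \<open>Over the interior equal classes have equal images under \<rho>, and over the
      boundary the expansion is stationary.\<close>
    show "X_class (\<Phi> (t, s)) = X_class (\<Phi> (t, s'))"
    proof (cases "simplex_interior x")
      case True
      then have "\<rho> y = \<rho> y'"
        using X_class_eq_iff[OF s(3-6), THEN iffD1, OF eq[unfolded s(1,2)]]
          simplex_interior_not_octahedron[OF True] by blast
      then show ?thesis unfolding X_class_def \<Phi>_def s(1,2) xx by simp
    next
      case False
      then obtain i where "x $ i = 0 \<or> x $ i = 1" by (rule not_simplex_interiorE)
      from push_boundary[OF s(3) t this] show ?thesis using eq unfolding \<Phi>_def s(1,2) xx by simp
    qed
  next
    fix t :: real and s s' assume t: "t \<in> {0..1}" and "s \<in> topspace ?A" "s' \<in> topspace ?A" and eq: "orbit_map s = orbit_map s'"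
    then obtain x y x' y' where s: "s = (x, y)" "s' = (x', y')" "x \<in> hypersimplex" "x' \<in> hypersimplex"
      "y \<in> dP5_lift" "y' \<in> dP5_lift" by auto
    note D = orbit_map_eqD[OF s(3-6) eq[unfolded s(1,2)]]
    have xx: "x' = x" using D(1) by simp
    show "orbit_map (\<Phi> (t, s)) = orbit_map (\<Phi> (t, s'))"
    proof (cases "simplex_interior x")
      case True
      from D(2)[OF True] consider "\<forall>k. cross_ratio_eq k (cross_data y k) (cross_data y' k)"
        | m n where "m \<noteq> n" "x $ m + x $ n \<ge> 1" "on_divisor m n (cross_data y)" "on_divisor m n (cross_data y')"
        by blast
      then have "orbit_map (push t x, y) = orbit_map (push t x, y')"
      proof cases
        case 1
        then show ?thesis by (intro orbit_map_eqI push_in_hypersimplex s t) auto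
      next
        case 2
        \<comment> \<open>The condition on m and n persists under the expansion. Should x arrive in
          an octahedron, the corresponding bundle is constant on the divisor, so the extra condition
          there holds too.\<close>
        note p = push_pair[OF s(3) t 2(2)]
        show ?thesis
        proof (rule orbit_map_eqI[OF push_in_hypersimplex[OF s(3) t] s(5,6)])
          show "cross_ratio_eq k (cross_data y k) (cross_data y' k)" if "push t x \<in> rel_interior (octahedron k)" for k
            using cross_ratio_eq_at_octahedron[OF that 2(1) p 2(3,4) s(5,6)] .
        qed (use 2 p in blast)
      qed
      then show ?thesis unfolding \<Phi>_def s(1,2) xx by simp
    next
      case False
      then obtain i where "x $ i = 0 \<or> x $ i = 1" by (rule not_simplex_interiorE)
      from push_boundary[OF s(3) t this] show ?thesis using eq unfolding \<Phi>_def s(1,2) xx by simp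
    qed
  next
    fix s s' assume "s \<in> topspace ?A" "s' \<in> topspace ?A" and eq: "orbit_map s = orbit_map s'"
    then obtain x y x' y' where s: "s = (x, y)" "s' = (x', y')" "x \<in> hypersimplex" "x' \<in> hypersimplex"
      "y \<in> dP5_lift" "y' \<in> dP5_lift" by auto
    note D = orbit_map_eqD[OF s(3-6) eq[unfolded s(1,2)]]
    have xx: "x' = x" using D(1) by simp
    have t: "(1::real) \<in> {0..1}" by simp
    note px = push_in_hypersimplex[OF s(3) t]
    have "X_class (push 1 x, y) = X_class (push 1 x, y')"
    proof (cases "simplex_interior x")
      case True
      from D(2)[OF True] consider "\<And>k. cross_ratio_eq k (cross_data y k) (cross_data y' k)"
        | m n where "m \<noteq> n" "x $ m + x $ n \<ge> 1" "on_divisor m n (cross_data y)" "on_divisor m n (cross_data y')"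
        by blast
      then show ?thesis
      proof cases
        case 1
        then have "\<rho> y = \<rho> y'" by (intro \<rho>_eqI s)
        then show ?thesis unfolding X_class_def by simp
      next
        case 2
        \<comment> \<open>At the boundary X either collapses the fibre to a point or applies the
          bundle of an octahedron, which takes the same value at y and y'. This is where X catches
          up with the orbit space.\<close>
        have "\<not> simplex_interior (push 1 x)"
          using push_1_boundary[OF s(3) 2(2)] unfolding simplex_interior_def by blast
        moreover have "cross_ratio_eq k (cross_data y k) (cross_data y' k)" if "push 1 x \<in> rel_interior (octahedron k)" for k
          using cross_ratio_eq_at_octahedron[OF that 2(1) push_pair[OF s(3) t 2(2)] 2(3,4) s(5,6)] .
        ultimately show ?thesis unfolding X_class_eq_iff[OF px px s(5,6)] by blast
      qed
    next
      case False
      then obtain i where "x $ i = 0 \<or> x $ i = 1" by (rule not_simplex_interiorE)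
      then have "push 1 x = x" by (rule push_boundary[OF s(3) t])
      then show ?thesis using False D(3) X_class_eq_iff[OF s(3,3,5,6)] by auto
    qed
    then show "X_class (\<Phi> (1, s)) = X_class (\<Phi> (1, s'))" unfolding \<Phi>_def s(1,2) xx by simp
  qed
qed

end

section \<open>Projective frames from general position\<close>

lemma independent_triple_combination:
  fixes b1 b2 b3 :: "complex ^ 3"
  assumes "(b1, b2) \<in> pairs2" "b3 \<notin> vec.span {b1, b2}" "x *s b1 + y *s b2 + z *s b3 = 0"
  shows "x = 0 \<and> y = 0 \<and> z = 0"
proof -
  have z: "z = 0"
  proof (rule ccontr)
    assume "z \<noteq> 0"
    have "b3 $ i = (- x / z) * b1 $ i + (- y / z) * b2 $ i" for i
    proof -
      have "x * b1 $ i + y * b2 $ i + z * b3 $ i = 0" using assms(3) by (simp add: vec_eq_iff)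
      then have "z * b3 $ i = - (x * b1 $ i) - y * b2 $ i" by algebra
      then have "b3 $ i = (- (x * b1 $ i) - y * b2 $ i) / z" using \<open>z \<noteq> 0\<close> by (simp add: nonzero_eq_divide_eq mult.commute)
      then show ?thesis by (simp add: diff_divide_distrib)
    qed
    then have "b3 = (- x / z) *s b1 + (- y / z) *s b2" by (simp add: vec_eq_iff)
    then show False using assms(2) unfolding span_pair by blast
  qed
  then have "x *s b1 + y *s b2 = 0" using assms(3) by simp
  then show ?thesis using pairs2_relation[OF assms(1)] z by blast
qed

text \<open>Write b 4 as u 1 * b 1 + u 2 * b 2 + u 3 * b 3. A vanishing coefficient would put three
  of the points on a line, so the b i may be rescaled by u i, and the sign of b 4 is reversed to
  make the sum zero.\<close>

lemma general_position_frame: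
  assumes gp: "general_position p"
  obtains a where "del_pezzo_points p a"
proof -
  have "\<exists>b. k \<in> pts \<longrightarrow> b \<noteq> 0 \<and> p k = vec.span {b}" for k
    using gp unfolding general_position_def topspace_grassmannian_1 by (cases "k \<in> pts") auto
  then have "\<forall>k. \<exists>b. k \<in> pts \<longrightarrow> b \<noteq> 0 \<and> p k = vec.span {b}" by blast
  then obtain b where "\<forall>k. k \<in> pts \<longrightarrow> b k \<noteq> 0 \<and> p k = vec.span {b k}" by (rule choice[THEN exE])
  then have b: "b k \<noteq> 0" "p k = vec.span {b k}" if "k \<in> pts" for k using that by blast+
  have pair: "(b i, b j) \<in> pairs2" if "i \<in> pts" "j \<in> pts" "i \<noteq> j" for i j
  proof (rule pairs2_distinct_spans)
    show "b i \<noteq> 0" "b j \<noteq> 0" using b that by auto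
    have "p i \<noteq> p j" using gp that unfolding general_position_def inj_on_def by blast
    then show "vec.span {b i} \<noteq> vec.span {b j}" using b that by auto
  qed
  have off: "b l \<notin> vec.span {b i, b j}" if ijl: "i \<in> pts" "j \<in> pts" "l \<in> pts" "distinct [i, j, l]" for i j l
  proof
    assume l: "b l \<in> vec.span {b i, b j}"
    have "vec.span {b i, b j} \<in> topspace CP2_dual"
      unfolding topspace_grassmannian_2 using pair ijl by auto
    moreover have "p i \<subseteq> vec.span {b i, b j}" "p j \<subseteq> vec.span {b i, b j}" "p l \<subseteq> vec.span {b i, b j}"
      unfolding b(2)[OF ijl(1)] b(2)[OF ijl(2)] b(2)[OF ijl(3)] span_subset_iff
      using l by (simp_all add: vec.span_base)
    moreover have "i \<noteq> j" "i \<noteq> l" "j \<noteq> l" using ijl by auto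
    ultimately show False using gp ijl(1-3) unfolding general_position_def by blast
  qed
  have P: "1 \<in> pts" "2 \<in> pts" "3 \<in> pts" "4 \<in> pts" by (auto simp: pts_def)
  define A :: "complex ^ 3 ^ 3" where
    "A = (\<chi> r s. if s = 1 then b 1 $ r else if s = 2 then b 2 $ r else b 3 $ r)"
  have A: "A *v u = u $ 1 *s b 1 + u $ 2 *s b 2 + u $ 3 *s b 3" for u
    by (simp add: A_def matrix_vector_mult_def vec_eq_iff sum_3 mult.commute)
  have "u = 0" if "A *v u = 0" for u
  proof -
    have "u $ 1 = 0 \<and> u $ 2 = 0 \<and> u $ 3 = 0"
      using independent_triple_combination[OF pair[OF P(1,2)] off[OF P(1,2,3)]] that unfolding A by simp
    then show ?thesis by (simp add: vec_eq_iff forall_3)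
  qed
  then obtain N where "N ** A = mat 1" using matrix_left_invertible_ker[of A] by blast
  then have "A ** N = mat 1" using matrix_left_right_inverse by blast
  then have "A *v (N *v b 4) = b 4" by (simp add: matrix_vector_mul_assoc)
  then obtain u :: "complex ^ 3" where u: "b 4 = u $ 1 *s b 1 + u $ 2 *s b 2 + u $ 3 *s b 3" unfolding A by metis
  have u0: "u $ 1 \<noteq> 0" "u $ 2 \<noteq> 0" "u $ 3 \<noteq> 0"
  proof -
    have n: "(1::5) \<noteq> 2" "(1::5) \<noteq> 3" "(1::5) \<noteq> 4" "(2::5) \<noteq> 3" "(2::5) \<noteq> 4" "(3::5) \<noteq> 4" by simp_all
    have "b 4 \<notin> vec.span {b 2, b 3}" "b 4 \<notin> vec.span {b 1, b 3}" "b 4 \<notin> vec.span {b 1, b 2}"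
      using off[OF P(2,3,4)] off[OF P(1,3,4)] off[OF P(1,2,4)] n by simp_all
    moreover have "b 4 \<in> vec.span {b 2, b 3}" if "u $ 1 = 0"
      unfolding span_pair using u that by auto
    moreover have "b 4 \<in> vec.span {b 1, b 3}" if "u $ 2 = 0"
      unfolding span_pair using u that by auto
    moreover have "b 4 \<in> vec.span {b 1, b 2}" if "u $ 3 = 0"
      unfolding span_pair using u that by auto
    ultimately show "u $ 1 \<noteq> 0" "u $ 2 \<noteq> 0" "u $ 3 \<noteq> 0" by blast+
  qed
  define a where "a k = (if k = 1 then u $ 1 else if k = 2 then u $ 2 else if k = 3 then u $ 3 else - 1) *s b k" for k
  have "del_pezzo_points p a"
  proof
    show "p k = vec.span {a k}" if "k \<noteq> 5" for k
    proof -
      have k: "k \<in> pts" using that by (simp add: pts_eq)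
      define c where "c = (if k = 1 then u $ 1 else if k = 2 then u $ 2 else if k = 3 then u $ 3 else - 1)"
      have c: "a k = c *s b k" "c \<noteq> 0" unfolding a_def c_def using u0 by auto
      then have "a k \<noteq> 0" using b(1)[OF k] by simp
      then show ?thesis using span_single_eq_iff[OF b(1)[OF k]] c b(2)[OF k] by blast
    qed
    show "a 1 + a 2 + a 3 + a 4 = 0" unfolding a_def using u by (simp add: vec_eq_iff)
    show "x = 0 \<and> y = 0 \<and> z = 0" if "x *s a 1 + y *s a 2 + z *s a 3 = 0" for x y z
    proof -
      have "(x * u $ 1) *s b 1 + (y * u $ 2) *s b 2 + (z * u $ 3) *s b 3 = 0"
        using that unfolding a_def by (simp add: vec_eq_iff)
      from independent_triple_combination[OF pair[OF P(1,2)] off[OF P(1,2,3)] this]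
      show ?thesis using u0 by simp
    qed
  qed
  then show ?thesis by (rule that)
qed

theorem theorem5:
  fixes p :: "5 \<Rightarrow> (complex ^ 3) set"
  assumes "general_position p"
  shows "X_space p homotopy_equivalent_space Gr25_mod_T"
proof -
  obtain a where "del_pezzo_points p a" using general_position_frame[OF assms] .
  then show ?thesis by (rule del_pezzo_points.X_space_homotopy_equivalent)
qed

end
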